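(* Let $H=\left(-\frac{d^2}{dx^2}\right)^{1/2}+x^2$ on $L^2(\mathbb{R})$, and consider the eigenvalue problem $H\varphi_n=\lambda_n\varphi_n$, where $\lambda_1<\lambda_2\le\lambda_3\le\dots$ are the eigenvalues. Let $a_k$ and $a_k'$, $k=1,2,\dots$, denote the zeroes of the Airy function $\mathrm{Ai}$ and of its derivative $\mathrm{Ai}'$, respectively, each listed in decreasing order. Then the eigenvalues are given by $$\lambda_{2k-1}=-a_k',\qquad \lambda_{2k}=-a_k,\qquad k=1,2,\dots.$$ They are all simple, the eigenfunctions $\varphi_{2k-1}$ are even and the eigenfunctions $\varphi_{2k}$ are odd. Furthermore, the Fourier transforms of the $L^2$-normalized eigenfunctions are given by $$\widehat{\varphi_n}(x)=\begin{cases}\dfrac{\mathrm{Ai}(|x|-\lambda_n)}{\sqrt{2\lambda_n}\,\mathrm{Ai}(-\lambda_n)}, & n=1,3,5,\dots,\\[2ex] \dfrac{\mathrm{sgn}(x)\,\mathrm{Ai}(|x|-\lambda_n)}{\sqrt{2}\,\mathrm{Ai}'(-\lambda_n)}, & n=2,4,6,\dots,\end{cases}\qquad x\in\mathbb{R}.$$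
   Context: $\left(-\frac{d^2}{dx^2}\right)^{1/2}$ is the Fourier multiplier operator with symbol $|k|$. The operator $H$ is the self-adjoint operator on $L^2(\mathbb{R})$ with $e^{-tH}=T_t$, where $(T_tf)(x)=\mathbb{E}^x\left[e^{-\int_0^t X_s^2\,ds}f(X_t)\right]$ and $(X_t)_{t\ge0}$ is the one-dimensional Cauchy process (the Lévy process with $\mathbb{E}^0[e^{i\xi X_t}]=e^{-t|\xi|}$). The operators $T_t$, $t>0$, are compact, so the spectrum of $H$ is purely discrete, with eigenvalues $0<\lambda_1<\lambda_2\le\lambda_3\le\dots\to\infty$ and an orthonormal basis of $L^2(\mathbb{R})$ consisting of eigenfunctions $\varphi_n$. The Fourier transform convention is $\widehat{\varphi}(x)=\frac{1}{\sqrt{2\pi}}\int_{\mathbb{R}}e^{ixz}\varphi(z)\,dz$. $\mathrm{Ai}$ is the standard Airy function, the solution of $y''=xy$ decaying at $+\infty$. *)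

theory Defs
  imports "HOL-Probability.Probability"
begin

section \<open>The Airy function and its zeros\<close>

text \<open>
  The solutions of \<open>y'' = x y\<close> that tend to \<open>0\<close> at \<open>+\<infinity>\<close> form a one-dimensional space; the standard
  normalization is the value \<open>Ai(0) = 3\<^bsup>-2/3\<^esup> / \<Gamma>(2/3)\<close>.
\<close>

definition Ai :: "real \<Rightarrow> real" where
  "Ai = (THE y.
     (\<exists>y'. \<forall>x. (y has_real_derivative y' x) (at x) \<and> (y' has_real_derivative x * y x) (at x)) \<and>
     (y \<longlongrightarrow> 0) at_top \<and>
     y 0 = 1 / (3 powr (2/3) * Gamma (2/3)))"

text \<open>
  The \<open>k\<close>-th element, \<open>k = 1, 2, \<dots>\<close>, of a set of reals listed in decreasing order: exactly \<open>k - 1\<close>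
  elements of the set are larger.
\<close>

definition kth_largest :: "real set \<Rightarrow> nat \<Rightarrow> real" where
  "kth_largest S k = (THE x. x \<in> S \<and> finite {y \<in> S. x < y} \<and> card {y \<in> S. x < y} + 1 = k)"

definition Ai_zero :: "nat \<Rightarrow> real" where
  "Ai_zero = kth_largest {x. Ai x = 0}"

definition Ai_deriv_zero :: "nat \<Rightarrow> real" where
  "Ai_deriv_zero = kth_largest {x. deriv Ai x = 0}"


section \<open>The Cauchy process\<close>

definition cadlag :: "(real \<Rightarrow> real) \<Rightarrow> bool" where
  "cadlag p \<longleftrightarrow>
     (\<forall>t\<ge>0. (p \<longlongrightarrow> p t) (at_right t)) \<and> (\<forall>t>0. \<exists>l. (p \<longlongrightarrow> l) (at_left t))"

text \<open>
  The process is indexed by \<open>t \<ge> 0\<close>; the values of \<open>X\<close> at negative times are irrelevant. All paths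
  (not only almost all) are cadlag, so that path integrals are measurable even if \<open>M\<close> is not complete.
\<close>

definition levy_process :: "'a measure \<Rightarrow> (real \<Rightarrow> 'a \<Rightarrow> real) \<Rightarrow> bool" where
  "levy_process M X \<longleftrightarrow>
     prob_space M \<and>
     (\<forall>t\<ge>0. X t \<in> borel_measurable M) \<and>
     (AE \<omega> in M. X 0 \<omega> = 0) \<and>
     (\<forall>(n::nat) \<tau>. 0 \<le> \<tau> 0 \<and> (\<forall>i<n. \<tau> i \<le> \<tau> (Suc i)) \<longrightarrow>
        prob_space.indep_vars M (\<lambda>_. borel) (\<lambda>i \<omega>. X (\<tau> (Suc i)) \<omega> - X (\<tau> i) \<omega>) {..<n}) \<and>
     (\<forall>s t. 0 \<le> s \<and> s \<le> t \<longrightarrow>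
        distr M borel (\<lambda>\<omega>. X t \<omega> - X s \<omega>) = distr M borel (X (t - s))) \<and>
     (\<forall>\<omega>\<in>space M. cadlag (\<lambda>t. X t \<omega>))"

definition cauchy_process :: "'a measure \<Rightarrow> (real \<Rightarrow> 'a \<Rightarrow> real) \<Rightarrow> bool" where
  "cauchy_process M X \<longleftrightarrow>
     levy_process M X \<and>
     (\<forall>t\<ge>0. \<forall>\<xi>. char (distr M borel (X t)) \<xi> = complex_of_real (exp (- t * \<bar>\<xi>\<bar>)))"


section \<open>Operators on the Hilbert space of square integrable functions\<close>

text \<open>
  Elements of \<open>L\<^sup>2(\<real>)\<close> are represented by Borel functions \<open>real \<Rightarrow> complex\<close>, and equality in \<open>L\<^sup>2\<close> is equality
  almost everywhere. Unbounded operators are represented by their graphs, which are closed under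
  almost everywhere equality in both components.
\<close>

definition L2 :: "(real \<Rightarrow> complex) set" where
  "L2 = {f. f \<in> borel_measurable lborel \<and> integrable lborel (\<lambda>x. (cmod (f x))\<^sup>2)}"

definition L2_norm :: "(real \<Rightarrow> complex) \<Rightarrow> real" where
  "L2_norm f = sqrt (LINT x|lborel. (cmod (f x))\<^sup>2)"

text \<open>
  Convergence in mean square is stated with the nonnegative integral, which, unlike the Bochner integral,
  does not vanish on functions that fail to be square integrable.
\<close>

definition tendsto_L2 ::
    "('i \<Rightarrow> real \<Rightarrow> complex) \<Rightarrow> (real \<Rightarrow> complex) \<Rightarrow> 'i filter \<Rightarrow> bool" where
  "tendsto_L2 u g F \<longleftrightarrow>
     ((\<lambda>i. \<integral>\<^sup>+x. ennreal ((cmod (u i x - g x))\<^sup>2) \<partial>lborel) \<longlongrightarrow> 0) F"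

type_synonym L2_operator = "((real \<Rightarrow> complex) \<times> (real \<Rightarrow> complex)) set"

text \<open>Under \<open>P\<^sup>x\<close> the process is \<open>x + X\<^sub>t\<close>, where \<open>X\<close> starts from \<open>0\<close>.\<close>

definition feynman_kac ::
    "'a measure \<Rightarrow> (real \<Rightarrow> 'a \<Rightarrow> real) \<Rightarrow> real \<Rightarrow> (real \<Rightarrow> complex) \<Rightarrow> real \<Rightarrow> complex" where
  "feynman_kac M X t f x =
     (LINT \<omega>|M. complex_of_real (exp (- (LBINT s:{0..t}. (x + X s \<omega>)\<^sup>2))) * f (x + X t \<omega>))"

text \<open>
  The self-adjoint operator \<open>H\<close> with \<open>e\<^bsup>-tH\<^esup> = T\<^sub>t\<close>, \<open>T\<^sub>t\<close> being \<open>feynman_kac M X t\<close>: the negative of the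
  infinitesimal generator of the semigroup, \<open>H f = lim\<^bsub>t\<rightarrow>0+\<^esub> (f - T\<^sub>t f) / t\<close>, with domain the set of
  all \<open>f\<close> for which the limit exists in \<open>L\<^sup>2\<close>.
\<close>

definition hamiltonian :: "'a measure \<Rightarrow> (real \<Rightarrow> 'a \<Rightarrow> real) \<Rightarrow> L2_operator" where
  "hamiltonian M X =
     {(f, g). f \<in> L2 \<and> g \<in> L2 \<and>
        tendsto_L2 (\<lambda>t x. (f x - feynman_kac M X t f x) / complex_of_real t) g (at_right 0)}"

definition fourier :: "(real \<Rightarrow> complex) \<Rightarrow> real \<Rightarrow> complex" where
  "fourier f x =
     complex_of_real (1 / sqrt (2 * pi)) * (LINT z|lborel. iexp (x * z) * f z)"

text \<open>The Fourier transform on \<open>L\<^sup>2\<close> is the limit of the transforms of the truncated functions.\<close>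

definition fourier_L2 :: "(real \<Rightarrow> complex) \<Rightarrow> (real \<Rightarrow> complex) \<Rightarrow> bool" where
  "fourier_L2 f F \<longleftrightarrow>
     f \<in> L2 \<and> F \<in> L2 \<and>
     tendsto_L2 (\<lambda>R. fourier (\<lambda>z. indicator {-R..R} z * f z)) F at_top"

text \<open>The operator \<open>(-d\<^sup>2/dx\<^sup>2)\<^bsup>1/2\<^esup>\<close> is the Fourier multiplier with symbol \<open>\<bar>k\<bar>\<close>.\<close>

definition half_laplacian :: L2_operator where
  "half_laplacian =
     {(f, g). \<exists>F G. fourier_L2 f F \<and> fourier_L2 g G \<and>
        (AE k in lborel. G k = complex_of_real \<bar>k\<bar> * F k)}"

text \<open>
  The operator sum \<open>(-d\<^sup>2/dx\<^sup>2)\<^bsup>1/2\<^esup> + x\<^sup>2\<close> on the intersection of the domains of the summands.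
\<close>

definition half_laplacian_plus_square :: L2_operator where
  "half_laplacian_plus_square =
     {(f, h). h \<in> L2 \<and> (\<lambda>x. complex_of_real (x\<^sup>2) * f x) \<in> L2 \<and>
        (\<exists>g. (f, g) \<in> half_laplacian \<and>
           (AE x in lborel. h x = g x + complex_of_real (x\<^sup>2) * f x))}"

definition eigenspace :: "L2_operator \<Rightarrow> complex \<Rightarrow> (real \<Rightarrow> complex) set" where
  "eigenspace H \<mu> = {f. (f, \<lambda>x. \<mu> * f x) \<in> H}"

text \<open>
  \<open>multiplicity_of H \<mu> m\<close>: modulo almost everywhere equality, the space \<open>ker (H - \<mu>)\<close> has a basis of \<open>m\<close>
  elements. Thus \<open>\<mu>\<close> is not an eigenvalue iff \<open>m = 0\<close>, and a simple eigenvalue iff \<open>m = 1\<close>.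
\<close>

definition multiplicity_of :: "L2_operator \<Rightarrow> complex \<Rightarrow> nat \<Rightarrow> bool" where
  "multiplicity_of H \<mu> m \<longleftrightarrow>
     (\<exists>e :: nat \<Rightarrow> real \<Rightarrow> complex.
        (\<forall>i<m. e i \<in> eigenspace H \<mu>) \<and>
        (\<forall>c. (AE x in lborel. (\<Sum>i<m. c i * e i x) = 0) \<longrightarrow> (\<forall>i<m. c i = 0)) \<and>
        (\<forall>f\<in>eigenspace H \<mu>. \<exists>c. AE x in lborel. f x = (\<Sum>i<m. c i * e i x)))"

text \<open>
  \<open>lam 1 \<le> lam 2 \<le> \<dots>\<close> lists all the eigenvalues of \<open>H\<close>, each one as often as its multiplicity.
  This determines \<open>lam n\<close> for \<open>n \<ge> 1\<close>; the value \<open>lam 0\<close> is irrelevant.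
\<close>

definition lists_eigenvalues :: "(nat \<Rightarrow> real) \<Rightarrow> L2_operator \<Rightarrow> bool" where
  "lists_eigenvalues lam H \<longleftrightarrow>
     (\<forall>n\<ge>1. lam n \<le> lam (Suc n)) \<and>
     (\<forall>\<mu>. finite {n. n \<ge> 1 \<and> complex_of_real (lam n) = \<mu>} \<and>
          multiplicity_of H \<mu> (card {n. n \<ge> 1 \<and> complex_of_real (lam n) = \<mu>}))"

end

theory Submission
  imports Defs
begin

text \<open>
  On the Fourier side the eigenvalue equation \<open>(-d\<^sup>2/dx\<^sup>2)\<^bsup>1/2\<^esup> \<phi> + x\<^sup>2 \<phi> = \<lambda> \<phi>\<close> becomes \<open>- u'' + \<bar>k\<bar> u = \<lambda> u\<close>, whose square
  integrable solutions on a half line are multiples of \<open>Ai (\<bar>k\<bar> - \<lambda>)\<close>. Matching at \<open>0\<close> leaves the even solution when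
  \<open>Ai' (- \<lambda>) = 0\<close> and the odd one when \<open>Ai (- \<lambda>) = 0\<close>, and by Rolle's theorem the two kinds of zeros alternate.

  The generator of the Feynman-Kac semigroup is reached by the Trotter product formula. The operator
  \<open>K s = e\<^bsup>-s x\<^sup>2/2\<^esup> P\<^sub>s e\<^bsup>-s x\<^sup>2/2\<^esup>\<close>, where \<open>P\<^sub>s\<close> is the transition operator of the Cauchy process, is a symmetric contraction,
  independence of the increments writes \<open>K (t/n)\<^sup>n f\<close> as an expectation with a trapezoidal sum in the exponent, and
  cadlag paths make it converge to the semigroup. If \<open>u\<close>, \<open>u'\<close>, \<open>u''\<close> decay exponentially, then the transform of \<open>u\<close> is
  in the domain of \<open>H\<close> and is mapped to the transform of \<open>- u'' + \<bar>k\<bar> u\<close>, by a telescoping sum and Fatou's lemma.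
  Conversely, \<open>H\<close> is symmetric, so its eigenvalues are real and an eigenfunction solves the Fourier side equation weakly,
  tested against such \<open>u\<close>; these suffice by variation of constants.
\<close>

section \<open>The Airy function and its zeros\<close>

text \<open>Two obstacles shape the proof. The domain of the generator is given only as the set of
  functions for which a limit exists, and the process only through independence, the laws of its
  increments and its cadlag paths. So membership in the domain is established for transforms of
  explicit functions, and an arbitrary eigenfunction is caught by pairing it with these. The symbol
  |k| has a corner at 0 and leads out of the smooth functions. The working class is therefore that
  of continuous functions with exponential decay: it is stable under multiplication by |k| and by
  exp (- s |k|), and it contains the Airy modes, cutoff functions and Gaussians. The estimates for
  Trotter steps are uniform in the number of steps: the defect of one step is handed on by
  contractivity, and only the total elapsed time enters. The constants in the normalized
  eigenfunctions originate in the primitive \<open>x Ai\<^sup>2 - Ai'\<^sup>2\<close> of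
  \<open>Ai\<^sup>2\<close>.\<close>

lemma deriv_nonneg_le:
  fixes f f' :: "real \<Rightarrow> real"
  assumes "a \<le> b"
    and "\<And>x. a \<le> x \<Longrightarrow> x \<le> b \<Longrightarrow> (f has_real_derivative f' x) (at x)"
    and "\<And>x. a \<le> x \<Longrightarrow> x \<le> b \<Longrightarrow> 0 \<le> f' x"
  shows "f a \<le> f b"
  by (rule DERIV_nonneg_imp_nondecreasing[OF assms(1)]) (use assms(2,3) in blast)

lemma deriv_nonpos_ge:
  fixes f f' :: "real \<Rightarrow> real"
  assumes "a \<le> b"
    and "\<And>x. a \<le> x \<Longrightarrow> x \<le> b \<Longrightarrow> (f has_real_derivative f' x) (at x)"
    and "\<And>x. a \<le> x \<Longrightarrow> x \<le> b \<Longrightarrow> f' x \<le> 0"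
  shows "f b \<le> f a"
  by (rule DERIV_nonpos_imp_nonincreasing[OF assms(1)]) (use assms(2,3) in blast)

section \<open>Airy's equation: existence, uniqueness, growth and decay of solutions\<close>

definition airy_eq :: "(real \<Rightarrow> real) \<Rightarrow> (real \<Rightarrow> real) \<Rightarrow> bool" where
  "airy_eq y y' \<longleftrightarrow>
     (\<forall>x. (y has_real_derivative y' x) (at x) \<and> (y' has_real_derivative x * y x) (at x))"

lemma airy_eqD:
  assumes "airy_eq y y'"
  shows "(y has_real_derivative y' x) (at x)" "(y' has_real_derivative x * y x) (at x)"
  using assms by (auto simp: airy_eq_def)

lemma airy_eq_lincomb:
  assumes "airy_eq y y'" "airy_eq z z'"
  shows "airy_eq (\<lambda>x. a * y x + b * z x) (\<lambda>x. a * y' x + b * z' x)"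
  using airy_eqD[OF assms(1)] airy_eqD[OF assms(2)]
  unfolding airy_eq_def by (auto intro!: derivative_eq_intros simp: algebra_simps)

text \<open>Taylor coefficients at 0 of the solution with \<open>y 0 = a\<close> and
  \<open>y' 0 = b\<close>: comparing coefficients in \<open>y'' = x y\<close> gives
  \<open>c 2 = 0\<close> and \<open>(n + 3) (n + 2) c (n + 3) = c n\<close>.\<close>

fun airy_coeff :: "real \<Rightarrow> real \<Rightarrow> nat \<Rightarrow> real" where
  "airy_coeff a b 0 = a"
| "airy_coeff a b (Suc 0) = b"
| "airy_coeff a b (Suc (Suc 0)) = 0"
| "airy_coeff a b (Suc (Suc (Suc n))) = airy_coeff a b n / (real (n + 3) * real (n + 2))"

lemma airy_coeff_nonneg: "0 \<le> a \<Longrightarrow> 0 \<le> b \<Longrightarrow> 0 \<le> airy_coeff a b n"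
  by (induction a b n rule: airy_coeff.induct) auto

text \<open>Passing from index \<open>m\<close> to \<open>m + 3\<close> multiplies
  \<open>\<bar>c m\<bar> * R ^ m\<close> by \<open>R ^ 3 / ((m + 3) * (m + 2))\<close>, which is at
  most 1 as soon as \<open>m \<ge> R ^ 3\<close>. The finitely many terms before that point dominate
  all later ones, and their sum serves as \<open>K\<close>.\<close>

lemma airy_coeff_bound:
  assumes "R > 0"
  shows "\<exists>K. \<forall>n. \<bar>airy_coeff a b n\<bar> * R ^ n \<le> K"
proof -
  define N where "N = nat \<lceil>R ^ 3\<rceil>"
  define K where "K = (\<Sum>n<N+3. \<bar>airy_coeff a b n\<bar> * R ^ n)"
  have "\<bar>airy_coeff a b n\<bar> * R ^ n \<le> K" for n
  proof (induction n rule: less_induct)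
    case (less n)
    show ?case
    proof (cases "n < N + 3")
      case True
      then show ?thesis unfolding K_def using assms
        by (intro member_le_sum) auto
    next
      case False
      then obtain m where m: "n = Suc (Suc (Suc m))" "m \<ge> N"
        by (intro that[of "n - 3"]) (auto simp: not_less)
      have "R ^ 3 \<le> real N" unfolding N_def by linarith
      also have "\<dots> \<le> real (m + 3) * 1" using m by simp
      also have "\<dots> \<le> real (m + 3) * real (m + 2)" by (intro mult_left_mono) auto
      finally have 1: "R ^ 3 / (real (m + 3) * real (m + 2)) \<le> 1" by (simp add: divide_simps)
      have "\<bar>airy_coeff a b n\<bar> * R ^ n
          = (\<bar>airy_coeff a b m\<bar> * R ^ m) * (R ^ 3 / (real (m + 3) * real (m + 2)))"
        unfolding m by (simp add: abs_mult power3_eq_cube)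
      also have "\<dots> \<le> (\<bar>airy_coeff a b m\<bar> * R ^ m) * 1"
        using assms by (intro mult_left_mono 1) auto
      also have "\<dots> \<le> K" using less[of m] m by simp
      finally show ?thesis .
    qed
  qed
  then show ?thesis by blast
qed

lemma airy_coeff_summable: "summable (\<lambda>n. airy_coeff a b n * x ^ n)"
proof -
  \<comment> \<open>The radius is positive even for \<open>x = 0\<close> and at least twice
    \<open>\<bar>x\<bar>\<close>, so that the bound leaves a geometric factor
    \<open>(1 / 2) ^ n\<close>.\<close>
  obtain K where K: "\<And>n. \<bar>airy_coeff a b n\<bar> * (2 * \<bar>x\<bar> + 1) ^ n \<le> K"
    using airy_coeff_bound[of "2 * \<bar>x\<bar> + 1" a b] by (auto simp: add_nonneg_pos)
  show ?thesis
  proof (rule summable_comparison_test'[of "\<lambda>n. K * (1 / 2) ^ n" 0])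
    fix n :: nat
    have "\<bar>x\<bar> ^ n \<le> ((2 * \<bar>x\<bar> + 1) * (1 / 2)) ^ n"
      by (intro power_mono) auto
    then have "\<bar>airy_coeff a b n\<bar> * \<bar>x\<bar> ^ n \<le> \<bar>airy_coeff a b n\<bar> * ((2 * \<bar>x\<bar> + 1) * (1 / 2)) ^ n"
      by (rule mult_left_mono) auto
    also have "\<dots> = \<bar>airy_coeff a b n\<bar> * (2 * \<bar>x\<bar> + 1) ^ n * (1 / 2) ^ n"
      by (simp add: power_mult_distrib[symmetric] mult.assoc)
    also have "\<dots> \<le> K * (1 / 2) ^ n"
      using K[of n] by (intro mult_right_mono) auto
    finally show "norm (airy_coeff a b n * x ^ n) \<le> K * (1 / 2) ^ n"
      by (simp add: abs_mult power_abs)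
  qed (intro summable_mult summable_geometric, simp)
qed

text \<open>Nonnegative data make all coefficients nonnegative, hence also the sum on the right half
  line; this sign is the starting point of the growth estimates below.\<close>

lemma airy_eq_exists:
  "\<exists>y y'. airy_eq y y' \<and> y 0 = a \<and> y' 0 = b \<and> (0 \<le> a \<longrightarrow> 0 \<le> b \<longrightarrow> (\<forall>x\<ge>0. 0 \<le> y x))"
proof -
  define c where "c = airy_coeff a b"
  have S: "summable (\<lambda>n. c n * x ^ n)" for x
    unfolding c_def by (rule airy_coeff_summable)
  have S1: "summable (\<lambda>n. diffs c n * x ^ n)" for x
    by (rule termdiff_converges_all) (rule S)
  define y where "y = (\<lambda>x. \<Sum>n. c n * x ^ n)"
  define y' where "y' = (\<lambda>x. \<Sum>n. diffs c n * x ^ n)"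
  have D1: "(y has_real_derivative y' x) (at x)" for x
    unfolding y_def y'_def by (rule termdiffs_strong_converges_everywhere) (rule S)
  have D2: "(y' has_real_derivative (\<Sum>n. diffs (diffs c) n * x ^ n)) (at x)" for x
    unfolding y'_def by (rule termdiffs_strong_converges_everywhere) (rule S1)
  have dd: "diffs (diffs c) (Suc n) = c n" for n
  proof -
    have "c (Suc (Suc (Suc n))) = c n / (real (n + 3) * real (n + 2))" by (simp add: c_def)
    then have "c (Suc (Suc (Suc n))) * (real (n + 3) * real (n + 2)) = c n" by simp
    then show ?thesis by (simp add: diffs_def algebra_simps)
  qed
  have dd0: "diffs (diffs c) 0 = 0"
    by (simp add: diffs_def c_def numeral_2_eq_2)
  have "(\<Sum>n. diffs (diffs c) n * x ^ n) = x * y x" for x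
  proof -
    have "summable (\<lambda>n. diffs (diffs c) n * x ^ n)"
      by (rule termdiff_converges_all) (rule S1)
    from suminf_split_head[OF this]
    have "(\<Sum>n. diffs (diffs c) n * x ^ n) = (\<Sum>n. diffs (diffs c) (Suc n) * x ^ Suc n)"
      by (simp add: dd0)
    also have "\<dots> = (\<Sum>n. x * (c n * x ^ n))" by (simp add: dd mult_ac)
    also have "\<dots> = x * y x" unfolding y_def by (rule suminf_mult) (rule S)
    finally show ?thesis .
  qed
  with D1 D2 have "airy_eq y y'" by (simp add: airy_eq_def)
  moreover have "y 0 = a" "y' 0 = b"
    unfolding y_def y'_def using powser_zero[of c] powser_zero[of "diffs c"]
    by (auto simp: c_def diffs_def)
  moreover have "\<forall>x\<ge>0. 0 \<le> y x" if "0 \<le> a" "0 \<le> b"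
    unfolding y_def using airy_coeff_nonneg[OF that] S
    by (auto intro!: suminf_nonneg simp: c_def)
  ultimately show ?thesis by blast
qed

text \<open>Gronwall's argument for the energy \<open>E = y\<^sup>2 + y'\<^sup>2\<close>: between
  \<open>x0\<close> and \<open>x\<close> one has \<open>\<bar>E'\<bar> \<le> c E\<close>, where
  \<open>c\<close> bounds \<open>\<bar>1 + t\<bar>\<close>. So \<open>E\<close> times a suitable
  exponential is monotone and cannot become positive on the way from \<open>x0\<close>, where it is
  0.\<close>

lemma airy_eq_unique_zero:
  assumes y: "airy_eq y y'" and 0: "y x0 = 0" "y' x0 = 0"
  shows "y x = 0"
proof -
  define c where "c = 1 + \<bar>x0\<bar> + \<bar>x\<bar>"
  define E where "E = (\<lambda>t. (y t)\<^sup>2 + (y' t)\<^sup>2)"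
  note D = airy_eqD[OF y]
  have E: "(E has_real_derivative 2 * (1 + t) * (y t * y' t)) (at t)" for t
    unfolding E_def by (rule derivative_eq_intros D refl)+ (simp add: algebra_simps)
  have bd: "\<bar>2 * (1 + t) * (y t * y' t)\<bar> \<le> c * E t" if "\<bar>t\<bar> \<le> \<bar>x0\<bar> + \<bar>x\<bar>" for t
  proof -
    have "2 * \<bar>y t * y' t\<bar> \<le> E t"
      unfolding E_def using sum_squares_bound[of "\<bar>y t\<bar>" "\<bar>y' t\<bar>"] by (simp add: abs_mult)
    moreover have "\<bar>1 + t\<bar> \<le> c" using that by (simp add: c_def)
    ultimately have "\<bar>1 + t\<bar> * (2 * \<bar>y t * y' t\<bar>) \<le> c * E t"
      by (intro mult_mono) (auto simp: c_def)
    moreover have "\<bar>2 * (1 + t) * (y t * y' t)\<bar> = \<bar>1 + t\<bar> * (2 * \<bar>y t * y' t\<bar>)"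
      by (simp only: abs_mult abs_numeral mult_ac)
    ultimately show ?thesis by simp
  qed
  have E0: "E x0 = 0" by (simp add: E_def 0)
  have "E x \<le> 0"
  proof (cases "x0 \<le> x")
    case True
    have "exp (- c * x) * E x \<le> exp (- c * x0) * E x0"
    proof (rule DERIV_nonpos_imp_nonincreasing[OF True])
      fix t assume t: "x0 \<le> t" "t \<le> x"
      then have "\<bar>t\<bar> \<le> \<bar>x0\<bar> + \<bar>x\<bar>" by arith
      from bd[OF this] have bd0: "2 * (1 + t) * (y t * y' t) \<le> c * E t" by linarith
      have "((\<lambda>t. exp (- c * t) * E t) has_real_derivative
          exp (- c * t) * (2 * (1 + t) * (y t * y' t) - c * E t)) (at t)"
        by (rule derivative_eq_intros E refl)+ (simp add: algebra_simps)
      moreover have "exp (- c * t) * (2 * (1 + t) * (y t * y' t) - c * E t) \<le> 0"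
        using bd0 by (intro mult_nonneg_nonpos) auto
      ultimately show "\<exists>d. ((\<lambda>t. exp (- c * t) * E t) has_real_derivative d) (at t) \<and> d \<le> 0"
        by blast
    qed
    then show ?thesis by (simp add: E0 mult_le_0_iff)
  next
    case False
    then have le: "x \<le> x0" by simp
    have "exp (c * x) * E x \<le> exp (c * x0) * E x0"
    proof (rule DERIV_nonneg_imp_nondecreasing[OF le])
      fix t assume t: "x \<le> t" "t \<le> x0"
      then have "\<bar>t\<bar> \<le> \<bar>x0\<bar> + \<bar>x\<bar>" by arith
      from bd[OF this] have bd0: "0 \<le> 2 * (1 + t) * (y t * y' t) + c * E t" by linarith
      have "((\<lambda>t. exp (c * t) * E t) has_real_derivative
          exp (c * t) * (2 * (1 + t) * (y t * y' t) + c * E t)) (at t)"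
        by (rule derivative_eq_intros E refl)+ (simp add: algebra_simps)
      moreover have "exp (c * t) * (2 * (1 + t) * (y t * y' t) + c * E t) \<ge> 0"
        using bd0 by (intro mult_nonneg_nonneg) auto
      ultimately show "\<exists>d. ((\<lambda>t. exp (c * t) * E t) has_real_derivative d) (at t) \<and> d \<ge> 0"
        by blast
    qed
    then show ?thesis by (simp add: E0 mult_le_0_iff)
  qed
  then show ?thesis unfolding E_def by (smt (verit) zero_le_power2 zero_eq_power2)
qed

lemma airy_eq_unique:
  assumes "airy_eq y y'" "airy_eq z z'" "y x0 = z x0" "y' x0 = z' x0"
  shows "y x = z x"
  using airy_eq_unique_zero[OF airy_eq_lincomb[OF assms(1,2), of 1 "-1"], of x0 x] assms(3,4) by simp

text \<open>On the right half line \<open>(y y')' = y'\<^sup>2 + x y\<^sup>2 \<ge> 0\<close>. If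
  \<open>y y'\<close> vanishes at \<open>x0 \<ge> 0\<close>, it stays nonnegative, so
  \<open>y\<^sup>2\<close> does not decrease from there on, and the limit 0 leaves only
  \<open>y = 0\<close>. In particular a nontrivial decaying solution has no zero of \<open>y\<close>
  or \<open>y'\<close> on \<open>{0..}\<close>.\<close>

lemma airy_eq_decaying_zero:
  assumes y: "airy_eq y y'" and lim: "(y \<longlongrightarrow> 0) at_top" and x0: "0 \<le> x0" and 0: "y x0 = 0 \<or> y' x0 = 0"
  shows "y x = 0"
proof -
  note D = airy_eqD[OF y]
  have yy: "0 \<le> y t * y' t" if "x0 \<le> t" for t
  proof -
    have "y x0 * y' x0 \<le> y t * y' t"
    proof (rule DERIV_nonneg_imp_nondecreasing[OF that])
      fix s assume s: "x0 \<le> s" "s \<le> t"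
      have "((\<lambda>t. y t * y' t) has_real_derivative (y' s)\<^sup>2 + s * (y s)\<^sup>2) (at s)"
        by (rule derivative_eq_intros D refl)+ (simp add: power2_eq_square)
      moreover have "0 \<le> (y' s)\<^sup>2 + s * (y s)\<^sup>2" using s x0 by auto
      ultimately show "\<exists>d. ((\<lambda>t. y t * y' t) has_real_derivative d) (at s) \<and> 0 \<le> d" by blast
    qed
    with 0 show ?thesis by auto
  qed
  have mono: "(y s)\<^sup>2 \<le> (y t)\<^sup>2" if "x0 \<le> s" "s \<le> t" for s t
  proof (rule DERIV_nonneg_imp_nondecreasing[OF that(2)])
    fix r assume r: "s \<le> r" "r \<le> t"
    have "((\<lambda>t. (y t)\<^sup>2) has_real_derivative 2 * (y r * y' r)) (at r)"
      by (rule derivative_eq_intros D refl)+ (simp add: algebra_simps)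
    moreover have "0 \<le> 2 * (y r * y' r)" using yy[of r] that r by auto
    ultimately show "\<exists>d. ((\<lambda>t. (y t)\<^sup>2) has_real_derivative d) (at r) \<and> 0 \<le> d" by blast
  qed
  have lim2: "((\<lambda>t. (y t)\<^sup>2) \<longlongrightarrow> 0) at_top" using tendsto_power[OF lim, of 2] by simp
  have z: "y s = 0" if "x0 \<le> s" for s
  proof -
    have "(y s)\<^sup>2 \<le> 0"
      by (rule tendsto_lowerbound[OF lim2])
         (use mono[OF that] in \<open>auto intro!: eventually_mono[OF eventually_ge_at_top[of s]]\<close>)
    then show ?thesis by simp
  qed
  have "y' (x0 + 1) = 0"
  proof (rule DERIV_unique)
    show "(y has_real_derivative y' (x0 + 1)) (at (x0 + 1))" by (rule D)
    show "(y has_real_derivative 0) (at (x0 + 1))"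
      by (rule has_field_derivative_transform_within_open[of "\<lambda>_. 0" _ _ "{x0<..}"]) (auto simp: z)
  qed
  then show ?thesis using airy_eq_unique_zero[OF y, of "x0 + 1"] z[of "x0 + 1"] by simp
qed

lemma airy_wronskian:
  assumes "airy_eq f f'" "airy_eq g g'"
  shows "f x * g' x - f' x * g x = f 0 * g' 0 - f' 0 * g 0"
proof -
  have "((\<lambda>x. f x * g' x - f' x * g x) has_real_derivative 0) (at x)" for x
    by (rule derivative_eq_intros airy_eqD[OF assms(1)] airy_eqD[OF assms(2)] refl)+ (simp add: algebra_simps)
  then show ?thesis
    by (intro DERIV_isconst_all[of "\<lambda>x. f x * g' x - f' x * g x"]) auto
qed

text \<open>A bootstrap on the right half line from \<open>g \<ge> 0\<close>: then
  \<open>g'' = x g \<ge> 0\<close>, so \<open>g' \<ge> g' 0 = 1\<close>, so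
  \<open>g \<ge> x\<close>.\<close>

lemma airy_growing_exists:
  "\<exists>g g'. airy_eq g g' \<and> g 0 = 0 \<and> g' 0 = 1 \<and> (\<forall>x\<ge>0. x \<le> g x \<and> 1 \<le> g' x)"
proof -
  obtain g g' where g: "airy_eq g g'" "g 0 = 0" "g' 0 = 1" "\<And>x. x \<ge> 0 \<Longrightarrow> 0 \<le> g x"
    using airy_eq_exists[of 0 1] by auto
  note D = airy_eqD[OF g(1)]
  have g': "1 \<le> g' x" if "0 \<le> x" for x
  proof -
    have "g' 0 \<le> g' x"
      by (rule deriv_nonneg_le[OF that], rule D(2)) (use g(4) in auto)
    then show ?thesis by (simp add: g)
  qed
  have "x \<le> g x" if "0 \<le> x" for x
  proof -
    have "g 0 - 0 \<le> g x - x"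
    proof (rule deriv_nonneg_le[OF that])
      show "((\<lambda>x. g x - x) has_real_derivative g' t - 1) (at t)" for t
        by (auto intro!: derivative_eq_intros D(1))
    qed (use g' in auto)
    then show ?thesis by (simp add: g)
  qed
  with g g' show ?thesis by blast
qed

text \<open>
  With \<open>f\<close> and \<open>g\<close> the solutions with initial data \<open>(1, 0)\<close> and \<open>(0, 1)\<close>, the quotient \<open>f / g\<close> decreases to some
  \<open>c\<close>, while \<open>f / g - 1 / (g g')\<close> increases to \<open>c\<close>; hence \<open>0 \<le> f - c g \<le> 1 / g'\<close>.
\<close>

lemma airy_decaying_exists: "\<exists>y y'. airy_eq y y' \<and> (y \<longlongrightarrow> 0) at_top \<and> y 0 \<noteq> 0"
proof -
  obtain g g' where g: "airy_eq g g'" "g 0 = 0" "g' 0 = 1" "\<And>x. x \<ge> 0 \<Longrightarrow> x \<le> g x"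
      "\<And>x. x \<ge> 0 \<Longrightarrow> 1 \<le> g' x"
    using airy_growing_exists by blast
  obtain f f' where f: "airy_eq f f'" "f 0 = 1" "f' 0 = 0" "\<And>x. x \<ge> 0 \<Longrightarrow> 0 \<le> f x"
    using airy_eq_exists[of 1 0] by auto
  note Df = airy_eqD[OF f(1)] and Dg = airy_eqD[OF g(1)]
  have W: "f x * g' x - f' x * g x = 1" for x
    using airy_wronskian[OF f(1) g(1), of x] by (simp add: f g)
  have gpos: "0 < g x" if "0 < x" for x using g(4)[of x] that by simp
  define q where "q = (\<lambda>x. f x / g x)"
  define r where "r = (\<lambda>x. 1 / (g x * g' x))"
  have Dq: "(q has_real_derivative - (1 / (g x)\<^sup>2)) (at x)" if "0 < x" for x
  proof -
    have "(q has_real_derivative (f' x * g x - f x * g' x) / (g x * g x)) (at x)"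
      unfolding q_def using gpos[OF that] by (intro DERIV_divide Df Dg) auto
    moreover have "f' x * g x - f x * g' x = - 1" using W[of x] by simp
    ultimately show ?thesis by (simp add: power2_eq_square)
  qed
  have Dr: "(r has_real_derivative - (((g' x)\<^sup>2 + x * (g x)\<^sup>2) / (g x * g' x)\<^sup>2)) (at x)" if "0 < x" for x
  proof -
    have "((\<lambda>x. g x * g' x) has_real_derivative ((g' x)\<^sup>2 + x * (g x)\<^sup>2)) (at x)"
      by (rule derivative_eq_intros Dg refl)+ (simp add: power2_eq_square)
    from DERIV_inverse'[OF this] show ?thesis
      using gpos[OF that] g(5)[of x] that
      by (simp add: r_def inverse_eq_divide power2_eq_square mult_ac)
  qed
  have q0: "0 \<le> q x" if "0 < x" for x using f(4)[of x] gpos[OF that] that by (simp add: q_def)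
  have qmono: "q t \<le> q s" if "0 < s" "s \<le> t" for s t
    by (rule deriv_nonpos_ge[OF that(2)], rule Dq) (use that in auto)
  have qrmono: "q s - r s \<le> q t - r t" if "0 < s" "s \<le> t" for s t
  proof (rule DERIV_nonneg_imp_nondecreasing[OF that(2)])
    fix x assume x: "s \<le> x" "x \<le> t"
    then have x0: "0 < x" using that by simp
    have "((\<lambda>x. q x - r x) has_real_derivative
        - (1 / (g x)\<^sup>2) - - (((g' x)\<^sup>2 + x * (g x)\<^sup>2) / (g x * g' x)\<^sup>2)) (at x)"
      by (intro DERIV_diff Dq Dr x0)
    moreover have "- (1 / (g x)\<^sup>2) - - (((g' x)\<^sup>2 + x * (g x)\<^sup>2) / (g x * g' x)\<^sup>2) = x / (g' x)\<^sup>2"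
      using gpos[OF x0] g(5)[of x] x0 by (simp add: field_simps)
    ultimately show "\<exists>d. ((\<lambda>x. q x - r x) has_real_derivative d) (at x) \<and> 0 \<le> d"
      using x0 by (metis divide_nonneg_nonneg less_imp_le zero_le_power2)
  qed
  define c where "c = Inf (q ` {0<..})"
  have bdd: "bdd_below (q ` {0<..})" using q0 by (auto intro!: bdd_belowI[of _ 0])
  have cq: "c \<le> q x" if "0 < x" for x
    unfolding c_def by (rule cInf_lower[OF _ bdd]) (use that in auto)
  have rb: "0 \<le> r x \<and> r x \<le> 1 / x" if "0 < x" for x
  proof -
    have "x * 1 \<le> g x * g' x" using that g(4)[of x] g(5)[of x] by (intro mult_mono) auto
    then show ?thesis using that gpos[OF that] g(5)[of x]
      by (auto simp: r_def intro!: divide_left_mono mult_pos_pos)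
  qed
  have qc: "q x - r x \<le> c" if x: "0 < x" for x
    unfolding c_def
  proof (rule cInf_greatest)
    fix v assume "v \<in> q ` {0<..}"
    then obtain z where z: "0 < z" "v = q z" by auto
    have "q x - r x \<le> q (max x z) - r (max x z)" using x by (intro qrmono) auto
    also have "\<dots> \<le> q (max x z)" using rb[of "max x z"] x by simp
    also have "\<dots> \<le> q z" using z by (intro qmono) auto
    finally show "q x - r x \<le> v" using z by simp
  qed auto
  \<comment> \<open>The bound \<open>1 \<le> g'\<close> is too weak for \<open>1 / g'\<close> to
    tend to 0; from \<open>x = 1\<close> on, \<open>g'' = x g \<ge> 1\<close> gives linear
    growth.\<close>
  have g'ge: "x \<le> g' x" if "1 \<le> x" for x
  proof -
    have "g' 1 - 1 \<le> g' x - x"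
    proof (rule DERIV_nonneg_imp_nondecreasing[OF that])
      fix t assume t: "1 \<le> t" "t \<le> x"
      have "1 * 1 \<le> t * g t" using t g(4)[of t] by (intro mult_mono) auto
      then show "\<exists>d. ((\<lambda>x. g' x - x) has_real_derivative d) (at t) \<and> 0 \<le> d"
        by (intro exI[of _ "t * g t - 1"]) (auto intro!: derivative_eq_intros Dg)
    qed
    then show ?thesis using g(5)[of 1] by simp
  qed
  define y where "y = (\<lambda>x. 1 * f x + (- c) * g x)"
  have y: "airy_eq y (\<lambda>x. 1 * f' x + (- c) * g' x)"
    unfolding y_def by (rule airy_eq_lincomb) (rule f g)+
  have yb: "0 \<le> y x \<and> y x \<le> 1 / x" if "1 \<le> x" for x
  proof -
    have x: "0 < x" using that by simp
    have yq: "y x = g x * (q x - c)" using gpos[OF x] by (simp add: y_def q_def field_simps)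
    have "y x \<le> g x * r x" unfolding yq using qc[OF x] gpos[OF x] by (intro mult_left_mono) auto
    also have "\<dots> = 1 / g' x" using gpos[OF x] by (simp add: r_def)
    also have "\<dots> \<le> 1 / x" using g'ge[OF that] x by (intro divide_left_mono mult_pos_pos) auto
    finally show ?thesis using yq cq[OF x] gpos[OF x] by simp
  qed
  have lim: "(y \<longlongrightarrow> 0) at_top"
  proof (rule Lim_null_comparison)
    show "((\<lambda>x::real. 1 / x) \<longlongrightarrow> 0) at_top" by real_asymp
    show "\<forall>\<^sub>F x in at_top. norm (y x) \<le> 1 / x"
      using yb by (auto intro!: eventually_mono[OF eventually_ge_at_top[of "1::real"]])
  qed
  have "y 0 \<noteq> 0" by (simp add: y_def f g)
  with y lim show ?thesis by blast
qed

section \<open>The function Ai on the right half line\<close>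

lemma Ai_spec: "airy_eq Ai (deriv Ai)" "(Ai \<longlongrightarrow> 0) at_top" "0 < Ai 0"
proof -
  define v where "v = 1 / (3 powr (2/3) * Gamma (2/3 :: real))"
  have v: "v > 0" by (simp add: v_def Gamma_real_pos)
  define P where "P = (\<lambda>y. (\<exists>y'. airy_eq y y') \<and> (y \<longlongrightarrow> 0) at_top \<and> y 0 = v)"
  have Ai: "Ai = (THE y. P y)"
    unfolding Ai_def P_def airy_eq_def v_def by simp
  obtain y y' where y: "airy_eq y y'" "(y \<longlongrightarrow> 0) at_top" "y 0 \<noteq> 0"
    using airy_decaying_exists by blast
  have "P Ai"
    unfolding Ai
  proof (rule theI[where P = P])
    have "airy_eq (\<lambda>x. (v / y 0) * y x + 0 * y x) (\<lambda>x. (v / y 0) * y' x + 0 * y' x)"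
      by (rule airy_eq_lincomb[OF y(1) y(1)])
    moreover have "((\<lambda>x. (v / y 0) * y x + 0 * y x) \<longlongrightarrow> 0) at_top"
      using tendsto_mult_right_zero[OF y(2), of "v / y 0"] by simp
    ultimately show "P (\<lambda>x. (v / y 0) * y x + 0 * y x)"
      unfolding P_def using y(3) by auto
  next
    fix z :: "real \<Rightarrow> real" assume "P z"
    then obtain z' where z: "airy_eq z z'" "(z \<longlongrightarrow> 0) at_top" "z 0 = v" by (auto simp: P_def)
    \<comment> \<open>Uniqueness: the difference of two candidates decays and vanishes at 0, which
      leaves only the zero function.\<close>
    have y2: "airy_eq (\<lambda>x. 1 * z x + (- (v / y 0)) * y x) (\<lambda>x. 1 * z' x + (- (v / y 0)) * y' x)"
      by (rule airy_eq_lincomb[OF z(1) y(1)])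
    have lim: "((\<lambda>x. 1 * z x + (- (v / y 0)) * y x) \<longlongrightarrow> 0) at_top"
      using tendsto_add[OF z(2) tendsto_mult_right_zero[OF y(2), of "- (v / y 0)"]] by simp
    from airy_eq_decaying_zero[OF y2 lim, of 0] z(3) y(3)
    show "z = (\<lambda>x. (v / y 0) * y x + 0 * y x)" by (auto simp: fun_eq_iff)
  qed
  then obtain A' where A: "airy_eq Ai A'" "(Ai \<longlongrightarrow> 0) at_top" "Ai 0 = v" by (auto simp: P_def)
  have "A' = deriv Ai" using airy_eqD(1)[OF A(1)] by (intro ext) (rule DERIV_imp_deriv[symmetric])
  with A v show "airy_eq Ai (deriv Ai)" "(Ai \<longlongrightarrow> 0) at_top" "0 < Ai 0" by auto
qed

lemmas DERIV_Ai = airy_eqD[OF Ai_spec(1)]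

lemma continuous_on_Ai: "continuous_on S Ai" "continuous_on S (deriv Ai)"
  using DERIV_Ai by (auto intro!: continuous_at_imp_continuous_on DERIV_isCont)

lemma Ai_nonzero:
  assumes "0 \<le> x"
  shows "Ai x \<noteq> 0" "deriv Ai x \<noteq> 0"
  using airy_eq_decaying_zero[OF Ai_spec(1,2) assms, of 0] Ai_spec(3) by auto

lemma Ai_no_common_zero: "Ai x \<noteq> 0 \<or> deriv Ai x \<noteq> 0"
  using airy_eq_unique_zero[OF Ai_spec(1), of x 0] Ai_spec(3) by auto

lemma Ai_pos: "0 < Ai x" if "0 \<le> x"
proof (rule ccontr)
  assume "\<not> 0 < Ai x"
  then have "Ai x \<le> 0" "0 \<le> Ai 0" using Ai_spec(3) by auto
  from IVT2'[OF this that continuous_on_Ai(1)] obtain z where "0 \<le> z" "Ai z = 0" by blast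
  then show False using Ai_nonzero by blast
qed

lemma deriv_Ai_mono:
  assumes "0 \<le> s" "s \<le> t"
  shows "deriv Ai s \<le> deriv Ai t"
  by (rule deriv_nonneg_le[OF assms(2)], rule DERIV_Ai(2)) (use assms in \<open>auto intro!: mult_nonneg_nonneg less_imp_le[OF Ai_pos]\<close>)

text \<open>\<open>Ai'\<close> does not decrease where \<open>Ai\<close> is positive and
  \<open>x \<ge> 0\<close>; were it nonnegative at such an \<open>x\<close>, \<open>Ai\<close> would
  stay above \<open>Ai x > 0\<close> from there on and could not tend to 0.\<close>

lemma deriv_Ai_neg: "deriv Ai x < 0" if "0 \<le> x"
proof (rule ccontr)
  assume n: "\<not> deriv Ai x < 0"
  have "Ai x \<le> Ai t" if t: "x \<le> t" for t
  proof (rule deriv_nonneg_le[OF t], rule DERIV_Ai(1))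
    fix s assume "x \<le> s"
    with deriv_Ai_mono[OF \<open>0 \<le> x\<close>, of s] n show "0 \<le> deriv Ai s" by simp
  qed
  then have "Ai x \<le> 0"
    by (intro tendsto_lowerbound[OF Ai_spec(2)])
       (auto intro!: eventually_mono[OF eventually_ge_at_top[of x]])
  then show False using Ai_pos[OF that] by simp
qed

text \<open>For \<open>x \<ge> 1\<close> the function \<open>exp (- x) * (Ai' + Ai)\<close> has
  derivative \<open>exp (- x) * (x - 1) * Ai \<ge> 0\<close> and limit 0, so
  \<open>Ai' + Ai \<le> 0\<close> and \<open>exp x * Ai\<close> does not increase. Monotonicity of
  \<open>Ai'\<close> and the mean value theorem on \<open>{x - 1..x}\<close> carry the bound over to
  the derivative; the compact remainder \<open>{r..2}\<close> only enlarges the constant.\<close>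

lemma Ai_exp_decay: "\<exists>C. \<forall>x\<ge>r. \<bar>Ai x\<bar> \<le> C * exp (- x) \<and> \<bar>deriv Ai x\<bar> \<le> C * exp (- x)"
proof -
  have D': "((\<lambda>x. exp (- x) * (deriv Ai x + Ai x)) has_real_derivative exp (- x) * ((x - 1) * Ai x)) (at x)" for x
    by (rule derivative_eq_intros DERIV_Ai refl)+ (simp add: algebra_simps)
  define K where "K = \<bar>deriv Ai 0\<bar> + Ai 0"
  have anti: "Ai t \<le> Ai s" if "0 \<le> s" "s \<le> t" for s t
    by (rule deriv_nonpos_ge[OF that(2)], rule DERIV_Ai(1)) (use that in \<open>auto intro!: less_imp_le[OF deriv_Ai_neg]\<close>)
  have bd: "\<bar>deriv Ai x + Ai x\<bar> \<le> K" if "0 \<le> x" for x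
    using deriv_Ai_mono[of 0 x] anti[of 0 x] that Ai_pos[of x] deriv_Ai_neg[of x] by (auto simp: K_def)
  have lim: "((\<lambda>x. exp (- x) * (deriv Ai x + Ai x)) \<longlongrightarrow> 0) at_top"
  proof (rule Lim_null_comparison)
    show "((\<lambda>x::real. exp (- x) * K) \<longlongrightarrow> 0) at_top" by real_asymp
    show "\<forall>\<^sub>F x in at_top. norm (exp (- x) * (deriv Ai x + Ai x)) \<le> exp (- x) * K"
      by (rule eventually_mono[OF eventually_ge_at_top[of 0]])
         (use bd in \<open>auto simp: abs_mult intro!: mult_left_mono\<close>)
  qed
  have neg: "deriv Ai x + Ai x \<le> 0" if "1 \<le> x" for x
  proof -
    have "exp (- x) * (deriv Ai x + Ai x) \<le> 0"
    proof (rule tendsto_lowerbound[OF lim])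
      have "exp (- x) * (deriv Ai x + Ai x) \<le> exp (- t) * (deriv Ai t + Ai t)" if t: "x \<le> t" for t
        by (rule deriv_nonneg_le[OF t], rule D')
           (use \<open>1 \<le> x\<close> Ai_pos in \<open>auto intro!: mult_nonneg_nonneg less_imp_le[OF Ai_pos]\<close>)
      then show "\<forall>\<^sub>F t in at_top. exp (- x) * (deriv Ai x + Ai x) \<le> exp (- t) * (deriv Ai t + Ai t)"
        by (intro eventually_mono[OF eventually_ge_at_top[of x]])
    qed simp
    then show ?thesis by (simp add: mult_le_0_iff)
  qed
  have D2: "((\<lambda>x. exp x * Ai x) has_real_derivative exp x * (deriv Ai x + Ai x)) (at x)" for x
    by (rule derivative_eq_intros DERIV_Ai refl)+ (simp add: algebra_simps)
  have A1: "exp x * Ai x \<le> exp 1 * Ai 1" if "1 \<le> x" for x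
    by (rule deriv_nonpos_ge[OF that], rule D2) (use neg that in \<open>auto intro!: mult_nonneg_nonpos\<close>)
  define C1 where "C1 = exp 1 * Ai 1"
  have A: "\<bar>Ai x\<bar> \<le> C1 * exp (- x)" if "1 \<le> x" for x
    using A1[OF that] Ai_pos[of x] that by (simp add: C1_def exp_minus divide_simps mult_ac)
  have A': "\<bar>deriv Ai x\<bar> \<le> C1 * exp 1 * exp (- x)" if "2 \<le> x" for x
  proof -
    obtain z where z: "x - 1 < z" "z < x" "Ai x - Ai (x - 1) = (x - (x - 1)) * deriv Ai z"
      using MVT2[of "x - 1" x Ai "deriv Ai"] DERIV_Ai(1) by auto
    have "- deriv Ai x \<le> - deriv Ai z" using deriv_Ai_mono[of z x] z that by simp
    also have "\<dots> \<le> Ai (x - 1)" using z Ai_pos[of x] that by simp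
    also have "\<dots> \<le> C1 * exp (- (x - 1))" using A[of "x - 1"] that by simp
    finally show ?thesis using deriv_Ai_neg[of x] that by (simp add: exp_diff exp_minus divide_simps mult_ac)
  qed
  have "compact {r..2}" by simp
  then have "bounded (Ai ` {r..2})" "bounded (deriv Ai ` {r..2})"
    by (auto intro!: compact_imp_bounded compact_continuous_image continuous_on_Ai)
  then obtain B1 B2 where "\<forall>x\<in>{r..2}. \<bar>Ai x\<bar> \<le> B1" "\<forall>x\<in>{r..2}. \<bar>deriv Ai x\<bar> \<le> B2"
    by (auto simp: bounded_iff)
  then have B: "\<And>x. r \<le> x \<Longrightarrow> x \<le> 2 \<Longrightarrow> \<bar>Ai x\<bar> \<le> B1" "\<And>x. r \<le> x \<Longrightarrow> x \<le> 2 \<Longrightarrow> \<bar>deriv Ai x\<bar> \<le> B2"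
    by auto
  have C1: "0 \<le> C1" using Ai_pos[of 1] by (simp add: C1_def)
  define C where "C = C1 * exp 1 + \<bar>B1\<bar> * exp 2 + \<bar>B2\<bar> * exp 2"
  have CC: "C1 \<le> C" "C1 * exp 1 \<le> C" "\<bar>B1\<bar> * exp 2 \<le> C" "\<bar>B2\<bar> * exp 2 \<le> C"
    using C1 mult_left_mono[of 1 "exp 1" C1] by (auto simp: C_def add_increasing2)
  have "\<bar>Ai x\<bar> \<le> C * exp (- x) \<and> \<bar>deriv Ai x\<bar> \<le> C * exp (- x)" if "r \<le> x" for x
  proof (cases "x \<le> 2")
    case True
    have e: "b \<le> C * exp (- x)" if "b \<le> \<bar>B\<bar>" "\<bar>B\<bar> * exp 2 \<le> C" for b B
    proof -
      have "b * 1 \<le> \<bar>B\<bar> * (exp 2 * exp (- x))"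
        using that True by (intro mult_mono) (auto simp: exp_add[symmetric])
      also have "\<dots> \<le> C * exp (- x)"
        using mult_right_mono[OF that(2), of "exp (- x)"] by (simp add: mult_ac)
      finally show ?thesis by simp
    qed
    show ?thesis using B[OF that True] CC by (auto intro: e[of _ B1] e[of _ B2])
  next
    case False
    moreover have "C1 * exp (- x) \<le> C * exp (- x)" "C1 * exp 1 * exp (- x) \<le> C * exp (- x)"
      by (intro mult_right_mono CC; simp)+
    ultimately show ?thesis using A[of x] A'[of x] by linarith
  qed
  then show ?thesis by blast
qed

text \<open>Airy's equation makes \<open>x Ai\<^sup>2 - Ai'\<^sup>2\<close> a primitive of
  \<open>Ai\<^sup>2\<close>, and it tends to 0 at infinity. At \<open>r = - lam\<close> this yields
  the norms of the eigenfunctions.\<close>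

lemma nn_integral_Ai_square:
  "(\<integral>\<^sup>+x. ennreal ((Ai x)\<^sup>2) * indicator {r..} x \<partial>lborel) = ennreal ((deriv Ai r)\<^sup>2 - r * (Ai r)\<^sup>2)"
proof -
  define F where "F = (\<lambda>x. x * (Ai x)\<^sup>2 - (deriv Ai x)\<^sup>2)"
  have D: "(F has_real_derivative (Ai x)\<^sup>2) (at x)" for x
    unfolding F_def by (rule derivative_eq_intros DERIV_Ai refl)+ (simp add: algebra_simps power2_eq_square)
  obtain C where C: "\<And>x. x \<ge> 0 \<Longrightarrow> \<bar>Ai x\<bar> \<le> C * exp (- x)" "\<And>x. x \<ge> 0 \<Longrightarrow> \<bar>deriv Ai x\<bar> \<le> C * exp (- x)"
    using Ai_exp_decay[of 0] by blast
  have lim: "(F \<longlongrightarrow> 0) at_top"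
  proof (rule Lim_null_comparison)
    have "((\<lambda>x::real. C\<^sup>2 * ((x + 1) * (exp (- x))\<^sup>2)) \<longlongrightarrow> C\<^sup>2 * 0) at_top"
      by (intro tendsto_mult tendsto_const) real_asymp
    then show "((\<lambda>x::real. (x + 1) * (C * exp (- x))\<^sup>2) \<longlongrightarrow> 0) at_top"
      by (simp add: power_mult_distrib mult_ac)
    show "\<forall>\<^sub>F x in at_top. norm (F x) \<le> (x + 1) * (C * exp (- x))\<^sup>2"
    proof (rule eventually_mono[OF eventually_ge_at_top[of 0]])
      fix x :: real assume x: "0 \<le> x"
      have "\<bar>F x\<bar> \<le> x * \<bar>Ai x\<bar>\<^sup>2 + \<bar>deriv Ai x\<bar>\<^sup>2"
        using mult_nonneg_nonneg[OF x zero_le_power2[of "Ai x"]] zero_le_power2[of "deriv Ai x"]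
        unfolding F_def power2_abs abs_le_iff by simp
      also have "\<dots> \<le> x * (C * exp (- x))\<^sup>2 + (C * exp (- x))\<^sup>2"
        using C[OF x] x by (intro add_mono mult_left_mono power_mono) auto
      finally show "norm (F x) \<le> (x + 1) * (C * exp (- x))\<^sup>2" by (simp add: algebra_simps)
    qed
  qed
  have "(\<integral>\<^sup>+x. ennreal ((Ai x)\<^sup>2) * indicator {r..} x \<partial>lborel) = ennreal (0 - F r)"
    by (rule nn_integral_FTC_atLeast[of "\<lambda>x. (Ai x)\<^sup>2" r F])
       (use D lim DERIV_Ai in \<open>auto intro!: borel_measurable_continuous_onI continuous_intros continuous_on_Ai\<close>)
  then show ?thesis by (simp add: F_def)
qed

text \<open>As \<open>Ai 0 \<noteq> 0 = g 0\<close> and \<open>g' 0 = 1\<close>, the coefficients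
  \<open>q\<close> and \<open>p\<close> can match value and derivative at 0. A restriction on the
  growth of \<open>y\<close> then becomes the condition \<open>p = 0\<close>.\<close>

lemma airy_eq_Ai_plus_growing:
  assumes "airy_eq y y'"
  shows "\<exists>q p g. (\<forall>x. y x = q * Ai x + p * g x) \<and> (\<forall>x\<ge>0. x \<le> g x)"
proof -
  obtain g g' where g: "airy_eq g g'" "g 0 = 0" "g' 0 = 1" "\<And>x. x \<ge> 0 \<Longrightarrow> x \<le> g x"
    using airy_growing_exists by blast
  define q where "q = y 0 / Ai 0"
  define p where "p = y' 0 - q * deriv Ai 0"
  have "y x = q * Ai x + p * g x" for x
    by (rule airy_eq_unique[OF assms airy_eq_lincomb[OF Ai_spec(1) g(1), of q p], of 0])
       (use Ai_spec(3) g in \<open>auto simp: q_def p_def\<close>)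
  then show ?thesis using g(4) by blast
qed

section \<open>The zeros of Ai and Ai'\<close>

lemma Ai_zeros_unbounded: "\<exists>x<b. Ai x = 0"
proof (rule ccontr)
  assume "\<not> (\<exists>x<b. Ai x = 0)"
  then have nz: "Ai x \<noteq> 0" if "x < b" for x using that by blast
  define b' where "b' = min b 0 - 1"
  have b': "b' < b" "b' < 0" by (auto simp: b'_def)
  \<comment> \<open>The sign makes the solution, free of zeros there, positive to the left of
    \<open>b' < 0\<close>, where \<open>y'' = x y\<close> is then negative: \<open>y\<close> is
    concave.\<close>
  define y where "y = (\<lambda>x. sgn (Ai b') * Ai x + 0 * Ai x)"
  define y' where "y' = (\<lambda>x. sgn (Ai b') * deriv Ai x + 0 * deriv Ai x)"
  have y: "airy_eq y y'" unfolding y_def y'_def by (rule airy_eq_lincomb[OF Ai_spec(1) Ai_spec(1)])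
  note D = airy_eqD[OF y]
  have cont: "continuous_on S y" for S
    using D(1) by (auto intro!: continuous_at_imp_continuous_on DERIV_isCont)
  have yb: "0 < y b'" using nz[OF b'(1)] by (auto simp: y_def sgn_if)
  have pos: "0 < y x" if x: "x \<le> b'" for x
  proof (rule ccontr)
    assume "\<not> 0 < y x"
    then have "y x \<le> 0" "0 \<le> y b'" using yb by auto
    from IVT'[OF this x cont] obtain z where z: "z \<le> b'" "y z = 0" by blast
    then show False using nz[of z] nz[of b'] b' by (auto simp: y_def sgn_if split: if_splits)
  qed
  have anti: "y' t \<le> y' s" if "s \<le> t" "t \<le> b'" for s t
    by (rule deriv_nonpos_ge[OF that(1)], rule D(2))
       (use that b' in \<open>auto intro!: mult_nonpos_nonneg less_imp_le[OF pos]\<close>)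
  have y'neg: "y' x \<le> 0" if x: "x \<le> b'" for x
  proof (rule ccontr)
    assume p: "\<not> y' x \<le> 0"
    \<comment> \<open>The zero of the tangent at \<open>x\<close>: for positive slope it lies to the
      left, and a concave function stays below its tangent.\<close>
    define t where "t = x - y x / y' x"
    have t: "t \<le> x" using p pos[OF x] by (simp add: t_def)
    have "y t - y' x * t \<le> y x - y' x * x"
    proof (rule deriv_nonneg_le[OF t])
      show "((\<lambda>t. y t - y' x * t) has_real_derivative y' s - y' x) (at s)" for s
        by (auto intro!: derivative_eq_intros D(1))
    qed (use anti x in auto)
    moreover have "y' x * (x - t) = y x" using p by (simp add: t_def)
    ultimately have "y t \<le> 0" by (simp add: algebra_simps)
    then show False using pos[of t] t x by simp
  qed
  have ge: "y b' \<le> y x" if "x \<le> b'" for x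
    by (rule deriv_nonpos_ge[OF that], rule D(1)) (use y'neg in auto)
  \<comment> \<open>To the left of \<open>b'\<close> one has \<open>y \<ge> y b'\<close>, so
    \<open>y'' \<le> - c\<close>, and \<open>y'\<close> grows at least linearly towards
    \<open>- \<infinity>\<close>; \<open>t\<close> below is the point where this lower bound reaches
    1, against \<open>y' \<le> 0\<close>.\<close>
  define c where "c = - b' * y b'"
  have c: "0 < c" using b' yb by (simp add: c_def mult_neg_pos)
  define t where "t = b' - (1 - y' b') / c"
  have t: "t \<le> b'" using c y'neg[of b'] by (simp add: t_def)
  have "y' b' + c * b' \<le> y' t + c * t"
  proof (rule deriv_nonpos_ge[OF t])
    show "((\<lambda>t. y' t + c * t) has_real_derivative s * y s + c) (at s)" for s
      by (auto intro!: derivative_eq_intros D(2))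
    fix s assume s: "t \<le> s" "s \<le> b'"
    have "- b' * y b' \<le> (- s) * y s" using s b' ge[of s] yb by (intro mult_mono) auto
    then show "s * y s + c \<le> 0" by (simp add: c_def)
  qed
  moreover have "c * (b' - t) = 1 - y' b'" using c by (simp add: t_def)
  ultimately have "1 \<le> y' t" by (simp add: algebra_simps)
  with y'neg[OF t] show False by simp
qed

text \<open>Infinitely many zeros in a compact interval accumulate at some \<open>z\<close>. There
  \<open>f z = 0\<close> by continuity, and the difference quotients along the zeros vanish, so
  \<open>f' z = 0\<close> and \<open>z\<close> is not simple.\<close>

lemma finite_simple_zeros:
  fixes f :: "real \<Rightarrow> real"
  assumes D: "\<And>x. (f has_real_derivative f' x) (at x)"
    and simple: "\<And>x. x \<in> {a..b} \<Longrightarrow> f x = 0 \<Longrightarrow> f' x \<noteq> 0"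
  shows "finite {x \<in> {a..b}. f x = 0}"
proof (rule ccontr)
  let ?Z = "{x \<in> {a..b}. f x = 0}"
  assume inf: "infinite ?Z"
  have "\<forall>T. infinite T \<and> T \<subseteq> {a..b} \<longrightarrow> (\<exists>x\<in>{a..b}. x islimpt T)"
    by (rule compact_eq_Bolzano_Weierstrass[THEN iffD1]) simp
  then have "\<exists>z\<in>{a..b}. z islimpt ?Z"
    by (rule allE[of _ ?Z]) (use inf in auto)
  then obtain z where z: "z \<in> {a..b}" "z islimpt ?Z" by blast
  have freq: "\<exists>\<^sub>F x in at z. f x = 0"
    using z(2) unfolding islimpt_conv_frequently_at by (auto elim: frequently_elim1)
  have "continuous (at z) f" using D by (rule DERIV_isCont)
  have fz: "f z = 0"
  proof (rule ccontr)
    assume "f z \<noteq> 0"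
    then have "\<forall>\<^sub>F x in at z. f x \<noteq> 0"
      using tendsto_imp_eventually_ne[of f "f z" "at z" 0] \<open>continuous (at z) f\<close> by (simp add: isCont_def)
    with freq show False by (auto simp: frequently_def)
  qed
  have "((\<lambda>x. (f x - f z) / (x - z)) \<longlongrightarrow> f' z) (at z)"
    using D[of z] by (simp add: has_field_derivative_iff)
  then have "\<forall>\<^sub>F x in at z. (f x - f z) / (x - z) \<noteq> 0"
    using simple[OF z(1) fz] by (rule tendsto_imp_eventually_ne)
  then have "\<forall>\<^sub>F x in at z. f x \<noteq> 0" by eventually_elim (auto simp: fz)
  with freq show False by (auto simp: frequently_def)
qed

lemma finite_Ai_zeros: "finite {x. b \<le> x \<and> (Ai x = 0 \<or> deriv Ai x = 0)}"
proof -
  have "{x. b \<le> x \<and> (Ai x = 0 \<or> deriv Ai x = 0)} \<subseteq>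
      {x \<in> {b..0}. Ai x = 0} \<union> {x \<in> {b..0}. deriv Ai x = 0}"
    using Ai_nonzero by (auto simp: not_le intro: less_imp_le) (meson linear)+
  moreover have "finite {x \<in> {b..0}. Ai x = 0}"
    using DERIV_Ai(1) by (rule finite_simple_zeros) (use Ai_no_common_zero in auto)
  \<comment> \<open>A zero of \<open>Ai'\<close> is simple because \<open>Ai'' = x Ai\<close>, where
    \<open>Ai x \<noteq> 0\<close>, and \<open>x \<noteq> 0\<close> since
    \<open>Ai' 0 \<noteq> 0\<close>.\<close>
  moreover have "finite {x \<in> {b..0}. deriv Ai x = 0}"
    using DERIV_Ai(2) by (rule finite_simple_zeros) (use Ai_no_common_zero Ai_nonzero(2)[of 0] in auto)
  ultimately show ?thesis by (meson finite_UnI finite_subset)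
qed

lemma kth_largest_eqI:
  assumes "x \<in> S" "finite {y \<in> S. x < y}" "card {y \<in> S. x < y} + 1 = k"
  shows "kth_largest S k = x"
  unfolding kth_largest_def
proof (rule the_equality)
  have lessc: "card {y \<in> S. b < y} < card {y \<in> S. a < y}"
    if "a < b" "b \<in> S" "finite {y \<in> S. a < y}" for a b
    by (rule psubset_card_mono) (use that in auto)
  fix z assume z: "z \<in> S \<and> finite {y \<in> S. z < y} \<and> card {y \<in> S. z < y} + 1 = k"
  show "z = x"
  proof (cases z x rule: linorder_cases)
    case less
    with lessc[of z x] show ?thesis using z assms by auto
  next
    case greater
    with lessc[of x z] show ?thesis using z assms by auto
  qed
qed (use assms in auto)

text \<open>Local finiteness provides a least element and, above every real, a next element of
  \<open>S\<close>; \<open>e\<close> iterates the latter. An element that is never reached would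
  have infinitely many elements of \<open>S\<close> below it.\<close>

lemma locally_finite_enumeration:
  fixes S :: "real set"
  assumes fin: "\<And>b. finite {x \<in> S. x \<le> b}" and unb: "\<And>b. \<exists>x\<in>S. b < x"
  shows "\<exists>e :: nat \<Rightarrow> real. strict_mono e \<and> range e = S"
proof -
  have "\<exists>y. y \<in> S \<and> x < y \<and> (\<forall>z\<in>S. x < z \<longrightarrow> y \<le> z)" for x
  proof -
    obtain s where s: "s \<in> S" "x < s" using unb by blast
    let ?T = "{y \<in> S. x < y \<and> y \<le> s}"
    have T: "finite ?T" "?T \<noteq> {}" using s finite_subset[OF _ fin[of s], of ?T] by auto
    have "Min ?T \<le> z" if "z \<in> S" "x < z" for z
    proof (cases "z \<le> s")
      case True
      then show ?thesis using that T by (intro Min_le) auto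
    next
      case False
      then show ?thesis using Min_in[OF T] by auto
    qed
    with Min_in[OF T] show ?thesis by blast
  qed
  then obtain nxt where nxt: "\<And>x. nxt x \<in> S" "\<And>x. x < nxt x" "\<And>x z. z \<in> S \<Longrightarrow> x < z \<Longrightarrow> nxt x \<le> z"
    by metis
  obtain s where s: "s \<in> S" using unb by blast
  define m where "m = Min {x \<in> S. x \<le> s}"
  have mne: "{x \<in> S. x \<le> s} \<noteq> {}" using s by auto
  have m: "m \<in> S" "\<And>z. z \<in> S \<Longrightarrow> m \<le> z"
  proof -
    show "m \<in> S" using Min_in[OF fin mne] by (auto simp: m_def)
    fix z assume "z \<in> S"
    then show "m \<le> z"
      using Min_in[OF fin mne] Min_le[OF fin, of z] by (cases "z \<le> s") (auto simp: m_def)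
  qed
  define e where "e = rec_nat m (\<lambda>_. nxt)"
  have e: "e 0 = m" "e (Suc n) = nxt (e n)" for n by (auto simp: e_def)
  have mono: "strict_mono e" by (simp add: strict_mono_Suc_iff e nxt)
  have "e n \<in> S" for n by (cases n) (auto simp: e m nxt)
  moreover have "x \<in> range e" if x: "x \<in> S" for x
  proof (rule ccontr)
    assume nr: "x \<notin> range e"
    have lt: "e n < x" for n
    proof (induction n)
      case 0
      then show ?case using m(2)[OF x] nr e(1) by (metis order_le_less rangeI)
    next
      case (Suc n)
      then show ?case using nxt(3)[OF x Suc] nr e(2) by (metis order_le_less rangeI)
    qed
    have "range e \<subseteq> {y \<in> S. y \<le> x}" using lt \<open>\<And>n. e n \<in> S\<close> by (auto intro: less_imp_le)
    then have "finite (range e)" using fin finite_subset by blast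
    then show False using range_inj_infinite[of e] strict_mono_imp_inj_on[OF mono] by auto
  qed
  ultimately show ?thesis using mono by (intro exI[of _ e]) auto
qed

definition airy_spectrum :: "real set" where
  "airy_spectrum = {l. Ai (- l) = 0 \<or> deriv Ai (- l) = 0}"

lemma airy_spectrum_pos: "l \<in> airy_spectrum \<Longrightarrow> 0 < l"
  using Ai_nonzero[of "- l"] by (auto simp: airy_spectrum_def not_less[symmetric])

lemma airy_spectrum_enumeration: "\<exists>e :: nat \<Rightarrow> real. strict_mono e \<and> range e = airy_spectrum"
proof (rule locally_finite_enumeration)
  fix b
  have "{x \<in> airy_spectrum. x \<le> b} = uminus ` {x. - b \<le> x \<and> (Ai x = 0 \<or> deriv Ai x = 0)}"
    by (auto simp: airy_spectrum_def intro!: image_eqI[of _ uminus "- _"])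
  then show "finite {x \<in> airy_spectrum. x \<le> b}" using finite_Ai_zeros[of "- b"] by simp
  obtain x where "x < - b" "Ai x = 0" using Ai_zeros_unbounded by blast
  then show "\<exists>x\<in>airy_spectrum. b < x" by (intro bexI[of _ "- x"]) (auto simp: airy_spectrum_def)
qed

text \<open>Neighbours in the spectrum enclose no zero of \<open>Ai\<close> or \<open>Ai'\<close>.
  Two zeros of \<open>Ai\<close> would enclose one of \<open>Ai'\<close>; two zeros of
  \<open>Ai'\<close> would enclose a zero of \<open>Ai'' = x Ai\<close>, hence of \<open>Ai\<close>,
  because the interval lies left of 0. The smallest point decides which kind comes first.\<close>

lemma airy_spectrum_alternates:
  assumes mono: "\<And>m n :: nat. 1 \<le> m \<Longrightarrow> m < n \<Longrightarrow> lam m < lam n"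
    and range: "lam ` {1..} = airy_spectrum"
    and "1 \<le> n"
  shows "(odd n \<longrightarrow> deriv Ai (- lam n) = 0) \<and> (even n \<longrightarrow> Ai (- lam n) = 0)"
proof -
  have gap: "x \<notin> airy_spectrum" if "lam n < x" "x < lam (Suc n)" "1 \<le> n" for x n
  proof
    assume "x \<in> airy_spectrum"
    then obtain m where m: "1 \<le> m" "x = lam m" unfolding range[symmetric] by auto
    show False
      using mono[of m n] mono[of "Suc n" m] that m
      by (cases "m < n"; cases "m = n"; cases "m = Suc n") auto
  qed
  show ?thesis using \<open>1 \<le> n\<close>
  proof (induction n rule: nat_induct_at_least)
    case base
    have l: "lam 1 \<in> airy_spectrum" using range by auto
    \<comment> \<open>If the zero closest to 0 belonged to \<open>Ai\<close>, then \<open>Ai\<close>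
      would rise from 0 there to \<open>Ai 0 > 0\<close>; so \<open>Ai'\<close> would be positive
      somewhere in between and negative at 0, with a zero even closer to 0.\<close>
    have "deriv Ai (- lam 1) = 0"
    proof (rule ccontr)
      assume "deriv Ai (- lam 1) \<noteq> 0"
      then have A: "Ai (- lam 1) = 0" using l by (simp add: airy_spectrum_def)
      have pos: "0 < lam 1" using l by (rule airy_spectrum_pos)
      obtain z where z: "- lam 1 < z" "z < 0" "Ai 0 - Ai (- lam 1) = (0 - - lam 1) * deriv Ai z"
        using MVT2[of "- lam 1" 0 Ai "deriv Ai"] DERIV_Ai(1) pos by auto
      have "0 < deriv Ai z" using z(3) A pos Ai_spec(3) by (simp add: zero_less_mult_iff)
      then have "deriv Ai 0 \<le> 0" "0 \<le> deriv Ai z" using deriv_Ai_neg[of 0] by auto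
      from IVT2'[OF this less_imp_le[OF z(2)] continuous_on_Ai(2)]
      obtain w where w: "z \<le> w" "deriv Ai w = 0" by blast
      then have "- w \<in> airy_spectrum" by (simp add: airy_spectrum_def)
      then obtain m where m: "1 \<le> m" "- w = lam m" unfolding range[symmetric] by auto
      then show False using mono[of 1 m] w z by (cases "m = 1") auto
    qed
    then show ?case by simp
  next
    case (Suc n)
    have S: "lam n \<in> airy_spectrum" "lam (Suc n) \<in> airy_spectrum" using range Suc by auto
    note pos = airy_spectrum_pos[OF S(1)] airy_spectrum_pos[OF S(2)]
    have lt: "- lam (Suc n) < - lam n" using mono[of n "Suc n"] Suc by simp
    have "Ai (- lam (Suc n)) = 0" if d: "deriv Ai (- lam n) = 0"
    proof (rule ccontr)
      assume "Ai (- lam (Suc n)) \<noteq> 0"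
      then have "deriv Ai (- lam (Suc n)) = 0" using S by (simp add: airy_spectrum_def)
      then obtain z where z: "- lam (Suc n) < z" "z < - lam n" "z * Ai z = 0"
        using MVT2[OF lt, of "deriv Ai" "\<lambda>x. x * Ai x"] d DERIV_Ai(2) lt by auto
      then have "- z \<in> airy_spectrum" using pos by (auto simp: airy_spectrum_def)
      then show False using gap[of n "- z"] z Suc by auto
    qed
    moreover have "deriv Ai (- lam (Suc n)) = 0" if d: "Ai (- lam n) = 0"
    proof (rule ccontr)
      assume "deriv Ai (- lam (Suc n)) \<noteq> 0"
      then have "Ai (- lam (Suc n)) = 0" using S by (simp add: airy_spectrum_def)
      then obtain z where z: "- lam (Suc n) < z" "z < - lam n" "deriv Ai z = 0"
        using MVT2[OF lt, of Ai "deriv Ai"] d DERIV_Ai(1) lt by auto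
      then have "- z \<in> airy_spectrum" by (auto simp: airy_spectrum_def)
      then show False using gap[of n "- z"] z Suc by auto
    qed
    ultimately show ?case using Suc.IH by auto
  qed
qed

text \<open>The larger zeros of the same kind are those with index \<open>j < k\<close>, and by
  strict monotonicity they are \<open>k - 1\<close> in number, which is what
  \<open>kth_largest\<close> counts.\<close>

lemma airy_spectrum_kth:
  assumes mono: "\<And>m n :: nat. 1 \<le> m \<Longrightarrow> m < n \<Longrightarrow> lam m < lam n"
    and range: "lam ` {1..} = airy_spectrum"
    and k: "1 \<le> k"
  shows "lam (2 * k - 1) = - Ai_deriv_zero k" "lam (2 * k) = - Ai_zero k"
proof -
  note alt = airy_spectrum_alternates[OF mono range]
  have inj: "lam m = lam n \<longleftrightarrow> m = n" if "1 \<le> m" "1 \<le> n" for m n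
    using mono[of m n] mono[of n m] that by (cases m n rule: linorder_cases) auto
  have lt: "lam m < lam n \<longleftrightarrow> m < n" if "1 \<le> m" "1 \<le> n" for m n
    using mono[of m n] mono[of n m] that by (cases m n rule: linorder_cases) auto
  have mem: "\<exists>n\<ge>1. y = - lam n" if "Ai y = 0 \<or> deriv Ai y = 0" for y
  proof -
    have "- y \<in> airy_spectrum" using that by (simp add: airy_spectrum_def)
    then show ?thesis unfolding range[symmetric] by force
  qed
  have even: "{y. Ai y = 0} = (\<lambda>j. - lam (2 * j)) ` {1..}"
  proof safe
    fix y assume "Ai y = 0"
    with mem obtain n where n: "n \<ge> 1" "y = - lam n" by blast
    with alt[of n] Ai_no_common_zero[of y] \<open>Ai y = 0\<close> have "even n" by auto
    then obtain j where "n = 2 * j" by blast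
    with n show "y \<in> (\<lambda>j. - lam (2 * j)) ` {1..}" by (intro image_eqI[of _ _ j]) auto
  qed (use alt in auto)
  have odd: "{y. deriv Ai y = 0} = (\<lambda>j. - lam (2 * j - 1)) ` {1..}"
  proof safe
    fix y assume "deriv Ai y = 0"
    with mem obtain n where n: "n \<ge> 1" "y = - lam n" by blast
    with alt[of n] Ai_no_common_zero[of y] \<open>deriv Ai y = 0\<close> have "odd n" by auto
    then obtain j where "n = 2 * j + 1" by (rule oddE)
    with n show "y \<in> (\<lambda>j. - lam (2 * j - 1)) ` {1..}" by (intro image_eqI[of _ _ "j + 1"]) auto
  qed (use alt in auto)
  have "{y \<in> {y. Ai y = 0}. - lam (2 * k) < y} = (\<lambda>j. - lam (2 * j)) ` {1..<k}"
    unfolding even using k by (auto simp: lt)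
  moreover have "inj_on (\<lambda>j. - lam (2 * j)) {1..<k}" by (auto simp: inj_on_def inj)
  ultimately have "kth_largest {y. Ai y = 0} k = - lam (2 * k)"
    using k alt[of "2 * k"] by (intro kth_largest_eqI) (auto simp: card_image)
  then show "lam (2 * k) = - Ai_zero k" by (simp add: Ai_zero_def)
  have "{y \<in> {y. deriv Ai y = 0}. - lam (2 * k - 1) < y} = (\<lambda>j. - lam (2 * j - 1)) ` {1..<k}"
    unfolding odd using k by (auto simp: lt)
  moreover have "inj_on (\<lambda>j. - lam (2 * j - 1)) {1..<k}" by (auto simp: inj_on_def inj)
  ultimately have "kth_largest {y. deriv Ai y = 0} k = - lam (2 * k - 1)"
    using k alt[of "2 * k - 1"] by (intro kth_largest_eqI) (auto simp: card_image)
  then show "lam (2 * k - 1) = - Ai_deriv_zero k" by (simp add: Ai_deriv_zero_def)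
qed

section \<open>Rapidly decaying functions and the Fourier transform\<close>

definition rapid :: "(real \<Rightarrow> real) \<Rightarrow> bool" where
  "rapid u \<longleftrightarrow> continuous_on UNIV u \<and> (\<exists>a>0. \<exists>C. \<forall>k. \<bar>u k\<bar> \<le> C * exp (- a * \<bar>k\<bar>))"

lemma rapidI:
  assumes "continuous_on UNIV u" "0 < a" "\<And>k. \<bar>u k\<bar> \<le> C * exp (- a * \<bar>k\<bar>)"
  shows "rapid u"
  using assms unfolding rapid_def by blast

lemma rapidE:
  assumes "rapid u"
  obtains a C where "0 < a" "0 \<le> C" "\<And>k. \<bar>u k\<bar> \<le> C * exp (- a * \<bar>k\<bar>)"
proof -
  from assms obtain a C where *: "a > 0" "\<And>k. \<bar>u k\<bar> \<le> C * exp (- a * \<bar>k\<bar>)"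
    unfolding rapid_def by blast
  from *(2)[of 0] have "0 \<le> C" by simp
  with * that show thesis by blast
qed

lemma rapid_continuous: "rapid u \<Longrightarrow> continuous_on UNIV u"
  by (simp add: rapid_def)

lemma rapid_isCont: "rapid u \<Longrightarrow> isCont u x"
  using rapid_continuous continuous_on_eq_continuous_at by blast

lemma rapid_measurable [measurable_dest]: "rapid u \<Longrightarrow> u \<in> borel_measurable borel"
  by (intro borel_measurable_continuous_onI rapid_continuous)

lemma rapid_bounded: "rapid u \<Longrightarrow> \<exists>B\<ge>0. \<forall>k. \<bar>u k\<bar> \<le> B"
proof -
  assume "rapid u"
  then obtain a C where a: "0 < a" "0 \<le> C" "\<And>k. \<bar>u k\<bar> \<le> C * exp (- a * \<bar>k\<bar>)" by (rule rapidE) blast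
  have "C * exp (- a * \<bar>k\<bar>) \<le> C * 1" for k
    using a by (intro mult_left_mono) auto
  with a show ?thesis by (metis mult.right_neutral order_trans)
qed

lemma rapid_add:
  assumes "rapid u" "rapid v"
  shows "rapid (\<lambda>k. u k + v k)"
proof -
  obtain a C where a: "0 < a" "0 \<le> C" "\<And>k. \<bar>u k\<bar> \<le> C * exp (- a * \<bar>k\<bar>)" by (rule rapidE[OF assms(1)]) blast
  obtain b D where b: "0 < b" "0 \<le> D" "\<And>k. \<bar>v k\<bar> \<le> D * exp (- b * \<bar>k\<bar>)" by (rule rapidE[OF assms(2)]) blast
  have "\<bar>u k + v k\<bar> \<le> (C + D) * exp (- min a b * \<bar>k\<bar>)" for k
  proof -
    have "\<bar>u k + v k\<bar> \<le> C * exp (- a * \<bar>k\<bar>) + D * exp (- b * \<bar>k\<bar>)"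
      using a(3)[of k] b(3)[of k] by linarith
    also have "\<dots> \<le> C * exp (- min a b * \<bar>k\<bar>) + D * exp (- min a b * \<bar>k\<bar>)"
      using a b by (intro add_mono mult_left_mono) (auto intro!: mult_right_mono)
    finally show ?thesis by (simp add: algebra_simps)
  qed
  then show ?thesis using a b rapid_continuous[OF assms(1)] rapid_continuous[OF assms(2)]
    by (intro rapidI[of _ "min a b" "C + D"] continuous_intros) auto
qed

lemma rapid_mult_bounded:
  assumes "rapid u" "continuous_on UNIV m" "\<And>k. \<bar>m k\<bar> \<le> B"
  shows "rapid (\<lambda>k. m k * u k)"
proof -
  obtain a C where a: "0 < a" "0 \<le> C" "\<And>k. \<bar>u k\<bar> \<le> C * exp (- a * \<bar>k\<bar>)" by (rule rapidE[OF assms(1)]) blast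
  have "\<bar>m k * u k\<bar> \<le> (B * C) * exp (- a * \<bar>k\<bar>)" for k
    unfolding abs_mult mult.assoc using a(2,3) assms(3)
    by (intro mult_mono) (auto intro: order_trans[OF abs_ge_zero])
  then show ?thesis using a assms rapid_continuous[OF assms(1)]
    by (intro rapidI[of _ a "B * C"] continuous_intros) auto
qed

lemma rapid_cmult: "rapid u \<Longrightarrow> rapid (\<lambda>k. c * u k)"
  by (rule rapid_mult_bounded[of _ "\<lambda>_. c" "\<bar>c\<bar>"]) auto

lemma rapid_minus: "rapid u \<Longrightarrow> rapid (\<lambda>k. - u k)"
  using rapid_cmult[of u "-1"] by simp

lemma rapid_diff: "rapid u \<Longrightarrow> rapid v \<Longrightarrow> rapid (\<lambda>k. u k - v k)"
  using rapid_add[OF _ rapid_minus, of u v] by simp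

lemma rapid_mult: "rapid u \<Longrightarrow> rapid v \<Longrightarrow> rapid (\<lambda>k. u k * v k)"
  using rapid_mult_bounded[of v u] rapid_bounded[of u] rapid_continuous by blast

lemma rapid_power2: "rapid u \<Longrightarrow> rapid (\<lambda>k. (u k)\<^sup>2)"
  unfolding power2_eq_square by (rule rapid_mult)

lemma rapid_reflect: "rapid u \<Longrightarrow> rapid (\<lambda>k. u (- k))"
proof -
  assume u: "rapid u"
  then obtain a C where a: "0 < a" "0 \<le> C" "\<And>k. \<bar>u k\<bar> \<le> C * exp (- a * \<bar>k\<bar>)" by (rule rapidE) blast
  have "continuous_on UNIV (\<lambda>k. u (- k))"
    by (rule continuous_on_compose2[OF rapid_continuous[OF u]]) (auto intro: continuous_intros)
  then show ?thesis using a(1) a(3)[of "- _"] by (intro rapidI[of _ a C]) auto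
qed

text \<open>Half of the decay rate is given up to absorb the factor:
  \<open>a / 2 * \<bar>k\<bar>\<close> is at most its exponential. This is why \<open>rapid\<close>
  leaves the rate unspecified.\<close>

lemma rapid_times_abs: "rapid u \<Longrightarrow> rapid (\<lambda>k. \<bar>k\<bar> * u k)"
proof -
  assume u: "rapid u"
  then obtain a C where a: "0 < a" "0 \<le> C" "\<And>k. \<bar>u k\<bar> \<le> C * exp (- a * \<bar>k\<bar>)" by (rule rapidE) blast
  have "\<bar>\<bar>k\<bar> * u k\<bar> \<le> (2 * C / a) * exp (- (a / 2) * \<bar>k\<bar>)" for k
  proof -
    have "a / 2 * \<bar>k\<bar> \<le> exp (a / 2 * \<bar>k\<bar>)" using exp_ge_add_one_self[of "a / 2 * \<bar>k\<bar>"] by linarith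
    then have "\<bar>k\<bar> \<le> (2 / a) * exp (a / 2 * \<bar>k\<bar>)" using a(1) by (simp add: field_simps)
    then have "\<bar>k\<bar> * \<bar>u k\<bar> \<le> ((2 / a) * exp (a / 2 * \<bar>k\<bar>)) * (C * exp (- a * \<bar>k\<bar>))"
      using a by (intro mult_mono) auto
    also have "\<dots> = (2 * C / a) * (exp (a / 2 * \<bar>k\<bar>) * exp (- a * \<bar>k\<bar>))" by simp
    also have "exp (a / 2 * \<bar>k\<bar>) * exp (- a * \<bar>k\<bar>) = exp (- (a / 2) * \<bar>k\<bar>)"
      unfolding exp_add[symmetric] by (simp add: field_simps)
    finally show ?thesis by (simp add: abs_mult)
  qed
  then show ?thesis using a(1) rapid_continuous[OF u]
    by (intro rapidI[of _ "a / 2" "2 * C / a"] continuous_intros) auto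
qed

lemma rapid_times_square: "rapid u \<Longrightarrow> rapid (\<lambda>k. k\<^sup>2 * u k)"
  using rapid_times_abs[OF rapid_times_abs, of u] by (simp add: power2_eq_square abs_mult_self mult.assoc[symmetric])

lemma rapid_compact_support:
  assumes "continuous_on UNIV u" "\<And>k. R < \<bar>k\<bar> \<Longrightarrow> u k = 0"
  shows "rapid u"
proof -
  have "compact (u ` {-R..R})"
    by (intro compact_continuous_image continuous_on_subset[OF assms(1)]) auto
  then obtain B where "\<forall>k\<in>{-R..R}. \<bar>u k\<bar> \<le> B"
    using compact_imp_bounded[of "u ` {-R..R}"] by (auto simp: bounded_iff)
  moreover have "k \<in> {-R..R}" if "\<bar>k\<bar> \<le> R" for k using that by (simp add: abs_le_iff)
  ultimately have B: "\<bar>k\<bar> \<le> R \<Longrightarrow> \<bar>u k\<bar> \<le> B" for k by blast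
  have "\<bar>u k\<bar> \<le> (\<bar>B\<bar> * exp \<bar>R\<bar>) * exp (- 1 * \<bar>k\<bar>)" for k
  proof (cases "\<bar>k\<bar> \<le> R")
    case True
    have "\<bar>u k\<bar> * 1 \<le> \<bar>B\<bar> * (exp \<bar>R\<bar> * exp (- \<bar>k\<bar>))"
      using B[OF True] True by (intro mult_mono) (auto simp: exp_add[symmetric])
    then show ?thesis by (simp add: mult_ac)
  qed (use assms in auto)
  then show ?thesis by (intro rapidI[OF assms(1), of 1 "\<bar>B\<bar> * exp \<bar>R\<bar>"]) auto
qed

section \<open>Integrability and Fubini's theorem for bounded kernels\<close>

lemma integrable_inverse_quadratic: "integrable lborel (\<lambda>x::real. inverse (1 + x\<^sup>2))"
  using integrable_inverse_1_plus_square by (simp add: set_integrable_def einterval_def)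

lemma integrable_quadratic_decay:
  fixes f :: "real \<Rightarrow> 'b :: {banach, second_countable_topology}"
  assumes [measurable]: "f \<in> borel_measurable borel" and b: "\<And>x. norm (f x) * (1 + x\<^sup>2) \<le> B"
  shows "integrable lborel f"
proof (rule Bochner_Integration.integrable_bound)
  show "integrable lborel (\<lambda>x::real. B * inverse (1 + x\<^sup>2))"
    by (intro integrable_mult_right integrable_inverse_quadratic)
  show "AE x in lborel. norm (f x) \<le> norm (B * inverse (1 + x\<^sup>2))"
  proof (intro always_eventually allI)
    fix x :: real
    have "0 < 1 + x\<^sup>2" by (simp add: add_pos_nonneg)
    then have "norm (f x) \<le> B * inverse (1 + x\<^sup>2)" using b[of x] by (simp add: field_simps)
    then show "norm (f x) \<le> norm (B * inverse (1 + x\<^sup>2))" by simp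
  qed
qed simp

lemma rapid_integrable:
  assumes "rapid u"
  shows "integrable lborel u"
proof -
  obtain B where "\<forall>k. \<bar>u k + k\<^sup>2 * u k\<bar> \<le> B"
    using rapid_bounded[OF rapid_add[OF assms rapid_times_square[OF assms]]] by blast
  moreover have "\<bar>u k\<bar> * (1 + k\<^sup>2) = \<bar>u k + k\<^sup>2 * u k\<bar>" for k
  proof -
    have "u k + k\<^sup>2 * u k = (1 + k\<^sup>2) * u k" by (simp add: algebra_simps)
    then show ?thesis by (simp only: abs_mult) (simp add: abs_of_nonneg add_nonneg_nonneg)
  qed
  ultimately show ?thesis using assms by (intro integrable_quadratic_decay[of u B]) auto
qed

lemma integrable_product_kernel:
  fixes f g :: "_ \<Rightarrow> complex"
  assumes "sigma_finite_measure M1" "sigma_finite_measure M2"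
    and f: "integrable M1 f" and g: "integrable M2 g"
    and h [measurable]: "h \<in> borel_measurable (M1 \<Otimes>\<^sub>M M2)" and b: "\<And>z. cmod (h z) \<le> 1"
  shows "integrable (M1 \<Otimes>\<^sub>M M2) (\<lambda>z. f (fst z) * g (snd z) * h z)"
proof -
  interpret pair_sigma_finite M1 M2
    using assms(1,2) by (rule pair_sigma_finite.intro)
  have [measurable]: "f \<in> borel_measurable M1" "g \<in> borel_measurable M2" using f g by auto
  have "integrable (M1 \<Otimes>\<^sub>M M2) (\<lambda>z. f (fst z) * g (snd z))"
  proof (rule Fubini_integrable)
    show "integrable M1 (\<lambda>x. \<integral>y. norm (f (fst (x, y)) * g (snd (x, y))) \<partial>M2)"
      using f by (simp add: norm_mult integrable_norm)
    show "AE x in M1. integrable M2 (\<lambda>y. f (fst (x, y)) * g (snd (x, y)))"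
      using g by simp
  qed simp
  then show ?thesis
    by (rule Bochner_Integration.integrable_bound)
       (use b in \<open>auto simp: norm_mult intro!: mult_left_le\<close>)
qed

text \<open>Two measures are allowed because the kernel \<open>iexp (x * y)\<close> is integrated
  against Lebesgue measure in both variables for the multiplication formula, and against a
  probability law in one of them for averages of translates.\<close>

lemma Fubini_product_kernel:
  fixes f g :: "_ \<Rightarrow> complex"
  assumes "sigma_finite_measure M1" "sigma_finite_measure M2"
    and f: "integrable M1 f" and g: "integrable M2 g"
    and h: "(\<lambda>z. h (fst z) (snd z)) \<in> borel_measurable (M1 \<Otimes>\<^sub>M M2)" and b: "\<And>x y. cmod (h x y) \<le> 1"
  shows "(LINT x|M1. f x * (LINT y|M2. g y * h x y)) = (LINT y|M2. g y * (LINT x|M1. f x * h x y))"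
proof -
  interpret pair_sigma_finite M1 M2
    using assms(1,2) by (rule pair_sigma_finite.intro)
  have "integrable (M1 \<Otimes>\<^sub>M M2) (\<lambda>z. f (fst z) * g (snd z) * h (fst z) (snd z))"
    using assms by (intro integrable_product_kernel[where h = "\<lambda>z. h (fst z) (snd z)"]) auto
  then have "integrable (M1 \<Otimes>\<^sub>M M2) (case_prod (\<lambda>x y. f x * g y * h x y))"
    by (simp add: case_prod_unfold)
  from Fubini_integral[OF this]
  have "(\<integral>x. \<integral>y. f x * g y * h x y \<partial>M2 \<partial>M1) = (\<integral>y. \<integral>x. f x * g y * h x y \<partial>M1 \<partial>M2)" by simp
  moreover have "(\<integral>y. f x * g y * h x y \<partial>M2) = f x * (\<integral>y. g y * h x y \<partial>M2)" for x
    by (simp add: mult.assoc)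
  moreover have "(\<integral>x. f x * g y * h x y \<partial>M1) = g y * (\<integral>x. f x * h x y \<partial>M1)" for y
  proof -
    have "f x * g y * h x y = g y * (f x * h x y)" for x by simp
    then show ?thesis by (simp only: integral_mult_right_zero)
  qed
  ultimately show ?thesis by simp
qed

section \<open>The Fourier transform: multiplication formula, inversion, Plancherel\<close>

lemma iexp_measurable [measurable (raw)]:
  "f \<in> borel_measurable M \<Longrightarrow> (\<lambda>x. iexp (f x)) \<in> borel_measurable M"
  by (rule borel_measurable_continuous_on) (auto intro!: continuous_intros)

lemma cnj_measurable [measurable (raw)]:
  "f \<in> borel_measurable M \<Longrightarrow> (\<lambda>x. cnj (f x)) \<in> borel_measurable M"
  by (rule borel_measurable_continuous_on) (auto intro!: continuous_intros)

lemma fourier_measurable [measurable]: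
  assumes [measurable]: "f \<in> borel_measurable borel"
  shows "fourier f \<in> borel_measurable borel"
  unfolding fourier_def by measurable

lemma cmod_fourier_le:
  "cmod (fourier f x) \<le> 1 / sqrt (2 * pi) * (LINT z|lborel. cmod (f z))"
proof -
  have "cmod (LINT z|lborel. iexp (x * z) * f z) \<le> (LINT z|lborel. cmod (iexp (x * z) * f z))"
    by (rule integral_norm_bound)
  then show ?thesis
    by (simp add: fourier_def norm_mult norm_divide divide_right_mono real_sqrt_ge_zero)
qed

text \<open>The kernel is symmetric in its two variables, so Fubini's theorem moves the transform
  from one factor to the other. Inversion, Plancherel and the pairings with eigenfunctions rest on
  this identity.\<close>

lemma fourier_mult_formula:
  assumes "integrable lborel f" "integrable lborel g"
  shows "(LINT x|lborel. fourier f x * g x) = (LINT x|lborel. f x * fourier g x)"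
proof -
  define c where "c = complex_of_real (1 / sqrt (2 * pi))"
  have "(LINT x|lborel. g x * (LINT z|lborel. f z * iexp (x * z))) =
        (LINT z|lborel. f z * (LINT x|lborel. g x * iexp (x * z)))"
    by (rule Fubini_product_kernel[where h = "\<lambda>x z. iexp (x * z)"])
       (use assms lborel.sigma_finite_measure_axioms in auto)
  then have "c * (LINT x|lborel. g x * (LINT z|lborel. f z * iexp (x * z))) =
        c * (LINT z|lborel. f z * (LINT x|lborel. g x * iexp (x * z)))" by simp
  moreover have f: "fourier f x = c * (LINT z|lborel. f z * iexp (x * z))" for x
    by (simp only: fourier_def c_def mult.commute[of _ "f _"])
  moreover have g: "fourier g z = c * (LINT x|lborel. g x * iexp (x * z))" for z
    by (simp only: fourier_def c_def mult.commute[of _ "g _"] mult.commute[of z])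
  ultimately show ?thesis
    by (simp only: f g mult.left_commute[of _ c] mult.assoc mult.commute[of _ "g _"] integral_mult_right_zero)
qed

text \<open>The characteristic function of the standard normal law at
  \<open>(y - x) / \<sigma>\<close>, after rescaling \<open>k\<close> by \<open>\<sigma>\<close>;
  the modulation \<open>iexp (- x * k)\<close> shifts the center of the resulting Gaussian to
  \<open>x\<close>.\<close>

lemma fourier_modulated_gaussian:
  assumes "0 < \<sigma>"
  shows "fourier (\<lambda>k. iexp (- x * k) * complex_of_real (exp (- (\<sigma> * k)\<^sup>2 / 2))) y
    = complex_of_real (sqrt (2 * pi) * normal_density x \<sigma> y)"
proof -
  define t where "t = (y - x) / \<sigma>"
  have "char std_normal_distribution t = complex_of_real (exp (- (t\<^sup>2) / 2))"
    by (simp add: char_std_normal_distribution)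
  also have "char std_normal_distribution t = (LINT k|lborel. std_normal_density k *\<^sub>R iexp (t * k))"
    unfolding char_def by (subst integral_density) (auto simp: normal_density_nonneg)
  also have "\<dots> = \<sigma> *\<^sub>R (LINT k|lborel. std_normal_density (0 + \<sigma> * k) *\<^sub>R iexp (t * (0 + \<sigma> * k)))"
    using assms by (subst lborel_integral_real_affine[of \<sigma> _ 0]) auto
  also have "\<dots> = (\<sigma> / sqrt (2 * pi)) *\<^sub>R
     (LINT k|lborel. iexp (y * k) * (iexp (- x * k) * complex_of_real (exp (- (\<sigma> * k)\<^sup>2 / 2))))"
  proof -
    have "std_normal_density (0 + \<sigma> * k) *\<^sub>R iexp (t * (0 + \<sigma> * k)) =
       (1 / sqrt (2 * pi)) *\<^sub>R (iexp (y * k) * (iexp (- x * k) * complex_of_real (exp (- (\<sigma> * k)\<^sup>2 / 2))))" for k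
    proof -
      have "\<i> * complex_of_real (t * (\<sigma> * k)) = \<i> * complex_of_real (y * k) + \<i> * complex_of_real (- x * k)"
        using assms by (simp add: t_def field_simps)
      then have "iexp (t * (0 + \<sigma> * k)) = iexp (y * k) * iexp (- x * k)" by (simp only: exp_add add_0)
      then show ?thesis
        by (simp add: std_normal_density_def scaleR_conv_of_real mult_ac)
    qed
    then show ?thesis by simp
  qed
  finally have e: "complex_of_real (exp (- (t\<^sup>2) / 2)) = (\<sigma> / sqrt (2 * pi)) *\<^sub>R
     (LINT k|lborel. iexp (y * k) * (iexp (- x * k) * complex_of_real (exp (- (\<sigma> * k)\<^sup>2 / 2))))" by simp
  have "fourier (\<lambda>k. iexp (- x * k) * complex_of_real (exp (- (\<sigma> * k)\<^sup>2 / 2))) y =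
     complex_of_real (1 / \<sigma>) * complex_of_real (exp (- (t\<^sup>2) / 2))"
    unfolding e fourier_def using assms by (simp add: scaleR_conv_of_real)
  also have "\<dots> = complex_of_real (sqrt (2 * pi) * normal_density x \<sigma> y)"
    using assms by (simp add: normal_density_def t_def real_sqrt_mult power_divide flip: of_real_mult)
  finally show ?thesis .
qed

lemma integrable_gaussian:
  assumes "0 < \<sigma>"
  shows "integrable lborel (\<lambda>k. iexp (a * k) * complex_of_real (exp (- (\<sigma> * k)\<^sup>2 / 2)))"
proof -
  have "integrable lborel (\<lambda>k. sqrt (2 * pi * (1 / \<sigma>)\<^sup>2) * normal_density 0 (1 / \<sigma>) k)"
    using assms by (intro integrable_mult_right integrable_normal_density) auto
  then have "integrable lborel (\<lambda>k::real. exp (- (\<sigma> * k)\<^sup>2 / 2))"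
    using assms by (simp add: normal_density_def power_mult_distrib field_simps)
  then show ?thesis
    by (rule Bochner_Integration.integrable_bound) (auto simp: norm_mult)
qed

text \<open>The multiplication formula with a modulated Gaussian as second factor: damping the
  inversion integral by a Gaussian in \<open>k\<close> amounts to smoothing \<open>f\<close> by a
  normal density of width \<open>\<sigma>\<close>.\<close>

lemma fourier_regularized_inversion:
  assumes "0 < \<sigma>" "integrable lborel f"
  shows "(LINT k|lborel. fourier f k * (iexp (- x * k) * complex_of_real (exp (- (\<sigma> * k)\<^sup>2 / 2))))
    = complex_of_real (sqrt (2 * pi)) * (LINT y|lborel. f y * complex_of_real (normal_density x \<sigma> y))"
proof -
  have "(LINT k|lborel. fourier f k * (iexp (- x * k) * complex_of_real (exp (- (\<sigma> * k)\<^sup>2 / 2))))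
    = (LINT y|lborel. f y * fourier (\<lambda>k. iexp (- x * k) * complex_of_real (exp (- (\<sigma> * k)\<^sup>2 / 2))) y)"
    by (rule fourier_mult_formula) (use assms integrable_gaussian[OF assms(1), of "- x"] in auto)
  also have "\<dots> = (LINT y|lborel. complex_of_real (sqrt (2 * pi)) * (f y * complex_of_real (normal_density x \<sigma> y)))"
    by (simp only: fourier_modulated_gaussian[OF assms(1)]) (simp add: mult_ac)
  finally show ?thesis by simp
qed

text \<open>Substituting \<open>y = x + \<sigma> n * z\<close> moves the parameter from the density
  into the argument of \<open>f\<close>; the bound on \<open>f\<close> gives a majorant independent
  of \<open>n\<close>, and continuity gives the limit.\<close>

lemma gaussian_approximate_identity:
  fixes f :: "real \<Rightarrow> complex"
  assumes cont: "continuous_on UNIV f" and b: "\<And>x. cmod (f x) \<le> B"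
    and \<sigma>: "\<And>n. 0 < \<sigma> n" "\<sigma> \<longlonglongrightarrow> 0"
  shows "(\<lambda>n. LINT y|lborel. f y * complex_of_real (normal_density x (\<sigma> n) y)) \<longlonglongrightarrow> f x"
proof -
  have [measurable]: "f \<in> borel_measurable borel" by (rule borel_measurable_continuous_onI[OF cont])
  have eq: "(LINT y|lborel. f y * complex_of_real (normal_density x (\<sigma> n) y)) =
      (LINT z|lborel. f (x + \<sigma> n * z) * complex_of_real (std_normal_density z))" for n
  proof -
    have "\<sigma> n * normal_density x (\<sigma> n) (x + \<sigma> n * z) = std_normal_density z" for z
      using \<sigma>(1)[of n] by (simp add: normal_density_def real_sqrt_mult power_mult_distrib)
    then have *: "\<sigma> n *\<^sub>R (f (x + \<sigma> n * z) * complex_of_real (normal_density x (\<sigma> n) (x + \<sigma> n * z))) =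
        f (x + \<sigma> n * z) * complex_of_real (std_normal_density z)" for z
      by (simp add: scaleR_conv_of_real mult.left_commute flip: of_real_mult)
    show ?thesis
      using \<sigma>(1)[of n] by (subst lborel_integral_real_affine[of "\<sigma> n" _ x]) (auto simp: * simp flip: integral_scaleR_right)
  qed
  have "(\<lambda>n. LINT z|lborel. f (x + \<sigma> n * z) * complex_of_real (std_normal_density z)) \<longlonglongrightarrow>
      (LINT z|lborel. f (x + 0 * z) * complex_of_real (std_normal_density z))"
  proof (rule integral_dominated_convergence)
    show "integrable lborel (\<lambda>z. B * std_normal_density z)"
      by (intro integrable_mult_right integrable_normal_density) auto
    show "AE z in lborel. (\<lambda>n. f (x + \<sigma> n * z) * complex_of_real (std_normal_density z)) \<longlonglongrightarrow>
        f (x + 0 * z) * complex_of_real (std_normal_density z)"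
    proof (intro always_eventually allI tendsto_mult tendsto_const)
      fix z
      have "(\<lambda>n. x + \<sigma> n * z) \<longlonglongrightarrow> x + 0 * z" by (intro tendsto_intros \<sigma>)
      then show "(\<lambda>n. f (x + \<sigma> n * z)) \<longlonglongrightarrow> f (x + 0 * z)"
        using cont by (intro isCont_tendsto_compose[of _ f]) (auto simp: continuous_on_eq_continuous_at)
    qed
    show "AE z in lborel. cmod (f (x + \<sigma> n * z) * complex_of_real (std_normal_density z)) \<le> B * std_normal_density z" for n
      using b by (auto simp: norm_mult normal_density_nonneg intro!: mult_right_mono)
  qed auto
  also have "(LINT z|lborel. f (x + 0 * z) * complex_of_real (std_normal_density z)) = f x"
    by (simp add: integral_normal_density)
  finally show ?thesis unfolding eq .
qed

lemma gaussian_convolution_bounded: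
  fixes f :: "real \<Rightarrow> complex"
  assumes [measurable]: "f \<in> borel_measurable borel" and b: "\<And>x. cmod (f x) \<le> B" and "0 < \<sigma>"
  shows "cmod (LINT y|lborel. f y * complex_of_real (normal_density x \<sigma> y)) \<le> B"
proof -
  have "cmod (LINT y|lborel. f y * complex_of_real (normal_density x \<sigma> y)) \<le>
      (LINT y|lborel. B * normal_density x \<sigma> y)"
  proof (rule Bochner_Integration.integral_norm_bound_integral)
    show i: "integrable lborel (\<lambda>y. B * normal_density x \<sigma> y)"
      using assms by (intro integrable_mult_right integrable_normal_density) auto
    show "integrable lborel (\<lambda>y. f y * complex_of_real (normal_density x \<sigma> y))"
      by (rule Bochner_Integration.integrable_bound[OF i])
         (use b in \<open>auto simp: norm_mult abs_mult intro!: mult_right_mono intro: order_trans[OF b abs_ge_self]\<close>)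
  qed (use b assms in \<open>auto simp: norm_mult normal_density_nonneg intro!: mult_right_mono\<close>)
  also have "\<dots> = B" using assms by (simp add: integral_normal_density)
  finally show ?thesis .
qed

text \<open>The damping is removed on both sides of the regularized formula. Transforming twice with
  the same sign in the exponent produces the reflection \<open>f (- x)\<close>.\<close>

lemma fourier_inversion:
  fixes f :: "real \<Rightarrow> complex"
  assumes cont: "continuous_on UNIV f" and b: "\<And>x. cmod (f x) \<le> B"
    and f: "integrable lborel f" and ff: "integrable lborel (fourier f)"
  shows "fourier (fourier f) x = f (- x)"
proof -
  define \<sigma> where "\<sigma> n = inverse (real (Suc n))" for n
  have \<sigma>: "\<And>n. 0 < \<sigma> n" "\<sigma> \<longlonglongrightarrow> 0" unfolding \<sigma>_def using LIMSEQ_inverse_real_of_nat by auto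
  have [measurable]: "f \<in> borel_measurable borel" by (rule borel_measurable_continuous_onI[OF cont])
  have "(\<lambda>n. LINT k|lborel. fourier f k * (iexp (- (- x) * k) * complex_of_real (exp (- (\<sigma> n * k)\<^sup>2 / 2))))
      \<longlonglongrightarrow> (LINT k|lborel. fourier f k * (iexp (- (- x) * k) * complex_of_real (exp (- (0 * k)\<^sup>2 / 2))))"
  proof (rule integral_dominated_convergence)
    show "integrable lborel (\<lambda>k. cmod (fourier f k))" using ff by (rule integrable_norm)
    show "AE k in lborel. (\<lambda>n. fourier f k * (iexp (- (- x) * k) * complex_of_real (exp (- (\<sigma> n * k)\<^sup>2 / 2))))
        \<longlonglongrightarrow> fourier f k * (iexp (- (- x) * k) * complex_of_real (exp (- (0 * k)\<^sup>2 / 2)))"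
      by (intro always_eventually allI tendsto_intros \<sigma>) auto
  qed (auto simp: norm_mult mult_left_le)
  moreover have "(\<lambda>n. LINT k|lborel. fourier f k * (iexp (- (- x) * k) * complex_of_real (exp (- (\<sigma> n * k)\<^sup>2 / 2))))
      \<longlonglongrightarrow> complex_of_real (sqrt (2 * pi)) * f (- x)"
    unfolding fourier_regularized_inversion[OF \<sigma>(1) f]
    by (intro tendsto_mult tendsto_const gaussian_approximate_identity[OF cont b \<sigma>])
  ultimately have "(LINT k|lborel. fourier f k * (iexp (- (- x) * k) * complex_of_real (exp (- (0 * k)\<^sup>2 / 2))))
      = complex_of_real (sqrt (2 * pi)) * f (- x)"
    by (rule LIMSEQ_unique)
  then have "(LINT k|lborel. iexp (x * k) * fourier f k) = complex_of_real (sqrt (2 * pi)) * f (- x)"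
    by (simp add: mult.commute)
  then show ?thesis unfolding fourier_def[of "fourier f"] by (simp flip: of_real_mult)
qed

text \<open>The second factor in the multiplication formula is the damped conjugate of
  \<open>fourier f\<close>; its transform is the conjugate of the smoothed \<open>f\<close>. The
  Gaussian makes this factor integrable when \<open>f\<close> is merely integrable.\<close>

lemma fourier_energy_regularized:
  fixes f :: "real \<Rightarrow> complex"
  assumes f: "integrable lborel f" and \<sigma>: "0 < \<sigma>"
  shows "complex_of_real (LINT k|lborel. (cmod (fourier f k))\<^sup>2 * exp (- (\<sigma> * k)\<^sup>2 / 2)) =
    (LINT x|lborel. f x * cnj (LINT y|lborel. f y * complex_of_real (normal_density x \<sigma> y)))"
    (is "?L = ?R")
    and "integrable lborel (\<lambda>k. (cmod (fourier f k))\<^sup>2 * exp (- (\<sigma> * k)\<^sup>2 / 2))"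
proof -
  define E where "E k = complex_of_real (exp (- (\<sigma> * k)\<^sup>2 / 2))" for k
  define g where "g k = cnj (fourier f k) * E k" for k
  have [measurable]: "f \<in> borel_measurable borel" using f by auto
  obtain B where B: "\<And>x. cmod (fourier f x) \<le> B" using cmod_fourier_le by blast
  have Ei: "integrable lborel E" using integrable_gaussian[OF \<sigma>, of 0] by (simp add: E_def[abs_def])
  have Em [measurable]: "E \<in> borel_measurable borel" using Ei by auto
  have gm [measurable]: "g \<in> borel_measurable borel" unfolding g_def by measurable
  have gi: "integrable lborel g"
    by (rule Bochner_Integration.integrable_bound[OF integrable_mult_right[OF Ei, of B]])
       (auto simp: g_def norm_mult intro!: mult_right_mono intro: order_trans[OF B abs_ge_self])
  have c1: "complex_of_real ((cmod (fourier f k))\<^sup>2 * exp (- (\<sigma> * k)\<^sup>2 / 2)) = fourier f k * g k" for k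
    using complex_norm_square[of "fourier f k"] by (simp add: g_def E_def mult_ac)
  have "integrable lborel (\<lambda>k. fourier f k * g k)"
    by (rule Bochner_Integration.integrable_bound[OF integrable_mult_right[OF gi, of B]])
       (auto simp: norm_mult intro!: mult_right_mono intro: order_trans[OF B abs_ge_self])
  then have "integrable lborel (\<lambda>k. complex_of_real ((cmod (fourier f k))\<^sup>2 * exp (- (\<sigma> * k)\<^sup>2 / 2)))"
    unfolding c1 .
  then show "integrable lborel (\<lambda>k. (cmod (fourier f k))\<^sup>2 * exp (- (\<sigma> * k)\<^sup>2 / 2))"
    by (simp only: complex_of_real_integrable_eq)
  have "?L = (LINT k|lborel. fourier f k * g k)"
    unfolding integral_complex_of_real[symmetric] c1 ..
  also have "\<dots> = (LINT x|lborel. f x * fourier g x)" by (rule fourier_mult_formula[OF f gi])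
  also have "\<dots> = ?R"
  proof (rule Bochner_Integration.integral_cong[OF refl])
    fix x :: real
    have "fourier g x = complex_of_real (1 / sqrt (2 * pi)) * (LINT z|lborel. iexp (x * z) * g z)"
      by (simp add: fourier_def)
    also have "(LINT z|lborel. iexp (x * z) * g z) =
        (LINT z|lborel. cnj (fourier f z * (iexp (- x * z) * complex_of_real (exp (- (\<sigma> * z)\<^sup>2 / 2)))))"
      by (simp add: g_def E_def exp_cnj mult_ac)
    also have "\<dots> = cnj (complex_of_real (sqrt (2 * pi)) * (LINT y|lborel. f y * complex_of_real (normal_density x \<sigma> y)))"
      by (simp only: Bochner_Integration.integral_cnj fourier_regularized_inversion[OF \<sigma> f])
    finally show "f x * fourier g x = f x * cnj (LINT y|lborel. f y * complex_of_real (normal_density x \<sigma> y))"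
      by (simp flip: of_real_mult)
  qed
  finally show "?L = ?R" .
qed

lemma nn_integral_normal_density:
  "0 < \<sigma> \<Longrightarrow> (\<integral>\<^sup>+y. ennreal (normal_density x \<sigma> y) \<partial>lborel) = 1"
  by (subst nn_integral_eq_integral) (auto simp: integral_normal_density normal_density_nonneg)

lemma normal_density_commute: "normal_density x \<sigma> y = normal_density y \<sigma> x"
  by (simp add: normal_density_def power2_commute)

text \<open>A Schur test: \<open>\<bar>f x\<bar> \<bar>f y\<bar>\<close> is at most the mean of the
  squares, and the normal density is a symmetric kernel of mass 1 in each variable. With nonnegative
  integrals the bound also covers an \<open>f\<close> that is not square integrable, where the right
  side is infinite.\<close>

lemma fourier_energy_regularized_le:
  fixes f :: "real \<Rightarrow> complex"
  assumes f: "integrable lborel f" and \<sigma>: "0 < \<sigma>"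
  shows "ennreal (LINT k|lborel. (cmod (fourier f k))\<^sup>2 * exp (- (\<sigma> * k)\<^sup>2 / 2)) \<le>
    (\<integral>\<^sup>+x. ennreal ((cmod (f x))\<^sup>2) \<partial>lborel)"
proof -
  have [measurable]: "f \<in> borel_measurable borel" using f by auto
  define N where "N x y = ennreal (normal_density x \<sigma> y)" for x y
  have Nm [measurable]: "case_prod N \<in> borel_measurable (borel \<Otimes>\<^sub>M borel)"
    unfolding N_def normal_density_def by measurable
  have Nm' [measurable]: "(\<lambda>x. N (a x) (b x)) \<in> borel_measurable M" if [measurable]: "a \<in> borel_measurable M" "b \<in> borel_measurable M" for a b M
    unfolding N_def normal_density_def by measurable
  define h where "h x = (LINT y|lborel. f y * complex_of_real (normal_density x \<sigma> y))" for x
  have "(LINT k|lborel. (cmod (fourier f k))\<^sup>2 * exp (- (\<sigma> * k)\<^sup>2 / 2)) =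
      cmod (complex_of_real (LINT k|lborel. (cmod (fourier f k))\<^sup>2 * exp (- (\<sigma> * k)\<^sup>2 / 2)))"
    by (simp add: integral_nonneg_AE)
  also have "\<dots> = cmod (LINT x|lborel. f x * cnj (h x))"
    unfolding fourier_energy_regularized(1)[OF assms] h_def ..
  finally have "ennreal (LINT k|lborel. (cmod (fourier f k))\<^sup>2 * exp (- (\<sigma> * k)\<^sup>2 / 2)) =
      ennreal (cmod (LINT x|lborel. f x * cnj (h x)))" by simp
  \<comment> \<open>If the product is not integrable, its Bochner integral is 0 by convention and
    the bound is trivial.\<close>
  also have "\<dots> \<le> (\<integral>\<^sup>+x. ennreal (cmod (f x * cnj (h x))) \<partial>lborel)"
    by (cases "integrable lborel (\<lambda>x. f x * cnj (h x))")
       (auto intro: integral_norm_bound_ennreal simp: not_integrable_integral_eq)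
  also have "\<dots> \<le> (\<integral>\<^sup>+x. \<integral>\<^sup>+y. ennreal (cmod (f x) * cmod (f y)) * N x y \<partial>lborel \<partial>lborel)"
  proof (rule nn_integral_mono)
    fix x
    have i: "integrable lborel (\<lambda>y. f y * complex_of_real (normal_density x \<sigma> y))"
    proof (rule Bochner_Integration.integrable_bound)
      show "integrable lborel (\<lambda>y. complex_of_real (1 / sqrt (2 * pi * \<sigma>\<^sup>2)) * f y)"
        using f by simp
    qed (auto simp: normal_density_def norm_mult norm_divide mult_ac intro!: mult_left_le divide_right_mono mult_left_mono)
    have "ennreal (cmod (h x)) \<le> (\<integral>\<^sup>+y. ennreal (cmod (f y * complex_of_real (normal_density x \<sigma> y))) \<partial>lborel)"
      unfolding h_def by (rule integral_norm_bound_ennreal[OF i])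
    then have "ennreal (cmod (f x)) * ennreal (cmod (h x)) \<le>
        ennreal (cmod (f x)) * (\<integral>\<^sup>+y. ennreal (cmod (f y * complex_of_real (normal_density x \<sigma> y))) \<partial>lborel)"
      by (intro mult_left_mono) auto
    also have "\<dots> = (\<integral>\<^sup>+y. ennreal (cmod (f x) * cmod (f y)) * N x y \<partial>lborel)"
      by (subst nn_integral_cmult[symmetric])
         (auto simp: norm_mult ennreal_mult N_def mult.assoc normal_density_nonneg)
    finally show "ennreal (cmod (f x * cnj (h x))) \<le> \<dots>" by (simp add: norm_mult ennreal_mult)
  qed
  also have "\<dots> \<le> (\<integral>\<^sup>+x. \<integral>\<^sup>+y. (ennreal ((cmod (f x))\<^sup>2 / 2) * N x y + ennreal ((cmod (f y))\<^sup>2 / 2) * N x y) \<partial>lborel \<partial>lborel)"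
  proof (intro nn_integral_mono)
    fix x y
    have "cmod (f x) * cmod (f y) \<le> (cmod (f x))\<^sup>2 / 2 + (cmod (f y))\<^sup>2 / 2"
      using sum_squares_bound[of "cmod (f x)" "cmod (f y)"] by simp
    then have "ennreal (cmod (f x) * cmod (f y)) \<le> ennreal ((cmod (f x))\<^sup>2 / 2) + ennreal ((cmod (f y))\<^sup>2 / 2)"
      by (subst ennreal_plus[symmetric]) (auto intro: ennreal_leI simp del: ennreal_plus)
    from mult_right_mono[OF this, of "N x y"]
    show "ennreal (cmod (f x) * cmod (f y)) * N x y \<le> ennreal ((cmod (f x))\<^sup>2 / 2) * N x y + ennreal ((cmod (f y))\<^sup>2 / 2) * N x y"
      by (simp add: distrib_right)
  qed
  also have "\<dots> = (\<integral>\<^sup>+x. \<integral>\<^sup>+y. ennreal ((cmod (f x))\<^sup>2 / 2) * N x y \<partial>lborel \<partial>lborel) +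
      (\<integral>\<^sup>+x. \<integral>\<^sup>+y. ennreal ((cmod (f y))\<^sup>2 / 2) * N x y \<partial>lborel \<partial>lborel)"
    by (simp add: nn_integral_add)
  also have "(\<integral>\<^sup>+x. \<integral>\<^sup>+y. ennreal ((cmod (f y))\<^sup>2 / 2) * N x y \<partial>lborel \<partial>lborel) =
      (\<integral>\<^sup>+y. \<integral>\<^sup>+x. ennreal ((cmod (f y))\<^sup>2 / 2) * N x y \<partial>lborel \<partial>lborel)"
    by (rule lborel_pair.Fubini') simp
  also have "\<dots> = (\<integral>\<^sup>+x. \<integral>\<^sup>+y. ennreal ((cmod (f x))\<^sup>2 / 2) * N x y \<partial>lborel \<partial>lborel)"
    by (simp add: N_def normal_density_commute)
  also have "(\<integral>\<^sup>+x. \<integral>\<^sup>+y. ennreal ((cmod (f x))\<^sup>2 / 2) * N x y \<partial>lborel \<partial>lborel) =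
      (\<integral>\<^sup>+x. ennreal ((cmod (f x))\<^sup>2 / 2) \<partial>lborel)"
    by (simp add: nn_integral_cmult N_def nn_integral_normal_density[OF \<sigma>])
  also have "\<dots> + \<dots> = (\<integral>\<^sup>+x. ennreal ((cmod (f x))\<^sup>2) \<partial>lborel)"
    by (subst nn_integral_add[symmetric]) (auto simp flip: ennreal_plus)
  finally show ?thesis .
qed

text \<open>Fatou's lemma as the damping is removed. Continuity of \<open>f\<close> is not assumed,
  so the inequality applies to functions truncated to an interval.\<close>

lemma fourier_bessel:
  fixes f :: "real \<Rightarrow> complex"
  assumes f: "integrable lborel f"
  shows "(\<integral>\<^sup>+k. ennreal ((cmod (fourier f k))\<^sup>2) \<partial>lborel) \<le> (\<integral>\<^sup>+x. ennreal ((cmod (f x))\<^sup>2) \<partial>lborel)"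
proof -
  define \<sigma> where "\<sigma> n = inverse (real (Suc n))" for n
  have \<sigma>: "\<And>n. 0 < \<sigma> n" "\<sigma> \<longlonglongrightarrow> 0" unfolding \<sigma>_def using LIMSEQ_inverse_real_of_nat by auto
  have [measurable]: "f \<in> borel_measurable borel" using f by auto
  have lim: "(\<lambda>n. ennreal ((cmod (fourier f k))\<^sup>2 * exp (- (\<sigma> n * k)\<^sup>2 / 2))) \<longlonglongrightarrow> ennreal ((cmod (fourier f k))\<^sup>2)" for k
  proof (rule tendsto_ennrealI)
    have "(\<lambda>n. (cmod (fourier f k))\<^sup>2 * exp (- (\<sigma> n * k)\<^sup>2 / 2)) \<longlonglongrightarrow> (cmod (fourier f k))\<^sup>2 * exp (- (0 * k)\<^sup>2 / 2)"
      by (intro tendsto_intros \<sigma>) auto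
    then show "(\<lambda>n. (cmod (fourier f k))\<^sup>2 * exp (- (\<sigma> n * k)\<^sup>2 / 2)) \<longlonglongrightarrow> (cmod (fourier f k))\<^sup>2" by simp
  qed
  have "(\<integral>\<^sup>+k. ennreal ((cmod (fourier f k))\<^sup>2) \<partial>lborel) =
      (\<integral>\<^sup>+k. liminf (\<lambda>n. ennreal ((cmod (fourier f k))\<^sup>2 * exp (- (\<sigma> n * k)\<^sup>2 / 2))) \<partial>lborel)"
    by (intro nn_integral_cong lim_imp_Liminf[OF sequentially_bot lim, symmetric])
  also have "\<dots> \<le> liminf (\<lambda>n. \<integral>\<^sup>+k. ennreal ((cmod (fourier f k))\<^sup>2 * exp (- (\<sigma> n * k)\<^sup>2 / 2)) \<partial>lborel)"
    by (rule nn_integral_liminf) simp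
  also have "\<dots> \<le> (\<integral>\<^sup>+x. ennreal ((cmod (f x))\<^sup>2) \<partial>lborel)"
  proof (rule Liminf_le)
    show "\<forall>\<^sub>F n in sequentially. (\<integral>\<^sup>+k. ennreal ((cmod (fourier f k))\<^sup>2 * exp (- (\<sigma> n * k)\<^sup>2 / 2)) \<partial>lborel)
        \<le> (\<integral>\<^sup>+x. ennreal ((cmod (f x))\<^sup>2) \<partial>lborel)"
      using fourier_energy_regularized_le[OF f \<sigma>(1)] fourier_energy_regularized(2)[OF f \<sigma>(1)]
      by (intro always_eventually allI) (subst nn_integral_eq_integral; simp)
  qed simp
  finally show ?thesis .
qed

text \<open>The reverse of Bessel's inequality: for continuous and bounded \<open>f\<close> the
  smoothed functions converge to \<open>f\<close> at every point, so the damped energies tend to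
  that of \<open>f\<close>, while each of them is at most the full energy of the transform.\<close>

lemma fourier_plancherel:
  fixes f :: "real \<Rightarrow> complex"
  assumes cont: "continuous_on UNIV f" and b: "\<And>x. cmod (f x) \<le> B" and f: "integrable lborel f"
  shows "(\<integral>\<^sup>+k. ennreal ((cmod (fourier f k))\<^sup>2) \<partial>lborel) = (\<integral>\<^sup>+x. ennreal ((cmod (f x))\<^sup>2) \<partial>lborel)"
proof (rule antisym[OF fourier_bessel[OF f]])
  define \<sigma> where "\<sigma> n = inverse (real (Suc n))" for n
  have \<sigma>: "\<And>n. 0 < \<sigma> n" "\<sigma> \<longlonglongrightarrow> 0" unfolding \<sigma>_def using LIMSEQ_inverse_real_of_nat by auto
  have [measurable]: "f \<in> borel_measurable borel" using f by auto
  define h where "h n x = (LINT y|lborel. f y * complex_of_real (normal_density x (\<sigma> n) y))" for n x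
  have hm [measurable]: "h n \<in> borel_measurable borel" for n
    unfolding h_def normal_density_def by measurable
  have B0: "0 \<le> B" using b[of 0] norm_ge_zero order_trans by blast
  have fi: "integrable lborel (\<lambda>x. B * cmod (f x))" using f by simp
  have sq: "integrable lborel (\<lambda>x. f x * cnj (f x))"
    by (rule Bochner_Integration.integrable_bound[OF fi])
       (use b B0 in \<open>auto simp: norm_mult abs_mult intro!: mult_right_mono\<close>)
  have "(\<lambda>n. LINT x|lborel. f x * cnj (h n x)) \<longlonglongrightarrow> (LINT x|lborel. f x * cnj (f x))"
  proof (rule integral_dominated_convergence[OF _ _ fi])
    show "AE x in lborel. (\<lambda>n. f x * cnj (h n x)) \<longlonglongrightarrow> f x * cnj (f x)"
      unfolding h_def
      by (intro always_eventually allI tendsto_mult tendsto_const tendsto_cnj gaussian_approximate_identity[OF cont b \<sigma>])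
    show "AE x in lborel. cmod (f x * cnj (h n x)) \<le> B * cmod (f x)" for n
      using gaussian_convolution_bounded[OF _ b \<sigma>(1)]
      by (auto simp: h_def norm_mult mult.commute[of B] intro!: mult_left_mono)
  qed auto
  also have "(LINT x|lborel. f x * cnj (f x)) = complex_of_real (LINT x|lborel. (cmod (f x))\<^sup>2)"
    by (simp add: complex_norm_square[symmetric] flip: integral_complex_of_real)
  finally have "(\<lambda>n. complex_of_real (LINT k|lborel. (cmod (fourier f k))\<^sup>2 * exp (- (\<sigma> n * k)\<^sup>2 / 2))) \<longlonglongrightarrow>
      complex_of_real (LINT x|lborel. (cmod (f x))\<^sup>2)"
    unfolding h_def fourier_energy_regularized(1)[OF f \<sigma>(1)] .
  then have "(\<lambda>n. LINT k|lborel. (cmod (fourier f k))\<^sup>2 * exp (- (\<sigma> n * k)\<^sup>2 / 2)) \<longlonglongrightarrow> (LINT x|lborel. (cmod (f x))\<^sup>2)"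
    by (simp only: tendsto_of_real_iff)
  then have l: "(\<lambda>n. ennreal (LINT k|lborel. (cmod (fourier f k))\<^sup>2 * exp (- (\<sigma> n * k)\<^sup>2 / 2))) \<longlonglongrightarrow>
      ennreal (LINT x|lborel. (cmod (f x))\<^sup>2)" by (rule tendsto_ennrealI)
  have "integrable lborel (\<lambda>x. (cmod (f x))\<^sup>2)"
    using sq by (simp only: complex_norm_square[symmetric] complex_of_real_integrable_eq)
  then have "(\<integral>\<^sup>+x. ennreal ((cmod (f x))\<^sup>2) \<partial>lborel) = ennreal (LINT x|lborel. (cmod (f x))\<^sup>2)"
    by (rule nn_integral_eq_integral) simp
  also have "\<dots> \<le> (\<integral>\<^sup>+k. ennreal ((cmod (fourier f k))\<^sup>2) \<partial>lborel)"
  proof (rule tendsto_upperbound[OF l])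
    show "\<forall>\<^sub>F n in sequentially. ennreal (LINT k|lborel. (cmod (fourier f k))\<^sup>2 * exp (- (\<sigma> n * k)\<^sup>2 / 2))
        \<le> (\<integral>\<^sup>+k. ennreal ((cmod (fourier f k))\<^sup>2) \<partial>lborel)"
    proof (intro always_eventually allI)
      fix n
      have "ennreal (LINT k|lborel. (cmod (fourier f k))\<^sup>2 * exp (- (\<sigma> n * k)\<^sup>2 / 2)) =
          (\<integral>\<^sup>+k. ennreal ((cmod (fourier f k))\<^sup>2 * exp (- (\<sigma> n * k)\<^sup>2 / 2)) \<partial>lborel)"
        by (rule nn_integral_eq_integral[OF fourier_energy_regularized(2)[OF f \<sigma>(1)], symmetric]) simp
      also have "\<dots> \<le> (\<integral>\<^sup>+k. ennreal ((cmod (fourier f k))\<^sup>2) \<partial>lborel)"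
        by (intro nn_integral_mono ennreal_leI mult_left_le) auto
      finally show "ennreal (LINT k|lborel. (cmod (fourier f k))\<^sup>2 * exp (- (\<sigma> n * k)\<^sup>2 / 2)) \<le> \<dots>" .
    qed
  qed simp
  finally show "(\<integral>\<^sup>+x. ennreal ((cmod (f x))\<^sup>2) \<partial>lborel) \<le> (\<integral>\<^sup>+k. ennreal ((cmod (fourier f k))\<^sup>2) \<partial>lborel)" .
qed

section \<open>Transforms of rapidly decaying real functions\<close>

definition rfourier :: "(real \<Rightarrow> real) \<Rightarrow> real \<Rightarrow> complex" where
  "rfourier u = fourier (\<lambda>k. complex_of_real (u k))"

lemma rapid_of_real_integrable: "rapid u \<Longrightarrow> integrable lborel (\<lambda>k. complex_of_real (u k))"
  using rapid_integrable by (simp add: complex_of_real_integrable_eq)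

lemma rfourier_measurable [measurable]: "rapid u \<Longrightarrow> rfourier u \<in> borel_measurable borel"
  unfolding rfourier_def by (rule fourier_measurable) simp

lemma rfourier_bounded: "\<exists>B. \<forall>x. cmod (rfourier u x) \<le> B"
  unfolding rfourier_def using cmod_fourier_le by blast

lemma rfourier_add:
  assumes "rapid u" "rapid v"
  shows "rfourier (\<lambda>k. u k + v k) x = rfourier u x + rfourier v x"
proof -
  have i: "integrable lborel (\<lambda>z. iexp (x * z) * complex_of_real (w z))" if "rapid w" for w
    by (rule Bochner_Integration.integrable_bound[OF rapid_of_real_integrable[OF that]])
       (use that in \<open>auto simp: norm_mult\<close>)
  show ?thesis
    using i[OF assms(1)] i[OF assms(2)] by (simp add: rfourier_def fourier_def distrib_left)
qed

lemma rfourier_cmult: "rfourier (\<lambda>k. c * u k) x = complex_of_real c * rfourier u x"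
proof -
  have "(LINT z|lborel. iexp (x * z) * complex_of_real (c * u z)) =
      (LINT z|lborel. complex_of_real c * (iexp (x * z) * complex_of_real (u z)))"
    by (rule Bochner_Integration.integral_cong) auto
  then show ?thesis by (simp add: rfourier_def fourier_def)
qed

lemma rfourier_minus: "rfourier (\<lambda>k. - u k) x = - rfourier u x"
  using rfourier_cmult[of "-1" u x] by simp

lemma rfourier_diff:
  assumes "rapid u" "rapid v"
  shows "rfourier (\<lambda>k. u k - v k) x = rfourier u x - rfourier v x"
  using rfourier_add[OF assms(1) rapid_minus[OF assms(2)], of x] by (simp add: rfourier_minus)

lemma rfourier_reflect: "rfourier (\<lambda>k. u (- k)) x = cnj (rfourier u x)"
proof -
  have "(LINT z|lborel. iexp (x * z) * complex_of_real (u (- z))) =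
        (LINT z|lborel. iexp (x * (0 + - 1 * z)) * complex_of_real (u (- (0 + - 1 * z))))"
    by (subst lborel_integral_real_affine[of "-1" _ 0]) simp_all
  also have "\<dots> = (LINT z|lborel. cnj (iexp (x * z) * complex_of_real (u z)))"
    by (simp add: exp_cnj)
  also have "\<dots> = cnj (LINT z|lborel. iexp (x * z) * complex_of_real (u z))" by (rule Bochner_Integration.integral_cnj)
  finally show ?thesis by (simp add: rfourier_def fourier_def)
qed

lemma rfourier_plancherel:
  assumes "rapid u"
  shows "(\<integral>\<^sup>+x. ennreal ((cmod (rfourier u x))\<^sup>2) \<partial>lborel) = (\<integral>\<^sup>+k. ennreal ((u k)\<^sup>2) \<partial>lborel)"
proof -
  obtain B where "\<forall>k. \<bar>u k\<bar> \<le> B" using rapid_bounded[OF assms] by blast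
  then show ?thesis
    unfolding rfourier_def
    by (subst fourier_plancherel[of _ B])
       (use assms rapid_continuous[OF assms] in \<open>auto intro!: continuous_intros rapid_of_real_integrable\<close>)
qed

lemma rfourier_square_integrable:
  assumes "rapid u"
  shows "integrable lborel (\<lambda>x. (cmod (rfourier u x))\<^sup>2)"
    and "(LINT x|lborel. (cmod (rfourier u x))\<^sup>2) = (LINT k|lborel. (u k)\<^sup>2)"
proof -
  have u2: "integrable lborel (\<lambda>k. (u k)\<^sup>2)" by (rule rapid_integrable[OF rapid_power2[OF assms]])
  have e: "(\<integral>\<^sup>+x. ennreal ((cmod (rfourier u x))\<^sup>2) \<partial>lborel) = ennreal (LINT k|lborel. (u k)\<^sup>2)"
    unfolding rfourier_plancherel[OF assms] by (rule nn_integral_eq_integral[OF u2]) simp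
  show i: "integrable lborel (\<lambda>x. (cmod (rfourier u x))\<^sup>2)"
    by (rule integrableI_nn_integral_finite[OF _ _ e]) (use assms in \<open>auto intro: integral_nonneg_AE\<close>)
  have "ennreal (LINT x|lborel. (cmod (rfourier u x))\<^sup>2) = ennreal (LINT k|lborel. (u k)\<^sup>2)"
    by (subst nn_integral_eq_integral[OF i, symmetric]) (simp_all add: e)
  then show "(LINT x|lborel. (cmod (rfourier u x))\<^sup>2) = (LINT k|lborel. (u k)\<^sup>2)"
    by (subst (asm) ennreal_inj) (auto intro: integral_nonneg_AE)
qed

text \<open>Both integrations by parts at once: \<open>iexp (x * k) * (u' - \<i> x u)\<close> has
  the derivative \<open>iexp (x * k) * (u'' + x\<^sup>2 u)\<close> and vanishes at both
  ends.\<close>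

lemma rfourier_second_derivative:
  assumes u: "rapid u" "rapid u'" "rapid u''"
    and D: "\<And>k. (u has_real_derivative u' k) (at k)" "\<And>k. (u' has_real_derivative u'' k) (at k)"
  shows "rfourier u'' x = - complex_of_real (x\<^sup>2) * rfourier u x"
proof -
  define F where "F k = iexp (x * k) * (complex_of_real (u' k) - \<i> * complex_of_real x * complex_of_real (u k))" for k
  define f where "f k = iexp (x * k) * complex_of_real (u'' k) + complex_of_real (x\<^sup>2) * (iexp (x * k) * complex_of_real (u k))" for k
  have i: "integrable lborel (\<lambda>z. iexp (x * z) * complex_of_real (w z))" if "rapid w" for w
    by (rule Bochner_Integration.integrable_bound[OF rapid_of_real_integrable[OF that]])
       (use that in \<open>auto simp: norm_mult\<close>)
  have fi: "integrable lborel f" unfolding f_def by (intro Bochner_Integration.integrable_add integrable_mult_right i u)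
  have DF: "(F has_vector_derivative f k) (at k)" for k
  proof -
    have 1: "((\<lambda>k. complex_of_real (u k)) has_vector_derivative complex_of_real (u' k)) (at k)"
      "((\<lambda>k. complex_of_real (u' k)) has_vector_derivative complex_of_real (u'' k)) (at k)"
      using D by (auto intro!: has_vector_derivative_of_real simp: has_real_derivative_iff_has_vector_derivative)
    have 2: "((\<lambda>k. iexp (x * k)) has_vector_derivative \<i> * complex_of_real x * iexp (x * k)) (at k)"
      by (auto intro!: derivative_eq_intros has_vector_derivative_real_field simp: )
    show ?thesis unfolding F_def f_def
      by (rule derivative_eq_intros 1 2 refl | simp)+ (simp add: algebra_simps power2_eq_square)
  qed
  \<comment> \<open>Any filter along which \<open>\<bar>k\<bar>\<close> tends to infinity, so that
    both ends are treated together.\<close>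
  have lim0: "(F \<longlongrightarrow> 0) G" if G: "filterlim abs at_top G" for G
  proof -
    have w: "(w \<longlongrightarrow> 0) G" if "rapid w" for w
    proof -
      obtain a C where a: "0 < a" "0 \<le> C" "\<And>k. \<bar>w k\<bar> \<le> C * exp (- a * \<bar>k\<bar>)" using rapidE[OF \<open>rapid w\<close>] by blast
      have "((\<lambda>t::real. exp (- a * t)) \<longlongrightarrow> 0) at_top" using a(1) by real_asymp
      from tendsto_mult_right_zero[OF filterlim_compose[OF this G], of C]
      show ?thesis by (rule Lim_null_comparison[rotated]) (use a(3) in auto)
    qed
    have 3: "((\<lambda>k. complex_of_real (u' k) - \<i> * complex_of_real x * complex_of_real (u k)) \<longlongrightarrow>
        complex_of_real 0 - \<i> * complex_of_real x * complex_of_real 0) G"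
      by (intro tendsto_intros w u)
    show ?thesis
      by (rule tendsto_norm_zero_cancel) (use tendsto_norm[OF 3] in \<open>simp add: F_def norm_mult\<close>)
  qed
  have cont: "isCont f k" for k
    unfolding f_def using rapid_isCont[OF u(1)] rapid_isCont[OF u(3)] by (intro continuous_intros) auto
  have "(LBINT k=-\<infinity>..\<infinity>. f k) = 0 - 0"
  proof (rule interval_integral_FTC_integrable)
    show "set_integrable lborel (einterval (- \<infinity>) \<infinity>) f" using fi by (simp add: set_integrable_def einterval_def)
    have "filterlim abs at_top (at_top :: real filter)" "filterlim abs at_top (at_bot :: real filter)"
      by (real_asymp, real_asymp)
    then show "((F \<circ> real_of_ereal) \<longlongrightarrow> 0) (at_right (- \<infinity>))" "((F \<circ> real_of_ereal) \<longlongrightarrow> 0) (at_left \<infinity>)"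
      unfolding ereal_tendsto_simps by (auto intro: lim0)
  qed (auto intro: DF cont)
  then have "(LINT k|lborel. f k) = 0"
    by (simp add: interval_lebesgue_integral_def set_lebesgue_integral_def einterval_def)
  then have "(LINT z|lborel. iexp (x * z) * complex_of_real (u'' z)) =
     - complex_of_real (x\<^sup>2) * (LINT z|lborel. iexp (x * z) * complex_of_real (u z))"
    unfolding f_def using i[OF u(1)] i[OF u(3)] by (simp add: add_eq_0_iff)
  then show ?thesis by (simp add: rfourier_def fourier_def)
qed

text \<open>The transform of \<open>u - u''\<close> is \<open>1 + x\<^sup>2\<close> times that of
  \<open>u\<close>, and transforms are bounded. Integrability of the transform, and with it
  pointwise inversion, follows.\<close>

lemma rfourier_quadratic_decay:
  assumes u: "rapid u" "rapid u'" "rapid u''"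
    and D: "\<And>k. (u has_real_derivative u' k) (at k)" "\<And>k. (u' has_real_derivative u'' k) (at k)"
  shows "\<exists>B. \<forall>x. cmod (rfourier u x) * (1 + x\<^sup>2) \<le> B"
proof -
  obtain B where B: "\<And>x. cmod (rfourier u x) \<le> B" using rfourier_bounded by blast
  obtain C where C: "\<And>x. cmod (rfourier u'' x) \<le> C" using rfourier_bounded by blast
  have "cmod (rfourier u x) * (1 + x\<^sup>2) \<le> B + C" for x
    using B[of x] C[of x] rfourier_second_derivative[OF assms, of x]
    by (simp add: norm_mult norm_power algebra_simps)
  then show ?thesis by blast
qed

lemma rfourier_integrable:
  assumes "rapid u" "rapid u'" "rapid u''"
    and "\<And>k. (u has_real_derivative u' k) (at k)" "\<And>k. (u' has_real_derivative u'' k) (at k)"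
  shows "integrable lborel (rfourier u)"
proof -
  obtain B where "\<And>x. cmod (rfourier u x) * (1 + x\<^sup>2) \<le> B" using rfourier_quadratic_decay[OF assms] by blast
  then show ?thesis using assms(1) by (intro integrable_quadratic_decay[of _ B]) auto
qed

lemma rfourier_inversion:
  assumes u: "rapid u" and i: "integrable lborel (rfourier u)"
  shows "fourier (rfourier u) x = complex_of_real (u (- x))"
proof -
  obtain B where "\<forall>k. \<bar>u k\<bar> \<le> B" using rapid_bounded[OF u] by blast
  then show ?thesis
    unfolding rfourier_def
    by (intro fourier_inversion[of _ B])
       (use u rapid_continuous[OF u] i in \<open>auto intro!: continuous_intros rapid_of_real_integrable simp: rfourier_def\<close>)
qed

section \<open>Injectivity of the Fourier transform\<close>

lemma fourier_cong_AE:
  assumes "AE x in lborel. f x = g x" "f \<in> borel_measurable borel" "g \<in> borel_measurable borel"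
  shows "fourier f = fourier g"
  unfolding fourier_def using assms
  by (intro ext arg_cong[where f = "(*) _"] integral_cong_AE) (auto elim: eventually_mono)

text \<open>The positive and negative parts of \<open>h\<close> have equal transforms, in particular
  equal mass \<open>c\<close>, seen at \<open>t = 0\<close>. If \<open>c > 0\<close>, dividing by it
  gives probability densities with the same characteristic function, and Levy's uniqueness theorem
  applies.\<close>

lemma real_fourier_injective:
  fixes h :: "real \<Rightarrow> real"
  assumes h: "integrable lborel h"
    and zero: "\<And>t. (LINT y|lborel. iexp (t * y) * complex_of_real (h y)) = 0"
  shows "AE y in lborel. h y = 0"
proof -
  have [measurable]: "h \<in> borel_measurable borel" using h by auto
  define p where "p y = max 0 (h y)" for y
  define n where "n y = max 0 (- h y)" for y
  have [measurable]: "p \<in> borel_measurable borel" "n \<in> borel_measurable borel" unfolding p_def n_def by auto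
  have pn: "h y = p y - n y" "0 \<le> p y" "0 \<le> n y" for y by (auto simp: p_def n_def)
  have i: "integrable lborel p" "integrable lborel n"
    unfolding p_def n_def using h by (auto intro: integrable_max)
  have i2: "integrable lborel (\<lambda>y. iexp (t * y) * complex_of_real (p y))"
       "integrable lborel (\<lambda>y. iexp (t * y) * complex_of_real (n y))" for t
    by (rule Bochner_Integration.integrable_bound[OF i(1)]; auto simp: norm_mult)
       (rule Bochner_Integration.integrable_bound[OF i(2)]; auto simp: norm_mult)
  have eq: "(LINT y|lborel. iexp (t * y) * complex_of_real (p y)) = (LINT y|lborel. iexp (t * y) * complex_of_real (n y))" for t
    using zero[of t] i2[of t] by (simp add: pn(1) right_diff_distrib)
  define c where "c = (LINT y|lborel. p y)"
  have cn: "c = (LINT y|lborel. n y)" using eq[of 0] by (simp add: c_def)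
  have c0: "0 \<le> c" unfolding c_def by (simp add: pn integral_nonneg_AE)
  show ?thesis
  proof (cases "c = 0")
    case True
    then have "AE y in lborel. p y = 0" "AE y in lborel. n y = 0"
      using integral_nonneg_eq_0_iff_AE[OF i(1)] integral_nonneg_eq_0_iff_AE[OF i(2)] pn cn c_def by auto
    then show ?thesis by eventually_elim (simp add: pn(1))
  next
    case False
    then have c: "0 < c" using c0 by simp
    define P :: "(real \<Rightarrow> real) \<Rightarrow> real measure" where "P g = density lborel (\<lambda>y. ennreal (g y / c))" for g
    have dist: "real_distribution (P g)" if [measurable]: "g \<in> borel_measurable borel" and g: "integrable lborel g" "\<And>y. 0 \<le> g y" "(LINT y|lborel. g y) = c" for g
    proof -
      have "emeasure (P g) (space (P g)) = (\<integral>\<^sup>+y. ennreal (g y / c) \<partial>lborel)"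
        by (simp add: P_def emeasure_density)
      also have "\<dots> = ennreal (LINT y|lborel. g y / c)"
        using g c by (intro nn_integral_eq_integral) auto
      also have "\<dots> = 1" using g c by simp
      finally have "prob_space (P g)" by (rule prob_spaceI)
      then show ?thesis by (simp add: real_distribution_def real_distribution_axioms_def P_def)
    qed
    have char: "char (P g) t = complex_of_real (1 / c) * (LINT y|lborel. iexp (t * y) * complex_of_real (g y))"
      if [measurable]: "g \<in> borel_measurable borel" and g: "\<And>y. 0 \<le> g y" for g t
    proof -
      have "char (P g) t = (LINT y|lborel. (g y / c) *\<^sub>R iexp (t * y))"
        unfolding char_def P_def using g c by (subst integral_density) auto
      also have "\<dots> = (LINT y|lborel. complex_of_real (1 / c) * (iexp (t * y) * complex_of_real (g y)))"
        by (rule Bochner_Integration.integral_cong) (auto simp: scaleR_conv_of_real)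
      finally show ?thesis by simp
    qed
    have "char (P p) = char (P n)"
      by (rule ext) (simp only: char[of p] char[of n] pn eq \<open>p \<in> _\<close> \<open>n \<in> _\<close>)
    then have "P p = P n"
      by (intro Levy_uniqueness dist) (use pn i cn c_def in auto)
    then have "AE y in lborel. ennreal (p y / c) = ennreal (n y / c)"
      unfolding P_def by (intro sigma_finite_measure.density_unique[OF lborel.sigma_finite_measure_axioms]) auto
    then show ?thesis
      by eventually_elim (use c pn in \<open>auto simp: pn(1)\<close>)
  qed
qed

text \<open>The transform of \<open>cnj f\<close> at \<open>t\<close> is the conjugate of that of
  \<open>f\<close> at \<open>- t\<close>, hence also 0; real and imaginary parts are combinations of
  \<open>f\<close> and \<open>cnj f\<close>.\<close>

lemma fourier_injective:
  fixes f :: "real \<Rightarrow> complex"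
  assumes f: "integrable lborel f" and zero: "\<And>t. fourier f t = 0"
  shows "AE y in lborel. f y = 0"
proof -
  have [measurable]: "f \<in> borel_measurable borel" using f by auto
  have z: "(LINT y|lborel. iexp (t * y) * f y) = 0" for t
    using zero[of t] by (simp add: fourier_def)
  have i: "integrable lborel (\<lambda>y. iexp (t * y) * f y)" for t
    by (rule Bochner_Integration.integrable_bound[OF f]) (auto simp: norm_mult)
  have "(LINT y|lborel. cnj (iexp (- t * y) * f y)) = 0" for t
    using z[of "- t"] by (simp only: Bochner_Integration.integral_cnj complex_cnj_zero)
  then have zc: "(LINT y|lborel. iexp (t * y) * cnj (f y)) = 0" for t by (simp add: exp_cnj)
  have ic: "integrable lborel (\<lambda>y. iexp (t * y) * cnj (f y))" for t
    by (rule Bochner_Integration.integrable_bound[OF f]) (auto simp: norm_mult)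
  have "(LINT y|lborel. iexp (t * y) * complex_of_real (Re (f y))) = 0" for t
  proof -
    have "iexp (t * y) * complex_of_real (Re (f y)) = (iexp (t * y) * f y + iexp (t * y) * cnj (f y)) / 2" for y
      by (simp add: complex_add_cnj flip: distrib_left)
    then show ?thesis 
      by (simp only: integral_divide_zero Bochner_Integration.integral_add[OF i ic] z zc) simp
  qed
  then have 1: "AE y in lborel. Re (f y) = 0" by (intro real_fourier_injective) (use f in auto)
  have "(LINT y|lborel. iexp (t * y) * complex_of_real (Im (f y))) = 0" for t
  proof -
    have "iexp (t * y) * complex_of_real (Im (f y)) = (iexp (t * y) * f y - iexp (t * y) * cnj (f y)) / (2 * \<i>)" for y
    proof -
      have "complex_of_real (Im (f y)) = (f y - cnj (f y)) / (2 * \<i>)" by (simp add: complex_diff_cnj complex_eq_iff)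
      then show ?thesis by (simp only: right_diff_distrib times_divide_eq_right)
    qed
    then show ?thesis 
      by (simp only: integral_divide_zero Bochner_Integration.integral_diff[OF i ic] z zc) simp
  qed
  then have 2: "AE y in lborel. Im (f y) = 0" by (intro real_fourier_injective) (use f in auto)
  from 1 2 show ?thesis by eventually_elim (simp add: complex_eq_iff)
qed

section \<open>Trotter steps on square integrable functions\<close>

lemma L2D:
  assumes "f \<in> L2"
  shows "f \<in> borel_measurable borel" "integrable lborel (\<lambda>x. (cmod (f x))\<^sup>2)"
  using assms by (auto simp: L2_def)

lemma L2I:
  assumes "f \<in> borel_measurable borel" "integrable lborel (\<lambda>x. (cmod (f x))\<^sup>2)"
  shows "f \<in> L2"
  using assms by (auto simp: L2_def)

lemma L2_nn_integral:
  assumes "f \<in> L2"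
  shows "(\<integral>\<^sup>+x. ennreal ((cmod (f x))\<^sup>2) \<partial>lborel) = ennreal ((L2_norm f)\<^sup>2)"
  using L2D[OF assms] by (subst nn_integral_eq_integral) (auto simp: L2_norm_def integral_nonneg_AE)

lemma L2_norm_nonneg [simp]: "0 \<le> L2_norm f"
  by (simp add: L2_norm_def integral_nonneg_AE)

lemma L2I_nn:
  assumes [measurable]: "f \<in> borel_measurable borel"
    and le: "(\<integral>\<^sup>+x. ennreal ((cmod (f x))\<^sup>2) \<partial>lborel) \<le> ennreal (c\<^sup>2)" and c: "0 \<le> c"
  shows "f \<in> L2" "L2_norm f \<le> c"
proof -
  show f: "f \<in> L2"
    by (intro L2I integrableI_bounded) (use le in \<open>auto simp: top.extremum_strict order.strict_trans1\<close>)
  show "L2_norm f \<le> c"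
    using le c unfolding L2_nn_integral[OF f] by (simp add: power2_le_iff_abs_le)
qed

lemma L2_dominated:
  assumes g: "g \<in> L2" and [measurable]: "f \<in> borel_measurable borel" and le: "\<And>x. cmod (f x) \<le> cmod (g x)"
  shows "f \<in> L2" "L2_norm f \<le> L2_norm g"
proof -
  have "(\<integral>\<^sup>+x. ennreal ((cmod (f x))\<^sup>2) \<partial>lborel) \<le> ennreal ((L2_norm g)\<^sup>2)"
    unfolding L2_nn_integral[OF g, symmetric]
    by (intro nn_integral_mono ennreal_leI power_mono le) auto
  from L2I_nn[OF _ this] show "f \<in> L2" "L2_norm f \<le> L2_norm g" by auto
qed

lemma L2_norm_cong_AE:
  assumes "AE x in lborel. cmod (f x) = cmod (g x)" "f \<in> borel_measurable borel" "g \<in> borel_measurable borel"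
  shows "L2_norm f = L2_norm g"
  unfolding L2_norm_def using assms by (intro arg_cong[where f = sqrt] integral_cong_AE) (auto elim: eventually_mono)

lemma L2_mult_integrable:
  assumes "f \<in> L2" "g \<in> L2"
  shows "integrable lborel (\<lambda>x. f x * g x)"
proof (rule Bochner_Integration.integrable_bound)
  note [measurable] = L2D(1)[OF assms(1)] L2D(1)[OF assms(2)]
  show "integrable lborel (\<lambda>x. ((cmod (f x))\<^sup>2 + (cmod (g x))\<^sup>2) / 2)"
    using L2D(2)[OF assms(1)] L2D(2)[OF assms(2)] by simp
  show "(\<lambda>x. f x * g x) \<in> borel_measurable lborel" by measurable
  show "AE x in lborel. norm (f x * g x) \<le> norm (((cmod (f x))\<^sup>2 + (cmod (g x))\<^sup>2) / 2)"
    using sum_squares_bound[of "cmod (f _)" "cmod (g _)"] by (simp add: norm_mult abs_of_nonneg field_simps)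
qed

lemma ennreal_power2_le_imp_le:
  fixes x y :: ennreal
  assumes "x\<^sup>2 \<le> y\<^sup>2"
  shows "x \<le> y"
proof (cases y rule: ennreal_cases)
  case y: (real r)
  then have "x \<noteq> top" using assms by (auto simp: ennreal_power power_eq_top_ennreal_iff top_unique)
  then obtain q where "x = ennreal q" "0 \<le> q" by (cases x rule: ennreal_cases) auto
  with y assms show ?thesis by (simp add: ennreal_power power2_le_iff_abs_le)
qed simp

lemma L2_nn_mult_le:
  assumes "f \<in> L2" "g \<in> L2"
  shows "(\<integral>\<^sup>+x. ennreal (cmod (f x) * cmod (g x)) \<partial>lborel) \<le> ennreal (L2_norm f * L2_norm g)"
proof -
  note [measurable] = L2D(1)[OF assms(1)] L2D(1)[OF assms(2)]
  have "(\<integral>\<^sup>+x. ennreal (cmod (f x)) * ennreal (cmod (g x)) \<partial>lborel)\<^sup>2 \<le>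
      (\<integral>\<^sup>+x. (ennreal (cmod (f x)))\<^sup>2 \<partial>lborel) * (\<integral>\<^sup>+x. (ennreal (cmod (g x)))\<^sup>2 \<partial>lborel)"
    by (rule Cauchy_Schwarz_nn_integral) auto
  also have "\<dots> = (ennreal (L2_norm f * L2_norm g))\<^sup>2"
    by (simp add: ennreal_power L2_nn_integral[OF assms(1)] L2_nn_integral[OF assms(2)] power_mult_distrib flip: ennreal_mult)
  finally have "(\<integral>\<^sup>+x. ennreal (cmod (f x) * cmod (g x)) \<partial>lborel)\<^sup>2 \<le> (ennreal (L2_norm f * L2_norm g))\<^sup>2"
    by (simp add: ennreal_mult)
  then show ?thesis by (rule ennreal_power2_le_imp_le)
qed

lemma L2_Cauchy_Schwarz:
  assumes "f \<in> L2" "g \<in> L2"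
  shows "cmod (LINT x|lborel. f x * g x) \<le> L2_norm f * L2_norm g"
proof -
  have "ennreal (cmod (LINT x|lborel. f x * g x)) \<le> (\<integral>\<^sup>+x. ennreal (cmod (f x * g x)) \<partial>lborel)"
    by (rule integral_norm_bound_ennreal[OF L2_mult_integrable[OF assms]])
  also have "\<dots> \<le> ennreal (L2_norm f * L2_norm g)"
    using L2_nn_mult_le[OF assms] by (simp add: norm_mult)
  finally show ?thesis by (simp add: ennreal_le_iff)
qed

lemma L2_cmult: "f \<in> L2 \<Longrightarrow> (\<lambda>x. c * f x) \<in> L2"
  by (rule L2I) (auto dest: L2D simp: norm_mult power_mult_distrib)

lemma L2_norm_cmult: "L2_norm (\<lambda>x. c * f x) = cmod c * L2_norm f"
  by (simp add: L2_norm_def norm_mult power_mult_distrib real_sqrt_mult)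

lemma L2_add:
  assumes "f \<in> L2" "g \<in> L2"
  shows "(\<lambda>x. f x + g x) \<in> L2" "L2_norm (\<lambda>x. f x + g x) \<le> L2_norm f + L2_norm g"
proof -
  note [measurable] = L2D(1)[OF assms(1)] L2D(1)[OF assms(2)]
  have "(\<integral>\<^sup>+x. ennreal ((cmod (f x + g x))\<^sup>2) \<partial>lborel) \<le>
    (\<integral>\<^sup>+x. ennreal ((cmod (f x))\<^sup>2) + (2 * ennreal (cmod (f x) * cmod (g x)) + ennreal ((cmod (g x))\<^sup>2)) \<partial>lborel)"
  proof (rule nn_integral_mono)
    fix x
    have "(cmod (f x + g x))\<^sup>2 \<le> (cmod (f x) + cmod (g x))\<^sup>2" by (intro power_mono norm_triangle_ineq) auto
    then have "ennreal ((cmod (f x + g x))\<^sup>2) \<le> ennreal ((cmod (f x))\<^sup>2 + (2 * (cmod (f x) * cmod (g x)) + (cmod (g x))\<^sup>2))"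
      by (intro ennreal_leI) (simp add: power2_sum)
    also have "\<dots> = ennreal ((cmod (f x))\<^sup>2) + (2 * ennreal (cmod (f x) * cmod (g x)) + ennreal ((cmod (g x))\<^sup>2))"
      by (simp add: ennreal_mult' ennreal_plus)
    finally show "ennreal ((cmod (f x + g x))\<^sup>2) \<le> \<dots>" .
  qed
  also have "\<dots> = ennreal ((L2_norm f)\<^sup>2) + (2 * (\<integral>\<^sup>+x. ennreal (cmod (f x) * cmod (g x)) \<partial>lborel) + ennreal ((L2_norm g)\<^sup>2))"
    by (simp add: nn_integral_add nn_integral_cmult L2_nn_integral[OF assms(1)] L2_nn_integral[OF assms(2)])
  also have "\<dots> \<le> ennreal ((L2_norm f)\<^sup>2) + (2 * ennreal (L2_norm f * L2_norm g) + ennreal ((L2_norm g)\<^sup>2))"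
    by (intro add_mono mult_left_mono L2_nn_mult_le assms) auto
  also have "\<dots> = ennreal ((L2_norm f + L2_norm g)\<^sup>2)"
  proof -
    have "2 * ennreal (L2_norm f * L2_norm g) = ennreal (2 * (L2_norm f * L2_norm g))"
      by (simp add: ennreal_mult')
    then show ?thesis by (simp only: flip: ennreal_plus) (simp add: power2_sum algebra_simps flip: ennreal_plus)
  qed
  finally have le: "(\<integral>\<^sup>+x. ennreal ((cmod (f x + g x))\<^sup>2) \<partial>lborel) \<le> ennreal ((L2_norm f + L2_norm g)\<^sup>2)" .
  from L2I_nn[OF _ le] show "(\<lambda>x. f x + g x) \<in> L2" "L2_norm (\<lambda>x. f x + g x) \<le> L2_norm f + L2_norm g" by auto
qed

lemma L2_minus: "f \<in> L2 \<Longrightarrow> (\<lambda>x. - f x) \<in> L2"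
  using L2_cmult[of f "-1"] by simp

lemma L2_diff:
  assumes "f \<in> L2" "g \<in> L2"
  shows "(\<lambda>x. f x - g x) \<in> L2" "L2_norm (\<lambda>x. f x - g x) \<le> L2_norm f + L2_norm g"
  using L2_add[OF assms(1) L2_minus[OF assms(2)]] by (auto simp: L2_norm_def)

lemma L2_zero: "(\<lambda>x. 0) \<in> L2"
  by (rule L2I) auto

lemma L2_sum:
  "(\<And>i. i \<in> I \<Longrightarrow> f i \<in> L2) \<Longrightarrow> (\<lambda>x. \<Sum>i\<in>I. f i x) \<in> L2 \<and> L2_norm (\<lambda>x. \<Sum>i\<in>I. f i x) \<le> (\<Sum>i\<in>I. L2_norm (f i))"
proof (induction I rule: infinite_finite_induct)
  case (insert i I)
  then show ?case using L2_add[of "f i" "\<lambda>x. \<Sum>i\<in>I. f i x"] by fastforce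
qed (simp_all add: L2_zero, simp_all add: L2_norm_def)

lemma L2_norm_eq_0_AE:
  assumes "f \<in> L2" "L2_norm f = 0"
  shows "AE x in lborel. f x = 0"
proof -
  have "(LINT x|lborel. (cmod (f x))\<^sup>2) = 0" using assms(2) by (simp add: L2_norm_def)
  then show ?thesis using integral_nonneg_eq_0_iff_AE[OF L2D(2)[OF assms(1)]] by simp
qed

lemma L2_norm_dominated_convergence:
  assumes [measurable]: "\<And>n. f n \<in> borel_measurable borel" and g: "g \<in> L2"
    and le: "\<And>n x. cmod (f n x) \<le> cmod (g x)"
    and lim: "\<And>x. (\<lambda>n. f n x) \<longlonglongrightarrow> 0"
  shows "(\<lambda>n. L2_norm (f n)) \<longlonglongrightarrow> 0"
proof -
  have "(\<lambda>n. LINT x|lborel. (cmod (f n x))\<^sup>2) \<longlonglongrightarrow> (LINT x|(lborel :: real measure). (0::real))"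
  proof (rule integral_dominated_convergence)
    show "integrable lborel (\<lambda>x. (cmod (g x))\<^sup>2)" by (rule L2D(2)[OF g])
    show "AE x in lborel. (\<lambda>n. (cmod (f n x))\<^sup>2) \<longlonglongrightarrow> 0"
      using tendsto_power[OF tendsto_norm[OF lim], where n = 2] by auto
    show "AE x in lborel. norm ((cmod (f n x))\<^sup>2) \<le> (cmod (g x))\<^sup>2" for n
      using le by (auto intro!: power_mono)
  qed auto
  then show ?thesis unfolding L2_norm_def using tendsto_real_sqrt by force
qed

lemma L2_rfourier:
  assumes "rapid u"
  shows "rfourier u \<in> L2" "L2_norm (rfourier u) = sqrt (LINT k|lborel. (u k)\<^sup>2)"
  using rfourier_square_integrable[OF assms] assms by (auto intro!: L2I simp: L2_norm_def)

text \<open>Plancherel's theorem moves the norm to the Fourier side, where dominated convergence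
  needs only pointwise limits under an explicit majorant.\<close>

lemma L2_norm_rfourier_dominated_convergence:
  assumes u: "\<And>n. rapid (u n)" and w: "rapid w" and le: "\<And>n k. \<bar>u n k\<bar> \<le> \<bar>w k\<bar>"
    and lim: "\<And>k. (\<lambda>n. u n k) \<longlonglongrightarrow> 0"
  shows "(\<lambda>n. L2_norm (rfourier (u n))) \<longlonglongrightarrow> 0"
proof -
  have "(\<lambda>n. LINT k|lborel. (u n k)\<^sup>2) \<longlonglongrightarrow> (LINT x|(lborel :: real measure). (0::real))"
  proof (rule integral_dominated_convergence)
    show "integrable lborel (\<lambda>k. (w k)\<^sup>2)" by (rule rapid_integrable[OF rapid_power2[OF w]])
    show "AE k in lborel. (\<lambda>n. (u n k)\<^sup>2) \<longlonglongrightarrow> 0"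
      using tendsto_power[OF lim, where n = 2] by auto
    show "AE k in lborel. norm ((u n k)\<^sup>2) \<le> (w k)\<^sup>2" for n
      using le by (auto simp: abs_le_square_iff)
  qed (use u in auto)
  then show ?thesis unfolding L2_rfourier(2)[OF u] using tendsto_real_sqrt by force
qed

text \<open>Bounded square integrable functions: on these, all the integrals defining the semigroup exist at every point.\<close>

definition BL2 :: "(real \<Rightarrow> complex) set" where
  "BL2 = {f \<in> L2. \<exists>B. \<forall>x. cmod (f x) \<le> B}"

lemma BL2D:
  assumes "f \<in> BL2"
  shows "f \<in> L2" "f \<in> borel_measurable borel" "\<exists>B\<ge>0. \<forall>x. cmod (f x) \<le> B"
proof -
  show "f \<in> L2" "f \<in> borel_measurable borel" using assms L2D(1) by (auto simp: BL2_def)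
  from assms obtain B where "\<And>x. cmod (f x) \<le> B" by (auto simp: BL2_def)
  moreover have "0 \<le> B" using calculation[of 0] norm_ge_zero order_trans by blast
  ultimately show "\<exists>B\<ge>0. \<forall>x. cmod (f x) \<le> B" by blast
qed

lemma BL2_rfourier: "rapid u \<Longrightarrow> rfourier u \<in> BL2"
  using L2_rfourier(1) rfourier_bounded by (auto simp: BL2_def)

lemma BL2_add: "f \<in> BL2 \<Longrightarrow> g \<in> BL2 \<Longrightarrow> (\<lambda>x. f x + g x) \<in> BL2"
  unfolding BL2_def by (auto intro: L2_add(1)) (meson add_mono norm_triangle_le)

lemma BL2_cmult: "f \<in> BL2 \<Longrightarrow> (\<lambda>x. c * f x) \<in> BL2"
  unfolding BL2_def by (auto intro: L2_cmult simp: norm_mult) (meson mult_left_mono norm_ge_zero)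

lemma BL2_diff: "f \<in> BL2 \<Longrightarrow> g \<in> BL2 \<Longrightarrow> (\<lambda>x. f x - g x) \<in> BL2"
  using BL2_add[of f "\<lambda>x. -1 * g x"] BL2_cmult[of g "-1"] by simp

lemma BL2_mult_bounded:
  assumes f: "f \<in> BL2" and [measurable]: "w \<in> borel_measurable borel" and w: "\<And>x. 0 \<le> w x" "\<And>x. w x \<le> 1"
  shows "(\<lambda>x. complex_of_real (w x) * f x) \<in> BL2" "L2_norm (\<lambda>x. complex_of_real (w x) * f x) \<le> L2_norm f"
proof -
  note [measurable] = BL2D(2)[OF f]
  have le: "cmod (complex_of_real (w x) * f x) \<le> cmod (f x)" for x
    using w by (simp add: norm_mult mult_left_le_one_le)
  have "(\<lambda>x. complex_of_real (w x) * f x) \<in> L2" by (rule L2_dominated(1)[OF BL2D(1)[OF f]]) (use le in auto)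
  then show "(\<lambda>x. complex_of_real (w x) * f x) \<in> BL2" using BL2D(3)[OF f] le by (auto simp: BL2_def intro: order_trans)
  show "L2_norm (\<lambda>x. complex_of_real (w x) * f x) \<le> L2_norm f"
    by (rule L2_dominated(2)[OF BL2D(1)[OF f]]) (use le in auto)
qed

section \<open>Transition operators as averages of translates\<close>

definition translate_avg :: "real measure \<Rightarrow> (real \<Rightarrow> complex) \<Rightarrow> real \<Rightarrow> complex" where
  "translate_avg \<mu> f x = (LINT y|\<mu>. f (x + y))"

context real_distribution
begin

lemma translate_avg_measurable [measurable]:
  assumes [measurable]: "f \<in> borel_measurable borel"
  shows "translate_avg M f \<in> borel_measurable borel"
  unfolding translate_avg_def by measurable

lemma translate_integrable:
  assumes [measurable]: "f \<in> borel_measurable borel" and "\<And>x. cmod (f x) \<le> B"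
  shows "integrable M (\<lambda>y. f (x + y))"
  by (rule integrable_const_bound[of _ B]) (use assms in auto)

lemma translate_avg_bounded:
  assumes [measurable]: "f \<in> borel_measurable borel" and "\<And>x. cmod (f x) \<le> B"
  shows "cmod (translate_avg M f x) \<le> B"
proof -
  have "cmod (translate_avg M f x) \<le> (LINT y|M. cmod (f (x + y)))"
    unfolding translate_avg_def by (rule integral_norm_bound)
  also have "\<dots> \<le> (LINT y|M. B)"
    by (intro integral_mono integrable_norm translate_integrable[of _ B]) (use assms in auto)
  also have "\<dots> = B" using prob_space by simp
  finally show ?thesis .
qed

lemma nn_integral_translate_avg:
  assumes [measurable]: "g \<in> borel_measurable borel"
  shows "(\<integral>\<^sup>+x. \<integral>\<^sup>+y. g (x + y) \<partial>M \<partial>lborel) = (\<integral>\<^sup>+x. (g x :: ennreal) \<partial>lborel)"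
proof -
  interpret pair_sigma_finite M lborel by standard
  have "(\<integral>\<^sup>+x. \<integral>\<^sup>+y. g (x + y) \<partial>M \<partial>lborel) = (\<integral>\<^sup>+y. \<integral>\<^sup>+x. g (x + y) \<partial>lborel \<partial>M)"
    by (rule Fubini'[of "\<lambda>y x. g (x + y)"]) measurable
  also have "\<dots> = (\<integral>\<^sup>+y. \<integral>\<^sup>+x. g x \<partial>lborel \<partial>M)"
  proof (rule nn_integral_cong)
    fix y
    show "(\<integral>\<^sup>+x. g (x + y) \<partial>lborel) = (\<integral>\<^sup>+x. g x \<partial>lborel)"
      using nn_integral_real_affine[of g 1 y] by (simp add: add.commute)
  qed
  also have "\<dots> = (\<integral>\<^sup>+x. g x \<partial>lborel)" using emeasure_space_1 by simp
  finally show ?thesis .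
qed

text \<open>Cauchy-Schwarz against the constant 1, whose norm is 1 for a probability measure.
  Integrated over \<open>x\<close>, translation invariance turns this into contractivity on
  \<open>L2\<close>.\<close>

lemma translate_avg_cmod_square_le:
  assumes [measurable]: "f \<in> borel_measurable borel"
  shows "ennreal ((cmod (translate_avg M f x))\<^sup>2) \<le> (\<integral>\<^sup>+y. ennreal ((cmod (f (x + y)))\<^sup>2) \<partial>M)"
proof -
  have "ennreal (cmod (translate_avg M f x)) \<le> (\<integral>\<^sup>+y. ennreal (cmod (f (x + y))) \<partial>M)"
    unfolding translate_avg_def
    by (cases "integrable M (\<lambda>y. f (x + y))")
       (auto intro: integral_norm_bound_ennreal simp: not_integrable_integral_eq)
  then have "(ennreal (cmod (translate_avg M f x)))\<^sup>2 \<le> (\<integral>\<^sup>+y. ennreal (cmod (f (x + y))) * 1 \<partial>M)\<^sup>2"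
    by (intro power_mono) auto
  also have "\<dots> \<le> (\<integral>\<^sup>+y. (ennreal (cmod (f (x + y))))\<^sup>2 \<partial>M) * (\<integral>\<^sup>+y. 1\<^sup>2 \<partial>M)"
    by (rule Cauchy_Schwarz_nn_integral) auto
  finally show ?thesis using emeasure_space_1 by (simp add: ennreal_power)
qed

lemma translate_avg_L2:
  assumes f: "f \<in> L2"
  shows "translate_avg M f \<in> L2" "L2_norm (translate_avg M f) \<le> L2_norm f"
proof -
  note [measurable] = L2D(1)[OF f]
  have "(\<integral>\<^sup>+x. ennreal ((cmod (translate_avg M f x))\<^sup>2) \<partial>lborel) \<le>
      (\<integral>\<^sup>+x. \<integral>\<^sup>+y. ennreal ((cmod (f (x + y)))\<^sup>2) \<partial>M \<partial>lborel)"
    by (intro nn_integral_mono translate_avg_cmod_square_le) simp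
  also have "\<dots> = (\<integral>\<^sup>+x. ennreal ((cmod (f x))\<^sup>2) \<partial>lborel)"
    by (rule nn_integral_translate_avg) simp
  also have "\<dots> = ennreal ((L2_norm f)\<^sup>2)" by (rule L2_nn_integral[OF f])
  finally have "(\<integral>\<^sup>+x. ennreal ((cmod (translate_avg M f x))\<^sup>2) \<partial>lborel) \<le> ennreal ((L2_norm f)\<^sup>2)" .
  from L2I_nn[OF _ this] show "translate_avg M f \<in> L2" "L2_norm (translate_avg M f) \<le> L2_norm f" by auto
qed

lemma translate_avg_BL2:
  assumes "f \<in> BL2"
  shows "translate_avg M f \<in> BL2"
  using translate_avg_L2(1)[OF BL2D(1)[OF assms]] BL2D(3)[OF assms] translate_avg_bounded[OF BL2D(2)[OF assms]]
  by (auto simp: BL2_def)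

lemma translate_avg_add:
  assumes "f \<in> BL2" "g \<in> BL2"
  shows "translate_avg M (\<lambda>x. f x + g x) x = translate_avg M f x + translate_avg M g x"
  using BL2D(2,3)[OF assms(1)] BL2D(2,3)[OF assms(2)] unfolding translate_avg_def
  by (auto intro!: Bochner_Integration.integral_add translate_integrable)

lemma translate_avg_cmult: "translate_avg M (\<lambda>x. c * f x) x = c * translate_avg M f x"
  by (simp add: translate_avg_def)

text \<open>Translating \<open>f\<close> by \<open>y\<close> against \<open>g\<close> amounts to
  translating \<open>g\<close> by \<open>- y\<close>, and the measure is invariant under this change
  of sign. Cauchy-Schwarz justifies Fubini's theorem, as all translates have the same norm.\<close>

lemma translate_avg_symmetric:
  assumes f: "f \<in> BL2" and g: "g \<in> BL2" and sym: "distr M borel uminus = M"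
  shows "(LINT x|lborel. translate_avg M f x * g x) = (LINT x|lborel. f x * translate_avg M g x)"
proof -
  interpret P: pair_sigma_finite M lborel by standard
  note [measurable] = BL2D(2)[OF f] BL2D(2)[OF g]
  note L = BL2D(1)[OF f] BL2D(1)[OF g]
  have shift: "(\<lambda>x. f (x + y)) \<in> L2" for y
  proof (rule L2I)
    show "integrable lborel (\<lambda>x. (cmod (f (x + y)))\<^sup>2)"
      using lborel_integrable_real_affine[OF L2D(2)[OF L(1)], of 1 y] by (simp add: add.commute)
  qed simp
  have norm: "L2_norm (\<lambda>x. f (x + y)) = L2_norm f" for y
    using lborel_integral_real_affine[of 1 "\<lambda>x. (cmod (f x))\<^sup>2" y] by (simp add: L2_norm_def add.commute)
  have int: "integrable (M \<Otimes>\<^sub>M lborel) (\<lambda>(y, x). f (x + y) * g x)"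
  proof (rule integrableI_bounded)
    have "(\<integral>\<^sup>+z. ennreal (norm (case z of (y, x) \<Rightarrow> f (x + y) * g x)) \<partial>(M \<Otimes>\<^sub>M lborel)) =
        (\<integral>\<^sup>+y. \<integral>\<^sup>+x. ennreal (cmod (f (x + y)) * cmod (g x)) \<partial>lborel \<partial>M)"
      by (subst lborel.nn_integral_fst[symmetric]) (auto simp: norm_mult)
    also have "\<dots> \<le> (\<integral>\<^sup>+y. ennreal (L2_norm f * L2_norm g) \<partial>M)"
      using L2_nn_mult_le[OF shift L(2)] by (intro nn_integral_mono) (simp add: norm)
    also have "\<dots> < \<infinity>" using emeasure_space_1 by simp
    finally show "(\<integral>\<^sup>+z. ennreal (norm (case z of (y, x) \<Rightarrow> f (x + y) * g x)) \<partial>(M \<Otimes>\<^sub>M lborel)) < \<infinity>" .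
  qed measurable
  have "(LINT x|lborel. translate_avg M f x * g x) = (LINT x|lborel. LINT y|M. f (x + y) * g x)"
    by (simp add: translate_avg_def)
  also have "\<dots> = (LINT y|M. LINT x|lborel. f (x + y) * g x)"
    by (rule P.Fubini_integral[OF int])
  also have "\<dots> = (LINT y|M. LINT x|lborel. f x * g (x + - y))"
  proof (rule Bochner_Integration.integral_cong[OF refl])
    fix y
    show "(LINT x|lborel. f (x + y) * g x) = (LINT x|lborel. f x * g (x + - y))"
      using lborel_integral_real_affine[of 1 "\<lambda>x. f (x + y) * g x" "- y"] by (simp add: add.commute)
  qed
  also have "\<dots> = (LINT y|distr M borel uminus. LINT x|lborel. f x * g (x + y))"
    by (subst integral_distr) (auto intro!: lborel.borel_measurable_lebesgue_integral)
  also have "\<dots> = (LINT y|M. LINT x|lborel. f x * g (x + y))" by (simp only: sym)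
  also have "\<dots> = (LINT x|lborel. LINT y|M. f x * g (x + y))"
  proof (rule P.Fubini_integral[symmetric], rule integrableI_bounded)
    have "(\<integral>\<^sup>+z. ennreal (norm (case z of (y, x) \<Rightarrow> f x * g (x + y))) \<partial>(M \<Otimes>\<^sub>M lborel)) =
        (\<integral>\<^sup>+y. \<integral>\<^sup>+x. ennreal (cmod (f x) * cmod (g (x + y))) \<partial>lborel \<partial>M)"
      by (subst lborel.nn_integral_fst[symmetric]) (auto simp: norm_mult)
    also have "\<dots> = (\<integral>\<^sup>+y. \<integral>\<^sup>+x. ennreal (cmod (f (x + - y)) * cmod (g x)) \<partial>lborel \<partial>M)"
    proof (rule nn_integral_cong)
      fix y
      show "(\<integral>\<^sup>+x. ennreal (cmod (f x) * cmod (g (x + y))) \<partial>lborel) = (\<integral>\<^sup>+x. ennreal (cmod (f (x + - y)) * cmod (g x)) \<partial>lborel)"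
        using nn_integral_real_affine[of "\<lambda>x. ennreal (cmod (f x) * cmod (g (x + y)))" 1 "- y"]
        by (simp add: add.commute)
    qed
    also have "\<dots> \<le> (\<integral>\<^sup>+y. ennreal (L2_norm f * L2_norm g) \<partial>M)"
      using L2_nn_mult_le[OF shift L(2)] by (intro nn_integral_mono) (metis norm)
    also have "\<dots> < \<infinity>" using emeasure_space_1 by simp
    finally show "(\<integral>\<^sup>+z. ennreal (norm (case z of (y, x) \<Rightarrow> f x * g (x + y))) \<partial>(M \<Otimes>\<^sub>M lborel)) < \<infinity>" .
  qed measurable
  also have "\<dots> = (LINT x|lborel. f x * translate_avg M g x)" by (simp add: translate_avg_def)
  finally show ?thesis .
qed

text \<open>Shifting the argument by \<open>y\<close> multiplies the integrand by
  \<open>iexp (k * y)\<close>, whose average over \<open>y\<close> is the characteristic function: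
  averaging becomes a Fourier multiplier.\<close>

lemma translate_avg_rfourier:
  assumes u: "rapid u" and \<phi>: "\<And>k. char M k = complex_of_real (\<phi> k)"
  shows "translate_avg M (rfourier u) x = rfourier (\<lambda>k. \<phi> k * u k) x"
proof -
  define c where "c = complex_of_real (1 / sqrt (2 * pi))"
  note [measurable] = rapid_measurable[OF u]
  have i: "integrable lborel (\<lambda>k. iexp (x * k) * complex_of_real (u k))"
    by (rule Bochner_Integration.integrable_bound[OF rapid_of_real_integrable[OF u]])
       (auto simp: norm_mult)
  have "translate_avg M (rfourier u) x = c * (LINT y|M. 1 * (LINT k|lborel. (iexp (x * k) * complex_of_real (u k)) * iexp (k * y)))"
    unfolding translate_avg_def rfourier_def fourier_def c_def[symmetric] integral_mult_right_zero
    by (intro arg_cong[where f = "(*) c"] Bochner_Integration.integral_cong)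
       (auto simp: exp_add distrib_right distrib_left mult_ac)
  also have "(LINT y|M. 1 * (LINT k|lborel. (iexp (x * k) * complex_of_real (u k)) * iexp (k * y))) =
      (LINT k|lborel. (iexp (x * k) * complex_of_real (u k)) * (LINT y|M. 1 * iexp (k * y)))"
    by (rule Fubini_product_kernel[where h = "\<lambda>y k. iexp (k * y)"])
       (use i sigma_finite_measure_axioms lborel.sigma_finite_measure_axioms in auto)
  also have "\<dots> = (LINT k|lborel. iexp (x * k) * complex_of_real (\<phi> k * u k))"
    using \<phi> by (simp add: char_def mult_ac)
  finally show ?thesis
    by (simp only: rfourier_def[of "\<lambda>k. \<phi> k * u k"] fourier_def c_def)
qed

end

section \<open>The one-step operator and its powers\<close>

locale cauchy_kernels =
  fixes \<mu> :: "real \<Rightarrow> real measure"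
  assumes distribution: "0 \<le> s \<Longrightarrow> real_distribution (\<mu> s)"
    and char_mu: "0 \<le> s \<Longrightarrow> char (\<mu> s) k = complex_of_real (exp (- s * \<bar>k\<bar>))"
begin

text \<open>The characteristic functions are even in \<open>k\<close>, so by Levy's uniqueness
  theorem the laws are symmetric; this makes the averages symmetric operators.\<close>

lemma distr_uminus: "0 \<le> s \<Longrightarrow> distr (\<mu> s) borel uminus = \<mu> s"
proof -
  assume s: "0 \<le> s"
  interpret real_distribution "\<mu> s" by (rule distribution[OF s])
  have [measurable]: "uminus \<in> measurable (\<mu> s) borel" by simp
  have "prob_space (distr (\<mu> s) borel uminus)" by (rule prob_space_distr) simp
  then have d: "real_distribution (distr (\<mu> s) borel uminus)"
    by (simp add: real_distribution_def real_distribution_axioms_def)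
  have "char (distr (\<mu> s) borel uminus) k = char (\<mu> s) (- k)" for k
    by (simp add: char_def integral_distr)
  then have "char (distr (\<mu> s) borel uminus) = char (\<mu> s)"
    using char_mu[OF s] by (simp add: fun_eq_iff)
  then show ?thesis by (intro Levy_uniqueness d distribution s)
qed

definition weight :: "real \<Rightarrow> real \<Rightarrow> real" where
  "weight s x = exp (- (s * x\<^sup>2 / 2))"

lemma weight_measurable [measurable]: "weight s \<in> borel_measurable borel"
  unfolding weight_def by measurable

lemma weight_bounds: "0 \<le> weight s x" "0 \<le> s \<Longrightarrow> weight s x \<le> 1"
  by (auto simp: weight_def)

text \<open>The symmetric splitting makes the one-step operator symmetric, and still leaves Riemann sums in its powers.\<close>

definition K :: "real \<Rightarrow> (real \<Rightarrow> complex) \<Rightarrow> real \<Rightarrow> complex" where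
  "K s f x = complex_of_real (weight s x) * translate_avg (\<mu> s) (\<lambda>y. complex_of_real (weight s y) * f y) x"

context
  fixes s :: real
  assumes s: "0 \<le> s"
begin

interpretation real_distribution "\<mu> s" by (rule distribution[OF s])

lemma weight_BL2:
  assumes "f \<in> BL2"
  shows "(\<lambda>x. complex_of_real (weight s x) * f x) \<in> BL2"
    "L2_norm (\<lambda>x. complex_of_real (weight s x) * f x) \<le> L2_norm f"
  using BL2_mult_bounded[OF assms weight_measurable weight_bounds(1) weight_bounds(2)[OF s]] by auto

lemma avg_BL2:
  assumes "f \<in> BL2"
  shows "translate_avg (\<mu> s) f \<in> BL2" "L2_norm (translate_avg (\<mu> s) f) \<le> L2_norm f"
  using translate_avg_BL2[OF assms] translate_avg_L2(2)[OF BL2D(1)[OF assms]] by auto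

lemma K_BL2:
  assumes "f \<in> BL2"
  shows "K s f \<in> BL2" "L2_norm (K s f) \<le> L2_norm f"
  unfolding K_def[abs_def] using assms
  by (auto intro!: weight_BL2(1) avg_BL2(1) order_trans[OF weight_BL2(2)] order_trans[OF avg_BL2(2)])

lemma K_add: "f \<in> BL2 \<Longrightarrow> g \<in> BL2 \<Longrightarrow> K s (\<lambda>x. f x + g x) = (\<lambda>x. K s f x + K s g x)"
  unfolding K_def by (simp add: distrib_left translate_avg_add weight_BL2(1))

lemma K_cmult: "K s (\<lambda>x. c * f x) = (\<lambda>x. c * K s f x)"
  unfolding K_def by (simp add: mult.left_commute[of _ c] translate_avg_cmult)

lemma K_symmetric:
  assumes "f \<in> BL2" "g \<in> BL2"
  shows "(LINT x|lborel. K s f x * g x) = (LINT x|lborel. f x * K s g x)"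
  using translate_avg_symmetric[OF weight_BL2(1)[OF assms(1)] weight_BL2(1)[OF assms(2)] distr_uminus[OF s]]
  by (simp add: K_def mult_ac)

lemma Kpow_BL2:
  assumes "f \<in> BL2"
  shows "(K s ^^ n) f \<in> BL2 \<and> L2_norm ((K s ^^ n) f) \<le> L2_norm f"
  by (induction n) (use assms in \<open>auto intro!: K_BL2 order_trans[OF K_BL2(2)]\<close>)

lemma Kpow_add:
  assumes "f \<in> BL2" "g \<in> BL2"
  shows "(K s ^^ n) (\<lambda>x. f x + g x) = (\<lambda>x. (K s ^^ n) f x + (K s ^^ n) g x)"
  by (induction n) (use Kpow_BL2 assms in \<open>auto simp: K_add\<close>)

lemma Kpow_cmult: "(K s ^^ n) (\<lambda>x. c * f x) = (\<lambda>x. c * (K s ^^ n) f x)"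
  by (induction n) (auto simp: K_cmult)

lemma Kpow_diff:
  assumes "f \<in> BL2" "g \<in> BL2"
  shows "(K s ^^ n) (\<lambda>x. f x - g x) = (\<lambda>x. (K s ^^ n) f x - (K s ^^ n) g x)"
  using Kpow_add[OF assms(1) BL2_cmult[OF assms(2), of "-1"], of n] Kpow_cmult[of n "-1" g] by simp

lemma Kpow_symmetric:
  assumes "f \<in> BL2" "g \<in> BL2"
  shows "(LINT x|lborel. (K s ^^ n) f x * g x) = (LINT x|lborel. f x * (K s ^^ n) g x)"
  using assms
proof (induction n arbitrary: f g)
  case (Suc n)
  then show ?case
    using K_symmetric[of "(K s ^^ n) f" g] Suc.IH[of f "K s g"] Kpow_BL2 K_BL2
    by (simp add: funpow_swap1)
qed simp

lemma Kpow_telescope: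
  assumes "f \<in> BL2"
  shows "f x - (K s ^^ n) f x = (\<Sum>i<n. (K s ^^ i) (\<lambda>y. f y - K s f y) x)"
proof (induction n)
  case (Suc n)
  have "(K s ^^ n) (\<lambda>y. f y - K s f y) x = (K s ^^ n) f x - (K s ^^ Suc n) f x"
    using assms by (simp add: Kpow_diff K_BL2 funpow_swap1)
  then show ?case unfolding sum.lessThan_Suc Suc[symmetric] by simp
qed simp

text \<open>All summands of the telescoping sum are images of the one-step defect under
  contractions, so \<open>n\<close> steps multiply the defect by at most \<open>n\<close>.\<close>

lemma Kpow_near:
  assumes f: "f \<in> BL2"
  shows "L2_norm (\<lambda>x. f x - (K s ^^ n) f x) \<le> real n * L2_norm (\<lambda>x. f x - K s f x)"
proof -
  have g: "(\<lambda>x. f x - K s f x) \<in> BL2" by (intro BL2_diff f K_BL2)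
  have "L2_norm (\<lambda>x. \<Sum>i<n. (K s ^^ i) (\<lambda>y. f y - K s f y) x) \<le>
      (\<Sum>i<n. L2_norm ((K s ^^ i) (\<lambda>y. f y - K s f y)))"
    using L2_sum[of "{..<n}" "\<lambda>i. (K s ^^ i) (\<lambda>y. f y - K s f y)"] Kpow_BL2[OF g] BL2D(1) by blast
  also have "\<dots> \<le> (\<Sum>i<n. L2_norm (\<lambda>y. f y - K s f y))"
    by (intro sum_mono) (use Kpow_BL2[OF g] in blast)
  finally show ?thesis by (simp add: Kpow_telescope[OF f])
qed

text \<open>With \<open>f - K s f = s (r + h)\<close>, the quotient after \<open>n\<close> steps is
  the mean of \<open>(K s ^^ i) (r + h)\<close> over \<open>i < n\<close>. Contractivity keeps the
  share of \<open>r\<close> below the one-step error, and \<open>\<epsilon>\<close> measures how far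
  the powers move \<open>h\<close>. The bound has no further dependence on \<open>n\<close>, which
  permits refining the steps at fixed total time \<open>n s\<close>.\<close>

lemma Kpow_generator_estimate:
  assumes f: "f \<in> BL2" and h: "h \<in> BL2" and "0 < s" "0 < n"
    and \<epsilon>: "\<And>i. i < n \<Longrightarrow> L2_norm (\<lambda>x. (K s ^^ i) h x - h x) \<le> \<epsilon>"
  shows "L2_norm (\<lambda>x. (f x - (K s ^^ n) f x) / complex_of_real (real n * s) - h x) \<le>
    L2_norm (\<lambda>x. (f x - K s f x) / complex_of_real s - h x) + \<epsilon>"
proof -
  define r where "r x = (f x - K s f x) / complex_of_real s - h x" for x
  have r: "r \<in> BL2"
    unfolding r_def using BL2_cmult[OF BL2_diff[OF f K_BL2(1)[OF f]], of "1 / complex_of_real s"] h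
    by (intro BL2_diff) auto
  have fK: "(\<lambda>y. f y - K s f y) = (\<lambda>y. complex_of_real s * (r y + h y))"
    using \<open>0 < s\<close> by (auto simp: r_def fun_eq_iff)
  define q where "q i x = (K s ^^ i) r x + ((K s ^^ i) h x - h x)" for i x
  have q: "q i \<in> L2" "i < n \<Longrightarrow> L2_norm (q i) \<le> L2_norm r + \<epsilon>" for i
  proof -
    have 1: "(K s ^^ i) r \<in> L2" "(\<lambda>x. (K s ^^ i) h x - h x) \<in> L2"
      using Kpow_BL2[OF r] Kpow_BL2[OF h] h by (simp_all add: L2_diff(1) BL2D(1))
    show "q i \<in> L2" unfolding q_def by (rule L2_add(1)[OF 1])
    assume "i < n"
    have "L2_norm (q i) \<le> L2_norm ((K s ^^ i) r) + L2_norm (\<lambda>x. (K s ^^ i) h x - h x)"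
      unfolding q_def by (rule L2_add(2)[OF 1])
    also have "\<dots> \<le> L2_norm r + \<epsilon>" using Kpow_BL2[OF r] \<epsilon>[OF \<open>i < n\<close>] by (intro add_mono) auto
    finally show "L2_norm (q i) \<le> L2_norm r + \<epsilon>" .
  qed
  have eq: "(f x - (K s ^^ n) f x) / complex_of_real (real n * s) - h x = complex_of_real (1 / real n) * (\<Sum>i<n. q i x)" for x
  proof -
    have "f x - (K s ^^ n) f x = (\<Sum>i<n. complex_of_real s * ((K s ^^ i) r x + (K s ^^ i) h x))"
      unfolding Kpow_telescope[OF f] fK by (simp add: Kpow_cmult Kpow_add[OF r h])
    also have "\<dots> = complex_of_real s * (\<Sum>i<n. q i x + h x)"
      by (simp add: q_def sum_distrib_left)
    also have "\<dots> = complex_of_real s * ((\<Sum>i<n. q i x) + of_nat n * h x)"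
      by (simp add: sum.distrib)
    finally show ?thesis using \<open>0 < s\<close> \<open>0 < n\<close> by (simp add: field_simps)
  qed
  have "L2_norm (\<lambda>x. \<Sum>i<n. q i x) \<le> (\<Sum>i<n. L2_norm (q i))" using L2_sum[of "{..<n}" q] q by blast
  also have "\<dots> \<le> (\<Sum>i<n. L2_norm r + \<epsilon>)" by (intro sum_mono q(2)) auto
  finally have "L2_norm (\<lambda>x. \<Sum>i<n. q i x) \<le> real n * (L2_norm r + \<epsilon>)" by simp
  then show ?thesis unfolding eq L2_norm_cmult r_def[symmetric] using \<open>0 < n\<close>
    by (simp add: norm_divide field_simps)
qed

end

end

section \<open>Twice differentiable test functions and their density\<close>

definition C2_rapid :: "(real \<Rightarrow> real) \<Rightarrow> (real \<Rightarrow> real) \<Rightarrow> (real \<Rightarrow> real) \<Rightarrow> bool" where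
  "C2_rapid u u' u'' \<longleftrightarrow> rapid u \<and> rapid u' \<and> rapid u'' \<and>
     (\<forall>k. (u has_real_derivative u' k) (at k) \<and> (u' has_real_derivative u'' k) (at k))"

lemma C2_rapidD:
  assumes "C2_rapid u u' u''"
  shows "rapid u" "rapid u'" "rapid u''" "\<And>k. (u has_real_derivative u' k) (at k)" "\<And>k. (u' has_real_derivative u'' k) (at k)"
  using assms by (auto simp: C2_rapid_def)

lemma rapid_shift:
  assumes "rapid v"
  shows "rapid (\<lambda>x. v (x + c))"
proof -
  obtain a C where a: "0 < a" "0 \<le> C" "\<And>k. \<bar>v k\<bar> \<le> C * exp (- a * \<bar>k\<bar>)" by (rule rapidE[OF assms]) blast
  have "\<bar>v (x + c)\<bar> \<le> (C * exp (a * \<bar>c\<bar>)) * exp (- a * \<bar>x\<bar>)" for x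
  proof -
    have "- a * \<bar>x + c\<bar> \<le> a * \<bar>c\<bar> + - a * \<bar>x\<bar>"
      using mult_left_mono[of "\<bar>x\<bar>" "\<bar>x + c\<bar> + \<bar>c\<bar>" a] a(1) by (simp add: algebra_simps)
    then have "exp (- a * \<bar>x + c\<bar>) \<le> exp (a * \<bar>c\<bar>) * exp (- a * \<bar>x\<bar>)" by (simp flip: exp_add)
    from mult_left_mono[OF this a(2)] a(3)[of "x + c"] show ?thesis by simp
  qed
  moreover have "continuous_on UNIV (\<lambda>x. v (x + c))"
    by (rule continuous_on_compose2[OF rapid_continuous[OF assms]]) (auto intro!: continuous_intros)
  ultimately show ?thesis using a(1) by (intro rapidI[of _ a]) auto
qed

text \<open>By the mean value theorem the increment is \<open>d * v z\<close> with \<open>z\<close>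
  within distance \<open>d\<close> of \<open>x\<close>, so it inherits the decay of \<open>v\<close>
  up to the factor \<open>exp (a * d)\<close>, although \<open>V\<close> may fail to decay.\<close>

lemma rapid_increment:
  assumes v: "rapid v" and V: "\<And>x. (V has_real_derivative v x) (at x)" and d: "0 < d"
  shows "rapid (\<lambda>x. V (x + d) - V x)"
proof -
  obtain a C where a: "0 < a" "0 \<le> C" "\<And>k. \<bar>v k\<bar> \<le> C * exp (- a * \<bar>k\<bar>)" by (rule rapidE[OF v]) blast
  have "\<bar>V (x + d) - V x\<bar> \<le> (d * C * exp (a * d)) * exp (- a * \<bar>x\<bar>)" for x
  proof -
    obtain z where z: "x < z" "z < x + d" "V (x + d) - V x = (x + d - x) * v z"
      using MVT2[of x "x + d" V v] V d by auto
    have "- a * \<bar>z\<bar> \<le> a * d + - a * \<bar>x\<bar>"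
      using mult_left_mono[of "\<bar>x\<bar>" "\<bar>z\<bar> + d" a] a(1) z by (simp add: algebra_simps)
    then have "exp (- a * \<bar>z\<bar>) \<le> exp (a * d) * exp (- a * \<bar>x\<bar>)" by (simp flip: exp_add)
    then have "C * exp (- a * \<bar>z\<bar>) \<le> C * (exp (a * d) * exp (- a * \<bar>x\<bar>))" by (rule mult_left_mono) (rule a)
    with a(3)[of z] have "\<bar>v z\<bar> \<le> C * (exp (a * d) * exp (- a * \<bar>x\<bar>))" by simp
    from mult_left_mono[OF this, of d] d show ?thesis by (simp add: z(3) abs_mult mult_ac)
  qed
  moreover have "continuous_on UNIV V"
    using V by (auto intro!: continuous_at_imp_continuous_on DERIV_isCont)
  then have "continuous_on UNIV (\<lambda>x. V (x + d) - V x)"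
    by (intro continuous_on_diff continuous_on_compose2[of UNIV V UNIV "\<lambda>x. x + d"] continuous_intros) auto
  ultimately show ?thesis using a(1) by (intro rapidI[of _ a]) auto
qed

lemma antiderivative_exists:
  fixes f :: "real \<Rightarrow> real"
  assumes "continuous_on UNIV f"
  shows "\<exists>F. \<forall>x. (F has_real_derivative f x) (at x)"
  using einterval_antiderivative[of "-\<infinity>" "\<infinity>" f] assms
  by (auto simp: continuous_on_eq_continuous_at has_real_derivative_iff_has_vector_derivative)

text \<open>Second difference quotients of a second antiderivative approximate \<open>v\<close>.\<close>

lemma C2_rapid_dense:
  assumes v: "rapid v" and "0 < \<epsilon>"
  shows "\<exists>u u' u''. C2_rapid u u' u'' \<and> L2_norm (\<lambda>x. rfourier u x - rfourier v x) < \<epsilon>"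
proof -
  obtain a C where a: "0 < a" "0 \<le> C" "\<And>k. \<bar>v k\<bar> \<le> C * exp (- a * \<bar>k\<bar>)" by (rule rapidE[OF v]) blast
  obtain V where V: "\<And>x. (V has_real_derivative v x) (at x)"
    using antiderivative_exists[OF rapid_continuous[OF v]] by blast
  have "continuous_on UNIV V"
    using V by (auto intro!: continuous_at_imp_continuous_on DERIV_isCont)
  then obtain W where W: "\<And>x. (W has_real_derivative V x) (at x)"
    using antiderivative_exists by blast
  \<comment> \<open>Backward differences. Since \<open>u\<close> below takes a forward difference of
    \<open>G\<close>, the second difference is centered, and two mean value steps give
    \<open>u d x = v z\<close> with \<open>\<bar>z - x\<bar> < d\<close>.\<close>
  define G where "G d x = W x - W (x - d)" for d x
  define G' where "G' d x = V x - V (x - d)" for d x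
  define G'' where "G'' d x = v x - v (x - d)" for d x
  have DG: "(G d has_real_derivative G' d x) (at x)" "(G' d has_real_derivative G'' d x) (at x)" for d x
    unfolding G_def G'_def G''_def
    by (auto intro!: DERIV_diff V W DERIV_chain'[of "\<lambda>x. x - d" 1 _ _ V, simplified] DERIV_chain'[of "\<lambda>x. x - d" 1 _ _ W, simplified] derivative_eq_intros)
  define u where "u d x = (1 / d\<^sup>2) * (G d (x + d) - G d x)" for d x
  define u' where "u' d x = (1 / d\<^sup>2) * (G' d (x + d) - G' d x)" for d x
  define u'' where "u'' d x = (1 / d\<^sup>2) * (G'' d (x + d) - G'' d x)" for d x
  have rG': "rapid (G' d)" if "0 < d" for d
    using rapid_shift[OF rapid_increment[OF v V that], of "- d"] by (simp add: G'_def[abs_def])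
  have rG'': "rapid (G'' d)" for d
    unfolding G''_def using rapid_shift[OF v, of "- d"] by (intro rapid_diff v) simp
  have C2: "C2_rapid (u d) (u' d) (u'' d)" if d: "0 < d" for d
    unfolding C2_rapid_def
  proof (intro conjI allI)
    show "rapid (u d)" unfolding u_def by (intro rapid_cmult rapid_increment[OF rG'[OF d] DG(1) d])
    show "rapid (u' d)" unfolding u'_def by (intro rapid_cmult rapid_diff rapid_shift rG'[OF d])
    show "rapid (u'' d)" unfolding u''_def by (intro rapid_cmult rapid_diff rapid_shift rG'')
    have sh: "((\<lambda>x. f (x + d)) has_real_derivative f' (k + d)) (at k)"
      if "\<And>x. (f has_real_derivative f' x) (at x)" for f f' k
      using DERIV_shift[of f "f' (k + d)" k d] that by simp
    show "(u d has_real_derivative u' d k) (at k)" for k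
      unfolding u_def u'_def by (intro DERIV_cmult DERIV_diff sh DG)
    show "(u' d has_real_derivative u'' d k) (at k)" for k
      unfolding u'_def u''_def by (intro DERIV_cmult DERIV_diff sh DG)
  qed
  have mv: "\<exists>z. \<bar>z - x\<bar> < d \<and> u d x = v z" if d: "0 < d" for d x
  proof -
    obtain y where y: "x < y" "y < x + d" "G d (x + d) - G d x = (x + d - x) * G' d y"
      using MVT2[of x "x + d" "G d" "G' d"] DG(1) d by auto
    obtain z where z: "y - d < z" "z < y" "V y - V (y - d) = (y - (y - d)) * v z"
      using MVT2[of "y - d" y V v] V d by auto
    have "u d x = v z" unfolding u_def y(3) G'_def z(3) using d by (simp add: power2_eq_square)
    then show ?thesis using y z by (intro exI[of _ z]) auto
  qed
  define d where "d n = inverse (real (Suc n))" for n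
  have d: "\<And>n. 0 < d n" "d \<longlonglongrightarrow> 0" "\<And>n. d n \<le> 1"
    unfolding d_def using LIMSEQ_inverse_real_of_nat by (auto simp: field_simps)
  have ru: "rapid (\<lambda>x. u (d n) x - v x)" for n by (intro rapid_diff v C2_rapidD(1)[OF C2[OF d(1)]])
  \<comment> \<open>\<open>C * exp a\<close> accounts for \<open>v z\<close>, because
    \<open>\<bar>z\<bar> \<ge> \<bar>x\<bar> - 1\<close>, and \<open>C\<close> for
    \<open>v x\<close>.\<close>
  define w where "w x = (C * exp a + C) * exp (- a * \<bar>x\<bar>)" for x
  have w: "rapid w" unfolding w_def using a by (intro rapidI[OF _ a(1), of _ "C * exp a + C"]) (auto intro!: continuous_intros)
  have lim: "(\<lambda>n. L2_norm (rfourier (\<lambda>x. u (d n) x - v x))) \<longlonglongrightarrow> 0"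
  proof (rule L2_norm_rfourier_dominated_convergence[OF ru w])
    fix n x
    obtain z where z: "\<bar>z - x\<bar> < d n" "u (d n) x = v z" using mv[OF d(1)] by blast
    have "- a * \<bar>z\<bar> \<le> a + - a * \<bar>x\<bar>"
      using mult_left_mono[of "\<bar>x\<bar>" "\<bar>z\<bar> + 1" a] a(1) z(1) d(3)[of n] by (simp add: algebra_simps)
    then have "exp (- a * \<bar>z\<bar>) \<le> exp a * exp (- a * \<bar>x\<bar>)" by (simp flip: exp_add)
    from mult_left_mono[OF this a(2)] a(3)[of z] have "\<bar>v z\<bar> \<le> C * exp a * exp (- a * \<bar>x\<bar>)" by simp
    then have "\<bar>u (d n) x - v x\<bar> \<le> w x" using a(3)[of x] by (simp add: z w_def algebra_simps)
    then show "\<bar>u (d n) x - v x\<bar> \<le> \<bar>w x\<bar>" by simp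
  next
    fix x
    have "\<exists>z. \<forall>n. \<bar>z n - x\<bar> < d n \<and> u (d n) x = v (z n)" using mv[OF d(1)] by (intro choice) blast
    then obtain z where z: "\<And>n. \<bar>z n - x\<bar> < d n" "\<And>n. u (d n) x = v (z n)" by blast
    have "(\<lambda>n. z n - x) \<longlonglongrightarrow> 0"
      by (rule Lim_null_comparison[OF _ d(2)]) (use z(1) in \<open>auto intro!: always_eventually less_imp_le\<close>)
    then have "z \<longlonglongrightarrow> x" by (simp add: LIM_zero_iff)
    then have "(\<lambda>n. v (z n)) \<longlonglongrightarrow> v x" by (rule isCont_tendsto_compose[OF rapid_isCont[OF v]])
    then show "(\<lambda>n. u (d n) x - v x) \<longlonglongrightarrow> 0" by (simp add: z(2) LIM_zero)
  qed
  obtain n where "L2_norm (rfourier (\<lambda>x. u (d n) x - v x)) < \<epsilon>"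
    using order_tendstoD(2)[OF lim \<open>0 < \<epsilon>\<close>] by (auto simp: eventually_sequentially)
  moreover have "rfourier (\<lambda>x. u (d n) x - v x) = (\<lambda>x. rfourier (u (d n)) x - rfourier v x)"
    using C2_rapidD(1)[OF C2[OF d(1)]] v by (auto simp: rfourier_diff)
  ultimately show ?thesis using C2[OF d(1)] by metis
qed

section \<open>The difference quotient of one step and strong continuity\<close>

context cauchy_kernels
begin

lemma avg_rfourier:
  "0 \<le> s \<Longrightarrow> rapid u \<Longrightarrow> translate_avg (\<mu> s) (rfourier u) = rfourier (\<lambda>k. exp (- s * \<bar>k\<bar>) * u k)"
  using real_distribution.translate_avg_rfourier[OF distribution _ char_mu] by blast

lemma rapid_damped: "0 \<le> s \<Longrightarrow> rapid u \<Longrightarrow> rapid (\<lambda>k. exp (- s * \<bar>k\<bar>) * u k)"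
  by (rule rapid_mult_bounded[of _ _ 1]) (auto intro!: continuous_intros)

text \<open>The quotient lies between 0 and \<open>r\<close>. With \<open>r = \<bar>k\<bar>\<close>
  for the averages and \<open>r = x\<^sup>2 / 2\<close> for the weights this is the majorant for
  dominated convergence.\<close>

lemma exp_quotient_bounds:
  fixes s r :: real
  assumes "0 < s" "0 \<le> r"
  shows "\<bar>(1 - exp (- s * r)) / s - r\<bar> \<le> r"
proof -
  have "1 - exp (- s * r) \<le> s * r" "0 \<le> 1 - exp (- s * r)"
    using exp_ge_add_one_self[of "- s * r"] assms by auto
  then have "0 \<le> (1 - exp (- s * r)) / s" "(1 - exp (- s * r)) / s \<le> r"
    using assms by (auto simp: field_simps)
  then show ?thesis by simp
qed

lemma exp_quotient_tendsto:
  fixes r :: real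
  assumes \<sigma>: "\<And>n. 0 < \<sigma> n" "\<sigma> \<longlonglongrightarrow> 0"
  shows "(\<lambda>n. (1 - exp (- \<sigma> n * r)) / \<sigma> n - r) \<longlonglongrightarrow> 0"
proof -
  have "((\<lambda>s. (1 - exp (- s * r)) / s - r) \<longlongrightarrow> 0) (at_right 0)" by real_asymp
  moreover have "filterlim \<sigma> (at_right 0) sequentially"
    unfolding filterlim_at using \<sigma> by (auto intro!: always_eventually) (metis less_irrefl)
  ultimately show ?thesis by (rule filterlim_compose)
qed

lemma weight_tendsto:
  assumes f: "f \<in> BL2" and \<sigma>: "\<And>n. 0 < \<sigma> n" "\<sigma> \<longlonglongrightarrow> 0"
  shows "(\<lambda>n. L2_norm (\<lambda>x. complex_of_real (weight (\<sigma> n) x) * f x - f x)) \<longlonglongrightarrow> 0"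
proof (rule L2_norm_dominated_convergence[OF _ BL2D(1)[OF f]])
  note [measurable] = BL2D(2)[OF f]
  show "(\<lambda>x. complex_of_real (weight (\<sigma> n) x) * f x - f x) \<in> borel_measurable borel" for n by measurable
  have "cmod (complex_of_real (weight (\<sigma> n) x) * f x - f x) = (1 - weight (\<sigma> n) x) * cmod (f x)" for n x
  proof -
    have "complex_of_real (weight (\<sigma> n) x) * f x - f x = complex_of_real (- (1 - weight (\<sigma> n) x)) * f x"
      by (simp add: algebra_simps)
    then show ?thesis using weight_bounds[of "\<sigma> n" x] \<sigma>(1)[of n] by (simp only: norm_mult norm_of_real) auto
  qed
  then show "cmod (complex_of_real (weight (\<sigma> n) x) * f x - f x) \<le> cmod (f x)" for n x
    using weight_bounds[of "\<sigma> n" x] \<sigma>(1)[of n] by (simp add: mult_left_le_one_le)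
  show "(\<lambda>n. complex_of_real (weight (\<sigma> n) x) * f x - f x) \<longlonglongrightarrow> 0" for x
  proof -
    have "(\<lambda>n. complex_of_real (weight (\<sigma> n) x) * f x - f x) \<longlonglongrightarrow> complex_of_real (exp (- (0 * x\<^sup>2 / 2))) * f x - f x"
      unfolding weight_def by (intro tendsto_intros \<sigma>) auto
    then show ?thesis by simp
  qed
qed

lemma avg_tendsto:
  assumes v: "rapid v" and \<sigma>: "\<And>n. 0 < \<sigma> n" "\<sigma> \<longlonglongrightarrow> 0"
  shows "(\<lambda>n. L2_norm (\<lambda>x. translate_avg (\<mu> (\<sigma> n)) (rfourier v) x - rfourier v x)) \<longlonglongrightarrow> 0"
proof -
  have \<sigma>0: "0 \<le> \<sigma> n" for n using \<sigma>(1)[of n] by simp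
  have "(\<lambda>n. L2_norm (rfourier (\<lambda>k. exp (- \<sigma> n * \<bar>k\<bar>) * v k - v k))) \<longlonglongrightarrow> 0"
  proof (rule L2_norm_rfourier_dominated_convergence[OF _ v])
    show "rapid (\<lambda>k. exp (- \<sigma> n * \<bar>k\<bar>) * v k - v k)" for n by (intro rapid_diff rapid_damped \<sigma>0 v)
    show "\<bar>exp (- \<sigma> n * \<bar>k\<bar>) * v k - v k\<bar> \<le> \<bar>v k\<bar>" for n k
    proof -
      have "exp (- \<sigma> n * \<bar>k\<bar>) * v k - v k = - (1 - exp (- \<sigma> n * \<bar>k\<bar>)) * v k" by (simp add: algebra_simps)
      moreover have "0 \<le> 1 - exp (- \<sigma> n * \<bar>k\<bar>)" using \<sigma>0[of n] by simp
      ultimately show ?thesis by (simp add: abs_mult mult_left_le_one_le)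
    qed
    show "(\<lambda>n. exp (- \<sigma> n * \<bar>k\<bar>) * v k - v k) \<longlonglongrightarrow> 0" for k
    proof -
      have "(\<lambda>n. exp (- \<sigma> n * \<bar>k\<bar>) * v k - v k) \<longlonglongrightarrow> exp (- 0 * \<bar>k\<bar>) * v k - v k" by (intro tendsto_intros \<sigma>)
      then show ?thesis by simp
    qed
  qed
  moreover have "rfourier (\<lambda>k. exp (- \<sigma> n * \<bar>k\<bar>) * v k - v k) =
      (\<lambda>x. translate_avg (\<mu> (\<sigma> n)) (rfourier v) x - rfourier v x)" for n
    unfolding avg_rfourier[OF \<sigma>0 v] by (intro ext rfourier_diff rapid_damped \<sigma>0 v)
  ultimately show ?thesis by simp
qed

lemma avg_quotient_tendsto:
  assumes u: "rapid u" and \<sigma>: "\<And>n. 0 < \<sigma> n" "\<sigma> \<longlonglongrightarrow> 0"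
  shows "(\<lambda>n. L2_norm (\<lambda>x. (rfourier u x - translate_avg (\<mu> (\<sigma> n)) (rfourier u) x) / complex_of_real (\<sigma> n)
      - rfourier (\<lambda>k. \<bar>k\<bar> * u k) x)) \<longlonglongrightarrow> 0"
proof -
  have \<sigma>0: "0 \<le> \<sigma> n" for n using \<sigma>(1)[of n] by simp
  define w where "w n k = (1 / \<sigma> n) * (u k - exp (- \<sigma> n * \<bar>k\<bar>) * u k) - \<bar>k\<bar> * u k" for n k
  have wr: "rapid (w n)" for n
    unfolding w_def by (intro rapid_diff rapid_cmult rapid_damped rapid_times_abs \<sigma>0 u)
  have w: "w n k = ((1 - exp (- \<sigma> n * \<bar>k\<bar>)) / \<sigma> n - \<bar>k\<bar>) * u k" for n k
    by (simp add: w_def field_simps)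
  have "(\<lambda>n. L2_norm (rfourier (w n))) \<longlonglongrightarrow> 0"
  proof (rule L2_norm_rfourier_dominated_convergence[OF wr rapid_times_abs[OF u]])
    show "\<bar>w n k\<bar> \<le> \<bar>\<bar>k\<bar> * u k\<bar>" for n k
      unfolding w abs_mult using exp_quotient_bounds[OF \<sigma>(1), of "\<bar>k\<bar>" n] by (intro mult_right_mono) auto
    show "(\<lambda>n. w n k) \<longlonglongrightarrow> 0" for k
      unfolding w using tendsto_mult_left_zero[OF exp_quotient_tendsto[OF \<sigma>], of "\<bar>k\<bar>" "u k"] by simp
  qed
  moreover have eq: "rfourier (w n) x = (rfourier u x - translate_avg (\<mu> (\<sigma> n)) (rfourier u) x) / complex_of_real (\<sigma> n)
      - rfourier (\<lambda>k. \<bar>k\<bar> * u k) x" for n x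
  proof -
    have 1: "rfourier (w n) x = rfourier (\<lambda>k. (1 / \<sigma> n) * (u k - exp (- \<sigma> n * \<bar>k\<bar>) * u k)) x - rfourier (\<lambda>k. \<bar>k\<bar> * u k) x"
      unfolding w_def by (intro rfourier_diff rapid_cmult rapid_diff rapid_damped rapid_times_abs \<sigma>0 u)
    have 2: "rfourier (\<lambda>k. u k - exp (- \<sigma> n * \<bar>k\<bar>) * u k) x = rfourier u x - rfourier (\<lambda>k. exp (- \<sigma> n * \<bar>k\<bar>) * u k) x"
      by (intro rfourier_diff rapid_damped \<sigma>0 u)
    show ?thesis unfolding 1 rfourier_cmult 2 avg_rfourier[OF \<sigma>0 u] by simp
  qed
  ultimately show ?thesis unfolding eq[symmetric] by simp
qed

lemma weight_quotient_tendsto: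
  assumes f: "f \<in> BL2" and xf: "(\<lambda>x. complex_of_real (x\<^sup>2 / 2) * f x) \<in> L2" and \<sigma>: "\<And>n. 0 < \<sigma> n" "\<sigma> \<longlonglongrightarrow> 0"
  shows "(\<lambda>n. L2_norm (\<lambda>x. (f x - complex_of_real (weight (\<sigma> n) x) * f x) / complex_of_real (\<sigma> n)
      - complex_of_real (x\<^sup>2 / 2) * f x)) \<longlonglongrightarrow> 0"
proof (rule L2_norm_dominated_convergence[OF _ xf])
  note [measurable] = BL2D(2)[OF f]
  show "(\<lambda>x. (f x - complex_of_real (weight (\<sigma> n) x) * f x) / complex_of_real (\<sigma> n)
      - complex_of_real (x\<^sup>2 / 2) * f x) \<in> borel_measurable borel" for n by measurable
  have eq: "(f x - complex_of_real (weight (\<sigma> n) x) * f x) / complex_of_real (\<sigma> n) - complex_of_real (x\<^sup>2 / 2) * f x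
      = complex_of_real ((1 - exp (- \<sigma> n * (x\<^sup>2 / 2))) / \<sigma> n - x\<^sup>2 / 2) * f x" for n x
    using \<sigma>(1)[of n] by (simp add: weight_def field_simps)
  show "cmod ((f x - complex_of_real (weight (\<sigma> n) x) * f x) / complex_of_real (\<sigma> n)
      - complex_of_real (x\<^sup>2 / 2) * f x) \<le> cmod (complex_of_real (x\<^sup>2 / 2) * f x)" for n x
    unfolding eq norm_mult norm_of_real using exp_quotient_bounds[OF \<sigma>(1), of "x\<^sup>2 / 2" n]
    by (intro mult_right_mono) auto
  show "(\<lambda>n. (f x - complex_of_real (weight (\<sigma> n) x) * f x) / complex_of_real (\<sigma> n)
      - complex_of_real (x\<^sup>2 / 2) * f x) \<longlonglongrightarrow> 0" for x
  proof -
    have "(\<lambda>n. complex_of_real ((1 - exp (- \<sigma> n * (x\<^sup>2 / 2))) / \<sigma> n - x\<^sup>2 / 2)) \<longlonglongrightarrow> 0"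
      using tendsto_of_real[OF exp_quotient_tendsto[OF \<sigma>, of "x\<^sup>2 / 2"], where ?'a = complex]
      by (simp only: of_real_0)
    then show ?thesis unfolding eq by (rule tendsto_mult_left_zero)
  qed
qed

text \<open>With \<open>W\<close> the weight and \<open>P\<close> the average,
  \<open>1 - W P W = (1 - W) + W (1 - P) + W P (1 - W)\<close>. Applied to \<open>f\<close> and
  divided by the step size, the brackets tend to \<open>a\<close>, \<open>b\<close> and
  \<open>a\<close>; the outer contractions carry the errors along and tend to the identity on these
  limits. The two halves of the potential add up to \<open>x\<^sup>2 f\<close>, the transform of
  \<open>- u''\<close>.\<close>

lemma K_quotient_tendsto:
  assumes u: "C2_rapid u u' u''" and \<sigma>: "\<And>n. 0 < \<sigma> n" "\<sigma> \<longlonglongrightarrow> 0"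
  shows "(\<lambda>n. L2_norm (\<lambda>x. (rfourier u x - K (\<sigma> n) (rfourier u) x) / complex_of_real (\<sigma> n)
      - rfourier (\<lambda>k. \<bar>k\<bar> * u k - u'' k) x)) \<longlonglongrightarrow> 0"
proof -
  note r = C2_rapidD[OF u]
  have \<sigma>0: "0 \<le> \<sigma> n" for n using \<sigma>(1)[of n] by simp
  define f where "f = rfourier u"
  \<comment> \<open>This is \<open>x\<^sup>2 / 2\<close> times \<open>f\<close>, written as a
    transform so that the averages act on it as multipliers.\<close>
  define a where "a = rfourier (\<lambda>k. (- 1 / 2) * u'' k)"
  define b where "b = rfourier (\<lambda>k. \<bar>k\<bar> * u k)"
  have f: "f \<in> BL2" and a: "a \<in> BL2" and b: "b \<in> BL2"
    unfolding f_def a_def b_def by (intro BL2_rfourier rapid_cmult rapid_times_abs r)+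
  have af: "a x = complex_of_real (x\<^sup>2 / 2) * f x" for x
    unfolding a_def f_def rfourier_cmult rfourier_second_derivative[OF r] by simp
  have h: "rfourier (\<lambda>k. \<bar>k\<bar> * u k - u'' k) x = a x + b x + a x" for x
  proof -
    have "a x + a x = rfourier (\<lambda>k. - u'' k) x"
      unfolding a_def rfourier_cmult rfourier_minus by (simp add: field_simps)
    moreover have "rfourier (\<lambda>k. \<bar>k\<bar> * u k - u'' k) x = b x + rfourier (\<lambda>k. - u'' k) x"
      unfolding b_def by (simp add: rfourier_diff rapid_times_abs r rfourier_minus)
    ultimately show ?thesis by (metis add.assoc add.commute)
  qed
  define W where "W n g = (\<lambda>x. complex_of_real (weight (\<sigma> n) x) * g x)" for n and g :: "real \<Rightarrow> complex"
  define P where "P n = translate_avg (\<mu> (\<sigma> n))" for n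
  have W: "g \<in> BL2 \<Longrightarrow> W n g \<in> BL2" "g \<in> BL2 \<Longrightarrow> L2_norm (W n g) \<le> L2_norm g" for n g
    unfolding W_def using weight_BL2[OF \<sigma>0] by auto
  have P: "g \<in> BL2 \<Longrightarrow> P n g \<in> BL2" "g \<in> BL2 \<Longrightarrow> L2_norm (P n g) \<le> L2_norm g" for n g
    unfolding P_def using avg_BL2[OF \<sigma>0] by auto
  define A where "A n x = (f x - W n f x) / complex_of_real (\<sigma> n) - a x" for n x
  define B where "B n x = (f x - P n f x) / complex_of_real (\<sigma> n) - b x" for n x
  have A: "A n \<in> BL2" and B: "B n \<in> BL2" for n
  proof -
    have "(\<lambda>x. (1 / complex_of_real (\<sigma> n)) * (f x - W n f x) - a x) \<in> BL2" by (intro BL2_diff BL2_cmult W f a)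
    then show "A n \<in> BL2" by (simp add: A_def[abs_def])
    have "(\<lambda>x. (1 / complex_of_real (\<sigma> n)) * (f x - P n f x) - b x) \<in> BL2" by (intro BL2_diff BL2_cmult P f b)
    then show "B n \<in> BL2" by (simp add: B_def[abs_def])
  qed
  have Plin: "P n (\<lambda>x. g x + g' x) = (\<lambda>x. P n g x + P n g' x)" if "g \<in> BL2" "g' \<in> BL2" for n g g'
    unfolding P_def using real_distribution.translate_avg_add[OF distribution[OF \<sigma>0] that] by auto
  have Pc: "P n (\<lambda>x. c * g x) = (\<lambda>x. c * P n g x)" for n c g
    unfolding P_def using real_distribution.translate_avg_cmult[OF distribution[OF \<sigma>0]] by auto
  have KW: "K (\<sigma> n) f = W n (P n (W n f))" for n by (simp add: K_def[abs_def] W_def P_def)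
  have decomp: "(f x - K (\<sigma> n) f x) / complex_of_real (\<sigma> n) - (a x + b x + a x) =
      A n x + (W n (B n) x + (W n b x - b x)) + (W n (P n (A n)) x + (W n (\<lambda>x. P n a x - a x) x + (W n a x - a x)))" for n x
  proof -
    have "W n f = (\<lambda>x. f x + (- complex_of_real (\<sigma> n)) * (A n x + a x))"
      using \<sigma>(1)[of n] by (auto simp: A_def field_simps)
    then have "P n (W n f) = (\<lambda>x. P n f x + (- complex_of_real (\<sigma> n)) * (P n (A n) x + P n a x))"
      using f A a by (simp only: Plin Pc BL2_add BL2_cmult)
    then have 1: "P n (W n f) x = f x - complex_of_real (\<sigma> n) * (B n x + b x) - complex_of_real (\<sigma> n) * (P n (A n) x + P n a x)"
      using \<sigma>(1)[of n] by (simp add: B_def field_simps)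
    have 2: "complex_of_real (weight (\<sigma> n) x) * f x = f x - complex_of_real (\<sigma> n) * (A n x + a x)"
      using \<sigma>(1)[of n] by (simp add: A_def W_def field_simps)
    have "K (\<sigma> n) f x = f x - complex_of_real (\<sigma> n) * (A n x + a x)
        - complex_of_real (weight (\<sigma> n) x) * (complex_of_real (\<sigma> n) * (B n x + b x) + complex_of_real (\<sigma> n) * (P n (A n) x + P n a x))"
      unfolding KW W_def[of n "P n (W n f)"] 1 2[symmetric] by (simp add: algebra_simps)
    then have "(f x - K (\<sigma> n) f x) / complex_of_real (\<sigma> n) = (A n x + a x)
        + complex_of_real (weight (\<sigma> n) x) * ((B n x + b x) + (P n (A n) x + P n a x))"
      using \<sigma>(1)[of n] by (simp add: field_simps)
    then show ?thesis by (simp add: W_def algebra_simps)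
  qed
  define E where "E n = L2_norm (A n) + (L2_norm (B n) + L2_norm (\<lambda>x. W n b x - b x)) +
      (L2_norm (A n) + (L2_norm (\<lambda>x. P n a x - a x) + L2_norm (\<lambda>x. W n a x - a x)))" for n
  have le: "L2_norm (\<lambda>x. (f x - K (\<sigma> n) f x) / complex_of_real (\<sigma> n) - (a x + b x + a x)) \<le> E n" for n
  proof -
    have m: "W n (B n) \<in> BL2" "(\<lambda>x. W n b x - b x) \<in> BL2" "W n (P n (A n)) \<in> BL2" "(\<lambda>x. P n a x - a x) \<in> BL2"
      "W n (\<lambda>x. P n a x - a x) \<in> BL2" "(\<lambda>x. W n a x - a x) \<in> BL2"
      by (intro W P BL2_diff A B a b)+
    have add: "L2_norm (\<lambda>x. g x + g' x) \<le> c + c'" if "g \<in> BL2" "g' \<in> BL2" "L2_norm g \<le> c" "L2_norm g' \<le> c'" for g g' c c'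
      using L2_add(2)[of g g'] BL2D(1) that by fastforce
    show ?thesis
      unfolding decomp E_def
      by (intro add m BL2_add A order_refl order_trans[OF W(2)] P B)
  qed
  have "(\<lambda>n. E n) \<longlonglongrightarrow> 0 + (0 + 0) + (0 + (0 + 0))"
    unfolding E_def
  proof (intro tendsto_add)
    show "(\<lambda>n. L2_norm (A n)) \<longlonglongrightarrow> 0"
      unfolding A_def W_def af by (rule weight_quotient_tendsto[OF f _ \<sigma>]) (use BL2D(1)[OF a] in \<open>simp add: af[abs_def]\<close>)
    then show "(\<lambda>n. L2_norm (A n)) \<longlonglongrightarrow> 0" .
    show "(\<lambda>n. L2_norm (B n)) \<longlonglongrightarrow> 0"
      unfolding B_def P_def f_def b_def by (rule avg_quotient_tendsto[OF r(1) \<sigma>])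
    show "(\<lambda>n. L2_norm (\<lambda>x. P n a x - a x)) \<longlonglongrightarrow> 0"
      unfolding P_def a_def by (rule avg_tendsto[OF rapid_cmult[OF r(3)] \<sigma>])
  qed (unfold W_def, (rule weight_tendsto[OF _ \<sigma>], rule a b)+)
  then have "(\<lambda>n. E n) \<longlonglongrightarrow> 0" by simp
  then show ?thesis
    unfolding h f_def[symmetric]
    by (rule Lim_null_comparison[rotated]) (use le in \<open>auto intro!: always_eventually\<close>)
qed

lemma K_quotient_tendsto_at_right:
  assumes "C2_rapid u u' u''"
  shows "((\<lambda>s. L2_norm (\<lambda>x. (rfourier u x - K s (rfourier u) x) / complex_of_real s
      - rfourier (\<lambda>k. \<bar>k\<bar> * u k - u'' k) x)) \<longlongrightarrow> 0) (at_right 0)"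
  unfolding tendsto_at_iff_sequentially comp_def
  using K_quotient_tendsto[OF assms] by auto

text \<open>The generator estimate applies this to the transform of
  \<open>\<bar>k\<bar> * u - u''\<close>, which decays rapidly but is in general not differentiable
  before the transform. So the displacement bound \<open>i * s * C\<close> for twice differentiable
  functions is carried over by density, with contractivity controlling the difference uniformly in
  \<open>i\<close> and \<open>s\<close>.\<close>

lemma K_strongly_continuous:
  assumes v: "rapid v" and \<epsilon>: "0 < \<epsilon>"
  shows "\<exists>\<delta>>0. \<forall>s i. 0 < s \<longrightarrow> real i * s \<le> \<delta> \<longrightarrow> L2_norm (\<lambda>x. (K s ^^ i) (rfourier v) x - rfourier v x) \<le> \<epsilon>"
proof -
  obtain u u' u'' where u: "C2_rapid u u' u''" and uv: "L2_norm (\<lambda>x. rfourier u x - rfourier v x) < \<epsilon> / 3"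
    using C2_rapid_dense[OF v, of "\<epsilon> / 3"] \<epsilon> by auto
  note r = C2_rapidD[OF u]
  define f where "f = rfourier u"
  define g where "g = rfourier v"
  define h where "h = rfourier (\<lambda>k. \<bar>k\<bar> * u k - u'' k)"
  have f: "f \<in> BL2" and g: "g \<in> BL2" and h: "h \<in> BL2"
    unfolding f_def g_def h_def by (intro BL2_rfourier rapid_diff rapid_times_abs r v)+
  define q where "q s x = (f x - K s f x) / complex_of_real s - h x" for s x
  have "\<forall>\<^sub>F s in at_right 0. L2_norm (q s) < 1"
    using order_tendstoD(2)[OF K_quotient_tendsto_at_right[OF u], of 1] by (simp add: q_def[abs_def] f_def h_def)
  then obtain s0 where s0: "0 < s0" "\<And>s. 0 < s \<Longrightarrow> s < s0 \<Longrightarrow> L2_norm (q s) < 1"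
    by (auto simp: eventually_at_right_field)
  \<comment> \<open>For small \<open>s\<close> the error \<open>q s\<close> has norm below 1, so one
    step moves \<open>f\<close> by at most \<open>s * (1 + L2_norm h)\<close>.\<close>
  define C where "C = 1 + L2_norm h"
  have C: "0 < C" by (simp add: C_def add_pos_nonneg)
  have one: "L2_norm (\<lambda>x. f x - K s f x) \<le> C * s" if s: "0 < s" "s < s0" for s
  proof -
    have q: "q s \<in> L2"
    proof -
      have "(\<lambda>x. (1 / complex_of_real s) * (f x - K s f x) - h x) \<in> BL2"
        using s by (intro BL2_diff BL2_cmult K_BL2 f h) auto
      then show ?thesis by (simp add: q_def[abs_def] BL2D(1))
    qed
    have "(\<lambda>x. f x - K s f x) = (\<lambda>x. complex_of_real s * (q s x + h x))"
      using s by (auto simp: q_def field_simps)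
    then have "L2_norm (\<lambda>x. f x - K s f x) = s * L2_norm (\<lambda>x. q s x + h x)"
      using s by (simp add: L2_norm_cmult)
    also have "\<dots> \<le> s * (L2_norm (q s) + L2_norm h)"
      using s by (intro mult_left_mono L2_add(2) q BL2D(1)[OF h]) auto
    also have "\<dots> \<le> s * C" using s s0(2)[OF s] by (intro mult_left_mono) (auto simp: C_def)
    finally show ?thesis by (simp add: mult.commute)
  qed
  \<comment> \<open>\<open>s0 / 2\<close> forces \<open>s < s0\<close> as soon as one step is made;
    \<open>\<epsilon> / (3 * C)\<close> makes the displacement of \<open>f\<close> at most
    \<open>\<epsilon> / 3\<close>.\<close>
  define \<delta> where "\<delta> = min (s0 / 2) (\<epsilon> / (3 * C))"
  have \<delta>: "0 < \<delta>" using s0 C \<epsilon> by (simp add: \<delta>_def)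
  have "L2_norm (\<lambda>x. (K s ^^ i) g x - g x) \<le> \<epsilon>" if s: "0 < s" and i: "real i * s \<le> \<delta>" for s i
  proof (cases "i = 0")
    case True
    then show ?thesis using \<epsilon> by (simp add: L2_norm_def)
  next
    case False
    then have "1 * s \<le> real i * s" using s by (intro mult_right_mono) auto
    then have ss: "s < s0" using i s0 by (simp add: \<delta>_def)
    have "L2_norm (\<lambda>x. f x - (K s ^^ i) f x) \<le> real i * (C * s)"
      using Kpow_near[OF _ f, of s i] one[OF s ss] s
      by (meson less_imp_le mult_left_mono of_nat_0_le_iff order_trans)
    also have "\<dots> = C * (real i * s)" by simp
    also have "\<dots> \<le> C * (\<epsilon> / (3 * C))" using i C by (intro mult_left_mono) (auto simp: \<delta>_def)
    finally have n1: "L2_norm (\<lambda>x. f x - (K s ^^ i) f x) \<le> \<epsilon> / 3" using C by simp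
    have gf: "(\<lambda>x. g x - f x) \<in> BL2" by (intro BL2_diff f g)
    have n2: "L2_norm (\<lambda>x. g x - f x) \<le> \<epsilon> / 3"
      using uv by (simp add: L2_norm_def f_def g_def norm_minus_commute)
    have n3: "L2_norm ((K s ^^ i) (\<lambda>x. g x - f x)) \<le> \<epsilon> / 3"
      using Kpow_BL2[OF _ gf, of s i] s n2 by auto
    have eq: "(K s ^^ i) g x - g x = (K s ^^ i) (\<lambda>x. g x - f x) x + ((-1) * (f x - (K s ^^ i) f x) + (-1) * (g x - f x))" for x
      using Kpow_diff[OF _ g f, of s i] s by simp
    have m: "(K s ^^ i) (\<lambda>x. g x - f x) \<in> L2" "(\<lambda>x. (-1) * (f x - (K s ^^ i) f x)) \<in> L2" "(\<lambda>x. (-1) * (g x - f x)) \<in> L2"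
      using Kpow_BL2[OF _ gf, of s i] Kpow_BL2[OF _ f, of s i] s f g
      by (auto intro!: BL2D(1) BL2_cmult BL2_diff simp del: mult_minus_left)
    have "L2_norm (\<lambda>x. (K s ^^ i) g x - g x) \<le> L2_norm ((K s ^^ i) (\<lambda>x. g x - f x)) +
        (L2_norm (\<lambda>x. (-1) * (f x - (K s ^^ i) f x)) + L2_norm (\<lambda>x. (-1) * (g x - f x)))"
      unfolding eq by (rule order_trans[OF L2_add(2)[OF m(1) L2_add(1)[OF m(2,3)]]]) (intro add_mono order_refl L2_add(2) m)
    then show ?thesis using n1 n2 n3 unfolding L2_norm_cmult by simp
  qed
  with \<delta> show ?thesis unfolding g_def by blast
qed

end

section \<open>The Feynman-Kac semigroup\<close>

lemma cadlag_bounded: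
  assumes p: "cadlag p" and "0 \<le> t"
  shows "\<exists>B. \<forall>r\<in>{0..t}. \<bar>p r\<bar> \<le> B"
proof -
  \<comment> \<open>A property of intervals for Bolzano's bisection principle: it is additive, and
    it holds near each point because of the one-sided limits. Restricting to nonnegative times
    replaces the left limit at 0, about which \<open>cadlag\<close> says nothing.\<close>
  define P where "P a b \<longleftrightarrow> (\<exists>B. \<forall>r\<in>{a..b}. 0 \<le> r \<longrightarrow> \<bar>p r\<bar> \<le> B)" for a b
  have "P 0 t"
    using \<open>0 \<le> t\<close>
  proof (induction rule: Bolzano)
    case (trans a b c)
    then obtain B1 B2 where "\<forall>r\<in>{a..b}. 0 \<le> r \<longrightarrow> \<bar>p r\<bar> \<le> B1" "\<forall>r\<in>{b..c}. 0 \<le> r \<longrightarrow> \<bar>p r\<bar> \<le> B2"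
      unfolding P_def by blast
    then have "\<forall>r\<in>{a..c}. 0 \<le> r \<longrightarrow> \<bar>p r\<bar> \<le> max B1 B2"
      by (metis atLeastAtMost_iff le_max_iff_disj linear)
    then show ?case unfolding P_def by blast
  next
    case (local x)
    have "\<forall>\<^sub>F r in at_right x. dist (p r) (p x) < 1"
      using p local by (intro tendstoD) (auto simp: cadlag_def)
    then obtain d1 where d1: "d1 > x" "\<And>r. x < r \<Longrightarrow> r < d1 \<Longrightarrow> \<bar>p r - p x\<bar> < 1"
      by (auto simp: eventually_at_right_field dist_real_def)
    have "\<exists>d2<x. \<exists>l. \<forall>r. d2 < r \<longrightarrow> r < x \<longrightarrow> 0 \<le> r \<longrightarrow> \<bar>p r - l\<bar> < 1"
    proof (cases "x = 0")
      case True
      then show ?thesis by (intro exI[of _ "-1"]) auto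
    next
      case False
      then obtain l where "(p \<longlongrightarrow> l) (at_left x)" using p local unfolding cadlag_def by (metis order_le_less)
      then have "\<forall>\<^sub>F r in at_left x. dist (p r) l < 1" by (rule tendstoD) simp
      then show ?thesis by (auto simp: eventually_at_left_field dist_real_def)
    qed
    then obtain d2 l where d2: "d2 < x" "\<And>r. d2 < r \<Longrightarrow> r < x \<Longrightarrow> 0 \<le> r \<Longrightarrow> \<bar>p r - l\<bar> < 1" by blast
    show ?case
    proof (intro exI conjI allI impI)
      show "0 < min (d1 - x) (x - d2)" using d1 d2 by simp
      fix a b assume ab: "a \<le> x \<and> x \<le> b \<and> b - a < min (d1 - x) (x - d2)"
      have "\<bar>p r\<bar> \<le> \<bar>p x\<bar> + \<bar>l\<bar> + 1" if "r \<in> {a..b}" "0 \<le> r" for r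
      proof (cases r x rule: linorder_cases)
        case less
        then have "\<bar>p r - l\<bar> < 1" using ab that by (intro d2(2)) auto
        then show ?thesis by linarith
      next
        case greater
        then have "\<bar>p r - p x\<bar> < 1" using ab that by (intro d1(2)) auto
        then show ?thesis by linarith
      qed auto
      then show "P a b" unfolding P_def by blast
    qed
  qed
  then show ?thesis unfolding P_def by auto
qed

text \<open>With right end points, the step functions evaluate \<open>g\<close> at points decreasing to \<open>r\<close>, so right continuity suffices.\<close>

lemma right_Riemann_sums_tendsto:
  fixes g :: "real \<Rightarrow> real"
  assumes t: "0 < t" and right: "\<And>r. 0 \<le> r \<Longrightarrow> (g \<longlongrightarrow> g r) (at_right r)" and B: "\<And>r. r \<in> {0..t} \<Longrightarrow> \<bar>g r\<bar> \<le> B"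
  shows "(\<lambda>n. t / real (Suc n) * (\<Sum>i<Suc n. g (real (Suc i) * (t / real (Suc n))))) \<longlonglongrightarrow> (LBINT r:{0..t}. g r)"
proof -
  define s where "s n = t / real (Suc n)" for n
  have s: "0 < s n" "real (Suc n) * s n = t" for n using t by (auto simp: s_def)
  define G where "G n r = (\<Sum>i<Suc n. indicator {real i * s n<..real (Suc i) * s n} r * g (real (Suc i) * s n))" for n r
  have loc: "\<exists>c. r \<le> c \<and> c < r + s n \<and> c \<le> t \<and> G n r = g c" if r: "0 < r" "r \<le> t" for n r
  proof -
    \<comment> \<open>The cell \<open>{j s<..(j + 1) s}\<close> that contains \<open>r\<close>; as
      \<open>r > 0\<close>, the ceiling is positive and the subtraction does not truncate.\<close>
    define j where "j = nat \<lceil>r / s n\<rceil> - 1"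
    have c1: "0 < \<lceil>r / s n\<rceil>" using r s(1)[of n] by simp
    have j: "real (Suc j) = of_int \<lceil>r / s n\<rceil>" unfolding j_def using c1 by auto
    have j1: "real j * s n < r" "r \<le> real (Suc j) * s n"
    proof -
      have "r / s n \<le> real (Suc j)" "real j < r / s n"
        using j by (auto simp: ceiling_correct) linarith+
      then show "real j * s n < r" "r \<le> real (Suc j) * s n" using s(1)[of n] by (auto simp: field_simps)
    qed
    have jn: "j < Suc n"
    proof (rule ccontr)
      assume "\<not> j < Suc n"
      then have "real (Suc n) * s n \<le> real j * s n" using s(1)[of n] by (intro mult_right_mono) auto
      then show False using s(2)[of n] j1 r by simp
    qed
    have ind: "indicator {real i * s n<..real (Suc i) * s n} r = (if i = j then 1 else 0 :: real)" for i
    proof (cases i j rule: linorder_cases)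
      case less
      then have "real (Suc i) * s n \<le> real j * s n" using s(1)[of n] by (intro mult_right_mono) auto
      then show ?thesis using less j1 by auto
    next
      case greater
      then have "real (Suc j) * s n \<le> real i * s n" using s(1)[of n] by (intro mult_right_mono) auto
      then show ?thesis using greater j1 by auto
    qed (use j1 in auto)
    have "G n r = (\<Sum>i<Suc n. if i = j then g (real (Suc i) * s n) else 0)"
      unfolding G_def ind by (intro sum.cong) auto
    also have "\<dots> = g (real (Suc j) * s n)" using jn by (subst sum.delta) auto
    finally have "G n r = g (real (Suc j) * s n)" .
    moreover have "real (Suc j) * s n \<le> t"
      unfolding s(2)[of n, symmetric] using jn s(1)[of n] by (intro mult_right_mono) auto
    moreover have "real (Suc j) * s n = real j * s n + s n" by (simp add: algebra_simps)
    ultimately show ?thesis using j1 by (intro exI[of _ "real (Suc j) * s n"]) (simp del: of_nat_Suc)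
  qed
  have out: "G n r = 0" if "\<not> (0 < r \<and> r \<le> t)" for n r
  proof -
    have "r \<notin> {real i * s n<..real (Suc i) * s n}" if "i < Suc n" for i
    proof
      assume m: "r \<in> {real i * s n<..real (Suc i) * s n}"
      have "0 \<le> real i * s n" using s(1)[of n] by simp
      moreover have "real (Suc i) * s n \<le> real (Suc n) * s n" using that s(1)[of n] by (intro mult_right_mono) auto
      ultimately show False using m s(2)[of n] \<open>\<not> (0 < r \<and> r \<le> t)\<close> by auto
    qed
    then show ?thesis unfolding G_def by (intro sum.neutral) auto
  qed
  have ssum: "s \<longlonglongrightarrow> 0" unfolding s_def by real_asymp
  have lim: "(\<lambda>n. G n r) \<longlonglongrightarrow> indicator {0<..t} r * g r" for r
  proof (cases "0 < r \<and> r \<le> t")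
    case True
    then have "\<forall>n. \<exists>c. r \<le> c \<and> c < r + s n \<and> c \<le> t \<and> G n r = g c" using loc by blast
    then obtain c where c: "\<And>n. r \<le> c n" "\<And>n. c n < r + s n" "\<And>n. G n r = g (c n)" by metis
    have "c \<longlonglongrightarrow> r"
    proof (rule tendsto_sandwich[of "\<lambda>_. r" _ _ "\<lambda>n. r + s n"])
      show "(\<lambda>n. r + s n) \<longlonglongrightarrow> r" using tendsto_add[OF tendsto_const ssum, of r] by simp
    qed (use c in \<open>auto intro!: always_eventually less_imp_le\<close>)
    moreover have "continuous (at r within {r..}) g"
      unfolding continuous_within at_within_Ici_at_right using right True by auto
    ultimately have "(\<lambda>n. g (c n)) \<longlonglongrightarrow> g r"
      unfolding continuous_within_sequentially using c(1) by (auto simp: comp_def)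
    then show ?thesis using True by (simp add: c(3))
  next
    case False
    then show ?thesis by (auto simp: out indicator_def)
  qed
  have bd: "\<bar>G n r\<bar> \<le> B * indicator {0..t} r" for n r
  proof (cases "0 < r \<and> r \<le> t")
    case True
    then obtain c where "r \<le> c" "c \<le> t" "G n r = g c" using loc by blast
    then show ?thesis using B[of c] True by auto
  next
    case False
    have "0 \<le> B" using B[of 0] t by auto
    then show ?thesis by (simp add: out[OF False])
  qed
  have Gm [measurable]: "G n \<in> borel_measurable borel" for n unfolding G_def by measurable
  have "(\<lambda>n. LBINT r. G n r) \<longlonglongrightarrow> (LBINT r. indicator {0<..t} r * g r)"
  proof (rule integral_dominated_convergence)
    show "(\<lambda>r. indicator {0<..t} r * g r) \<in> borel_measurable lborel"
      by (rule borel_measurable_LIMSEQ_real[OF lim]) simp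
    show "integrable lborel (\<lambda>r. B * indicator {0..t} r)"
      using t by (intro integrable_mult_right integrable_real_indicator) auto
  qed (use lim bd in auto)
  \<comment> \<open>The cells cover the interval up to its left end point, a null set.\<close>
  also have "(LBINT r. indicator {0<..t} r * g r) = (LBINT r:{0..t}. g r)"
    unfolding set_lebesgue_integral_def
  proof (rule integral_cong_AE)
    have m: "(\<lambda>r. indicator {0<..t} r * g r) \<in> borel_measurable lborel"
      by (rule borel_measurable_LIMSEQ_real[OF lim]) simp
    then show "(\<lambda>r. indicator {0<..t} r * g r) \<in> borel_measurable lborel" .
    have "(\<lambda>r. indicator {0..t} r *\<^sub>R g r) = (\<lambda>r. indicator {0<..t} r * g r + indicator {0} r * g 0)"
      using t by (auto simp: fun_eq_iff indicator_def)
    then show "(\<lambda>r. indicator {0..t} r *\<^sub>R g r) \<in> borel_measurable lborel" using m by simp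
    show "AE r in lborel. indicator {0<..t} r * g r = indicator {0..t} r *\<^sub>R g r"
      using AE_lborel_singleton[of 0] by eventually_elim (auto simp: indicator_def)
  qed
  also have "(\<lambda>n. LBINT r. G n r) = (\<lambda>n. s n * (\<Sum>i<Suc n. g (real (Suc i) * s n)))"
  proof (rule ext)
    fix n
    have "(LBINT r. G n r) = (\<Sum>i<Suc n. (LBINT r. indicator {real i * s n<..real (Suc i) * s n} r * g (real (Suc i) * s n)))"
      unfolding G_def using s(1)[of n]
      by (intro Bochner_Integration.integral_sum integrable_mult_left integrable_real_indicator) auto
    also have "\<dots> = (\<Sum>i<Suc n. s n * g (real (Suc i) * s n))"
      using s(1)[of n] by (intro sum.cong) (auto simp: algebra_simps)
    finally show "(LBINT r. G n r) = s n * (\<Sum>i<Suc n. g (real (Suc i) * s n))" by (simp only: sum_distrib_left)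
  qed
  finally show ?thesis unfolding s_def .
qed

text \<open>Fubini's theorem for a product law. The map \<open>e\<close> extracts a real value from
  \<open>C\<close>, because independence will be applied to families of increments indexed by
  \<open>{..<n}\<close> and \<open>{n}\<close>, where the last increment is an element of a product
  space.\<close>

lemma (in prob_space) expectation_indep_pair:
  fixes h :: "'b \<times> real \<Rightarrow> complex"
  assumes ind: "indep_var N A N' C" and e [measurable]: "e \<in> borel_measurable N'"
    and h [measurable]: "h \<in> borel_measurable (N \<Otimes>\<^sub>M (borel :: real measure))" and b: "\<And>z. cmod (h z) \<le> B"
  shows "expectation (\<lambda>\<omega>. h (A \<omega>, e (C \<omega>))) = expectation (\<lambda>\<omega>. LINT z|distr M borel (\<lambda>\<omega>. e (C \<omega>)). h (A \<omega>, z))"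
proof -
  have [measurable]: "A \<in> measurable M N" "C \<in> measurable M N'"
    and eq: "distr M N A \<Otimes>\<^sub>M distr M N' C = distr M (N \<Otimes>\<^sub>M N') (\<lambda>\<omega>. (A \<omega>, C \<omega>))"
    using ind by (auto simp: indep_var_distribution_eq)
  interpret A: prob_space "distr M N A" by (rule prob_space_distr) simp
  interpret C: prob_space "distr M N' C" by (rule prob_space_distr) simp
  interpret P: pair_prob_space "distr M N A" "distr M N' C" by standard
  interpret Z: prob_space "distr M borel (\<lambda>\<omega>. e (C \<omega>))" by (rule prob_space_distr) simp
  have hm: "(\<lambda>z. h (fst z, e (snd z))) \<in> borel_measurable (N \<Otimes>\<^sub>M N')" by measurable
  have hi: "integrable (distr M N A \<Otimes>\<^sub>M distr M N' C) (\<lambda>z. h (fst z, e (snd z)))"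
    by (rule P.integrable_const_bound[of _ B])
       (use b hm in \<open>auto simp: measurable_cong_sets[OF sets_pair_measure_cong[OF sets_distr sets_distr] refl]\<close>)
  have hz: "(\<lambda>a. LINT z|distr M borel (\<lambda>\<omega>. e (C \<omega>)). h (a, z)) \<in> borel_measurable N"
    by (rule Z.borel_measurable_lebesgue_integral) simp
  have "expectation (\<lambda>\<omega>. h (A \<omega>, e (C \<omega>))) = (LINT z|(distr M N A \<Otimes>\<^sub>M distr M N' C). h (fst z, e (snd z)))"
    unfolding eq by (subst integral_distr) auto
  also have "\<dots> = (LINT a|distr M N A. LINT c|distr M N' C. h (fst (a, c), e (snd (a, c))))"
    by (rule P.integral_fst'[OF hi, symmetric])
  also have "\<dots> = (LINT a|distr M N A. LINT z|distr M borel (\<lambda>\<omega>. e (C \<omega>)). h (a, z))"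
  proof (rule Bochner_Integration.integral_cong[OF refl])
    fix a assume "a \<in> space (distr M N A)"
    then have [measurable]: "(\<lambda>z. h (a, z)) \<in> borel_measurable borel" by simp
    show "(LINT c|distr M N' C. h (fst (a, c), e (snd (a, c)))) = (LINT z|distr M borel (\<lambda>\<omega>. e (C \<omega>)). h (a, z))"
      by (simp add: integral_distr)
  qed
  also have "\<dots> = expectation (\<lambda>\<omega>. LINT z|distr M borel (\<lambda>\<omega>. e (C \<omega>)). h (A \<omega>, z))"
    using hz by (subst integral_distr) auto
  finally show ?thesis .
qed

section \<open>Powers of the one-step operator as expectations over the process\<close>

locale cauchy =
  fixes M :: "'a measure" and X :: "real \<Rightarrow> 'a \<Rightarrow> real"
  assumes cauchy_process: "cauchy_process M X"
begin

lemma levy: "levy_process M X"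
  using cauchy_process by (simp add: cauchy_process_def)

sublocale prob_space M
  using levy by (simp add: levy_process_def)

lemma X_measurable [measurable]: "0 \<le> t \<Longrightarrow> X t \<in> borel_measurable M"
  using levy by (simp add: levy_process_def)

lemma X_0: "AE \<omega> in M. X 0 \<omega> = 0"
  using levy by (simp add: levy_process_def)

lemma X_cadlag: "\<omega> \<in> space M \<Longrightarrow> cadlag (\<lambda>t. X t \<omega>)"
  using levy by (simp add: levy_process_def)

lemma X_increment:
  "0 \<le> s \<Longrightarrow> s \<le> t \<Longrightarrow> distr M borel (\<lambda>\<omega>. X t \<omega> - X s \<omega>) = distr M borel (X (t - s))"
  using levy by (simp add: levy_process_def)

lemma X_indep:
  fixes \<tau> :: "nat \<Rightarrow> real"
  shows "0 \<le> \<tau> 0 \<Longrightarrow> (\<And>i. i < n \<Longrightarrow> \<tau> i \<le> \<tau> (Suc i)) \<Longrightarrow>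
   indep_vars (\<lambda>_. borel) (\<lambda>i \<omega>. X (\<tau> (Suc i)) \<omega> - X (\<tau> i) \<omega>) {..<n}"
  using levy by (simp add: levy_process_def)

definition law :: "real \<Rightarrow> real measure" where
  "law s = distr M borel (X s)"

lemma law_distribution: "0 \<le> s \<Longrightarrow> real_distribution (law s)"
  unfolding law_def by (rule real_distribution_distr) simp

lemma char_law: "0 \<le> s \<Longrightarrow> char (law s) k = complex_of_real (exp (- s * \<bar>k\<bar>))"
  using cauchy_process by (simp add: cauchy_process_def law_def)

sublocale cauchy_kernels law
  by (rule cauchy_kernels.intro[OF law_distribution char_law])

text \<open>The exponent collected by \<open>n\<close> steps: each step contributes half a weight at
  either end, so inner nodes count fully and the two outer ones by half. Grouping by steps lets the
  induction append one summand.\<close>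

definition trapezoid :: "real \<Rightarrow> nat \<Rightarrow> real \<Rightarrow> 'a \<Rightarrow> real" where
  "trapezoid s n x \<omega> = (\<Sum>i<n. s * (x + X (real i * s) \<omega>)\<^sup>2 / 2 + s * (x + X (real (Suc i) * s) \<omega>)\<^sup>2 / 2)"

lemma trapezoid_nonneg: "0 \<le> s \<Longrightarrow> 0 \<le> trapezoid s n x \<omega>"
  unfolding trapezoid_def by (intro sum_nonneg) auto

lemma trapezoid_measurable [measurable]:
  assumes [measurable]: "a \<in> borel_measurable N" "w \<in> measurable N M" and s: "0 \<le> s"
  shows "(\<lambda>z. trapezoid s n (a z) (w z)) \<in> borel_measurable N"
proof -
  have [measurable]: "(\<lambda>z. X (real i * s) (w z)) \<in> borel_measurable N" for i
    by (rule measurable_compose[OF assms(2) X_measurable]) (use s in auto)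
  have [measurable]: "(\<lambda>z. X (real (Suc i) * s) (w z)) \<in> borel_measurable N" for i
    by (rule measurable_compose[OF assms(2) X_measurable]) (use s in auto)
  show ?thesis unfolding trapezoid_def by measurable
qed

text \<open>Induction with the new factor applied to \<open>f\<close> first: \<open>K s f\<close> is
  an average over the last increment, which is independent of the earlier ones. These determine the
  path up to time \<open>n s\<close> almost surely, as \<open>X 0 = 0\<close> holds almost
  surely.\<close>

lemma Kpow_expectation:
  assumes s: "0 \<le> s" and f: "f \<in> borel_measurable borel" "\<And>x. cmod (f x) \<le> B"
  shows "(K s ^^ n) f x = expectation (\<lambda>\<omega>. complex_of_real (exp (- trapezoid s n x \<omega>)) * f (x + X (real n * s) \<omega>))"
  using f
proof (induction n arbitrary: f)
  case 0
  have "expectation (\<lambda>\<omega>. complex_of_real (exp (- trapezoid s 0 x \<omega>)) * f (x + X (real 0 * s) \<omega>)) = expectation (\<lambda>\<omega>. f x)"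
  proof (rule integral_cong_AE)
    note [measurable] = 0(1)
    show "(\<lambda>\<omega>. complex_of_real (exp (- trapezoid s 0 x \<omega>)) * f (x + X (real 0 * s) \<omega>)) \<in> borel_measurable M"
      using s by measurable
    show "AE \<omega> in M. complex_of_real (exp (- trapezoid s 0 x \<omega>)) * f (x + X (real 0 * s) \<omega>) = f x"
      using X_0 by eventually_elim (simp add: trapezoid_def)
  qed simp
  then show ?case by (simp add: prob_space)
next
  case (Suc n)
  note [measurable] = Suc.prems(1)
  interpret L: real_distribution "law s" by (rule distribution[OF s])
  define w where "w = weight s"
  have w: "0 \<le> w y" "w y \<le> 1" for y unfolding w_def using weight_bounds s by auto
  have wm [measurable]: "w \<in> borel_measurable borel" by (simp add: w_def)
  have wf: "cmod (complex_of_real (w y) * f y) \<le> B" for y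
    using w[of y] Suc.prems(2)[of y] by (simp add: norm_mult) (meson mult_left_le_one_le norm_ge_zero order_trans)
  have Kf: "K s f y = (LINT z|law s. complex_of_real (w y) * (complex_of_real (w (y + z)) * f (y + z)))" for y
    by (simp add: K_def translate_avg_def w_def)
  have Kfb: "cmod (K s f y) \<le> B" for y
  proof -
    have "cmod (K s f y) = w y * cmod (translate_avg (law s) (\<lambda>y. complex_of_real (w y) * f y) y)"
      using w by (simp add: K_def norm_mult w_def)
    also have "\<dots> \<le> 1 * B"
      using w wf by (intro mult_mono L.translate_avg_bounded) (auto intro: order_trans[OF norm_ge_zero])
    finally show ?thesis by simp
  qed
  have Kfm [measurable]: "K s f \<in> borel_measurable borel"
    unfolding K_def[abs_def] by measurable
  define \<tau> where "\<tau> i = real i * s" for i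
  define Z where "Z i \<omega> = X (\<tau> (Suc i)) \<omega> - X (\<tau> i) \<omega>" for i \<omega>
  have \<tau>: "0 \<le> \<tau> i" "\<tau> i \<le> \<tau> (Suc i)" for i using s by (auto simp: \<tau>_def algebra_simps)
  have Zind: "indep_vars (\<lambda>_. borel) Z {..<Suc n}"
    unfolding Z_def using X_indep[of \<tau> "Suc n"] \<tau> by auto
  have Zdist: "distr M borel (Z n) = law s"
    using X_increment[of "\<tau> n" "\<tau> (Suc n)"] \<tau> by (simp add: Z_def[abs_def] law_def \<tau>_def algebra_simps)
  have ind: "indep_var (PiM {..<n} (\<lambda>_. borel)) (\<lambda>\<omega>. \<lambda>i\<in>{..<n}. Z i \<omega>) (PiM {n} (\<lambda>_. borel)) (\<lambda>\<omega>. \<lambda>i\<in>{n}. Z i \<omega>)"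
    by (rule indep_var_restrict[OF Zind]) auto
  have proj: "(\<lambda>a :: nat \<Rightarrow> real. a n) \<in> borel_measurable (PiM {n} (\<lambda>_. borel))" by simp
  \<comment> \<open>Partial sums recover the positions \<open>X (i s)\<close> from the increments,
    so the exponent becomes a function \<open>R\<close> of the first \<open>n\<close>
    increments.\<close>
  define S :: "nat \<Rightarrow> (nat \<Rightarrow> real) \<Rightarrow> real" where "S i a = (\<Sum>j<i. a j)" for i a
  have Sm [measurable]: "(\<lambda>a. S i a) \<in> borel_measurable (PiM {..<n} (\<lambda>_. borel))" if "i \<le> n" for i
    unfolding S_def by (rule borel_measurable_sum) (use that in auto)
  define R where "R a = (\<Sum>i<n. s * (x + S i a)\<^sup>2 / 2 + s * (x + S (Suc i) a)\<^sup>2 / 2)" for a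
  have Rm [measurable]: "R \<in> borel_measurable (PiM {..<n} (\<lambda>_. borel))"
    unfolding R_def
  proof (rule borel_measurable_sum)
    fix i assume "i \<in> {..<n}"
    then have "i \<le> n" "Suc i \<le> n" by auto
    note [measurable] = Sm[OF this(1)] Sm[OF this(2)]
    show "(\<lambda>a. s * (x + S i a)\<^sup>2 / 2 + s * (x + S (Suc i) a)\<^sup>2 / 2) \<in> borel_measurable (PiM {..<n} (\<lambda>_. borel))"
      by measurable
  qed
  have R0: "0 \<le> R a" for a unfolding R_def using s by (intro sum_nonneg) auto
  have SX: "S i (\<lambda>i\<in>{..<n}. Z i \<omega>) = X (real i * s) \<omega>" if "i \<le> n" "X 0 \<omega> = 0" for i \<omega>
  proof -
    have "S i (\<lambda>i\<in>{..<n}. Z i \<omega>) = (\<Sum>j<i. X (\<tau> (Suc j)) \<omega> - X (\<tau> j) \<omega>)"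
      unfolding S_def using that by (intro sum.cong) (auto simp: Z_def)
    also have "\<dots> = X (\<tau> i) \<omega> - X (\<tau> 0) \<omega>" by (rule sum_lessThan_telescope)
    finally show ?thesis using that by (simp add: \<tau>_def)
  qed
  have RX: "R (\<lambda>i\<in>{..<n}. Z i \<omega>) = trapezoid s n x \<omega>" if "X 0 \<omega> = 0" for \<omega>
    unfolding R_def trapezoid_def using that by (intro sum.cong) (auto simp: SX simp del: of_nat_Suc)
  define h where "h z = complex_of_real (exp (- R (fst z))) *
      (complex_of_real (w (x + S n (fst z))) * (complex_of_real (w (x + S n (fst z) + snd z)) * f (x + S n (fst z) + snd z)))" for z
  have Smn [measurable]: "(\<lambda>a. S n a) \<in> borel_measurable (PiM {..<n} (\<lambda>_. borel))" by (rule Sm) simp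
  have hm: "h \<in> borel_measurable (PiM {..<n} (\<lambda>_. borel) \<Otimes>\<^sub>M borel)"
    unfolding h_def by measurable
  have hb: "cmod (h z) \<le> B" for z
  proof -
    have "cmod (h z) = exp (- R (fst z)) * (w (x + S n (fst z)) * cmod (complex_of_real (w (x + S n (fst z) + snd z)) * f (x + S n (fst z) + snd z)))"
      using w by (simp add: h_def norm_mult)
    also have "\<dots> \<le> 1 * (1 * B)"
      using R0[of "fst z"] w wf by (intro mult_mono) (auto intro: order_trans[OF norm_ge_zero])
    finally show ?thesis by simp
  qed
  have Zm: "(\<lambda>\<omega>. \<lambda>i\<in>{..<n}. Z i \<omega>) \<in> measurable M (PiM {..<n} (\<lambda>_. borel))" "Z n \<in> borel_measurable M"
    using ind Zind by (auto simp: indep_var_distribution_eq indep_vars_def)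
  have ns: "0 \<le> real n * s" "0 \<le> real (Suc n) * s" using s by auto
  have "(K s ^^ Suc n) f x = (K s ^^ n) (K s f) x" by (simp add: funpow_swap1)
  also have "\<dots> = expectation (\<lambda>\<omega>. complex_of_real (exp (- trapezoid s n x \<omega>)) * K s f (x + X (real n * s) \<omega>))"
    by (rule Suc.IH[OF Kfm Kfb])
  also have "\<dots> = expectation (\<lambda>\<omega>. LINT z|distr M borel (Z n). h (\<lambda>i\<in>{..<n}. Z i \<omega>, z))"
  proof (rule integral_cong_AE)
    note [measurable] = X_measurable[OF ns(1)]
    show "(\<lambda>\<omega>. complex_of_real (exp (- trapezoid s n x \<omega>)) * K s f (x + X (real n * s) \<omega>)) \<in> borel_measurable M"
      using s by measurable
    show "(\<lambda>\<omega>. LINT z|distr M borel (Z n). h (\<lambda>i\<in>{..<n}. Z i \<omega>, z)) \<in> borel_measurable M"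
      unfolding Zdist
      by (rule L.borel_measurable_lebesgue_integral) (use Zm hm in measurable)
    show "AE \<omega> in M. complex_of_real (exp (- trapezoid s n x \<omega>)) * K s f (x + X (real n * s) \<omega>) =
        (LINT z|distr M borel (Z n). h (\<lambda>i\<in>{..<n}. Z i \<omega>, z))"
      using X_0
    proof eventually_elim
      case (elim \<omega>)
      show ?case by (simp add: Zdist h_def RX[OF elim] SX[OF order_refl elim] Kf)
    qed
  qed
  also have "\<dots> = expectation (\<lambda>\<omega>. h (\<lambda>i\<in>{..<n}. Z i \<omega>, Z n \<omega>))"
    using expectation_indep_pair[OF ind proj hm hb] by simp
  also have "\<dots> = expectation (\<lambda>\<omega>. complex_of_real (exp (- trapezoid s (Suc n) x \<omega>)) * f (x + X (real (Suc n) * s) \<omega>))"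
  proof (rule integral_cong_AE)
    note [measurable] = X_measurable[OF ns(2)]
    show "(\<lambda>\<omega>. complex_of_real (exp (- trapezoid s (Suc n) x \<omega>)) * f (x + X (real (Suc n) * s) \<omega>)) \<in> borel_measurable M"
      using s by measurable
    show "(\<lambda>\<omega>. h (\<lambda>i\<in>{..<n}. Z i \<omega>, Z n \<omega>)) \<in> borel_measurable M"
      using Zm hm by measurable
    show "AE \<omega> in M. h (\<lambda>i\<in>{..<n}. Z i \<omega>, Z n \<omega>) = complex_of_real (exp (- trapezoid s (Suc n) x \<omega>)) * f (x + X (real (Suc n) * s) \<omega>)"
      using X_0
    proof eventually_elim
      case (elim \<omega>)
      have e: "x + X (real n * s) \<omega> + Z n \<omega> = x + X (real (Suc n) * s) \<omega>" by (simp add: Z_def \<tau>_def)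
      have t: "trapezoid s (Suc n) x \<omega> = trapezoid s n x \<omega> +
          (s * (x + X (real n * s) \<omega>)\<^sup>2 / 2 + s * (x + X (real (Suc n) * s) \<omega>)\<^sup>2 / 2)"
        by (simp add: trapezoid_def)
      have t': "exp (- trapezoid s (Suc n) x \<omega>) = exp (- trapezoid s n x \<omega>) *
          (w (x + X (real n * s) \<omega>) * w (x + X (real (Suc n) * s) \<omega>))"
        by (simp only: t w_def weight_def exp_add[symmetric]) simp
      show ?case
        by (simp only: h_def fst_conv snd_conv RX[OF elim] SX[OF order_refl elim] e t' of_real_mult mult.assoc)
    qed
  qed
  finally show ?case .
qed

text \<open>Along a single path the trapezoidal sum is the right Riemann sum plus
  \<open>s * (g 0 - g t) / 2\<close>, by telescoping, and this correction vanishes with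
  \<open>s\<close>.\<close>

lemma trapezoid_tendsto:
  assumes \<omega>: "\<omega> \<in> space M" and t: "0 < t"
  shows "(\<lambda>n. trapezoid (t / real (Suc n)) (Suc n) x \<omega>) \<longlonglongrightarrow> (LBINT s:{0..t}. (x + X s \<omega>)\<^sup>2)"
proof -
  define g where "g r = (x + X r \<omega>)\<^sup>2" for r
  define s where "s n = t / real (Suc n)" for n
  have sn: "real (Suc n) * s n = t" for n by (simp add: s_def)
  have p: "cadlag (\<lambda>r. X r \<omega>)" by (rule X_cadlag[OF \<omega>])
  obtain B where B: "\<forall>r\<in>{0..t}. \<bar>X r \<omega>\<bar> \<le> B" using cadlag_bounded[OF p, of t] t by auto
  have right: "(\<lambda>n. s n * (\<Sum>i<Suc n. g (real (Suc i) * s n))) \<longlonglongrightarrow> (LBINT r:{0..t}. g r)"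
    unfolding s_def
  proof (rule right_Riemann_sums_tendsto[OF t])
    show "(g \<longlongrightarrow> g r) (at_right r)" if "0 \<le> r" for r
      unfolding g_def using p that by (intro tendsto_intros) (auto simp: cadlag_def)
    show "\<bar>g r\<bar> \<le> (\<bar>x\<bar> + B)\<^sup>2" if "r \<in> {0..t}" for r
    proof -
      have "\<bar>x + X r \<omega>\<bar> \<le> \<bar>x\<bar> + B" using bspec[OF B that] by linarith
      then have "\<bar>x + X r \<omega>\<bar>\<^sup>2 \<le> (\<bar>x\<bar> + B)\<^sup>2" by (rule power_mono) simp
      then show ?thesis by (simp add: g_def)
    qed
  qed
  have "s \<longlonglongrightarrow> 0" unfolding s_def by real_asymp
  from tendsto_mult_left_zero[OF this] have corr: "(\<lambda>n. s n * ((g 0 - g t) / 2)) \<longlonglongrightarrow> 0" .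
  have "trapezoid (s n) (Suc n) x \<omega> = s n * (\<Sum>i<Suc n. g (real (Suc i) * s n)) + s n * ((g 0 - g t) / 2)" for n
  proof -
    have tel: "(\<Sum>i<Suc n. g (real i * s n) - g (real (Suc i) * s n)) = g 0 - g t"
      using sum_lessThan_telescope'[of "\<lambda>i. g (real i * s n)" "Suc n"] sn[of n] by simp
    have "trapezoid (s n) (Suc n) x \<omega> = (\<Sum>i<Suc n. s n * g (real (Suc i) * s n) + s n / 2 * (g (real i * s n) - g (real (Suc i) * s n)))"
      unfolding trapezoid_def g_def by (intro sum.cong) (auto simp: field_simps)
    also have "\<dots> = s n * (\<Sum>i<Suc n. g (real (Suc i) * s n)) + s n / 2 * (\<Sum>i<Suc n. g (real i * s n) - g (real (Suc i) * s n))"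
      by (simp only: sum.distrib sum_distrib_left)
    finally show ?thesis unfolding tel by simp
  qed
  then show ?thesis using tendsto_add[OF right corr] by (simp add: s_def g_def)
qed

text \<open>The trapezoidal sums involve finitely many values of the process and converge at every
  point of \<open>space M\<close>, all paths being cadlag; so the path integral inherits
  measurability jointly in the starting point and \<open>\<omega>\<close>.\<close>

lemma FK_weight_measurable:
  assumes [measurable]: "a \<in> borel_measurable N" "w \<in> measurable N M" and t: "0 < t"
  shows "(\<lambda>z. LBINT s:{0..t}. (a z + X s (w z))\<^sup>2) \<in> borel_measurable N"
proof (rule borel_measurable_LIMSEQ_real)
  show "(\<lambda>n. trapezoid (t / real (Suc n)) (Suc n) (a z) (w z)) \<longlonglongrightarrow> (LBINT s:{0..t}. (a z + X s (w z))\<^sup>2)"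
    if "z \<in> space N" for z
    using measurable_space[OF assms(2) that] t by (rule trapezoid_tendsto)
  show "(\<lambda>z. trapezoid (t / real (Suc n)) (Suc n) (a z) (w z)) \<in> borel_measurable N" for n
    using t by (intro trapezoid_measurable) auto
qed

lemma FK_weight_nonneg: "0 \<le> (LBINT s:{0..t}. (x + X s \<omega>)\<^sup>2)"
  unfolding set_lebesgue_integral_def by (intro integral_nonneg_AE) auto

section \<open>The semigroup on square integrable functions\<close>

abbreviation FK :: "real \<Rightarrow> (real \<Rightarrow> complex) \<Rightarrow> real \<Rightarrow> complex" where
  "FK \<equiv> feynman_kac M X"

lemma FK_integrand_measurable:
  assumes [measurable]: "f \<in> borel_measurable borel" and t: "0 < t"
  shows "(\<lambda>z. complex_of_real (exp (- (LBINT s:{0..t}. (fst z + X s (snd z))\<^sup>2))) * f (fst z + X t (snd z)))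
    \<in> borel_measurable (borel \<Otimes>\<^sub>M M)"
proof -
  have [measurable]: "X t \<in> borel_measurable M" using t by simp
  have [measurable]: "(\<lambda>z. LBINT s:{0..t}. (fst z + X s (snd z))\<^sup>2) \<in> borel_measurable (borel \<Otimes>\<^sub>M M)"
    by (rule FK_weight_measurable) (use t in auto)
  show ?thesis by measurable
qed

lemma FK_integrand_measurable_Pair2:
  assumes "f \<in> borel_measurable borel" and "0 < t"
  shows "(\<lambda>\<omega>. complex_of_real (exp (- (LBINT s:{0..t}. (x + X s \<omega>)\<^sup>2))) * f (x + X t \<omega>)) \<in> borel_measurable M"
  using measurable_compose[OF measurable_Pair1'[of x borel M] FK_integrand_measurable[OF assms]] by simp

lemma FK_measurable:
  assumes "f \<in> borel_measurable borel" and "0 < t"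
  shows "FK t f \<in> borel_measurable borel"
  unfolding feynman_kac_def[abs_def]
  by (rule borel_measurable_lebesgue_integral) (use FK_integrand_measurable[OF assms] in \<open>simp add: case_prod_unfold\<close>)

lemma FK_integrand_le:
  "cmod (complex_of_real (exp (- (LBINT s:{0..t}. (x + X s \<omega>)\<^sup>2))) * f (x + X t \<omega>)) \<le> cmod (f (x + X t \<omega>))"
  using FK_weight_nonneg[of t x \<omega>] by (simp add: norm_mult mult_left_le_one_le)

text \<open>The Trotter product formula at a single point: on every path the exponents converge, and
  as they are nonpositive, the bound on \<open>f\<close> is a majorant.\<close>

lemma Kpow_tendsto_FK:
  assumes f [measurable]: "f \<in> borel_measurable borel" and B: "\<And>x. cmod (f x) \<le> B" and t: "0 < t"
  shows "(\<lambda>n. (K (t / real (Suc n)) ^^ Suc n) f x) \<longlonglongrightarrow> FK t f x"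
proof -
  have Kn: "(K (t / real (Suc n)) ^^ Suc n) f x =
      expectation (\<lambda>\<omega>. complex_of_real (exp (- trapezoid (t / real (Suc n)) (Suc n) x \<omega>)) * f (x + X t \<omega>))" for n
    using Kpow_expectation[of "t / real (Suc n)" f B "Suc n" x] f B t by simp
  have [measurable]: "X t \<in> borel_measurable M" using t by simp
  have tm [measurable]: "(\<lambda>\<omega>. trapezoid (t / real (Suc n)) (Suc n) x \<omega>) \<in> borel_measurable M" for n
    using t by (intro trapezoid_measurable) auto
  show ?thesis
    unfolding Kn feynman_kac_def
  proof (rule integral_dominated_convergence)
    show "integrable M (\<lambda>\<omega>. B)" by simp
    show "(\<lambda>\<omega>. complex_of_real (exp (- (LBINT s:{0..t}. (x + X s \<omega>)\<^sup>2))) * f (x + X t \<omega>)) \<in> borel_measurable M"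
      by (rule FK_integrand_measurable_Pair2[OF f t])
    show "AE \<omega> in M. (\<lambda>n. complex_of_real (exp (- trapezoid (t / real (Suc n)) (Suc n) x \<omega>)) * f (x + X t \<omega>)) \<longlonglongrightarrow>
        complex_of_real (exp (- (LBINT s:{0..t}. (x + X s \<omega>)\<^sup>2))) * f (x + X t \<omega>)"
      by (rule AE_I2) (intro tendsto_intros trapezoid_tendsto t)
    show "AE \<omega> in M. cmod (complex_of_real (exp (- trapezoid (t / real (Suc n)) (Suc n) x \<omega>)) * f (x + X t \<omega>)) \<le> B" for n
    proof (rule AE_I2)
      fix \<omega>
      have "0 \<le> trapezoid (t / real (Suc n)) (Suc n) x \<omega>" using t by (intro trapezoid_nonneg) simp
      then have "cmod (complex_of_real (exp (- trapezoid (t / real (Suc n)) (Suc n) x \<omega>)) * f (x + X t \<omega>)) \<le> cmod (f (x + X t \<omega>))"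
        by (simp only: norm_mult norm_of_real) (simp add: mult_left_le_one_le)
      then show "cmod (complex_of_real (exp (- trapezoid (t / real (Suc n)) (Suc n) x \<omega>)) * f (x + X t \<omega>)) \<le> B"
        using B order_trans by blast
    qed
  qed measurable
qed

lemma FK_L2:
  assumes f: "f \<in> L2" and t: "0 < t"
  shows "FK t f \<in> L2" "L2_norm (FK t f) \<le> L2_norm f"
proof -
  interpret L: real_distribution "law t" using t by (intro distribution) simp
  have [measurable]: "X t \<in> borel_measurable M" using t by simp
  note [measurable] = L2D(1)[OF f]
  have "ennreal ((cmod (FK t f x))\<^sup>2) \<le> (\<integral>\<^sup>+y. ennreal ((cmod (f (x + y)))\<^sup>2) \<partial>law t)" for x
  proof -
    define F where "F \<omega> = complex_of_real (exp (- (LBINT s:{0..t}. (x + X s \<omega>)\<^sup>2))) * f (x + X t \<omega>)" for \<omega>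
    have [measurable]: "F \<in> borel_measurable M"
      unfolding F_def by (rule FK_integrand_measurable_Pair2[OF _ t]) simp
    have "ennreal (cmod (FK t f x)) \<le> (\<integral>\<^sup>+\<omega>. ennreal (cmod (F \<omega>)) \<partial>M)"
      unfolding feynman_kac_def F_def[symmetric]
      by (cases "integrable M F") (auto intro: integral_norm_bound_ennreal simp: not_integrable_integral_eq)
    also have "\<dots> \<le> (\<integral>\<^sup>+\<omega>. ennreal (cmod (f (x + X t \<omega>))) * 1 \<partial>M)"
      unfolding F_def by (intro nn_integral_mono) (simp add: FK_integrand_le)
    finally have "(ennreal (cmod (FK t f x)))\<^sup>2 \<le> (\<integral>\<^sup>+\<omega>. ennreal (cmod (f (x + X t \<omega>))) * 1 \<partial>M)\<^sup>2"
      by (intro power_mono) auto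
    also have "\<dots> \<le> (\<integral>\<^sup>+\<omega>. (ennreal (cmod (f (x + X t \<omega>))))\<^sup>2 \<partial>M) * (\<integral>\<^sup>+\<omega>. 1\<^sup>2 \<partial>M)"
      by (rule Cauchy_Schwarz_nn_integral) auto
    also have "\<dots> = (\<integral>\<^sup>+\<omega>. ennreal ((cmod (f (x + X t \<omega>)))\<^sup>2) \<partial>M)" by (simp add: ennreal_power emeasure_space_1)
    also have "\<dots> = (\<integral>\<^sup>+y. ennreal ((cmod (f (x + y)))\<^sup>2) \<partial>law t)"
      unfolding law_def by (subst nn_integral_distr) auto
    finally show ?thesis by (simp add: ennreal_power)
  qed
  then have "(\<integral>\<^sup>+x. ennreal ((cmod (FK t f x))\<^sup>2) \<partial>lborel) \<le> (\<integral>\<^sup>+x. \<integral>\<^sup>+y. ennreal ((cmod (f (x + y)))\<^sup>2) \<partial>law t \<partial>lborel)"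
    by (intro nn_integral_mono)
  also have "\<dots> = (\<integral>\<^sup>+x. ennreal ((cmod (f x))\<^sup>2) \<partial>lborel)" by (rule L.nn_integral_translate_avg) simp
  also have "\<dots> = ennreal ((L2_norm f)\<^sup>2)" by (rule L2_nn_integral[OF f])
  finally have le: "(\<integral>\<^sup>+x. ennreal ((cmod (FK t f x))\<^sup>2) \<partial>lborel) \<le> ennreal ((L2_norm f)\<^sup>2)" .
  from L2I_nn[OF FK_measurable[OF _ t] le] show "FK t f \<in> L2" "L2_norm (FK t f) \<le> L2_norm f" by auto
qed

text \<open>Dropping the exponential leaves the average of \<open>\<bar>f\<bar>\<close> under the
  free process, a square integrable function. It majorizes the semigroup on all truncations of
  \<open>f\<close>, at every \<open>x\<close> where the expectation of \<open>\<bar>f\<bar>\<close>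
  is finite, that is, almost everywhere.\<close>

lemma FK_dominated:
  assumes f: "f \<in> L2" and t: "0 < t"
  shows "translate_avg (law t) (\<lambda>y. complex_of_real (cmod (f y))) \<in> L2"
    and "AE x in lborel. integrable M (\<lambda>\<omega>. cmod (f (x + X t \<omega>)))"
    and "integrable M (\<lambda>\<omega>. cmod (f (x + X t \<omega>))) \<Longrightarrow> g \<in> borel_measurable borel \<Longrightarrow> (\<And>y. cmod (g y) \<le> cmod (f y)) \<Longrightarrow>
      cmod (FK t g x) \<le> cmod (translate_avg (law t) (\<lambda>y. complex_of_real (cmod (f y))) x)"
proof -
  interpret L: real_distribution "law t" using t by (intro distribution) simp
  have [measurable]: "X t \<in> borel_measurable M" using t by simp
  note [measurable] = L2D(1)[OF f]
  have "(\<lambda>y. complex_of_real (cmod (f y))) \<in> L2" by (rule L2_dominated(1)[OF f]) auto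
  then show "translate_avg (law t) (\<lambda>y. complex_of_real (cmod (f y))) \<in> L2" by (rule L.translate_avg_L2)
  have "(\<integral>\<^sup>+x. \<integral>\<^sup>+y. ennreal ((cmod (f (x + y)))\<^sup>2) \<partial>law t \<partial>lborel) = (\<integral>\<^sup>+x. ennreal ((cmod (f x))\<^sup>2) \<partial>lborel)"
    by (rule L.nn_integral_translate_avg) simp
  also have "\<dots> < \<infinity>" by (simp add: L2_nn_integral[OF f])
  finally have "AE x in lborel. (\<integral>\<^sup>+y. ennreal ((cmod (f (x + y)))\<^sup>2) \<partial>law t) \<noteq> \<infinity>"
    by (intro nn_integral_PInf_AE) auto
  then show "AE x in lborel. integrable M (\<lambda>\<omega>. cmod (f (x + X t \<omega>)))"
  proof eventually_elim
    case (elim x)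
    have "integrable M (\<lambda>\<omega>. (cmod (f (x + X t \<omega>)))\<^sup>2)"
    proof (rule integrableI_bounded)
      have "(\<integral>\<^sup>+\<omega>. ennreal (norm ((cmod (f (x + X t \<omega>)))\<^sup>2)) \<partial>M) = (\<integral>\<^sup>+y. ennreal ((cmod (f (x + y)))\<^sup>2) \<partial>law t)"
        unfolding law_def by (subst nn_integral_distr) auto
      then show "(\<integral>\<^sup>+\<omega>. ennreal (norm ((cmod (f (x + X t \<omega>)))\<^sup>2)) \<partial>M) < \<infinity>" using elim by (simp add: less_top)
    qed simp
    then have "integrable M (\<lambda>\<omega>. 1 + (cmod (f (x + X t \<omega>)))\<^sup>2)" by simp
    then show ?case
    proof (rule Bochner_Integration.integrable_bound)
      \<comment> \<open>The pointwise bound by which square integrability on a probability space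
        implies integrability.\<close>
      have "c \<le> 1 + c\<^sup>2" for c :: real
      proof -
        have "0 \<le> (c - 1)\<^sup>2 + c\<^sup>2 + 1" by simp
        also have "\<dots> = 2 * (1 + c\<^sup>2 - c)" by (simp add: power2_diff)
        finally show ?thesis by simp
      qed
      then show "AE \<omega> in M. norm (cmod (f (x + X t \<omega>))) \<le> norm (1 + (cmod (f (x + X t \<omega>)))\<^sup>2)" by simp
    qed simp
  qed
  assume i: "integrable M (\<lambda>\<omega>. cmod (f (x + X t \<omega>)))" and [measurable]: "g \<in> borel_measurable borel" and gf: "\<And>y. cmod (g y) \<le> cmod (f y)"
  have "cmod (FK t g x) \<le> (LINT \<omega>|M. cmod (complex_of_real (exp (- (LBINT s:{0..t}. (x + X s \<omega>)\<^sup>2))) * g (x + X t \<omega>)))"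
    unfolding feynman_kac_def by (rule integral_norm_bound)
  also have "\<dots> \<le> (LINT \<omega>|M. cmod (f (x + X t \<omega>)))"
  proof (rule integral_mono'[OF i])
    fix \<omega>
    show "cmod (complex_of_real (exp (- (LBINT s:{0..t}. (x + X s \<omega>)\<^sup>2))) * g (x + X t \<omega>)) \<le> cmod (f (x + X t \<omega>))"
      using FK_integrand_le[of t x \<omega> g] gf[of "x + X t \<omega>"] by linarith
  qed simp
  also have "\<dots> = (LINT y|law t. cmod (f (x + y)))"
    unfolding law_def by (subst integral_distr) auto
  also have "\<dots> = cmod (translate_avg (law t) (\<lambda>y. complex_of_real (cmod (f y))) x)"
    by (simp add: translate_avg_def integral_nonneg_AE)
  finally show "cmod (FK t g x) \<le> cmod (translate_avg (law t) (\<lambda>y. complex_of_real (cmod (f y))) x)" .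
qed

text \<open>Powers of the symmetric operator \<open>K\<close> are symmetric, and both sides pass to
  the limit: the free average of one function's modulus times the modulus of the other is an
  integrable majorant for all \<open>n\<close>.\<close>

lemma FK_symmetric_BL2:
  assumes f: "f \<in> BL2" and g: "g \<in> BL2" and t: "0 < t"
  shows "(LINT x|lborel. FK t f x * g x) = (LINT x|lborel. f x * FK t g x)"
proof -
  have lim: "(\<lambda>n. LINT x|lborel. (K (t / real (Suc n)) ^^ Suc n) a x * b x) \<longlonglongrightarrow> (LINT x|lborel. FK t a x * b x)"
    if a: "a \<in> BL2" and b: "b \<in> BL2" for a b
  proof -
    note [measurable] = BL2D(2)[OF a] BL2D(2)[OF b] FK_measurable[OF BL2D(2)[OF a] t]
    obtain B where B: "\<And>x. cmod (a x) \<le> B" using BL2D(3)[OF a] by blast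
    have kb: "(K (t / real (Suc n)) ^^ Suc n) a \<in> BL2" for n
      using Kpow_BL2[of "t / real (Suc n)" a "Suc n"] a t by simp
    note [measurable] = BL2D(2)[OF kb]
    define D where "D = translate_avg (law t) (\<lambda>y. complex_of_real (cmod (a y)))"
    have D: "D \<in> L2" unfolding D_def by (rule FK_dominated(1)[OF BL2D(1)[OF a] t])
    have [measurable]: "X t \<in> borel_measurable M" using t by simp
    show ?thesis
    proof (rule integral_dominated_convergence)
      show "integrable lborel (\<lambda>x. cmod (D x * b x))"
        by (intro integrable_norm L2_mult_integrable D BL2D(1)[OF b])
      show "AE x in lborel. (\<lambda>n. (K (t / real (Suc n)) ^^ Suc n) a x * b x) \<longlonglongrightarrow> FK t a x * b x"
        by (intro always_eventually allI tendsto_intros Kpow_tendsto_FK[OF _ B t]) simp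
      show "AE x in lborel. norm ((K (t / real (Suc n)) ^^ Suc n) a x * b x) \<le> cmod (D x * b x)" for n
      proof (intro always_eventually allI)
        fix x
        have s: "0 \<le> t / real (Suc n)" "real (Suc n) * (t / real (Suc n)) = t" using t by auto
        have i: "integrable M (\<lambda>\<omega>. cmod (a (x + X t \<omega>)))"
          by (rule integrable_const_bound[of _ B]) (use B in auto)
        have "cmod ((K (t / real (Suc n)) ^^ Suc n) a x) \<le>
           (LINT \<omega>|M. cmod (complex_of_real (exp (- trapezoid (t / real (Suc n)) (Suc n) x \<omega>)) * a (x + X t \<omega>)))"
          unfolding Kpow_expectation[OF s(1) BL2D(2)[OF a] B] s(2) by (rule integral_norm_bound)
        also have "\<dots> \<le> (LINT \<omega>|M. cmod (a (x + X t \<omega>)))"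
          using trapezoid_nonneg[OF s(1), of "Suc n" x]
          by (intro integral_mono'[OF i]) (simp_all add: norm_mult mult_left_le_one_le del: of_nat_Suc)
        also have "\<dots> = (LINT y|law t. cmod (a (x + y)))"
          unfolding law_def by (subst integral_distr) auto
        also have "\<dots> = cmod (D x)"
          by (simp add: D_def translate_avg_def integral_nonneg_AE)
        finally show "norm ((K (t / real (Suc n)) ^^ Suc n) a x * b x) \<le> cmod (D x * b x)"
          by (simp only: norm_mult) (rule mult_right_mono, simp_all)
      qed
    qed measurable
  qed
  have "(LINT x|lborel. (K (t / real (Suc n)) ^^ Suc n) f x * g x) = (LINT x|lborel. (K (t / real (Suc n)) ^^ Suc n) g x * f x)" for n
    using Kpow_symmetric[OF _ f g, of "t / real (Suc n)" "Suc n"] t by (simp add: mult.commute)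
  with lim[OF f g] lim[OF g f] have "(LINT x|lborel. FK t f x * g x) = (LINT x|lborel. FK t g x * f x)"
    by (intro LIMSEQ_unique[of _ _]) auto
  then show ?thesis by (simp add: mult.commute)
qed

text \<open>Truncation extends the symmetry from \<open>BL2\<close>, where the Trotter approximation converges at every point, to all of \<open>L2\<close>.\<close>

definition truncation :: "nat \<Rightarrow> (real \<Rightarrow> complex) \<Rightarrow> real \<Rightarrow> complex" where
  "truncation m f x = (if cmod (f x) \<le> real m then f x else 0)"

lemma truncation_le: "cmod (truncation m f x) \<le> cmod (f x)"
  by (simp add: truncation_def)

lemma truncation_measurable [measurable]:
  assumes [measurable]: "f \<in> borel_measurable borel"
  shows "truncation m f \<in> borel_measurable borel"
  unfolding truncation_def[abs_def] by measurable

lemma truncation_BL2: "f \<in> L2 \<Longrightarrow> truncation m f \<in> BL2"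
  unfolding BL2_def
  by (auto intro!: L2_dominated(1)[of f] truncation_le truncation_measurable dest: L2D exI[of _ "real m"] simp: truncation_def)

lemma truncation_tendsto: "(\<lambda>m. truncation m f x) \<longlonglongrightarrow> f x"
proof (rule tendsto_eventually)
  obtain N where "cmod (f x) \<le> real N" using real_arch_simple by blast
  then show "\<forall>\<^sub>F m in sequentially. truncation m f x = f x"
    by (intro eventually_sequentiallyI[of N]) (auto simp: truncation_def)
qed

lemma truncation_pairing_tendsto:
  assumes f: "f \<in> L2" and g: "g \<in> L2"
  shows "(\<lambda>m. LINT x|lborel. truncation m f x * g x) \<longlonglongrightarrow> (LINT x|lborel. f x * g x)"
proof (rule integral_dominated_convergence)
  note [measurable] = L2D(1)[OF f] L2D(1)[OF g]
  show "integrable lborel (\<lambda>x. cmod (f x * g x))" by (intro integrable_norm L2_mult_integrable f g)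
  show "AE x in lborel. (\<lambda>m. truncation m f x * g x) \<longlonglongrightarrow> f x * g x"
    by (intro always_eventually allI tendsto_intros truncation_tendsto)
  show "AE x in lborel. norm (truncation m f x * g x) \<le> cmod (f x * g x)" for m
    by (simp add: norm_mult mult_right_mono truncation_le)
  show "(\<lambda>x. f x * g x) \<in> borel_measurable lborel" "(\<lambda>x. truncation m f x * g x) \<in> borel_measurable lborel" for m
    by measurable
qed

lemma FK_truncation_pairing_tendsto:
  assumes f: "f \<in> L2" and g: "g \<in> L2" and t: "0 < t"
  shows "(\<lambda>m. LINT x|lborel. FK t (truncation m f) x * g x) \<longlonglongrightarrow> (LINT x|lborel. FK t f x * g x)"
proof (rule integral_dominated_convergence)
  define D where "D = translate_avg (law t) (\<lambda>y. complex_of_real (cmod (f y)))"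
  have D: "D \<in> L2" unfolding D_def by (rule FK_dominated(1)[OF f t])
  note [measurable] = L2D(1)[OF f] L2D(1)[OF g]
  have [measurable]: "X t \<in> borel_measurable M" using t by simp
  show "integrable lborel (\<lambda>x. cmod (D x * g x))" by (intro integrable_norm L2_mult_integrable D g)
  have m: "FK t f \<in> borel_measurable borel" "FK t (truncation m f) \<in> borel_measurable borel" for m
    by (rule FK_measurable[OF _ t]; measurable)+
  then show "(\<lambda>x. FK t f x * g x) \<in> borel_measurable lborel" "(\<lambda>x. FK t (truncation m f) x * g x) \<in> borel_measurable lborel" for m
    by measurable
  show "AE x in lborel. norm (FK t (truncation m f) x * g x) \<le> cmod (D x * g x)" for m
    using FK_dominated(2)[OF f t]
  proof eventually_elim
    case (elim x)
    have "cmod (FK t (truncation m f) x) \<le> cmod (D x)"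
      unfolding D_def by (rule FK_dominated(3)[OF f t elim]) (auto simp: truncation_le)
    then show ?case by (simp add: norm_mult mult_right_mono)
  qed
  show "AE x in lborel. (\<lambda>m. FK t (truncation m f) x * g x) \<longlonglongrightarrow> FK t f x * g x"
    using FK_dominated(2)[OF f t]
  proof eventually_elim
    case (elim x)
    have "(\<lambda>m. FK t (truncation m f) x) \<longlonglongrightarrow> FK t f x"
      unfolding feynman_kac_def
    proof (rule integral_dominated_convergence[OF _ _ elim])
      show "AE \<omega> in M. (\<lambda>m. complex_of_real (exp (- (LBINT s:{0..t}. (x + X s \<omega>)\<^sup>2))) * truncation m f (x + X t \<omega>)) \<longlonglongrightarrow>
          complex_of_real (exp (- (LBINT s:{0..t}. (x + X s \<omega>)\<^sup>2))) * f (x + X t \<omega>)"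
        by (rule AE_I2) (intro tendsto_intros truncation_tendsto)
      show "AE \<omega> in M. cmod (complex_of_real (exp (- (LBINT s:{0..t}. (x + X s \<omega>)\<^sup>2))) * truncation m f (x + X t \<omega>)) \<le> cmod (f (x + X t \<omega>))" for m
        by (rule AE_I2) (rule order_trans[OF FK_integrand_le truncation_le])
    qed (intro FK_integrand_measurable_Pair2 truncation_measurable L2D(1)[OF f] t)+
    then show ?case by (intro tendsto_intros)
  qed
qed

lemma FK_symmetric:
  assumes f: "f \<in> L2" and g: "g \<in> L2" and t: "0 < t"
  shows "(LINT x|lborel. FK t f x * g x) = (LINT x|lborel. f x * FK t g x)"
proof -
  \<comment> \<open>One argument is truncated at a time: first \<open>a\<close> against a bounded
    \<open>b\<close>, then \<open>g\<close> against the general \<open>f\<close>, by the first case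
    with the roles exchanged.\<close>
  have 1: "(LINT x|lborel. FK t a x * b x) = (LINT x|lborel. a x * FK t b x)" if a: "a \<in> L2" and b: "b \<in> BL2" for a b
  proof (rule LIMSEQ_unique[OF FK_truncation_pairing_tendsto[OF a BL2D(1)[OF b] t]])
    show "(\<lambda>m. LINT x|lborel. FK t (truncation m a) x * b x) \<longlonglongrightarrow> (LINT x|lborel. a x * FK t b x)"
      unfolding FK_symmetric_BL2[OF truncation_BL2[OF a] b t]
      by (rule truncation_pairing_tendsto[OF a FK_L2(1)[OF BL2D(1)[OF b] t]])
  qed
  have "(LINT x|lborel. FK t g x * f x) = (LINT x|lborel. g x * FK t f x)"
  proof (rule LIMSEQ_unique[OF FK_truncation_pairing_tendsto[OF g f t]])
    have e: "(LINT x|lborel. FK t (truncation m g) x * f x) = (LINT x|lborel. truncation m g x * FK t f x)" for m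
      using 1[OF f truncation_BL2[OF g, of m]] by (simp add: mult.commute)
    show "(\<lambda>m. LINT x|lborel. FK t (truncation m g) x * f x) \<longlonglongrightarrow> (LINT x|lborel. g x * FK t f x)"
      unfolding e by (rule truncation_pairing_tendsto[OF g FK_L2(1)[OF f t]])
  qed
  then show ?thesis by (simp add: mult.commute)
qed

section \<open>The generator: values on transforms, symmetry, real eigenvalues\<close>

lemma FK_cnj: "FK t (\<lambda>x. cnj (f x)) x = cnj (FK t f x)"
  unfolding feynman_kac_def by (simp flip: Bochner_Integration.integral_cnj)

text \<open>Fatou's lemma in \<open>n\<close>: the powers converge to the semigroup at every point,
  so a bound on the norms that is uniform in \<open>n\<close> passes to the limit.\<close>

lemma FK_quotient_estimate:
  assumes f: "f \<in> BL2" and h: "h \<in> BL2" and t: "0 < t"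
    and le: "\<And>n. L2_norm (\<lambda>x. (f x - (K (t / real (Suc n)) ^^ Suc n) f x) / complex_of_real t - h x) \<le> \<epsilon>"
  shows "L2_norm (\<lambda>x. (f x - FK t f x) / complex_of_real t - h x) \<le> \<epsilon>"
    and "(\<lambda>x. (f x - FK t f x) / complex_of_real t - h x) \<in> L2"
proof -
  note [measurable] = BL2D(2)[OF f] BL2D(2)[OF h] FK_measurable[OF BL2D(2)[OF f] t]
  obtain B where B: "\<And>x. cmod (f x) \<le> B" using BL2D(3)[OF f] by blast
  define q where "q n x = (f x - (K (t / real (Suc n)) ^^ Suc n) f x) / complex_of_real t - h x" for n x
  have q: "q n \<in> L2" for n
  proof -
    have "(\<lambda>x. (1 / complex_of_real t) * (f x - (K (t / real (Suc n)) ^^ Suc n) f x) - h x) \<in> BL2"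
      using Kpow_BL2[of "t / real (Suc n)" f "Suc n"] f t by (intro BL2_diff BL2_cmult h) auto
    then show ?thesis by (simp add: q_def[abs_def] BL2D(1) del: funpow.simps)
  qed
  have \<epsilon>: "0 \<le> \<epsilon>" using le[of 0] L2_norm_nonneg order_trans by blast
  have lim: "(\<lambda>n. ennreal ((cmod (q n x))\<^sup>2)) \<longlonglongrightarrow> ennreal ((cmod ((f x - FK t f x) / complex_of_real t - h x))\<^sup>2)" for x
    unfolding q_def using t by (intro tendsto_ennrealI tendsto_intros Kpow_tendsto_FK[OF _ B]) auto
  have "(\<integral>\<^sup>+x. ennreal ((cmod ((f x - FK t f x) / complex_of_real t - h x))\<^sup>2) \<partial>lborel) =
      (\<integral>\<^sup>+x. liminf (\<lambda>n. ennreal ((cmod (q n x))\<^sup>2)) \<partial>lborel)"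
    by (intro nn_integral_cong lim_imp_Liminf[OF sequentially_bot lim, symmetric])
  also have "\<dots> \<le> liminf (\<lambda>n. \<integral>\<^sup>+x. ennreal ((cmod (q n x))\<^sup>2) \<partial>lborel)"
    using L2D(1)[OF q] by (intro nn_integral_liminf) measurable
  also have "\<dots> \<le> ennreal (\<epsilon>\<^sup>2)"
  proof (rule Liminf_le)
    show "\<forall>\<^sub>F n in sequentially. (\<integral>\<^sup>+x. ennreal ((cmod (q n x))\<^sup>2) \<partial>lborel) \<le> ennreal (\<epsilon>\<^sup>2)"
      unfolding L2_nn_integral[OF q] using le by (auto intro!: always_eventually ennreal_leI power_mono simp: q_def[abs_def] simp del: funpow.simps)
  qed simp
  finally have "(\<integral>\<^sup>+x. ennreal ((cmod ((f x - FK t f x) / complex_of_real t - h x))\<^sup>2) \<partial>lborel) \<le> ennreal (\<epsilon>\<^sup>2)" .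
  from L2I_nn[OF _ this \<epsilon>] show "L2_norm (\<lambda>x. (f x - FK t f x) / complex_of_real t - h x) \<le> \<epsilon>"
    "(\<lambda>x. (f x - FK t f x) / complex_of_real t - h x) \<in> L2" by auto
qed

text \<open>With \<open>s = t / (n + 1)\<close>, the step size and all the times
  \<open>i * s\<close> that occur are at most \<open>t\<close>. So for \<open>t\<close> below
  \<open>s0\<close> and \<open>\<delta>\<close> the one-step error and the motion of
  \<open>h\<close> under the powers are each at most \<open>\<epsilon> / 2\<close>, whatever
  \<open>n\<close> is.\<close>

lemma hamiltonian_rfourier:
  assumes u: "C2_rapid u u' u''"
  shows "(rfourier u, rfourier (\<lambda>k. \<bar>k\<bar> * u k - u'' k)) \<in> hamiltonian M X"
proof -
  note r = C2_rapidD[OF u]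
  define f where "f = rfourier u"
  define h where "h = rfourier (\<lambda>k. \<bar>k\<bar> * u k - u'' k)"
  have v: "rapid (\<lambda>k. \<bar>k\<bar> * u k - u'' k)" by (intro rapid_diff rapid_times_abs r)
  have f: "f \<in> BL2" and h: "h \<in> BL2" unfolding f_def h_def by (intro BL2_rfourier r v)+
  define q where "q t x = (f x - FK t f x) / complex_of_real t - h x" for t x
  have small: "\<exists>t0>0. \<forall>t. 0 < t \<longrightarrow> t < t0 \<longrightarrow> q t \<in> L2 \<and> L2_norm (q t) \<le> \<epsilon>" if \<epsilon>: "0 < \<epsilon>" for \<epsilon>
  proof -
    obtain \<delta> where \<delta>: "0 < \<delta>" "\<And>s i. 0 < s \<Longrightarrow> real i * s \<le> \<delta> \<Longrightarrow> L2_norm (\<lambda>x. (K s ^^ i) h x - h x) \<le> \<epsilon> / 2"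
      using K_strongly_continuous[OF v, of "\<epsilon> / 2"] \<epsilon> unfolding h_def by auto
    have "\<forall>\<^sub>F s in at_right 0. L2_norm (\<lambda>x. (f x - K s f x) / complex_of_real s - h x) < \<epsilon> / 2"
      using order_tendstoD(2)[OF K_quotient_tendsto_at_right[OF u], of "\<epsilon> / 2"] \<epsilon> by (simp add: f_def h_def)
    then obtain s0 where s0: "0 < s0" "\<And>s. 0 < s \<Longrightarrow> s < s0 \<Longrightarrow> L2_norm (\<lambda>x. (f x - K s f x) / complex_of_real s - h x) < \<epsilon> / 2"
      by (auto simp: eventually_at_right_field)
    have "q t \<in> L2 \<and> L2_norm (q t) \<le> \<epsilon>" if t: "0 < t" "t < min s0 \<delta>" for t
    proof -
      have "L2_norm (\<lambda>x. (f x - (K (t / real (Suc n)) ^^ Suc n) f x) / complex_of_real t - h x) \<le> \<epsilon>" for n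
      proof -
        define s where "s = t / real (Suc n)"
        have s: "0 < s" "real (Suc n) * s = t" using t by (auto simp: s_def)
        have "s * 1 \<le> s * real (Suc n)" using s(1) by (intro mult_left_mono) auto
        then have st: "s \<le> t" using s(2) by (simp add: mult.commute)
        have "L2_norm (\<lambda>x. (f x - (K s ^^ Suc n) f x) / complex_of_real (real (Suc n) * s) - h x) \<le>
            L2_norm (\<lambda>x. (f x - K s f x) / complex_of_real s - h x) + \<epsilon> / 2"
        proof (rule Kpow_generator_estimate[OF less_imp_le[OF s(1)] f h s(1)])
          fix i assume "i < Suc n"
          then have "real i * s \<le> real (Suc n) * s" using s(1) by (intro mult_right_mono) auto
          then have "real i * s \<le> \<delta>" unfolding s(2) using t by simp
          then show "L2_norm (\<lambda>x. (K s ^^ i) h x - h x) \<le> \<epsilon> / 2" by (rule \<delta>(2)[OF s(1)])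
        qed simp
        also have "\<dots> \<le> \<epsilon>" using s0(2)[of s] s st t by simp
        finally show ?thesis unfolding s(2) unfolding s_def .
      qed
      from FK_quotient_estimate[OF f h t(1) this] show ?thesis by (simp add: q_def[abs_def])
    qed
    then show ?thesis using \<delta> s0 by (intro exI[of _ "min s0 \<delta>"]) auto
  qed
  have ev: "\<forall>\<^sub>F t in at_right 0. q t \<in> L2 \<and> L2_norm (q t) \<le> \<epsilon>" if \<epsilon>: "0 < \<epsilon>" for \<epsilon>
    using small[OF \<epsilon>] by (auto simp: eventually_at_right_field)
  have "((\<lambda>t. L2_norm (q t)) \<longlongrightarrow> 0) (at_right 0)"
  proof (rule tendstoI)
    fix e :: real assume "0 < e"
    then show "\<forall>\<^sub>F t in at_right 0. dist (L2_norm (q t)) 0 < e"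
      using ev[of "e / 2"] by (auto elim!: eventually_mono)
  qed
  then have "((\<lambda>t. (L2_norm (q t))\<^sup>2) \<longlongrightarrow> 0\<^sup>2) (at_right 0)" by (rule tendsto_power)
  then have "((\<lambda>t. ennreal ((L2_norm (q t))\<^sup>2)) \<longlongrightarrow> ennreal (0\<^sup>2)) (at_right 0)" by (rule tendsto_ennrealI)
  moreover have "\<forall>\<^sub>F t in at_right 0. ennreal ((L2_norm (q t))\<^sup>2) = (\<integral>\<^sup>+x. ennreal ((cmod (q t x))\<^sup>2) \<partial>lborel)"
    using ev[of 1] by (auto elim!: eventually_mono simp: L2_nn_integral)
  ultimately have "((\<lambda>t. \<integral>\<^sup>+x. ennreal ((cmod (q t x))\<^sup>2) \<partial>lborel) \<longlongrightarrow> ennreal (0\<^sup>2)) (at_right 0)"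
    by (rule Lim_transform_eventually)
  then have "tendsto_L2 (\<lambda>t x. (f x - FK t f x) / complex_of_real t) h (at_right 0)"
    by (simp add: tendsto_L2_def q_def)
  then show ?thesis using BL2D(1)[OF f] BL2D(1)[OF h] by (simp add: hamiltonian_def f_def h_def)
qed

lemma hamiltonian_pairing_tendsto:
  assumes fg: "(f, g) \<in> hamiltonian M X" and k: "k \<in> L2"
  shows "((\<lambda>t. LINT x|lborel. (f x - FK t f x) / complex_of_real t * k x) \<longlongrightarrow> (LINT x|lborel. g x * k x)) (at_right 0)"
proof -
  have f: "f \<in> L2" and g: "g \<in> L2"
    and lim: "((\<lambda>t. \<integral>\<^sup>+x. ennreal ((cmod ((f x - FK t f x) / complex_of_real t - g x))\<^sup>2) \<partial>lborel) \<longlongrightarrow> 0) (at_right 0)"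
    using fg by (auto simp: hamiltonian_def tendsto_L2_def)
  define q where "q t x = (f x - FK t f x) / complex_of_real t" for t x
  have q: "q t \<in> L2" if "0 < t" for t
    using L2_cmult[OF L2_diff(1)[OF f FK_L2(1)[OF f that]], of "1 / complex_of_real t"] by (simp add: q_def[abs_def])
  have qg: "(\<lambda>x. q t x - g x) \<in> L2" if "0 < t" for t by (rule L2_diff(1)[OF q[OF that] g])
  have pos: "\<forall>\<^sub>F t in at_right 0. 0 < (t :: real)" by (simp add: eventually_at_right_less)
  have "((\<lambda>t. L2_norm (\<lambda>x. q t x - g x)) \<longlongrightarrow> 0) (at_right 0)"
  proof (rule tendstoI)
    fix e :: real assume e: "0 < e"
    have "\<forall>\<^sub>F t in at_right 0. (\<integral>\<^sup>+x. ennreal ((cmod (q t x - g x))\<^sup>2) \<partial>lborel) < ennreal (e\<^sup>2)"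
      using order_tendstoD(2)[OF lim, of "ennreal (e\<^sup>2)"] e by (simp add: q_def)
    with pos show "\<forall>\<^sub>F t in at_right 0. dist (L2_norm (\<lambda>x. q t x - g x)) 0 < e"
    proof eventually_elim
      case (elim t)
      then have "(L2_norm (\<lambda>x. q t x - g x))\<^sup>2 < e\<^sup>2"
        by (simp add: L2_nn_integral[OF qg] ennreal_less_iff)
      then show ?case using e by (simp add: power2_less_imp_less)
    qed
  qed
  from tendsto_mult_left_zero[OF this, of "L2_norm k"]
  have "((\<lambda>t. (LINT x|lborel. q t x * k x) - (LINT x|lborel. g x * k x)) \<longlongrightarrow> 0) (at_right 0)"
  proof (rule Lim_null_comparison[rotated])
    show "\<forall>\<^sub>F t in at_right 0. norm ((LINT x|lborel. q t x * k x) - (LINT x|lborel. g x * k x)) \<le> L2_norm (\<lambda>x. q t x - g x) * L2_norm k"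
      using pos
    proof eventually_elim
      case (elim t)
      have "(LINT x|lborel. q t x * k x) - (LINT x|lborel. g x * k x) = (LINT x|lborel. (q t x - g x) * k x)"
        using L2_mult_integrable[OF q[OF elim] k] L2_mult_integrable[OF g k] by (simp add: left_diff_distrib)
      then show ?case using L2_Cauchy_Schwarz[OF qg[OF elim] k] by simp
    qed
  qed
  then show ?thesis unfolding q_def by (simp add: LIM_zero_iff)
qed

text \<open>By symmetry of the semigroup the two difference quotients have equal pairings for every
  \<open>t > 0\<close>, and so have their limits. The pairing is bilinear; conjugation enters
  through \<open>hamiltonian_cnj\<close>.\<close>

lemma hamiltonian_symmetric:
  assumes f1: "(f1, g1) \<in> hamiltonian M X" and f2: "(f2, g2) \<in> hamiltonian M X"
  shows "(LINT x|lborel. g1 x * f2 x) = (LINT x|lborel. f1 x * g2 x)"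
proof -
  have L: "f1 \<in> L2" "f2 \<in> L2" using assms by (auto simp: hamiltonian_def)
  have "\<forall>\<^sub>F t in at_right 0. (LINT x|lborel. (f2 x - FK t f2 x) / complex_of_real t * f1 x) = (LINT x|lborel. (f1 x - FK t f1 x) / complex_of_real t * f2 x)"
    using eventually_at_right_less[of "0::real"]
  proof eventually_elim
    case (elim t)
    have i: "integrable lborel (\<lambda>x. f1 x * f2 x)" "integrable lborel (\<lambda>x. FK t f1 x * f2 x)" "integrable lborel (\<lambda>x. f1 x * FK t f2 x)"
      by (intro L2_mult_integrable L FK_L2(1) elim)+
    have 1: "(f1 x - FK t f1 x) / complex_of_real t * f2 x = (1 / complex_of_real t) * (f1 x * f2 x - FK t f1 x * f2 x)"
      and 2: "(f2 x - FK t f2 x) / complex_of_real t * f1 x = (1 / complex_of_real t) * (f1 x * f2 x - f1 x * FK t f2 x)" for x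
      by (simp_all add: algebra_simps diff_divide_distrib)
    show ?case
      unfolding 1 2 integral_mult_right_zero
      by (simp only: Bochner_Integration.integral_diff[OF i(1) i(2)] Bochner_Integration.integral_diff[OF i(1) i(3)] FK_symmetric[OF L elim])
  qed
  from Lim_transform_eventually[OF hamiltonian_pairing_tendsto[OF f2 L(1)] this]
  have "((\<lambda>t. LINT x|lborel. (f1 x - FK t f1 x) / complex_of_real t * f2 x) \<longlongrightarrow> (LINT x|lborel. g2 x * f1 x)) (at_right 0)" .
  from tendsto_unique[OF _ this hamiltonian_pairing_tendsto[OF f1 L(2)]]
  show ?thesis by (simp add: mult.commute)
qed

lemma hamiltonian_cnj:
  assumes "(f, g) \<in> hamiltonian M X"
  shows "((\<lambda>x. cnj (f x)), (\<lambda>x. cnj (g x))) \<in> hamiltonian M X"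
proof -
  have c: "(\<lambda>x. cnj (a x)) \<in> L2" if "a \<in> L2" for a by (rule L2_dominated(1)[OF that]) (use L2D(1)[OF that] in auto)
  have "cmod ((cnj a - cnj b) / complex_of_real t - cnj d) = cmod ((a - b) / complex_of_real t - d)" for a b d t
    using complex_mod_cnj[of "(a - b) / complex_of_real t - d"] by simp
  then show ?thesis using assms by (auto simp: hamiltonian_def c tendsto_L2_def FK_cnj)
qed

text \<open>Symmetry applied to \<open>f\<close> and its conjugate shows that \<open>z\<close> and
  \<open>cnj z\<close> have the same product with the squared norm of \<open>f\<close>, which is not
  0.\<close>

lemma eigenvalue_real:
  assumes f: "f \<in> eigenspace (hamiltonian M X) z" and nz: "\<not> (AE x in lborel. f x = 0)"
  shows "z \<in> \<real>"
proof -
  have fz: "(f, \<lambda>x. z * f x) \<in> hamiltonian M X" using f by (simp add: eigenspace_def)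
  have f2: "f \<in> L2" using fz by (simp add: hamiltonian_def)
  have "(LINT x|lborel. z * f x * cnj (f x)) = (LINT x|lborel. f x * cnj (z * f x))"
    using hamiltonian_symmetric[OF fz hamiltonian_cnj[OF fz]] .
  then have "z * (LINT x|lborel. f x * cnj (f x)) = cnj z * (LINT x|lborel. f x * cnj (f x))"
    by (simp add: mult.assoc mult.left_commute)
  moreover have "(LINT x|lborel. f x * cnj (f x)) = complex_of_real ((L2_norm f)\<^sup>2)"
    by (simp add: complex_norm_square[symmetric] L2_norm_def integral_nonneg_AE flip: integral_complex_of_real)
  moreover have "L2_norm f \<noteq> 0" using L2_norm_eq_0_AE[OF f2] nz by blast
  ultimately have "z = cnj z" by simp
  then show ?thesis by (metis Reals_cnj_iff)
qed

end

section \<open>Eigenfunctions on the Fourier side\<close>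

text \<open>The potential \<open>\<bar>k\<bar>\<close> has a corner at 0, so solutions on the line
  are assembled from Airy solutions on the two half lines. The lemma is applied to a solution and
  again to its derivative.\<close>

lemma DERIV_glue_at_0:
  fixes p q :: "real \<Rightarrow> real"
  assumes p: "\<And>x. (p has_real_derivative p' x) (at x)" and q: "\<And>x. (q has_real_derivative q' x) (at x)"
    and "p 0 = q 0" "p' 0 = q' 0"
  shows "((\<lambda>x. if 0 \<le> x then p x else q x) has_real_derivative (if 0 \<le> x then p' x else q' x)) (at x)"
    (is "(?f has_real_derivative _) _")
proof (cases x "0 :: real" rule: linorder_cases)
  case less
  have "(?f has_real_derivative q' x) (at x)"
    by (rule has_field_derivative_transform_within_open[OF q, where S = "{..<0}"]) (use less in auto)
  then show ?thesis using less by simp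
next
  case greater
  have "(?f has_real_derivative p' x) (at x)"
    by (rule has_field_derivative_transform_within_open[OF p, where S = "{0<..}"]) (use greater in auto)
  then show ?thesis using greater by simp
next
  case equal
  have l: "((\<lambda>y. (?f y - ?f 0) / (y - 0)) \<longlongrightarrow> p' 0) (at_left 0)"
  proof (rule Lim_transform_eventually)
    show "((\<lambda>y. (q y - q 0) / (y - 0)) \<longlongrightarrow> p' 0) (at_left 0)"
      using q[of 0] assms(4) by (auto simp: has_field_derivative_iff intro: filterlim_mono[OF _ order_refl at_le])
    show "\<forall>\<^sub>F y in at_left 0. (q y - q 0) / (y - 0) = (?f y - ?f 0) / (y - 0)"
      using assms(3) by (auto simp: eventually_at_left_field intro!: exI[of _ "-1"])
  qed
  have r: "((\<lambda>y. (?f y - ?f 0) / (y - 0)) \<longlongrightarrow> p' 0) (at_right 0)"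
  proof (rule Lim_transform_eventually)
    show "((\<lambda>y. (p y - p 0) / (y - 0)) \<longlongrightarrow> p' 0) (at_right 0)"
      using p[of 0] by (auto simp: has_field_derivative_iff intro: filterlim_mono[OF _ order_refl at_le])
    show "\<forall>\<^sub>F y in at_right 0. (p y - p 0) / (y - 0) = (?f y - ?f 0) / (y - 0)"
      by (auto simp: eventually_at_right_field intro!: exI[of _ "1"])
  qed
  from filterlim_split_at[OF l r] show ?thesis using equal by (simp add: has_field_derivative_iff)
qed

section \<open>Solutions of the eigenvalue equation on the Fourier side\<close>

definition schroedinger_eq :: "real \<Rightarrow> (real \<Rightarrow> real) \<Rightarrow> (real \<Rightarrow> real) \<Rightarrow> bool" where
  "schroedinger_eq l A A' \<longleftrightarrow>
     (\<forall>k. (A has_real_derivative A' k) (at k) \<and> (A' has_real_derivative (\<bar>k\<bar> - l) * A k) (at k))"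

lemma schroedinger_eqD:
  assumes "schroedinger_eq l A A'"
  shows "(A has_real_derivative A' k) (at k)" "(A' has_real_derivative (\<bar>k\<bar> - l) * A k) (at k)"
  using assms by (auto simp: schroedinger_eq_def)

lemma schroedinger_eq_continuous:
  assumes "schroedinger_eq l A A'"
  shows "continuous_on S A" "continuous_on S A'"
  using schroedinger_eqD[OF assms] by (auto intro!: continuous_at_imp_continuous_on DERIV_isCont)

lemma airy_reflected_derivs:
  assumes "airy_eq y y'"
  shows "((\<lambda>x. y (x - l)) has_real_derivative y' (x - l)) (at x)"
    "((\<lambda>x. y' (x - l)) has_real_derivative (x - l) * y (x - l)) (at x)"
    "((\<lambda>x. y (- x - l)) has_real_derivative - y' (- x - l)) (at x)"
    "((\<lambda>x. y' (- x - l)) has_real_derivative - ((- x - l) * y (- x - l))) (at x)"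
proof -
  have d: "((\<lambda>x. x - l) has_real_derivative 1) (at x)" "((\<lambda>x. - x - l) has_real_derivative - 1) (at x)"
    by (auto intro!: derivative_eq_intros)
  show "((\<lambda>x. y (x - l)) has_real_derivative y' (x - l)) (at x)"
    using DERIV_chain2[OF airy_eqD(1)[OF assms] d(1)] by simp
  show "((\<lambda>x. y' (x - l)) has_real_derivative (x - l) * y (x - l)) (at x)"
    using DERIV_chain2[OF airy_eqD(2)[OF assms] d(1)] by simp
  show "((\<lambda>x. y (- x - l)) has_real_derivative - y' (- x - l)) (at x)"
    using DERIV_chain2[OF airy_eqD(1)[OF assms] d(2)] by simp
  show "((\<lambda>x. y' (- x - l)) has_real_derivative - ((- x - l) * y (- x - l))) (at x)"
    using DERIV_chain2[OF airy_eqD(2)[OF assms] d(2)] by simp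
qed

lemma schroedinger_even:
  assumes y: "airy_eq y y'" and 0: "y' (- l) = 0"
  shows "schroedinger_eq l (\<lambda>k. y (\<bar>k\<bar> - l)) (\<lambda>k. sgn k * y' (\<bar>k\<bar> - l))"
proof -
  note d = airy_reflected_derivs[OF y, where l = l]
  \<comment> \<open>At \<open>k = 0\<close> the value \<open>sgn 0 = 0\<close> agrees with the
    branch for \<open>0 \<le> k\<close> because \<open>y' (- l) = 0\<close>.\<close>
  have e: "(\<lambda>k. y (\<bar>k\<bar> - l)) = (\<lambda>k. if 0 \<le> k then y (k - l) else y (- k - l))"
    "(\<lambda>k. sgn k * y' (\<bar>k\<bar> - l)) = (\<lambda>k. if 0 \<le> k then y' (k - l) else - y' (- k - l))"
    using 0 by (auto simp: fun_eq_iff sgn_if)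
  show ?thesis
    unfolding schroedinger_eq_def
  proof (intro allI conjI)
    fix k :: real
    show "((\<lambda>k. y (\<bar>k\<bar> - l)) has_real_derivative sgn k * y' (\<bar>k\<bar> - l)) (at k)"
      unfolding e(1) fun_cong[OF e(2)] by (rule DERIV_glue_at_0[OF d(1,3)]) (use 0 in auto)
    have "((\<lambda>k. if 0 \<le> k then y' (k - l) else - y' (- k - l)) has_real_derivative
        (if 0 \<le> k then (k - l) * y (k - l) else - (- ((- k - l) * y (- k - l))))) (at k)"
      by (rule DERIV_glue_at_0[OF d(2) DERIV_minus[OF d(4)]]) (use 0 in auto)
    moreover have "(\<bar>k\<bar> - l) * y (\<bar>k\<bar> - l) = (if 0 \<le> k then (k - l) * y (k - l) else - (- ((- k - l) * y (- k - l))))"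
      by auto
    ultimately show "((\<lambda>k. sgn k * y' (\<bar>k\<bar> - l)) has_real_derivative (\<bar>k\<bar> - l) * y (\<bar>k\<bar> - l)) (at k)"
      unfolding e(2) by simp
  qed
qed

lemma schroedinger_odd:
  assumes y: "airy_eq y y'" and 0: "y (- l) = 0"
  shows "schroedinger_eq l (\<lambda>k. sgn k * y (\<bar>k\<bar> - l)) (\<lambda>k. y' (\<bar>k\<bar> - l))"
proof -
  note d = airy_reflected_derivs[OF y, where l = l]
  have e: "(\<lambda>k. sgn k * y (\<bar>k\<bar> - l)) = (\<lambda>k. if 0 \<le> k then y (k - l) else - y (- k - l))"
    "(\<lambda>k. y' (\<bar>k\<bar> - l)) = (\<lambda>k. if 0 \<le> k then y' (k - l) else y' (- k - l))"
    using 0 by (auto simp: fun_eq_iff sgn_if)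
  show ?thesis
    unfolding schroedinger_eq_def
  proof (intro allI conjI)
    fix k :: real
    have "((\<lambda>k. if 0 \<le> k then y (k - l) else - y (- k - l)) has_real_derivative
        (if 0 \<le> k then y' (k - l) else - (- y' (- k - l)))) (at k)"
      by (rule DERIV_glue_at_0[OF d(1) DERIV_minus[OF d(3)]]) (use 0 in auto)
    moreover have "y' (\<bar>k\<bar> - l) = (if 0 \<le> k then y' (k - l) else - (- y' (- k - l)))" by auto
    ultimately show "((\<lambda>k. sgn k * y (\<bar>k\<bar> - l)) has_real_derivative y' (\<bar>k\<bar> - l)) (at k)"
      unfolding e(1) by simp
    have "((\<lambda>k. if 0 \<le> k then y' (k - l) else y' (- k - l)) has_real_derivative
        (if 0 \<le> k then (k - l) * y (k - l) else - ((- k - l) * y (- k - l)))) (at k)"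
      by (rule DERIV_glue_at_0[OF d(2,4)]) (use 0 in auto)
    moreover have "(\<bar>k\<bar> - l) * (sgn k * y (\<bar>k\<bar> - l)) = (if 0 \<le> k then (k - l) * y (k - l) else - ((- k - l) * y (- k - l)))"
      using 0 by (auto simp: sgn_if)
    ultimately show "((\<lambda>k. y' (\<bar>k\<bar> - l)) has_real_derivative (\<bar>k\<bar> - l) * (sgn k * y (\<bar>k\<bar> - l))) (at k)"
      unfolding e(2) by simp
  qed
qed

text \<open>Odd or even according to which of \<open>Ai\<close> and \<open>Ai'\<close> vanishes at
  \<open>- l\<close>; on the spectrum exactly one of them does. For other \<open>l\<close> this is
  an even function with a corner at 0, and the results below then give it the coefficient 0.\<close>

definition airy_mode :: "real \<Rightarrow> real \<Rightarrow> real" where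
  "airy_mode l k = (if Ai (- l) = 0 then sgn k else 1) * Ai (\<bar>k\<bar> - l)"

lemma airy_mode_reflect: "airy_mode l (- k) = (if Ai (- l) = 0 then - 1 else 1) * airy_mode l k"
  by (simp add: airy_mode_def)

lemma Ai_shift_bound:
  "\<exists>C. \<forall>k. \<bar>Ai (\<bar>k\<bar> - l)\<bar> \<le> C * exp (- 1 * \<bar>k\<bar>) \<and> \<bar>deriv Ai (\<bar>k\<bar> - l)\<bar> \<le> C * exp (- 1 * \<bar>k\<bar>)"
proof -
  obtain C where C: "\<And>x. - l \<le> x \<Longrightarrow> \<bar>Ai x\<bar> \<le> C * exp (- x) \<and> \<bar>deriv Ai x\<bar> \<le> C * exp (- x)"
    using Ai_exp_decay[of "- l"] by blast
  have e: "exp (- (\<bar>k\<bar> - l)) = exp l * exp (- 1 * \<bar>k\<bar>)" for k by (simp flip: exp_add)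
  show ?thesis using C[of "\<bar>_\<bar> - l"] unfolding e by (intro exI[of _ "C * exp l"]) (auto simp: mult.assoc)
qed

lemma airy_mode_C2_rapid:
  assumes "l \<in> airy_spectrum"
  shows "\<exists>u'. C2_rapid (airy_mode l) u' (\<lambda>k. (\<bar>k\<bar> - l) * airy_mode l k)"
proof -
  obtain C where C: "\<And>k. \<bar>Ai (\<bar>k\<bar> - l)\<bar> \<le> C * exp (- 1 * \<bar>k\<bar>)" "\<And>k. \<bar>deriv Ai (\<bar>k\<bar> - l)\<bar> \<le> C * exp (- 1 * \<bar>k\<bar>)"
    using Ai_shift_bound[of l] by blast
  have "\<exists>u'. schroedinger_eq l (airy_mode l) u' \<and> (\<forall>k. \<bar>u' k\<bar> \<le> \<bar>deriv Ai (\<bar>k\<bar> - l)\<bar>)"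
  proof (cases "Ai (- l) = 0")
    case True
    then have "airy_mode l = (\<lambda>k. sgn k * Ai (\<bar>k\<bar> - l))" by (auto simp: airy_mode_def)
    with schroedinger_odd[OF Ai_spec(1) True] show ?thesis by auto
  next
    case False
    then have "airy_mode l = (\<lambda>k. Ai (\<bar>k\<bar> - l))" "deriv Ai (- l) = 0"
      using assms by (auto simp: airy_mode_def airy_spectrum_def)
    with schroedinger_even[OF Ai_spec(1), of l] show ?thesis
      by (intro exI[of _ "\<lambda>k. sgn k * deriv Ai (\<bar>k\<bar> - l)"]) (auto simp: abs_mult abs_sgn_eq)
  qed
  then obtain u' where u': "schroedinger_eq l (airy_mode l) u'" "\<And>k. \<bar>u' k\<bar> \<le> \<bar>deriv Ai (\<bar>k\<bar> - l)\<bar>" by blast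
  have "\<bar>airy_mode l k\<bar> \<le> \<bar>Ai (\<bar>k\<bar> - l)\<bar>" for k by (auto simp: airy_mode_def abs_mult abs_sgn_eq)
  then have ru: "rapid (airy_mode l)"
    using C(1) order_trans by (intro rapidI[OF schroedinger_eq_continuous(1)[OF u'(1)], of 1 C]) (simp, blast)
  have ru': "rapid u'"
    using C(2) u'(2) order_trans by (intro rapidI[OF schroedinger_eq_continuous(2)[OF u'(1)], of 1 C]) (simp, blast)
  have "rapid (\<lambda>k. \<bar>k\<bar> * airy_mode l k - l * airy_mode l k)"
    by (intro rapid_diff rapid_times_abs rapid_cmult ru)
  then have "rapid (\<lambda>k. (\<bar>k\<bar> - l) * airy_mode l k)" by (simp add: left_diff_distrib)
  with ru ru' schroedinger_eqD[OF u'(1)] show ?thesis unfolding C2_rapid_def by blast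
qed

lemma airy_mode_rapid: "l \<in> airy_spectrum \<Longrightarrow> rapid (airy_mode l)"
  using airy_mode_C2_rapid C2_rapidD(1) by blast

text \<open>Each half line contributes the integral of \<open>Ai\<^sup>2\<close> from
  \<open>- l\<close> on. As one of the two terms vanishes on the spectrum, the two different
  normalizations arise.\<close>

lemma airy_mode_square_integral:
  assumes "l \<in> airy_spectrum"
  shows "(LINT k|lborel. (airy_mode l k)\<^sup>2) = 2 * (l * (Ai (- l))\<^sup>2 + (deriv Ai (- l))\<^sup>2)"
    and "0 < (LINT k|lborel. (airy_mode l k)\<^sup>2)"
proof -
  define I where "I = l * (Ai (- l))\<^sup>2 + (deriv Ai (- l))\<^sup>2"
  have l: "0 < l" by (rule airy_spectrum_pos[OF assms])
  have I: "0 < I" unfolding I_def using Ai_no_common_zero[of "- l"] l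
    by (auto intro: add_pos_nonneg add_nonneg_pos)
  have [measurable]: "Ai \<in> borel_measurable borel" by (rule borel_measurable_continuous_onI[OF continuous_on_Ai(1)])
  have half: "(\<integral>\<^sup>+k. ennreal ((Ai (k - l))\<^sup>2) * indicator {0..} k \<partial>lborel) = ennreal I"
  proof -
    have "(\<integral>\<^sup>+x. ennreal ((Ai x)\<^sup>2) * indicator {- l..} x \<partial>lborel) =
        (\<integral>\<^sup>+k. ennreal ((Ai (- l + 1 * k))\<^sup>2) * indicator {- l..} (- l + 1 * k) \<partial>lborel)"
      by (subst nn_integral_real_affine[of _ 1 "- l"]) auto
    also have "\<dots> = (\<integral>\<^sup>+k. ennreal ((Ai (k - l))\<^sup>2) * indicator {0..} k \<partial>lborel)"
      by (intro nn_integral_cong) (auto simp: indicator_def)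
    finally show ?thesis using nn_integral_Ai_square[of "- l"] by (simp add: I_def add.commute)
  qed
  have half2: "(\<integral>\<^sup>+k. ennreal ((Ai (- k - l))\<^sup>2) * indicator {..0} k \<partial>lborel) = ennreal I"
  proof -
    have "(\<integral>\<^sup>+k. ennreal ((Ai (k - l))\<^sup>2) * indicator {0..} k \<partial>lborel) =
        (\<integral>\<^sup>+k. ennreal ((Ai ((0 + -1 * k) - l))\<^sup>2) * indicator {0..} (0 + -1 * k) \<partial>lborel)"
      by (subst nn_integral_real_affine[of _ "-1" 0]) auto
    also have "\<dots> = (\<integral>\<^sup>+k. ennreal ((Ai (- k - l))\<^sup>2) * indicator {..0} k \<partial>lborel)"
      by (intro nn_integral_cong) (auto simp: indicator_def)
    finally show ?thesis using half by simp
  qed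
  have "(\<integral>\<^sup>+k. ennreal ((airy_mode l k)\<^sup>2) \<partial>lborel) =
      (\<integral>\<^sup>+k. ennreal ((Ai (k - l))\<^sup>2) * indicator {0..} k + ennreal ((Ai (- k - l))\<^sup>2) * indicator {..0} k \<partial>lborel)"
  proof (rule nn_integral_cong_AE)
    show "AE k in lborel. ennreal ((airy_mode l k)\<^sup>2) =
        ennreal ((Ai (k - l))\<^sup>2) * indicator {0..} k + ennreal ((Ai (- k - l))\<^sup>2) * indicator {..0} k"
      using AE_lborel_singleton[of 0]
      by eventually_elim (auto simp: airy_mode_def sgn_if indicator_def power_mult_distrib)
  qed
  also have "\<dots> = ennreal I + ennreal I"
    by (subst nn_integral_add) (auto simp: half half2)
  also have "\<dots> = ennreal (2 * I)" using I by (simp flip: ennreal_plus)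
  finally have nn: "(\<integral>\<^sup>+k. ennreal ((airy_mode l k)\<^sup>2) \<partial>lborel) = ennreal (2 * I)" .
  have "integrable lborel (\<lambda>k. (airy_mode l k)\<^sup>2)" by (rule rapid_integrable[OF rapid_power2[OF airy_mode_rapid[OF assms]]])
  then have "ennreal (LINT k|lborel. (airy_mode l k)\<^sup>2) = ennreal (2 * I)"
    using nn by (subst nn_integral_eq_integral[symmetric]) auto
  then have eq: "(LINT k|lborel. (airy_mode l k)\<^sup>2) = 2 * I"
    using I by (subst (asm) ennreal_inj) (auto intro: integral_nonneg_AE)
  then show "(LINT k|lborel. (airy_mode l k)\<^sup>2) = 2 * (l * (Ai (- l))\<^sup>2 + (deriv Ai (- l))\<^sup>2)"
    by (simp add: I_def)
  show "0 < (LINT k|lborel. (airy_mode l k)\<^sup>2)" using eq I by simp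
qed

lemma airy_mode_rfourier_integrable: "l \<in> airy_spectrum \<Longrightarrow> integrable lborel (rfourier (airy_mode l))"
  using airy_mode_C2_rapid rfourier_integrable unfolding C2_rapid_def by blast

text \<open>Cramer's rule for the data at \<open>x0\<close> in terms of the two standard solutions,
  whose Wronskian is 1 everywhere.\<close>

lemma airy_eq_exists_at: "\<exists>y y'. airy_eq y y' \<and> y x0 = a \<and> y' x0 = b"
proof -
  obtain f f' where f: "airy_eq f f'" "f 0 = 1" "f' 0 = 0" using airy_eq_exists[of 1 0] by blast
  obtain g g' where g: "airy_eq g g'" "g 0 = 0" "g' 0 = 1" using airy_eq_exists[of 0 1] by blast
  have W: "f x * g' x - f' x * g x = 1" for x
    using airy_wronskian[OF f(1) g(1), of x] by (simp add: f g)
  define \<alpha> where "\<alpha> = a * g' x0 - b * g x0"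
  define \<beta> where "\<beta> = b * f x0 - a * f' x0"
  have "\<alpha> * f x0 + \<beta> * g x0 = a * (f x0 * g' x0 - f' x0 * g x0)"
    "\<alpha> * f' x0 + \<beta> * g' x0 = b * (f x0 * g' x0 - f' x0 * g x0)"
    by (simp_all add: \<alpha>_def \<beta>_def algebra_simps)
  with airy_eq_lincomb[OF f(1) g(1), of \<alpha> \<beta>] show ?thesis unfolding W by auto
qed

section \<open>Compactly supported test functions and completeness\<close>

definition compactly_supported :: "(real \<Rightarrow> real) \<Rightarrow> bool" where
  "compactly_supported w \<longleftrightarrow> continuous_on UNIV w \<and> (\<exists>R. \<forall>k. R < \<bar>k\<bar> \<longrightarrow> w k = 0)"

lemma compactly_supported_rapid: "compactly_supported w \<Longrightarrow> rapid w"
  unfolding compactly_supported_def using rapid_compact_support by blast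

lemma compactly_supported_mult:
  "compactly_supported w \<Longrightarrow> continuous_on UNIV g \<Longrightarrow> compactly_supported (\<lambda>k. g k * w k)"
  unfolding compactly_supported_def by (auto intro!: continuous_intros)

lemma compactly_supported_diff:
  assumes "compactly_supported v" "compactly_supported w"
  shows "compactly_supported (\<lambda>k. v k - w k)"
proof -
  obtain R S where "\<And>k. R < \<bar>k\<bar> \<Longrightarrow> v k = 0" "\<And>k. S < \<bar>k\<bar> \<Longrightarrow> w k = 0"
    using assms by (auto simp: compactly_supported_def)
  then have "\<forall>k. max R S < \<bar>k\<bar> \<longrightarrow> v k - w k = 0" by auto
  with assms show ?thesis unfolding compactly_supported_def by (blast intro: continuous_on_diff)
qed

lemma compactly_supported_cmult: "compactly_supported w \<Longrightarrow> compactly_supported (\<lambda>k. c * w k)"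
  by (rule compactly_supported_mult) auto

text \<open>The antiderivative normalized at \<open>- R\<close> is constant on either side of the
  support; the vanishing total integral makes the constant on the right 0 as well.\<close>

lemma compact_antiderivative:
  fixes v :: "real \<Rightarrow> real"
  assumes cont: "continuous_on UNIV v" and supp: "\<And>k. R < \<bar>k\<bar> \<Longrightarrow> v k = 0" and R: "0 \<le> R"
    and int: "(LINT k|lborel. v k) = 0"
  shows "\<exists>V. (\<forall>k. (V has_real_derivative v k) (at k)) \<and> (\<forall>k. R < \<bar>k\<bar> \<longrightarrow> V k = 0)"
proof -
  obtain F where F: "\<And>x. (F has_real_derivative v x) (at x)" using antiderivative_exists[OF cont] by blast
  have vm: "isCont v x" for x using cont by (simp add: continuous_on_eq_continuous_at)
  have const: "F b - F a = (LINT k|lborel. v k * indicator {a..b} k)" if "a \<le> b" for a b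
    using integral_FTC_Icc_real[OF that, of F v] F vm by simp
  have full: "F b = F a" if "a \<le> - R" "R \<le> b" for a b
  proof -
    have e: "v k * indicator {a..b} k = v k" for k
      using that supp[of k] by (cases "R < \<bar>k\<bar>") (auto simp: indicator_def)
    have "(LINT k|lborel. v k * indicator {a..b} k) = (LINT k|lborel. v k)" unfolding e ..
    then show ?thesis using const[of a b] that R int by simp
  qed
  have "F k - F (- R) = 0" if k: "R < \<bar>k\<bar>" for k
  proof (cases "0 \<le> k")
    case True
    then show ?thesis using full[of "- R" k] k by simp
  next
    case False
    then show ?thesis using full[of k R] full[of "- R" R] k R by simp
  qed
  moreover have "((\<lambda>k. F k - F (- R)) has_real_derivative v k) (at k)" for k
    using F by (auto intro!: derivative_eq_intros)
  ultimately show ?thesis by (intro exI[of _ "\<lambda>k. F k - F (- R)"]) auto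
qed

text \<open>Variation of constants, with the two orthogonality conditions forcing compact support.\<close>

lemma schroedinger_inhomogeneous:
  assumes A: "schroedinger_eq l A A'" and B: "schroedinger_eq l B B'"
    and W: "\<And>k. A k * B' k - A' k * B k = 1"
    and w: "compactly_supported w" and orth: "(LINT k|lborel. A k * w k) = 0" "(LINT k|lborel. B k * w k) = 0"
  shows "\<exists>u u'. C2_rapid u u' (\<lambda>k. (\<bar>k\<bar> - l) * u k - w k)"
proof -
  obtain R0 where R0: "\<And>k. R0 < \<bar>k\<bar> \<Longrightarrow> w k = 0" using w by (auto simp: compactly_supported_def)
  define R where "R = max R0 0"
  have R: "0 \<le> R" "\<And>k. R < \<bar>k\<bar> \<Longrightarrow> w k = 0" using R0 by (auto simp: R_def)
  have wc: "continuous_on UNIV w" using w by (simp add: compactly_supported_def)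
  note cA = schroedinger_eq_continuous[OF A, of UNIV] and cB = schroedinger_eq_continuous[OF B, of UNIV]
  obtain IA where IA: "\<And>k. (IA has_real_derivative A k * w k) (at k)" "\<And>k. R < \<bar>k\<bar> \<Longrightarrow> IA k = 0"
    using compact_antiderivative[of "\<lambda>k. A k * w k" R] R orth(1) cA wc by (auto intro: continuous_on_mult)
  obtain IB where IB: "\<And>k. (IB has_real_derivative B k * w k) (at k)" "\<And>k. R < \<bar>k\<bar> \<Longrightarrow> IB k = 0"
    using compact_antiderivative[of "\<lambda>k. B k * w k" R] R orth(2) cB wc by (auto intro: continuous_on_mult)
  define u where "u k = A k * IB k - B k * IA k" for k
  define u' where "u' k = A' k * IB k - B' k * IA k" for k
  have D1: "(u has_real_derivative u' k) (at k)" for k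
    unfolding u_def u'_def
    by (rule derivative_eq_intros schroedinger_eqD[OF A] schroedinger_eqD[OF B] IA IB refl)+ (simp add: algebra_simps)
  have D2: "(u' has_real_derivative (\<bar>k\<bar> - l) * u k - w k) (at k)" for k
  proof -
    have "(u' has_real_derivative (\<bar>k\<bar> - l) * u k - (A k * B' k - A' k * B k) * w k) (at k)"
      unfolding u_def u'_def
      by (rule derivative_eq_intros schroedinger_eqD[OF A] schroedinger_eqD[OF B] IA IB refl)+ (simp add: algebra_simps)
    then show ?thesis by (simp add: W)
  qed
  have cu: "continuous_on UNIV u" "continuous_on UNIV u'"
    using D1 D2 by (auto intro!: continuous_at_imp_continuous_on DERIV_isCont)
  have "rapid u" "rapid u'" "rapid (\<lambda>k. (\<bar>k\<bar> - l) * u k - w k)"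
    using cu wc IA(2) IB(2) R(2)
    by (auto intro!: rapid_compact_support[of _ R] continuous_intros simp: u_def u'_def)
  then show ?thesis using D1 D2 unfolding C2_rapid_def by blast
qed

definition cutoff :: "real \<Rightarrow> real \<Rightarrow> real" where
  "cutoff R k = max 0 (min 1 (R + 1 - \<bar>k\<bar>))"

lemma cutoff_bounds:
  "0 \<le> cutoff R k" "cutoff R k \<le> 1" "\<bar>k\<bar> \<le> R \<Longrightarrow> cutoff R k = 1" "cutoff R (- k) = cutoff R k" "(cutoff R k)\<^sup>2 \<le> cutoff R k"
proof -
  show a: "0 \<le> cutoff R k" "cutoff R k \<le> 1" "\<bar>k\<bar> \<le> R \<Longrightarrow> cutoff R k = 1" "cutoff R (- k) = cutoff R k"
    by (auto simp: cutoff_def)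
  show "(cutoff R k)\<^sup>2 \<le> cutoff R k" using mult_left_le[OF a(2,1)] by (simp add: power2_eq_square)
qed

lemma compactly_supported_cutoff: "compactly_supported (cutoff R)"
  unfolding compactly_supported_def cutoff_def
  by (intro conjI exI[of _ "R + 1"]) (auto intro!: continuous_intros)

text \<open>In \<open>y = q Ai + p g\<close> the growing part is at least 1 for arguments
  \<open>k - l \<ge> 1\<close>, so \<open>p\<^sup>2 \<le> 2 y\<^sup>2 + 2 (q Ai)\<^sup>2\<close>
  there. Integrating over an interval of length \<open>n\<close> bounds \<open>p\<^sup>2 * n\<close>
  independently of \<open>n\<close>.\<close>

lemma airy_eq_L2_bounded:
  assumes y: "airy_eq y y'" and bd: "\<And>R. (LINT k|lborel. (y (\<bar>k\<bar> - l))\<^sup>2 * cutoff R k) \<le> C"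
  shows "\<exists>q. \<forall>x. y x = q * Ai x"
proof -
  obtain q p g where g: "\<And>x. y x = q * Ai x + p * g x" "\<And>x. 0 \<le> x \<Longrightarrow> x \<le> g x"
    using airy_eq_Ai_plus_growing[OF y] by blast
  have "p = 0"
  proof (rule ccontr)
    assume p: "p \<noteq> 0"
    define k0 where "k0 = max 0 (1 + l)"
    obtain D where "\<forall>k. \<bar>Ai (\<bar>k\<bar> - l)\<bar> \<le> D * exp (- 1 * \<bar>k\<bar>)" using Ai_shift_bound[of l] by blast
    moreover have "continuous_on UNIV (\<lambda>k. Ai (\<bar>k\<bar> - l))"
      by (rule continuous_on_compose2[OF continuous_on_Ai(1)]) (auto intro!: continuous_intros)
    ultimately have rA: "rapid (\<lambda>k. Ai (\<bar>k\<bar> - l))" by (intro rapidI[of _ 1 D]) auto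
    have "continuous_on UNIV y"
      using airy_eqD(1)[OF y] by (auto intro!: continuous_at_imp_continuous_on DERIV_isCont)
    then have "continuous_on UNIV (\<lambda>k. (y (\<bar>k\<bar> - l))\<^sup>2)"
      by (intro continuous_on_power continuous_on_compose2[of UNIV y UNIV "\<lambda>k. \<bar>k\<bar> - l"]) (auto intro!: continuous_intros)
    then have ry: "rapid (\<lambda>k. (y (\<bar>k\<bar> - l))\<^sup>2 * cutoff R k)" for R
      by (intro compactly_supported_rapid compactly_supported_mult compactly_supported_cutoff)
    define E where "E = 2 * q\<^sup>2 * (LINT k|lborel. (Ai (\<bar>k\<bar> - l))\<^sup>2)"
    have N: "p\<^sup>2 * real n \<le> 2 * C + E" for n
    proof -
      define R where "R = k0 + real n"
      have "p\<^sup>2 * real n = (LINT k|lborel. p\<^sup>2 * indicator {k0..R} k)" by (simp add: R_def)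
      also have "\<dots> \<le> (LINT k|lborel. 2 * ((y (\<bar>k\<bar> - l))\<^sup>2 * cutoff R k) + 2 * q\<^sup>2 * (Ai (\<bar>k\<bar> - l))\<^sup>2)"
      proof (rule integral_mono)
        show "integrable lborel (\<lambda>k. p\<^sup>2 * indicator {k0..R} k :: real)"
          by (intro integrable_mult_right integrable_real_indicator) (auto simp: R_def)
        show "integrable lborel (\<lambda>k. 2 * ((y (\<bar>k\<bar> - l))\<^sup>2 * cutoff R k) + 2 * q\<^sup>2 * (Ai (\<bar>k\<bar> - l))\<^sup>2)"
          by (intro Bochner_Integration.integrable_add integrable_mult_right rapid_integrable ry rapid_power2 rA)
        fix k :: real
        show "p\<^sup>2 * indicator {k0..R} k \<le> 2 * ((y (\<bar>k\<bar> - l))\<^sup>2 * cutoff R k) + 2 * q\<^sup>2 * (Ai (\<bar>k\<bar> - l))\<^sup>2"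
        proof (cases "k \<in> {k0..R}")
          case True
          then have k: "0 \<le> k" "1 \<le> k - l" "\<bar>k\<bar> \<le> R" by (auto simp: k0_def)
          have "1 \<le> g (k - l)" using g(2)[of "k - l"] k by simp
          then have "p\<^sup>2 * 1 \<le> p\<^sup>2 * (g (k - l))\<^sup>2" by (intro mult_left_mono one_le_power) auto
          also have "\<dots> = (y (k - l) - q * Ai (k - l))\<^sup>2" by (simp add: g(1) power_mult_distrib)
          also have "\<dots> \<le> 2 * (y (k - l))\<^sup>2 + 2 * (q * Ai (k - l))\<^sup>2"
            using zero_le_power2[of "y (k - l) + q * Ai (k - l)"] unfolding power2_sum power2_diff by linarith
          finally show ?thesis using True k cutoff_bounds(3)[OF k(3)] by (simp add: power_mult_distrib)
        next
          case False
          then show ?thesis using cutoff_bounds(1) by simp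
        qed
      qed
      also have "\<dots> = 2 * (LINT k|lborel. (y (\<bar>k\<bar> - l))\<^sup>2 * cutoff R k) + E"
        unfolding E_def using rapid_integrable[OF ry] rapid_integrable[OF rapid_power2[OF rA]] by simp
      also have "\<dots> \<le> 2 * C + E" using bd[of R] by simp
      finally show ?thesis .
    qed
    obtain n where "(2 * C + E) / p\<^sup>2 < real n" using reals_Archimedean2 by blast
    then show False using N[of n] p by (simp add: field_simps)
  qed
  then show ?thesis using g(1) by auto
qed

lemma rfourier_shifted_gaussian:
  "rfourier (\<lambda>k. exp (- (k - \<xi>)\<^sup>2 / 2)) x = iexp (\<xi> * x) * complex_of_real (exp (- x\<^sup>2 / 2))"
proof -
  have "(LINT z|lborel. iexp (x * z) * complex_of_real (exp (- (z - \<xi>)\<^sup>2 / 2))) =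
     (LINT z|lborel. iexp (x * (\<xi> + 1 * z)) * complex_of_real (exp (- (\<xi> + 1 * z - \<xi>)\<^sup>2 / 2)))"
    by (subst lborel_integral_real_affine[of 1 _ \<xi>]) auto
  also have "\<dots> = (LINT z|lborel. iexp (\<xi> * x) * (iexp (x * z) * (iexp (- 0 * z) * complex_of_real (exp (- (1 * z)\<^sup>2 / 2)))))"
    by (rule Bochner_Integration.integral_cong) (auto simp: exp_add distrib_left mult_ac)
  finally have "rfourier (\<lambda>k. exp (- (k - \<xi>)\<^sup>2 / 2)) x =
      iexp (\<xi> * x) * fourier (\<lambda>k. iexp (- 0 * k) * complex_of_real (exp (- (1 * k)\<^sup>2 / 2))) x"
    by (simp only: rfourier_def fourier_def integral_mult_right_zero mult.left_commute)
  also have "fourier (\<lambda>k. iexp (- 0 * k) * complex_of_real (exp (- (1 * k)\<^sup>2 / 2))) x = complex_of_real (exp (- x\<^sup>2 / 2))"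
    by (subst fourier_modulated_gaussian) (auto simp: std_normal_density_def)
  finally show ?thesis .
qed

lemma rapid_shifted_gaussian: "rapid (\<lambda>k. exp (- (k - \<xi>)\<^sup>2 / 2))"
proof -
  have "rapid (\<lambda>k::real. exp (- k\<^sup>2 / 2))"
  proof (rule rapidI[of _ 1 "exp (1 / 2)"])
    fix k :: real
    have "0 \<le> (\<bar>k\<bar> - 1)\<^sup>2" by simp
    then have "- k\<^sup>2 / 2 \<le> 1 / 2 + - 1 * \<bar>k\<bar>" by (simp add: power2_diff)
    then have "exp (- k\<^sup>2 / 2) \<le> exp (1 / 2 + - 1 * \<bar>k\<bar>)" by simp
    then show "\<bar>exp (- k\<^sup>2 / 2)\<bar> \<le> exp (1 / 2) * exp (- 1 * \<bar>k\<bar>)" unfolding exp_add by simp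
  qed (auto intro!: continuous_intros)
  from rapid_shift[OF this, of "- \<xi>"] show ?thesis by simp
qed

text \<open>Cutting off extends orthogonality to every rapidly decaying \<open>w\<close>. Gaussians
  centered at \<open>\<xi>\<close> then say that the transform of
  \<open>f x * exp (- x\<^sup>2 / 2)\<close> vanishes at \<open>\<xi>\<close>; this product is
  integrable, so injectivity applies, and the Gaussian has no zeros.\<close>

lemma L2_orthogonal_to_rfourier:
  assumes f: "f \<in> L2" and orth: "\<And>w. compactly_supported w \<Longrightarrow> (LINT x|lborel. f x * rfourier w x) = 0"
  shows "AE x in lborel. f x = 0"
proof -
  note [measurable] = L2D(1)[OF f]
  have all: "(LINT x|lborel. f x * rfourier w x) = 0" if w: "rapid w" for w
  proof -
    define wn where "wn n k = w k * cutoff (real n) k" for n k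
    have wn: "compactly_supported (wn n)" for n
      unfolding wn_def by (intro compactly_supported_mult compactly_supported_cutoff rapid_continuous w)
    have d: "rapid (\<lambda>k. w k - wn n k)" for n by (intro rapid_diff w compactly_supported_rapid wn)
    have lim: "(\<lambda>n. L2_norm (rfourier (\<lambda>k. w k - wn n k))) \<longlonglongrightarrow> 0"
    proof (rule L2_norm_rfourier_dominated_convergence[OF d w])
      fix n k
      have "w k - wn n k = (1 - cutoff (real n) k) * w k" by (simp add: wn_def algebra_simps)
      then show "\<bar>w k - wn n k\<bar> \<le> \<bar>w k\<bar>"
        using cutoff_bounds(1,2)[of "real n" k] by (simp add: abs_mult mult_left_le_one_le)
    next
      fix k
      obtain N where N: "\<bar>k\<bar> \<le> real N" using real_arch_simple by blast
      show "(\<lambda>n. w k - wn n k) \<longlonglongrightarrow> 0"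
        by (rule tendsto_eventually)
           (use N in \<open>auto intro!: eventually_sequentiallyI[of N] simp: wn_def cutoff_bounds(3)\<close>)
    qed
    have "cmod (LINT x|lborel. f x * rfourier w x) \<le> L2_norm f * L2_norm (rfourier (\<lambda>k. w k - wn n k))" for n
    proof -
      have "(LINT x|lborel. f x * rfourier (\<lambda>k. w k - wn n k) x) =
          (LINT x|lborel. f x * rfourier w x - f x * rfourier (wn n) x)"
        using w compactly_supported_rapid[OF wn] by (simp add: rfourier_diff right_diff_distrib)
      also have "\<dots> = (LINT x|lborel. f x * rfourier w x)"
        using w compactly_supported_rapid[OF wn] orth[OF wn, of n]
        by (subst Bochner_Integration.integral_diff) (auto intro!: L2_mult_integrable f L2_rfourier(1))
      finally show ?thesis using L2_Cauchy_Schwarz[OF f L2_rfourier(1)[OF d, of n]] by simp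
    qed
    moreover have "(\<lambda>n. L2_norm f * L2_norm (rfourier (\<lambda>k. w k - wn n k))) \<longlonglongrightarrow> 0"
      using tendsto_mult_right_zero[OF lim, of "L2_norm f"] .
    ultimately have "cmod (LINT x|lborel. f x * rfourier w x) \<le> 0"
      by (intro LIMSEQ_le_const) auto
    then show ?thesis by simp
  qed
  define g where "g x = f x * complex_of_real (exp (- x\<^sup>2 / 2))" for x
  have "integrable lborel g"
  proof -
    have "rfourier (\<lambda>k. exp (- (k - 0)\<^sup>2 / 2)) \<in> L2" by (rule L2_rfourier(1)[OF rapid_shifted_gaussian])
    from L2_mult_integrable[OF f this] show ?thesis
      unfolding g_def rfourier_shifted_gaussian by simp
  qed
  moreover have "fourier g \<xi> = 0" for \<xi>
  proof -
    have "(LINT x|lborel. f x * rfourier (\<lambda>k. exp (- (k - \<xi>)\<^sup>2 / 2)) x) = 0" by (rule all[OF rapid_shifted_gaussian])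
    then show ?thesis unfolding rfourier_shifted_gaussian by (simp add: fourier_def g_def mult.left_commute)
  qed
  ultimately have "AE x in lborel. g x = 0" by (rule fourier_injective)
  then show ?thesis by eventually_elim (simp add: g_def)
qed

text \<open>The antiderivative is monotone and vanishes on both sides of the support, so it is
  identically 0, and so is its derivative.\<close>

lemma compactly_supported_integral_zero:
  assumes v: "compactly_supported v" and nonneg: "\<And>k. 0 \<le> v k" and int: "(LINT k|lborel. v k) = 0"
  shows "v k = 0"
proof -
  obtain R0 where R0: "\<And>k. R0 < \<bar>k\<bar> \<Longrightarrow> v k = 0" using v by (auto simp: compactly_supported_def)
  define R where "R = max R0 0"
  have R: "0 \<le> R" "\<And>k. R < \<bar>k\<bar> \<Longrightarrow> v k = 0" using R0 by (auto simp: R_def)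
  have vc: "continuous_on UNIV v" using v by (simp add: compactly_supported_def)
  obtain V where V: "\<And>k. (V has_real_derivative v k) (at k)" "\<And>k. R < \<bar>k\<bar> \<Longrightarrow> V k = 0"
    using compact_antiderivative[OF vc R(2,1) int] by blast
  have mono: "V a \<le> V b" if "a \<le> b" for a b by (rule deriv_nonneg_le[OF that V(1) nonneg])
  have "V x = 0" for x
  proof -
    define m where "m = \<bar>x\<bar> + R + 1"
    have "V (- m) = 0" "V m = 0" using R(1) by (auto intro!: V(2) simp: m_def)
    moreover have "- m \<le> x" "x \<le> m" using R(1) by (auto simp: m_def)
    ultimately show ?thesis using mono[of "- m" x] mono[of x m] by simp
  qed
  then have "V = (\<lambda>_. 0)" by auto
  then show ?thesis using V(1)[of k] DERIV_unique[of "\<lambda>_. 0" "v k" k 0] by simp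
qed

lemma integral_odd_function:
  fixes g :: "real \<Rightarrow> real"
  assumes "\<And>k. g (- k) = - g k"
  shows "(LINT k|lborel. g k) = 0"
proof -
  have "(LINT k|lborel. g k) = (LINT k|lborel. g (0 + - 1 * k))"
    by (subst lborel_integral_real_affine[of "-1" _ 0]) simp_all
  then show ?thesis by (simp add: assms)
qed

section \<open>Eigenfunctions as functionals on test functions\<close>

context cauchy
begin

lemma airy_mode_eigenspace:
  assumes "l \<in> airy_spectrum"
  shows "rfourier (airy_mode l) \<in> eigenspace (hamiltonian M X) (complex_of_real l)"
proof -
  obtain u' where u: "C2_rapid (airy_mode l) u' (\<lambda>k. (\<bar>k\<bar> - l) * airy_mode l k)"
    using airy_mode_C2_rapid[OF assms] by blast
  have "(\<lambda>k. \<bar>k\<bar> * airy_mode l k - (\<bar>k\<bar> - l) * airy_mode l k) = (\<lambda>k. l * airy_mode l k)"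
    by (simp add: algebra_simps)
  then have "rfourier (\<lambda>k. \<bar>k\<bar> * airy_mode l k - (\<bar>k\<bar> - l) * airy_mode l k) =
      (\<lambda>x. complex_of_real l * rfourier (airy_mode l) x)"
    by (auto simp: rfourier_cmult)
  with hamiltonian_rfourier[OF u] show ?thesis by (simp add: eigenspace_def)
qed

text \<open>The operator maps the transform of \<open>u\<close> to that of \<open>l u + w\<close>;
  by symmetry the terms with \<open>l\<close> cancel, and the pairing of \<open>f\<close> with the
  transform of \<open>w\<close> remains.\<close>

lemma eigenfunction_orthogonal:
  assumes f: "f \<in> eigenspace (hamiltonian M X) (complex_of_real l)"
    and u: "C2_rapid u u' (\<lambda>k. (\<bar>k\<bar> - l) * u k - w k)" and w: "rapid w"
  shows "(LINT x|lborel. f x * rfourier w x) = 0"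
proof -
  have fz: "(f, \<lambda>x. complex_of_real l * f x) \<in> hamiltonian M X" using f by (simp add: eigenspace_def)
  have f2: "f \<in> L2" using fz by (simp add: hamiltonian_def)
  note r = C2_rapidD(1)[OF u]
  have "(\<lambda>k. \<bar>k\<bar> * u k - ((\<bar>k\<bar> - l) * u k - w k)) = (\<lambda>k. l * u k + w k)"
    by (simp add: algebra_simps)
  then have e: "rfourier (\<lambda>k. \<bar>k\<bar> * u k - ((\<bar>k\<bar> - l) * u k - w k)) x = complex_of_real l * rfourier u x + rfourier w x" for x
    using rfourier_add[OF rapid_cmult[OF r] w] by (simp add: rfourier_cmult)
  have "(LINT x|lborel. complex_of_real l * f x * rfourier u x) =
      (LINT x|lborel. f x * (complex_of_real l * rfourier u x + rfourier w x))"
    using hamiltonian_symmetric[OF fz hamiltonian_rfourier[OF u]] by (simp add: e)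
  also have "\<dots> = (LINT x|lborel. complex_of_real l * f x * rfourier u x + f x * rfourier w x)"
    by (simp add: algebra_simps)
  also have "\<dots> = (LINT x|lborel. complex_of_real l * f x * rfourier u x) + (LINT x|lborel. f x * rfourier w x)"
    by (intro Bochner_Integration.integral_add L2_mult_integrable L2_cmult f2 L2_rfourier(1) r w)
  finally show ?thesis by simp
qed

text \<open>
  Instead of the \<open>L\<^sup>2\<close> Fourier transform of an eigenfunction \<open>f\<close> we use the functional \<open>L w = \<integral> f \<cdot> rfourier w\<close> on test
  functions. It vanishes on every \<open>w\<close> orthogonal to the even and the odd solution \<open>A\<close>, \<open>B\<close> of the Schroedinger
  equation, hence is a combination of pairings with \<open>A\<close> and \<open>B\<close>; its \<open>L\<^sup>2\<close> continuity rules out solutions that grow.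
\<close>

lemma eigenfunction_functional:
  assumes f: "f \<in> eigenspace (hamiltonian M X) (complex_of_real l)"
  shows "\<exists>c. (l \<notin> airy_spectrum \<longrightarrow> c = 0) \<and>
    (\<forall>w. compactly_supported w \<longrightarrow>
      (LINT x|lborel. f x * rfourier w x) = c * complex_of_real (LINT k|lborel. airy_mode l k * w k))"
proof -
  have f2: "f \<in> L2" using f by (simp add: eigenspace_def hamiltonian_def)
  obtain y y' where y: "airy_eq y y'" "y (- l) = 1" "y' (- l) = 0" using airy_eq_exists_at by blast
  obtain z z' where z: "airy_eq z z'" "z (- l) = 0" "z' (- l) = 1" using airy_eq_exists_at by blast
  define A where "A k = y (\<bar>k\<bar> - l)" for k
  define A' where "A' k = sgn k * y' (\<bar>k\<bar> - l)" for k
  define B where "B k = sgn k * z (\<bar>k\<bar> - l)" for k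
  define B' where "B' k = z' (\<bar>k\<bar> - l)" for k
  have A: "schroedinger_eq l A A'" unfolding A_def A'_def by (rule schroedinger_even[OF y(1,3)])
  have B: "schroedinger_eq l B B'" unfolding B_def B'_def by (rule schroedinger_odd[OF z(1,2)])
  note cA = schroedinger_eq_continuous(1)[OF A, of UNIV] and cB = schroedinger_eq_continuous(1)[OF B, of UNIV]
  have W: "A k * B' k - A' k * B k = 1" for k
  proof -
    have "((\<lambda>k. A k * B' k - A' k * B k) has_real_derivative 0) (at k)" for k
      by (rule derivative_eq_intros schroedinger_eqD[OF A] schroedinger_eqD[OF B] refl)+ (simp add: algebra_simps)
    then have "A k * B' k - A' k * B k = A 0 * B' 0 - A' 0 * B 0"
      by (intro DERIV_isconst_all[of "\<lambda>k. A k * B' k - A' k * B k"]) auto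
    then show ?thesis by (simp add: A_def B_def A'_def B'_def y z)
  qed
  define L where "L w = (LINT x|lborel. f x * rfourier w x)" for w
  have Ldiff: "L (\<lambda>k. v k - w k) = L v - L w" if "rapid v" "rapid w" for v w
    unfolding L_def using that
    by (simp add: rfourier_diff right_diff_distrib Bochner_Integration.integral_diff L2_mult_integrable f2 L2_rfourier(1))
  have Lc: "L (\<lambda>k. c * w k) = complex_of_real c * L w" for c w
    unfolding L_def rfourier_cmult by (simp add: mult.left_commute)
  have L0: "L w = 0" if w: "compactly_supported w" "(LINT k|lborel. A k * w k) = 0" "(LINT k|lborel. B k * w k) = 0" for w
  proof -
    obtain u u' where "C2_rapid u u' (\<lambda>k. (\<bar>k\<bar> - l) * u k - w k)"
      using schroedinger_inhomogeneous[OF A B W w] by blast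
    then show ?thesis unfolding L_def by (rule eigenfunction_orthogonal[OF f]) (rule compactly_supported_rapid[OF w(1)])
  qed
  \<comment> \<open>Truncated solutions serve as test functions: at \<open>R = 0\<close> they
    determine the coefficients, and for large \<open>R\<close> they detect growth. As
    \<open>A\<close> is even and \<open>B\<close> is odd, the mixed pairings vanish.\<close>
  define wA where "wA R k = A k * cutoff R k" for R k
  define wB where "wB R k = B k * cutoff R k" for R k
  have csA: "compactly_supported (wA R)" and csB: "compactly_supported (wB R)" for R
    unfolding wA_def wB_def by (intro compactly_supported_mult compactly_supported_cutoff cA cB)+
  have cross: "(LINT k|lborel. A k * wB R k) = 0" "(LINT k|lborel. B k * wA R k) = 0" for R
    by (rule integral_odd_function; simp add: A_def B_def wA_def wB_def cutoff_bounds)+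
  define IA where "IA R = (LINT k|lborel. A k * wA R k)" for R
  define IB where "IB R = (LINT k|lborel. B k * wB R k)" for R
  have pos: "0 \<le> A k * wA R k" "0 \<le> B k * wB R k" for R k
    using cutoff_bounds(1)[of R k] by (auto simp: wA_def wB_def mult.assoc[symmetric])
  have IA0: "0 \<le> IA R" and IB0: "0 \<le> IB R" for R
    unfolding IA_def IB_def using pos by (auto intro!: integral_nonneg_AE)
  have "IA 0 \<noteq> 0"
  proof
    assume "IA 0 = 0"
    then have "A 0 * wA 0 0 = 0"
      using compactly_supported_integral_zero[OF compactly_supported_mult[OF csA cA], of 0 0] pos by (simp add: IA_def)
    then show False by (simp add: wA_def A_def y cutoff_bounds)
  qed
  then have IA1: "0 < IA 0" using IA0[of 0] by simp
  \<comment> \<open>Since \<open>B 0 = 0\<close>, the value at 0 gives no contradiction, as it does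
    for \<open>A\<close>; instead the slope \<open>B' 0 = 1\<close> excludes that \<open>B\<close>
    vanishes near 0.\<close>
  have "IB 0 \<noteq> 0"
  proof
    assume "IB 0 = 0"
    then have z0: "B k * wB 0 k = 0" for k
      using compactly_supported_integral_zero[OF compactly_supported_mult[OF csB cB], of 0 k] pos by (simp add: IB_def)
    have Bz: "B k = 0" if "k \<in> {-1<..<1}" for k
    proof -
      have "0 < cutoff 0 k" using that by (auto simp: cutoff_def abs_if)
      then show ?thesis using z0[of k] by (simp add: wB_def)
    qed
    have "(B has_real_derivative 0) (at 0)"
      by (rule has_field_derivative_transform_within_open[of "\<lambda>_. 0" _ _ "{-1<..<1}"]) (auto simp: Bz)
    then have "B' 0 = 0" using schroedinger_eqD(1)[OF B, of 0] DERIV_unique by blast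
    then show False by (simp add: B'_def z)
  qed
  then have IB1: "0 < IB 0" using IB0[of 0] by simp
  define a where "a = L (wA 0) / complex_of_real (IA 0)"
  define b where "b = L (wB 0) / complex_of_real (IB 0)"
  have rep: "L w = a * complex_of_real (LINT k|lborel. A k * w k) + b * complex_of_real (LINT k|lborel. B k * w k)"
    if w: "compactly_supported w" for w
  proof -
    \<comment> \<open>Subtracting these multiples of \<open>wA 0\<close> and \<open>wB 0\<close>
      makes \<open>w\<close> orthogonal to \<open>A\<close> and \<open>B\<close>, where the
      functional vanishes.\<close>
    define \<alpha> where "\<alpha> = (LINT k|lborel. A k * w k) / IA 0"
    define \<beta> where "\<beta> = (LINT k|lborel. B k * w k) / IB 0"
    have rw: "rapid w" "rapid (\<lambda>k. \<alpha> * wA 0 k)" "rapid (\<lambda>k. \<beta> * wB 0 k)"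
      by (intro rapid_cmult compactly_supported_rapid w csA csB)+
    have i: "integrable lborel (\<lambda>k. g k * v k)" if "compactly_supported v" "continuous_on UNIV g" for g v
      by (intro rapid_integrable compactly_supported_rapid compactly_supported_mult that)
    have cs: "compactly_supported (\<lambda>k. w k - \<alpha> * wA 0 k - \<beta> * wB 0 k)"
      by (intro compactly_supported_diff compactly_supported_cmult w csA csB)
    have exp: "(LINT k|lborel. g k * (w k - \<alpha> * wA 0 k - \<beta> * wB 0 k)) =
        (LINT k|lborel. g k * w k) - \<alpha> * (LINT k|lborel. g k * wA 0 k) - \<beta> * (LINT k|lborel. g k * wB 0 k)"
      if g: "continuous_on UNIV g" for g
    proof -
      have "(LINT k|lborel. g k * (w k - \<alpha> * wA 0 k - \<beta> * wB 0 k)) =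
          (LINT k|lborel. g k * w k - \<alpha> * (g k * wA 0 k) - \<beta> * (g k * wB 0 k))"
        by (simp add: algebra_simps)
      then show ?thesis using i[OF w g] i[OF csA g] i[OF csB g] by simp
    qed
    have "L (\<lambda>k. w k - \<alpha> * wA 0 k - \<beta> * wB 0 k) = 0"
    proof (rule L0[OF cs])
      show "(LINT k|lborel. A k * (w k - \<alpha> * wA 0 k - \<beta> * wB 0 k)) = 0"
        unfolding exp[OF cA] cross using IA1 by (simp add: IA_def[symmetric] \<alpha>_def)
      show "(LINT k|lborel. B k * (w k - \<alpha> * wA 0 k - \<beta> * wB 0 k)) = 0"
        unfolding exp[OF cB] cross using IB1 by (simp add: IB_def[symmetric] \<beta>_def)
    qed
    then have "L w = complex_of_real \<alpha> * L (wA 0) + complex_of_real \<beta> * L (wB 0)"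
      unfolding Ldiff[OF rapid_diff[OF rw(1,2)] rw(3)] Ldiff[OF rw(1,2)] Lc by (simp add: algebra_simps)
    then show ?thesis by (simp add: a_def b_def \<alpha>_def \<beta>_def mult.commute)
  qed
  \<comment> \<open>On the test function \<open>G * cutoff R\<close> the functional takes the value
    \<open>c v\<close>, while the squared norm is at most \<open>v\<close>, as
    \<open>cutoff\<^sup>2 \<le> cutoff\<close>. So
    \<open>\<bar>c\<bar> v \<le> \<parallel>f\<parallel> sqrt v\<close>, which bounds
    \<open>v\<close> uniformly in \<open>R\<close>.\<close>
  have bound: "v \<le> (L2_norm f / cmod c)\<^sup>2"
    if c: "c \<noteq> 0" and G: "continuous_on UNIV G" and v: "v = (LINT k|lborel. G k * (G k * cutoff R k))"
      and Lw: "L (\<lambda>k. G k * cutoff R k) = c * complex_of_real (v)" for c G v and R :: real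
  proof -
    have cs: "compactly_supported (\<lambda>k. G k * cutoff R k)" by (intro compactly_supported_mult compactly_supported_cutoff G)
    have I0: "0 \<le> v" unfolding v using cutoff_bounds(1) by (auto intro!: integral_nonneg_AE simp: mult.assoc[symmetric])
    have "(LINT k|lborel. (G k * cutoff R k)\<^sup>2) \<le> v"
      unfolding v
    proof (rule integral_mono)
      show "integrable lborel (\<lambda>k. (G k * cutoff R k)\<^sup>2)"
        by (intro rapid_integrable rapid_power2 compactly_supported_rapid cs)
      show "integrable lborel (\<lambda>k. G k * (G k * cutoff R k))"
        by (intro rapid_integrable compactly_supported_rapid compactly_supported_mult[OF cs G])
      show "(G k * cutoff R k)\<^sup>2 \<le> G k * (G k * cutoff R k)" for k
        using mult_left_mono[OF cutoff_bounds(5)[of R k], of "(G k)\<^sup>2"] by (simp add: power_mult_distrib power2_eq_square mult_ac)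
    qed
    then have "L2_norm (rfourier (\<lambda>k. G k * cutoff R k)) \<le> sqrt v"
      by (simp add: L2_rfourier(2)[OF compactly_supported_rapid[OF cs]])
    moreover have "cmod c * v \<le> L2_norm f * L2_norm (rfourier (\<lambda>k. G k * cutoff R k))"
      using L2_Cauchy_Schwarz[OF f2 L2_rfourier(1)[OF compactly_supported_rapid[OF cs]]] Lw I0
      by (simp add: L_def norm_mult)
    ultimately have cv: "cmod c * v \<le> L2_norm f * sqrt v"
      by (meson L2_norm_nonneg mult_left_mono order_trans)
    have le: "sqrt v * (cmod c * sqrt v) \<le> sqrt v * L2_norm f"
    proof -
      have e: "sqrt v * (cmod c * sqrt v) = cmod c * v"
        using I0 by (simp only: mult.left_commute[of "sqrt v"] real_sqrt_mult_self abs_of_nonneg)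
      then show ?thesis unfolding e using cv by (simp add: mult.commute)
    qed
    have "sqrt v \<le> L2_norm f / cmod c"
    proof (cases "v = 0")
      case False
      then have "0 < sqrt v" using I0 by simp
      from mult_left_le_imp_le[OF le this] show ?thesis using c by (simp add: field_simps)
    qed simp
    from power_mono[OF this, of 2] I0 show ?thesis by simp
  qed
  \<comment> \<open>The uniform bound makes the even solution a multiple of \<open>Ai\<close>, and
    its vanishing slope at \<open>- l\<close> becomes a zero of \<open>Ai'\<close>;
    \<open>case_b\<close> is the analogue for the odd solution and a zero of
    \<open>Ai\<close>.\<close>
  have case_a: "\<exists>q. q \<noteq> 0 \<and> deriv Ai (- l) = 0 \<and> (\<forall>k. A k = q * Ai (\<bar>k\<bar> - l))" if "a \<noteq> 0"
  proof -
    have "\<exists>q. \<forall>x. y x = q * Ai x"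
    proof (rule airy_eq_L2_bounded[OF y(1)])
      fix R
      have "IA R \<le> (L2_norm f / cmod a)\<^sup>2"
        by (rule bound[OF that cA, of "IA R" R]) (use rep[OF csA, of R] cross in \<open>auto simp: IA_def wA_def[abs_def]\<close>)
      then show "(LINT k|lborel. (y (\<bar>k\<bar> - l))\<^sup>2 * cutoff R k) \<le> (L2_norm f / cmod a)\<^sup>2"
        by (simp add: IA_def wA_def A_def power2_eq_square mult.assoc)
    qed
    then obtain q where q: "\<And>x. y x = q * Ai x" by blast
    have "((\<lambda>x. q * Ai x) has_real_derivative q * deriv Ai (- l)) (at (- l))" by (rule DERIV_cmult[OF DERIV_Ai(1)])
    moreover have "y = (\<lambda>x. q * Ai x)" using q by auto
    ultimately have "y' (- l) = q * deriv Ai (- l)" using airy_eqD(1)[OF y(1)] DERIV_unique by blast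
    moreover have "q \<noteq> 0" using q[of "- l"] y(2) by auto
    ultimately show ?thesis using y(3) q by (intro exI[of _ q]) (auto simp: A_def)
  qed
  have case_b: "\<exists>q. q \<noteq> 0 \<and> Ai (- l) = 0 \<and> (\<forall>k. B k = q * (sgn k * Ai (\<bar>k\<bar> - l)))" if "b \<noteq> 0"
  proof -
    have "\<exists>q. \<forall>x. z x = q * Ai x"
    proof (rule airy_eq_L2_bounded[OF z(1)])
      fix R
      have "IB R \<le> (L2_norm f / cmod b)\<^sup>2"
        by (rule bound[OF that cB, of "IB R" R]) (use rep[OF csB, of R] cross in \<open>auto simp: IB_def wB_def[abs_def]\<close>)
      moreover have "B k * wB R k = (z (\<bar>k\<bar> - l))\<^sup>2 * cutoff R k" for k
        by (auto simp: wB_def B_def power2_eq_square sgn_if z)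
      ultimately show "(LINT k|lborel. (z (\<bar>k\<bar> - l))\<^sup>2 * cutoff R k) \<le> (L2_norm f / cmod b)\<^sup>2"
        by (simp add: IB_def)
    qed
    then obtain q where q: "\<And>x. z x = q * Ai x" by blast
    have "((\<lambda>x. q * Ai x) has_real_derivative q * deriv Ai (- l)) (at (- l))" by (rule DERIV_cmult[OF DERIV_Ai(1)])
    moreover have "z = (\<lambda>x. q * Ai x)" using q by auto
    ultimately have "z' (- l) = q * deriv Ai (- l)" using airy_eqD(1)[OF z(1)] DERIV_unique by blast
    then have "q \<noteq> 0" using z(3) by auto
    then show ?thesis using z(2) q by (intro exI[of _ q]) (auto simp: B_def)
  qed
  show ?thesis
  proof (cases "a = 0")
    case a0: True
    show ?thesis
    proof (cases "b = 0")
      case True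
      then show ?thesis using rep a0 by (intro exI[of _ 0]) (auto simp: L_def)
    next
      case False
      then obtain q where q: "q \<noteq> 0" "Ai (- l) = 0" "\<And>k. B k = q * (sgn k * Ai (\<bar>k\<bar> - l))" using case_b by blast
      have Bq: "B k = q * airy_mode l k" for k using q by (simp add: airy_mode_def)
      have "L w = (b * complex_of_real q) * complex_of_real (LINT k|lborel. airy_mode l k * w k)" if "compactly_supported w" for w
        using rep[OF that] a0 by (simp add: Bq mult.assoc)
      then show ?thesis using q(2) by (intro exI[of _ "b * complex_of_real q"]) (auto simp: L_def airy_spectrum_def)
    qed
  next
    case False
    then obtain q where q: "q \<noteq> 0" "deriv Ai (- l) = 0" "\<And>k. A k = q * Ai (\<bar>k\<bar> - l)" using case_a by blast
    have nz: "Ai (- l) \<noteq> 0" using q(2) Ai_no_common_zero by blast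
    then have b0: "b = 0" using case_b by blast
    have Aq: "A k = q * airy_mode l k" for k using q nz by (simp add: airy_mode_def)
    have "L w = (a * complex_of_real q) * complex_of_real (LINT k|lborel. airy_mode l k * w k)" if "compactly_supported w" for w
      using rep[OF that] b0 by (simp add: Aq mult.assoc)
    then show ?thesis using q(2) by (intro exI[of _ "a * complex_of_real q"]) (auto simp: L_def airy_spectrum_def)
  qed
qed

text \<open>By the multiplication formula and inversion, the transform of the mode induces the same
  functional up to a constant and the sign \<open>\<sigma>\<close>, the parity of the mode, because
  transforming twice reflects. The difference of \<open>f\<close> and the matching multiple is
  orthogonal to all transforms of test functions.\<close>

lemma eigenfunction_representation:
  assumes f: "f \<in> eigenspace (hamiltonian M X) (complex_of_real l)"
  shows "\<exists>c. (l \<notin> airy_spectrum \<longrightarrow> c = 0) \<and> (AE x in lborel. f x = c * rfourier (airy_mode l) x)"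
proof -
  have f2: "f \<in> L2" using f by (simp add: eigenspace_def hamiltonian_def)
  obtain c where c: "l \<notin> airy_spectrum \<longrightarrow> c = 0"
    and rep: "\<And>w. compactly_supported w \<Longrightarrow>
      (LINT x|lborel. f x * rfourier w x) = c * complex_of_real (LINT k|lborel. airy_mode l k * w k)"
    using eigenfunction_functional[OF f] by blast
  show ?thesis
  proof (cases "l \<in> airy_spectrum")
    case False
    then have "AE x in lborel. f x = 0" using c rep by (intro L2_orthogonal_to_rfourier[OF f2]) simp
    then show ?thesis by (intro exI[of _ 0]) simp
  next
    case True
    define \<sigma> where "\<sigma> = (if Ai (- l) = 0 then - 1 else 1 :: real)"
    have \<sigma>: "complex_of_real \<sigma> * complex_of_real \<sigma> = 1" by (simp add: \<sigma>_def)
    define \<phi> where "\<phi> = rfourier (airy_mode l)"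
    have u: "rapid (airy_mode l)" by (rule airy_mode_rapid[OF True])
    have \<phi>2: "\<phi> \<in> L2" unfolding \<phi>_def by (rule L2_rfourier(1)[OF u])
    have \<phi>i: "integrable lborel \<phi>" unfolding \<phi>_def by (rule airy_mode_rfourier_integrable[OF True])
    have \<phi>w: "(LINT x|lborel. \<phi> x * rfourier w x) = complex_of_real \<sigma> * complex_of_real (LINT k|lborel. airy_mode l k * w k)"
      if w: "compactly_supported w" for w
    proof -
      have "(LINT x|lborel. \<phi> x * rfourier w x) = (LINT k|lborel. fourier \<phi> k * complex_of_real (w k))"
        unfolding rfourier_def[of w]
        by (rule fourier_mult_formula[OF \<phi>i rapid_of_real_integrable[OF compactly_supported_rapid[OF w]], symmetric])
      also have "\<dots> = (LINT k|lborel. complex_of_real (\<sigma> * (airy_mode l k * w k)))"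
        using rfourier_inversion[OF u \<phi>i[unfolded \<phi>_def]] by (simp add: \<phi>_def airy_mode_reflect \<sigma>_def)
      also have "\<dots> = complex_of_real (LINT k|lborel. \<sigma> * (airy_mode l k * w k))" by (rule integral_complex_of_real)
      finally show ?thesis by simp
    qed
    define d where "d = c * complex_of_real \<sigma>"
    have "AE x in lborel. f x - d * \<phi> x = 0"
    proof (rule L2_orthogonal_to_rfourier)
      show "(\<lambda>x. f x - d * \<phi> x) \<in> L2" by (intro L2_diff(1) L2_cmult f2 \<phi>2)
      fix w assume w: "compactly_supported w"
      note w2 = L2_rfourier(1)[OF compactly_supported_rapid[OF w]]
      have "(LINT x|lborel. (f x - d * \<phi> x) * rfourier w x) = (LINT x|lborel. f x * rfourier w x - d * (\<phi> x * rfourier w x))"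
        by (simp add: algebra_simps)
      also have "\<dots> = (LINT x|lborel. f x * rfourier w x) - d * (LINT x|lborel. \<phi> x * rfourier w x)"
        using L2_mult_integrable[OF f2 w2] L2_mult_integrable[OF \<phi>2 w2] by simp
      also have "\<dots> = 0" unfolding rep[OF w] \<phi>w[OF w] d_def using \<sigma> by (simp add: mult.assoc)
      finally show "(LINT x|lborel. (f x - d * \<phi> x) * rfourier w x) = 0" .
    qed
    then have "AE x in lborel. f x = d * \<phi> x" by eventually_elim simp
    then show ?thesis using True unfolding \<phi>_def by blast
  qed
qed

section \<open>Multiplicities of the eigenvalues\<close>

lemma airy_mode_rfourier_nonzero:
  assumes "l \<in> airy_spectrum"
  shows "\<not> (AE x in lborel. rfourier (airy_mode l) x = 0)"
proof
  assume 0: "AE x in lborel. rfourier (airy_mode l) x = 0"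
  note u = airy_mode_rapid[OF assms]
  have "L2_norm (rfourier (airy_mode l)) = L2_norm (\<lambda>x. 0)"
    using 0 u by (intro L2_norm_cong_AE) (auto elim: eventually_mono)
  then show False using airy_mode_square_integral(2)[OF assms] by (simp add: L2_rfourier(2)[OF u]) (simp add: L2_norm_def)
qed

text \<open>As \<open>multiplicity_of\<close> is a relation, existence and uniqueness of
  \<open>m\<close> are both at stake. On the spectrum every eigenfunction is a multiple of the
  transformed mode; elsewhere eigenfunctions vanish, for nonreal \<open>z\<close> by
  symmetry.\<close>

lemma multiplicity_hamiltonian:
  "multiplicity_of (hamiltonian M X) z m \<longleftrightarrow> m = (if z \<in> complex_of_real ` airy_spectrum then 1 else 0)"
proof (cases "z \<in> complex_of_real ` airy_spectrum")
  case True
  then obtain l where l: "l \<in> airy_spectrum" "z = complex_of_real l" by blast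
  define \<phi> where "\<phi> = rfourier (airy_mode l)"
  have \<phi>: "\<phi> \<in> eigenspace (hamiltonian M X) z" unfolding \<phi>_def l by (rule airy_mode_eigenspace[OF l(1)])
  have nz: "\<not> (AE x in lborel. \<phi> x = 0)" unfolding \<phi>_def by (rule airy_mode_rfourier_nonzero[OF l(1)])
  have rep: "\<exists>c. AE x in lborel. f x = c * \<phi> x" if "f \<in> eigenspace (hamiltonian M X) z" for f
    using eigenfunction_representation[of f l] that unfolding \<phi>_def l by blast
  have "multiplicity_of (hamiltonian M X) z 1"
    unfolding multiplicity_of_def
  proof (intro exI[of _ "\<lambda>_. \<phi>"] conjI allI impI ballI)
    show "\<phi> \<in> eigenspace (hamiltonian M X) z" by (rule \<phi>)
  next
    fix c :: "nat \<Rightarrow> complex" and i :: nat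
    assume 0: "AE x in lborel. (\<Sum>i<1. c i * \<phi> x) = 0" and "i < 1"
    show "c i = 0"
    proof (rule ccontr)
      assume "c i \<noteq> 0"
      then have "AE x in lborel. \<phi> x = 0" using 0 \<open>i < 1\<close> by simp
      with nz show False ..
    qed
  next
    fix f assume "f \<in> eigenspace (hamiltonian M X) z"
    then obtain c where "AE x in lborel. f x = c * \<phi> x" using rep by blast
    then show "\<exists>c. AE x in lborel. f x = (\<Sum>i<1::nat. c i * \<phi> x)" by (intro exI[of _ "\<lambda>_. c"]) simp
  qed
  moreover have "m = 1" if m: "multiplicity_of (hamiltonian M X) z m"
  proof -
    obtain e where e: "\<And>i. i < m \<Longrightarrow> e i \<in> eigenspace (hamiltonian M X) z"
      and ind: "\<And>c. (AE x in lborel. (\<Sum>i<m. c i * e i x) = 0) \<Longrightarrow> \<forall>i<m. c i = 0"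
      and span: "\<And>f. f \<in> eigenspace (hamiltonian M X) z \<Longrightarrow> \<exists>c. AE x in lborel. f x = (\<Sum>i<m. c i * e i x)"
      using m unfolding multiplicity_of_def by blast
    have "m \<noteq> 0"
    proof
      assume "m = 0"
      with span[OF \<phi>] have "AE x in lborel. \<phi> x = 0" by simp
      with nz show False ..
    qed
    moreover have "\<not> 2 \<le> m"
    proof
      assume m2: "2 \<le> m"
      obtain c0 c1 where c: "AE x in lborel. e 0 x = c0 * \<phi> x" "AE x in lborel. e 1 x = c1 * \<phi> x"
        using rep[OF e, of 0] rep[OF e, of 1] m2 by auto
      have two: "(\<Sum>i<m. (if i = 0 then p else if i = 1 then q else 0) * e i x) = p * e 0 x + q * e 1 x" for p q x
      proof -
        have "(\<Sum>i<m. (if i = 0 then p else if i = 1 then q else 0) * e i x) =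
            (\<Sum>i\<in>{0, 1}. (if i = 0 then p else if i = 1 then q else 0) * e i x)"
          using m2 by (intro sum.mono_neutral_right) auto
        then show ?thesis by simp
      qed
      \<comment> \<open>With \<open>e 0 = c0 \<phi>\<close> and \<open>e 1 = c1 \<phi>\<close> the
        combination \<open>c1 e 0 - c0 e 1\<close> is 0, which gives \<open>c1 = 0\<close>; then
        \<open>e 1 = 0\<close>, again against independence.\<close>
      have "AE x in lborel. (\<Sum>i<m. (if i = 0 then c1 else if i = 1 then - c0 else 0) * e i x) = 0"
        using c unfolding two by eventually_elim simp
      from ind[OF this] have c1: "c1 = 0" using m2 by (auto dest: spec[of _ 0])
      have "AE x in lborel. (\<Sum>i<m. (if i = 0 then 0 else if i = 1 then 1 else 0) * e i x) = 0"
        using c(2) unfolding two by eventually_elim (simp add: c1)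
      from ind[OF this] show False using m2 by (auto dest: spec[of _ 1])
    qed
    ultimately show ?thesis by simp
  qed
  ultimately show ?thesis using True by auto
next
  case False
  have zero: "AE x in lborel. f x = 0" if f: "f \<in> eigenspace (hamiltonian M X) z" for f
  proof (rule ccontr)
    assume nz: "\<not> (AE x in lborel. f x = 0)"
    then obtain l where l: "z = complex_of_real l" using eigenvalue_real[OF f nz] by (auto elim: Reals_cases)
    with False have "l \<notin> airy_spectrum" by auto
    with eigenfunction_representation[of f l] f nz show False unfolding l by auto
  qed
  have "multiplicity_of (hamiltonian M X) z 0"
    unfolding multiplicity_of_def using zero by auto
  moreover have "m = 0" if m: "multiplicity_of (hamiltonian M X) z m"
  proof (rule ccontr)
    assume m0: "m \<noteq> 0"
    obtain e where e: "\<And>i. i < m \<Longrightarrow> e i \<in> eigenspace (hamiltonian M X) z"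
      and ind: "\<And>c. (AE x in lborel. (\<Sum>i<m. c i * e i x) = 0) \<Longrightarrow> \<forall>i<m. c i = 0"
      using m unfolding multiplicity_of_def by blast
    have one: "(\<Sum>i<m. (if i = 0 then 1 else 0) * e i x) = e 0 x" for x
    proof -
      have "(\<Sum>i<m. (if i = 0 then 1 else 0) * e i x) = (\<Sum>i\<in>{0}. (if i = 0 then 1 else 0) * e i x)"
        using m0 by (intro sum.mono_neutral_right) auto
      then show ?thesis by simp
    qed
    have "AE x in lborel. (\<Sum>i<m. (if i = 0 then 1 else 0) * e i x) = 0"
      unfolding one using zero[OF e[of 0]] m0 by simp
    from ind[OF this] show False using m0 by auto
  qed
  ultimately show ?thesis using False by auto
qed

end

section \<open>Eigenvalues and normalized eigenfunctions\<close>

text \<open>Let \<open>T R\<close> be the truncation of \<open>rfourier v\<close> and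
  \<open>V k = v (- k)\<close>. In the squared distance of \<open>fourier (T R)\<close> from
  \<open>V\<close>, the first term is at most \<open>I R\<close> by Bessel's inequality, although
  \<open>T R\<close> may jump, the mixed term is exactly \<open>2 * I R\<close> by the
  multiplication formula, and the last one is \<open>J\<close> by Plancherel. What remains is at
  most \<open>J - I R\<close>, which tends to 0.\<close>

lemma fourier_L2_rfourier:
  assumes v: "rapid v" and f [measurable]: "f \<in> borel_measurable borel" and fv: "AE x in lborel. f x = c * rfourier v x"
  shows "fourier_L2 f (\<lambda>k. c * complex_of_real (v (- k)))"
proof -
  define g where "g = rfourier v"
  define V where "V k = complex_of_real (v (- k))" for k
  note [measurable] = rfourier_measurable[OF v]
  have g2: "g \<in> L2" unfolding g_def by (rule L2_rfourier(1)[OF v])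
  note [measurable] = L2D(1)[OF g2]
  have gb: "integrable lborel (\<lambda>x. (cmod (g x))\<^sup>2)" by (rule L2D(2)[OF g2])
  have V: "integrable lborel V" unfolding V_def by (rule rapid_of_real_integrable[OF rapid_reflect[OF v]])
  have [measurable]: "V \<in> borel_measurable borel" using V by auto
  have "integrable lborel (\<lambda>k. (v (- k))\<^sup>2)" by (rule rapid_integrable[OF rapid_power2[OF rapid_reflect[OF v]]])
  then have V2: "V \<in> L2" by (intro L2I) (auto simp: V_def)
  have c2: "(\<lambda>x. c * g x) \<in> L2" by (rule L2_cmult[OF g2])
  have f2: "f \<in> L2"
  proof (rule L2I[OF f])
    have "integrable lborel (\<lambda>x. (cmod (c * g x))\<^sup>2)" by (rule L2D(2)[OF c2])
    then show "integrable lborel (\<lambda>x. (cmod (f x))\<^sup>2)"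
      by (rule integrable_cong_AE_imp) (use fv in \<open>auto simp: g_def elim: eventually_mono\<close>)
  qed
  define T where "T R x = indicator {-R..R} x * g x" for R :: real and x
  have [measurable]: "T R \<in> borel_measurable borel" for R unfolding T_def[abs_def] by measurable
  have T2: "T R \<in> L2" for R
    by (rule L2_dominated(1)[OF g2]) (auto simp: T_def indicator_def)
  obtain B where B: "\<And>x. cmod (g x) \<le> B" using rfourier_bounded unfolding g_def by blast
  have T1: "integrable lborel (T R)" for R
  proof (rule Bochner_Integration.integrable_bound)
    show "integrable lborel (\<lambda>x. B * indicator {-R..R} x)"
      by (cases "0 \<le> R") (auto intro!: integrable_mult_right integrable_real_indicator)
    show "AE x in lborel. norm (T R x) \<le> norm (B * indicator {-R..R} x)"
      using B order_trans[OF B abs_ge_self] by (auto simp: T_def indicator_def)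
  qed measurable
  define I where "I R = (LINT x|lborel. (cmod (T R x))\<^sup>2)" for R
  define J where "J = (LINT x|lborel. (cmod (g x))\<^sup>2)"
  have J: "J = (LINT k|lborel. (cmod (V k))\<^sup>2)"
  proof -
    have "(LINT k|lborel. (v k)\<^sup>2) = (LINT k|lborel. (v (0 + - 1 * k))\<^sup>2)"
      by (subst lborel_integral_real_affine[of "-1" _ 0]) simp_all
    then show ?thesis unfolding J_def g_def rfourier_square_integrable(2)[OF v] by (simp add: V_def)
  qed
  have fourier_T: "fourier (\<lambda>z. indicator {-R..R} z * f z) = (\<lambda>k. c * fourier (T R) k)" for R
  proof -
    have "fourier (\<lambda>z. indicator {-R..R} z * f z) = fourier (\<lambda>z. c * T R z)"
      by (rule fourier_cong_AE) (use fv in \<open>auto simp: T_def g_def elim: eventually_mono\<close>)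
    also have "\<dots> = (\<lambda>k. c * fourier (T R) k)"
      by (rule ext) (simp add: fourier_def mult.left_commute[of _ c])
    finally show ?thesis .
  qed
  have bes: "fourier (T R) \<in> L2" "(LINT k|lborel. (cmod (fourier (T R) k))\<^sup>2) \<le> I R" for R
  proof -
    have "(\<integral>\<^sup>+k. ennreal ((cmod (fourier (T R) k))\<^sup>2) \<partial>lborel) \<le> ennreal ((L2_norm (T R))\<^sup>2)"
      using fourier_bessel[OF T1[of R]] by (simp add: L2_nn_integral[OF T2])
    from L2I_nn[OF _ this] have 1: "fourier (T R) \<in> L2" "L2_norm (fourier (T R)) \<le> L2_norm (T R)" by auto
    from power_mono[OF 1(2), of 2] 1(1)
    show "fourier (T R) \<in> L2" "(LINT k|lborel. (cmod (fourier (T R) k))\<^sup>2) \<le> I R"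
      by (auto simp: L2_norm_def I_def integral_nonneg_AE)
  qed
  have cross: "(LINT k|lborel. fourier (T R) k * V k) = complex_of_real (I R)" for R
  proof -
    have "(LINT k|lborel. fourier (T R) k * V k) = (LINT x|lborel. T R x * fourier V x)"
      by (rule fourier_mult_formula[OF T1 V])
    also have "fourier V x = cnj (g x)" for x
      using rfourier_reflect[of v x] by (simp add: rfourier_def V_def[abs_def] g_def)
    then have "(LINT x|lborel. T R x * fourier V x) = (LINT x|lborel. complex_of_real ((cmod (T R x))\<^sup>2))"
      by (intro Bochner_Integration.integral_cong) (auto simp: T_def indicator_def simp flip: complex_norm_square)
    finally show ?thesis unfolding I_def by (simp only: integral_complex_of_real)
  qed
  have dist: "(\<lambda>k. fourier (T R) k - V k) \<in> L2" "(L2_norm (\<lambda>k. fourier (T R) k - V k))\<^sup>2 \<le> J - I R" for R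
  proof -
    show d2: "(\<lambda>k. fourier (T R) k - V k) \<in> L2" by (rule L2_diff(1)[OF bes(1) V2])
    have pt: "(cmod (a - complex_of_real r))\<^sup>2 = (cmod a)\<^sup>2 - 2 * Re (a * complex_of_real r) + (cmod (complex_of_real r))\<^sup>2" for a r
      unfolding cmod_power2 by (simp add: power2_diff algebra_simps)
    have Re: "(LINT k|lborel. Re (fourier (T R) k * V k)) = I R"
      using integral_Re[OF L2_mult_integrable[OF bes(1) V2], of R] cross[of R] by simp
    have "(L2_norm (\<lambda>k. fourier (T R) k - V k))\<^sup>2 = (LINT k|lborel. (cmod (fourier (T R) k - V k))\<^sup>2)"
      by (simp add: L2_norm_def integral_nonneg_AE)
    also have "\<dots> = (LINT k|lborel. (cmod (fourier (T R) k))\<^sup>2 - 2 * Re (fourier (T R) k * V k) + (cmod (V k))\<^sup>2)"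
      unfolding V_def pt ..
    also have "\<dots> = (LINT k|lborel. (cmod (fourier (T R) k))\<^sup>2) - 2 * (LINT k|lborel. Re (fourier (T R) k * V k)) + (LINT k|lborel. (cmod (V k))\<^sup>2)"
      using L2D(2)[OF bes(1)] L2D(2)[OF V2] integrable_Re[OF L2_mult_integrable[OF bes(1) V2]]
      by (simp del: times_complex.simps)
    also have "\<dots> \<le> J - I R" using bes(2)[of R] unfolding Re J[symmetric] by simp
    finally show "(L2_norm (\<lambda>k. fourier (T R) k - V k))\<^sup>2 \<le> J - I R" .
  qed
  have "(I \<longlongrightarrow> J) at_top"
    unfolding I_def J_def
  proof (rule integral_dominated_convergence_at_top)
    show "integrable lborel (\<lambda>x. (cmod (g x))\<^sup>2)" by (rule gb)
    show "\<forall>\<^sub>F R in at_top. AE x in lborel. norm ((cmod (T R x))\<^sup>2) \<le> (cmod (g x))\<^sup>2"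
      by (intro always_eventually allI AE_I2) (auto simp: T_def indicator_def)
    show "AE x in lborel. ((\<lambda>R. (cmod (T R x))\<^sup>2) \<longlongrightarrow> (cmod (g x))\<^sup>2) at_top"
    proof (intro AE_I2 tendsto_eventually)
      fix x
      show "\<forall>\<^sub>F R in at_top. (cmod (T R x))\<^sup>2 = (cmod (g x))\<^sup>2"
        by (rule eventually_mono[OF eventually_ge_at_top[of "\<bar>x\<bar>"]]) (auto simp: T_def indicator_def abs_le_iff)
    qed
  qed measurable
  then have JI: "((\<lambda>R. (cmod c)\<^sup>2 * (J - I R)) \<longlongrightarrow> (cmod c)\<^sup>2 * (J - J)) at_top"
    by (intro tendsto_intros)
  have "((\<lambda>R. \<integral>\<^sup>+k. ennreal ((cmod (fourier (\<lambda>z. indicator {-R..R} z * f z) k - c * V k))\<^sup>2) \<partial>lborel) \<longlongrightarrow> 0) at_top"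
  proof (rule tendsto_sandwich[OF _ _ tendsto_const])
    show "((\<lambda>R. ennreal ((cmod c)\<^sup>2 * (J - I R))) \<longlongrightarrow> 0) at_top"
      using tendsto_ennrealI[OF JI] by simp
    show "\<forall>\<^sub>F R in at_top. (\<integral>\<^sup>+k. ennreal ((cmod (fourier (\<lambda>z. indicator {-R..R} z * f z) k - c * V k))\<^sup>2) \<partial>lborel)
        \<le> ennreal ((cmod c)\<^sup>2 * (J - I R))"
    proof (intro always_eventually allI)
      fix R
      have e: "fourier (\<lambda>z. indicator {-R..R} z * f z) k - c * V k = c * (fourier (T R) k - V k)" for k
        unfolding fourier_T by (simp add: right_diff_distrib)
      have "(L2_norm (\<lambda>k. c * (fourier (T R) k - V k)))\<^sup>2 \<le> (cmod c)\<^sup>2 * (J - I R)"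
        unfolding L2_norm_cmult power_mult_distrib by (intro mult_left_mono dist(2)) simp
      then show "(\<integral>\<^sup>+k. ennreal ((cmod (fourier (\<lambda>z. indicator {-R..R} z * f z) k - c * V k))\<^sup>2) \<partial>lborel)
          \<le> ennreal ((cmod c)\<^sup>2 * (J - I R))"
        unfolding e L2_nn_integral[OF L2_cmult[OF dist(1)]] by (rule ennreal_leI)
    qed
  qed simp
  then show ?thesis
    using f2 L2_cmult[OF V2, of c] by (simp add: fourier_L2_def tendsto_L2_def V_def[abs_def])
qed

text \<open>The share \<open>g\<close> of the half Laplacian is what the eigenvalue equation leaves,
  \<open>l f - x\<^sup>2 f\<close>. On the Fourier side it is \<open>\<bar>k\<bar>\<close> times the
  mode, as \<open>x\<^sup>2\<close> acts as minus the second derivative; square integrability of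
  \<open>x\<^sup>2 f\<close> follows from that of \<open>g\<close>.\<close>

lemma airy_mode_half_laplacian:
  assumes l: "l \<in> airy_spectrum" and f2: "f \<in> L2" and fu: "AE x in lborel. f x = c * rfourier (airy_mode l) x"
  shows "(f, \<lambda>x. complex_of_real l * f x) \<in> half_laplacian_plus_square"
proof -
  obtain u' where u: "C2_rapid (airy_mode l) u' (\<lambda>k. (\<bar>k\<bar> - l) * airy_mode l k)"
    using airy_mode_C2_rapid[OF l] by blast
  note r = C2_rapidD[OF u]
  note [measurable] = L2D(1)[OF f2]
  define g where "g x = complex_of_real l * f x - complex_of_real (x\<^sup>2) * f x" for x
  have gm [measurable]: "g \<in> borel_measurable borel" unfolding g_def by measurable
  have "AE x in lborel. g x = c * rfourier (\<lambda>k. \<bar>k\<bar> * airy_mode l k) x"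
    using fu
  proof eventually_elim
    case (elim x)
    have sum: "rfourier (\<lambda>k. \<bar>k\<bar> * airy_mode l k) x =
        rfourier (\<lambda>k. (\<bar>k\<bar> - l) * airy_mode l k) x + rfourier (\<lambda>k. l * airy_mode l k) x"
      using rfourier_add[OF r(3) rapid_cmult[OF r(1), of l], of x] by (simp add: algebra_simps)
    then show ?case
      by (simp only: g_def elim sum rfourier_cmult rfourier_second_derivative[OF r]) (simp add: algebra_simps)
  qed
  then have G: "fourier_L2 g (\<lambda>k. c * complex_of_real (\<bar>- k\<bar> * airy_mode l (- k)))"
    by (rule fourier_L2_rfourier[OF rapid_times_abs[OF r(1)] gm])
  have F: "fourier_L2 f (\<lambda>k. c * complex_of_real (airy_mode l (- k)))"
    by (rule fourier_L2_rfourier[OF r(1) _ fu]) simp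
  have "(f, g) \<in> half_laplacian"
    unfolding half_laplacian_def
    by (clarsimp, intro exI conjI, rule F, rule G) simp
  moreover have "g \<in> L2" using G by (simp add: fourier_L2_def)
  then have "(\<lambda>x. complex_of_real l * f x - g x) \<in> L2" by (intro L2_diff(1) L2_cmult f2)
  then have "(\<lambda>x. complex_of_real (x\<^sup>2) * f x) \<in> L2" by (simp add: g_def)
  moreover have "(\<lambda>x. complex_of_real l * f x) \<in> L2" by (rule L2_cmult[OF f2])
  ultimately show ?thesis
    unfolding half_laplacian_plus_square_def by (auto simp: g_def[abs_def])
qed

lemma AE_lborel_reflect:
  assumes "AE x in lborel. P (x :: real)" "Measurable.pred borel P"
  shows "AE x in lborel. P (- x)"
proof -
  have [measurable]: "Measurable.pred borel P" by fact
  have d: "distr lborel borel uminus = (lborel :: real measure)" by (rule lborel_distr_uminus)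
  have "AE x in distr lborel borel uminus. P x" unfolding d by (rule assms)
  then show ?thesis by (subst (asm) AE_distr_iff) auto
qed

text \<open>Parity of the mode carries over to its transform. Since that transform is integrable,
  inversion holds at every point, so \<open>fourier f\<close> is known everywhere although
  \<open>f\<close> is given only almost everywhere.\<close>

lemma airy_mode_eigenfunction_properties:
  assumes l: "l \<in> airy_spectrum" and f2: "f \<in> L2" and fu: "AE x in lborel. f x = c * rfourier (airy_mode l) x"
  shows "AE x in lborel. f (- x) = (if Ai (- l) = 0 then - f x else f x)"
    and "integrable lborel f"
    and "fourier f x = c * complex_of_real (airy_mode l (- x))"
    and "L2_norm f = cmod c * sqrt (2 * (l * (Ai (- l))\<^sup>2 + (deriv Ai (- l))\<^sup>2))"
proof -
  note u = airy_mode_rapid[OF l]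
  note ui = airy_mode_rfourier_integrable[OF l]
  note [measurable] = L2D(1)[OF f2] rfourier_measurable[OF u]
  define \<phi> where "\<phi> = rfourier (airy_mode l)"
  have [measurable]: "\<phi> \<in> borel_measurable borel" unfolding \<phi>_def by measurable
  have parity: "\<phi> (- x) = (if Ai (- l) = 0 then - \<phi> x else \<phi> x)" for x
  proof -
    have "(LINT z|lborel. iexp (- x * z) * complex_of_real (airy_mode l z)) =
        (LINT z|lborel. iexp (- x * (0 + - 1 * z)) * complex_of_real (airy_mode l (0 + - 1 * z)))"
      by (subst lborel_integral_real_affine[of "-1" _ 0]) simp_all
    then have "\<phi> (- x) = rfourier (\<lambda>k. (if Ai (- l) = 0 then - 1 else 1) * airy_mode l k) x"
      by (simp add: \<phi>_def rfourier_def fourier_def airy_mode_reflect)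
    then show ?thesis unfolding rfourier_cmult \<phi>_def by simp
  qed
  have "AE x in lborel. f (- x) = c * \<phi> (- x)"
    using fu unfolding \<phi>_def[symmetric] by (rule AE_lborel_reflect) measurable
  then show "AE x in lborel. f (- x) = (if Ai (- l) = 0 then - f x else f x)"
    using fu unfolding \<phi>_def[symmetric] by eventually_elim (simp add: parity)
  show "integrable lborel f"
  proof (rule integrable_cong_AE_imp)
    show "integrable lborel (\<lambda>x. c * rfourier (airy_mode l) x)" using ui by simp
  qed (use fu in auto)
  have "fourier f = fourier (\<lambda>x. c * rfourier (airy_mode l) x)" by (rule fourier_cong_AE[OF fu]) auto
  then have "fourier f x = c * fourier (rfourier (airy_mode l)) x"
    by (simp add: fourier_def mult.left_commute[of _ c])
  then show "fourier f x = c * complex_of_real (airy_mode l (- x))" using rfourier_inversion[OF u ui] by simp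
  have "L2_norm f = L2_norm (\<lambda>x. c * rfourier (airy_mode l) x)"
    by (rule L2_norm_cong_AE) (use fu in \<open>auto elim: eventually_mono\<close>)
  then show "L2_norm f = cmod c * sqrt (2 * (l * (Ai (- l))\<^sup>2 + (deriv Ai (- l))\<^sup>2))"
    by (simp add: L2_norm_cmult L2_rfourier(2)[OF u] airy_mode_square_integral(1)[OF l])
qed

section \<open>The list of eigenvalues\<close>

context cauchy
begin

lemma lists_eigenvalues_exists: "\<exists>lam. lists_eigenvalues lam (hamiltonian M X)"
proof -
  obtain e :: "nat \<Rightarrow> real" where e: "strict_mono e" "range e = airy_spectrum"
    using airy_spectrum_enumeration by blast
  \<comment> \<open>The list starts at index 1 and the enumeration at 0; \<open>lam 0\<close> equals
    \<open>lam 1\<close> but is not counted.\<close>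
  define lam where "lam n = e (n - 1)" for n
  have "finite {n. n \<ge> 1 \<and> complex_of_real (lam n) = z} \<and>
      card {n. n \<ge> 1 \<and> complex_of_real (lam n) = z} = (if z \<in> complex_of_real ` airy_spectrum then 1 else 0)" for z
  proof (cases "z \<in> complex_of_real ` airy_spectrum")
    case True
    then obtain l where l: "l \<in> range e" "z = complex_of_real l" unfolding e(2) by blast
    then obtain m where m: "z = complex_of_real (e m)" by blast
    then have "{n. n \<ge> 1 \<and> complex_of_real (lam n) = z} = {Suc m}"
      using strict_mono_eq[OF e(1)] by (auto simp: lam_def)
    then show ?thesis using True by simp
  next
    case False
    then have empty: "{n. n \<ge> 1 \<and> complex_of_real (lam n) = z} = {}" using e(2) by (auto simp: lam_def)
    show ?thesis unfolding empty using False by simp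
  qed
  moreover have "lam n \<le> lam (Suc n)" for n
    using strict_mono_less_eq[OF e(1)] by (auto simp: lam_def)
  ultimately have "lists_eigenvalues lam (hamiltonian M X)"
    unfolding lists_eigenvalues_def multiplicity_hamiltonian by blast
  then show ?thesis by blast
qed

text \<open>Multiplicity 1 on the spectrum and 0 elsewhere fix how often each number occurs, so a
  nondecreasing list is strictly increasing and meets every point of the spectrum.\<close>

lemma lists_eigenvalues_enumerates:
  assumes "lists_eigenvalues lam (hamiltonian M X)"
  shows "lam ` {1..} = airy_spectrum" and "1 \<le> m \<Longrightarrow> m < n \<Longrightarrow> lam m < lam n"
proof -
  have fin: "finite {n. n \<ge> 1 \<and> complex_of_real (lam n) = z}"
    and card: "card {n. n \<ge> 1 \<and> complex_of_real (lam n) = z} = (if z \<in> complex_of_real ` airy_spectrum then 1 else 0)" for z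
    using assms unfolding lists_eigenvalues_def multiplicity_hamiltonian by blast+
  show "lam ` {1..} = airy_spectrum"
  proof safe
    fix n :: nat assume n: "1 \<le> n"
    then have "n \<in> {m. m \<ge> 1 \<and> complex_of_real (lam m) = complex_of_real (lam n)}" by simp
    then have "card {m. m \<ge> 1 \<and> complex_of_real (lam m) = complex_of_real (lam n)} \<noteq> 0"
      using fin[of "complex_of_real (lam n)"] by (metis card_0_eq empty_iff)
    then show "lam n \<in> airy_spectrum" unfolding card by (auto split: if_splits)
  next
    fix l assume "l \<in> airy_spectrum"
    then have "card {n. n \<ge> 1 \<and> complex_of_real (lam n) = complex_of_real l} = 1" unfolding card by simp
    then obtain n where "{n. n \<ge> 1 \<and> complex_of_real (lam n) = complex_of_real l} = {n}" by (auto simp: card_1_singleton_iff)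
    then have "n \<ge> 1 \<and> complex_of_real (lam n) = complex_of_real l" by blast
    then show "l \<in> lam ` {1..}" by auto
  qed
  assume mn: "1 \<le> m" "m < n"
  have "lam m \<le> lam k" if "m \<le> k" for k
    using that
  proof (induction k rule: dec_induct)
    case (step k)
    then have "lam k \<le> lam (Suc k)" using assms mn(1) by (simp add: lists_eigenvalues_def)
    with step show ?case by simp
  qed simp
  then have "lam m \<le> lam n" using mn by simp
  moreover have "lam m \<noteq> lam n"
  proof
    assume "lam m = lam n"
    then have "{m, n} \<subseteq> {k. k \<ge> 1 \<and> complex_of_real (lam k) = complex_of_real (lam m)}" using mn by auto
    from card_mono[OF fin this] have "2 \<le> card {k. k \<ge> 1 \<and> complex_of_real (lam k) = complex_of_real (lam m)}"
      using mn by simp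
    then show False unfolding card by (auto split: if_splits)
  qed
  ultimately show "lam m < lam n" by simp
qed

end

text \<open>A normalized eigenfunction is determined almost everywhere and up to a phase, for which
  \<open>c\<close> accounts. Its integrability makes the transform an ordinary integral, so the
  formula can be claimed at every \<open>x\<close>.\<close>

theorem theorem3p5:
  fixes M :: "'a measure" and X :: "real \<Rightarrow> 'a \<Rightarrow> real"
  assumes "cauchy_process M X"
  shows "(\<exists>lam. lists_eigenvalues lam (hamiltonian M X)) \<and>
    (\<forall>lam. lists_eigenvalues lam (hamiltonian M X) \<longrightarrow>
       (\<forall>k\<ge>1. lam (2 * k - 1) = - Ai_deriv_zero k \<and> lam (2 * k) = - Ai_zero k) \<and>
       (\<forall>n\<ge>1. multiplicity_of (hamiltonian M X) (complex_of_real (lam n)) 1) \<and>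
       (\<forall>n\<ge>1. \<forall>\<phi> \<in> eigenspace (hamiltonian M X) (complex_of_real (lam n)).
          (\<phi>, \<lambda>x. complex_of_real (lam n) * \<phi> x) \<in> half_laplacian_plus_square \<and>
          (odd n \<longrightarrow> (AE x in lborel. \<phi> (- x) = \<phi> x)) \<and>
          (even n \<longrightarrow> (AE x in lborel. \<phi> (- x) = - \<phi> x)) \<and>
          (L2_norm \<phi> = 1 \<longrightarrow>
             integrable lborel \<phi> \<and>
             (\<exists>c. cmod c = 1 \<and>
                (\<forall>x. fourier \<phi> x = c * complex_of_real
                   (if odd n
                    then Ai (\<bar>x\<bar> - lam n) / (sqrt (2 * lam n) * Ai (- lam n))
                    else sgn x * Ai (\<bar>x\<bar> - lam n) / (sqrt 2 * deriv Ai (- lam n))))))))"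
proof -
  interpret cauchy M X by (rule cauchy.intro[OF assms])
  have main: "(\<forall>k\<ge>1. lam (2 * k - 1) = - Ai_deriv_zero k \<and> lam (2 * k) = - Ai_zero k) \<and>
       (\<forall>n\<ge>1. multiplicity_of (hamiltonian M X) (complex_of_real (lam n)) 1) \<and>
       (\<forall>n\<ge>1. \<forall>\<phi> \<in> eigenspace (hamiltonian M X) (complex_of_real (lam n)).
          (\<phi>, \<lambda>x. complex_of_real (lam n) * \<phi> x) \<in> half_laplacian_plus_square \<and>
          (odd n \<longrightarrow> (AE x in lborel. \<phi> (- x) = \<phi> x)) \<and>
          (even n \<longrightarrow> (AE x in lborel. \<phi> (- x) = - \<phi> x)) \<and>
          (L2_norm \<phi> = 1 \<longrightarrow>
             integrable lborel \<phi> \<and>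
             (\<exists>c. cmod c = 1 \<and>
                (\<forall>x. fourier \<phi> x = c * complex_of_real
                   (if odd n
                    then Ai (\<bar>x\<bar> - lam n) / (sqrt (2 * lam n) * Ai (- lam n))
                    else sgn x * Ai (\<bar>x\<bar> - lam n) / (sqrt 2 * deriv Ai (- lam n)))))))"
    if lam: "lists_eigenvalues lam (hamiltonian M X)" for lam
  proof (intro conjI allI impI ballI)
    note mono = lists_eigenvalues_enumerates(2)[OF lam] and range = lists_eigenvalues_enumerates(1)[OF lam]
    fix k :: nat assume k: "1 \<le> k"
    show "lam (2 * k - 1) = - Ai_deriv_zero k" "lam (2 * k) = - Ai_zero k"
      using airy_spectrum_kth[OF mono range k] by auto
  next
    note mono = lists_eigenvalues_enumerates(2)[OF lam] and range = lists_eigenvalues_enumerates(1)[OF lam]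
    fix n :: nat assume n: "1 \<le> n"
    then have S: "lam n \<in> airy_spectrum" unfolding range[symmetric] by auto
    then show "multiplicity_of (hamiltonian M X) (complex_of_real (lam n)) 1"
      by (simp add: multiplicity_hamiltonian)
    note alt = airy_spectrum_alternates[OF mono range n]
    have parity: "Ai (- lam n) = 0 \<longleftrightarrow> even n" using alt Ai_no_common_zero by blast
    have pos: "0 < lam n" by (rule airy_spectrum_pos[OF S])
    fix \<phi> assume \<phi>: "\<phi> \<in> eigenspace (hamiltonian M X) (complex_of_real (lam n))"
    then have \<phi>2: "\<phi> \<in> L2" by (simp add: eigenspace_def hamiltonian_def)
    obtain c where c: "AE x in lborel. \<phi> x = c * rfourier (airy_mode (lam n)) x"
      using eigenfunction_representation[OF \<phi>] by blast
    note props = airy_mode_eigenfunction_properties[OF S \<phi>2 c]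
    show "(\<phi>, \<lambda>x. complex_of_real (lam n) * \<phi> x) \<in> half_laplacian_plus_square"
      by (rule airy_mode_half_laplacian[OF S \<phi>2 c])
    show "AE x in lborel. \<phi> (- x) = \<phi> x" if "odd n" using props(1) that parity by simp
    show "AE x in lborel. \<phi> (- x) = - \<phi> x" if "even n" using props(1) that parity by simp
    assume norm: "L2_norm \<phi> = 1"
    show "integrable lborel \<phi>" by (rule props(2))
    \<comment> \<open>The ratio of the reflected mode to the claimed formula; for even
      \<open>n\<close> the minus sign comes from reflecting an odd function. Its modulus is the norm
      of the transformed mode, one of \<open>Ai\<close> and \<open>Ai'\<close> being 0 at
      \<open>- lam n\<close>, so \<open>c * r\<close> has modulus 1.\<close>
    define r where "r = (if odd n then sqrt (2 * lam n) * Ai (- lam n) else - (sqrt 2 * deriv Ai (- lam n)))"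
    have "\<bar>r\<bar> = sqrt (2 * (lam n * (Ai (- lam n))\<^sup>2 + (deriv Ai (- lam n))\<^sup>2))"
      using alt pos by (auto simp: r_def abs_mult real_sqrt_mult)
    then have 1: "cmod (c * complex_of_real r) = 1" using norm props(4) by (simp add: norm_mult)
    then have r0: "r \<noteq> 0" by auto
    show "\<exists>c. cmod c = 1 \<and> (\<forall>x. fourier \<phi> x = c * complex_of_real
           (if odd n
            then Ai (\<bar>x\<bar> - lam n) / (sqrt (2 * lam n) * Ai (- lam n))
            else sgn x * Ai (\<bar>x\<bar> - lam n) / (sqrt 2 * deriv Ai (- lam n))))"
    proof (intro exI[of _ "c * complex_of_real r"] conjI allI 1)
      fix x
      have "airy_mode (lam n) (- x) = r * (if odd n
            then Ai (\<bar>x\<bar> - lam n) / (sqrt (2 * lam n) * Ai (- lam n))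
            else sgn x * Ai (\<bar>x\<bar> - lam n) / (sqrt 2 * deriv Ai (- lam n)))"
        using r0 parity by (auto simp: r_def airy_mode_def)
      then show "fourier \<phi> x = c * complex_of_real r * complex_of_real (if odd n
            then Ai (\<bar>x\<bar> - lam n) / (sqrt (2 * lam n) * Ai (- lam n))
            else sgn x * Ai (\<bar>x\<bar> - lam n) / (sqrt 2 * deriv Ai (- lam n)))"
        unfolding props(3) by (simp only: of_real_mult mult.assoc)
    qed
  qed
  show ?thesis using lists_eigenvalues_exists main by blast
qed

end
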